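(* Let $s\ge1$ be an integer, $C_0>0$, and consider two functions $\mathbf c^{in}\in H^s(\mathbb{T}^3)$ (with values in $\mathbb{R}^N$) and $\mathbf u^{in}\in H^{s-1}(\mathbb{T}^3)$ (with values in $(\mathbb{R}^3)^N$) verifying, for almost any $x\in\mathbb{T}^3$, $\mathbf c^{in}(x)\ge0$ and $\sum_{i=1}^Nc_i^{in}(x)=C_0$. Let $(\mathbf c,\mathbf u)\in L^\infty(\mathbb{R}_+;H^s(\mathbb{T}^3))\times L^\infty(\mathbb{R}_+;H^{s-1}(\mathbb{T}^3))$ have initial datum $(\mathbf c^{in},\mathbf u^{in})$. Then $(\mathbf c,\mathbf u)$ is a solution to the incompressible Maxwell-Stefan system $$\partial_t\mathbf c+\nabla_x\cdot(\mathbf c\mathbf u)=0,\qquad\nabla_x\mathbf c=A(\mathbf c)\mathbf u,\qquad\nabla_x\cdot\langle\mathbf c,\mathbf u\rangle=0$$ if and only if there exist two functions $\mathbf U:\mathbb{R}_+\times\mathbb{T}^3\to\mathbb{R}^{3N}$ and $\bar u:\mathbb{R}_+\times\mathbb{T}^3\to\mathbb{R}^3$ in $L^\infty(\mathbb{R}_+;H^{s-1}(\mathbb{T}^3))$ such that, for almost any $(t,x)\in\mathbb{R}_+\times\mathbb{T}^3$, (1) $\mathbf U(t,x)\in(\mathrm{Span}(\mathbf 1))^\perp$ and $\nabla_x\cdot\bar u(t,x)=0$; (2) $\mathbf u(t,x)=\bar{\mathbf u}(t,x)+\mathbf V_U(t,x)$, with $\bar{\mathbf u}=(\bar u,\dots,\bar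 u)$ and $\mathbf V_U=\mathbf U-\frac1{C_0}\langle\mathbf c,\mathbf U\rangle\mathbf 1$; (3) $\partial_t\mathbf c+\nabla_x\cdot(\mathbf c\mathbf V_U)+\bar u\cdot\nabla_x\mathbf c=0$ and $\nabla_x\mathbf c=A(\mathbf c)\mathbf U$.
   Context: $N\ge2$ is an integer and $\Delta_{ij}=\Delta_{ji}>0$ ($1\le i,j\le N$) are fixed constants. For $\mathbf c\in\mathbb{R}^N$, $A(\mathbf c)$ is the $N\times N$ matrix with entries $A(\mathbf c)_{ij}=\frac{c_ic_j}{\Delta_{ij}}-\big(\sum_{k=1}^N\frac{c_ic_k}{\Delta_{ik}}\big)\delta_{ij}$. Bold letters denote $N$-vectors indexed by species; $\mathbf c$ has real components, while $\mathbf u,\mathbf U$ have $\mathbb{R}^3$-valued components. $\mathbf 1=(1,\dots,1)$; products such as $\mathbf c\mathbf u=(c_iu_i)_i$ are componentwise; $\langle\cdot,\cdot\rangle$ is the Euclidean pairing over the species index, so $\langle\mathbf c,\mathbf u\rangle=\sum_ic_iu_i\in\mathbb{R}^3$; $V\cdot\mathbf w=(V\cdot w_i)_i$ for $V\in\mathbb{R}^3$ and $\mathbf w\in(\mathbb{R}^3)^N$, and so $\bar u\cdot\nabla_x\mathbf c=(\bar u\cdot\nabla_xc_i)_i$. $A(\mathbf c)$ acts on $(\mathbb{R}^3)^N$ through the species index, separately in each of the three spatial coordinates, and $\mathbf U\in(\mathrm{Span}(\mathbf 1))^\perp$ means $\sum_iU_i=0$ in $\mathbb{R}^3$. $\mathbf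 c^{in}\ge0$ is meant componentwise. The differential equations are understood in the weak sense. *)

theory Defs
  imports "HOL-Analysis.Analysis"
begin

section \<open>Functions on the torus and on space-time\<close>

text \<open>
  The torus is \<open>\<real>\<^sup>3 / \<int>\<^sup>3\<close>: functions on it are functions on \<^typ>\<open>real^3\<close> that are
  1-periodic in every coordinate, integrated over the closed unit cube.  Functions of
  \<open>(t, x)\<close> have type \<open>real \<times> (real^3) \<Rightarrow> 'b\<close>; only their values for \<open>t \<ge> 0\<close> matter.
\<close>

definition periodic :: "(real^3 \<Rightarrow> 'b) \<Rightarrow> bool" where
  "periodic f \<longleftrightarrow> (\<forall>x k. f (x + axis k 1) = f x)"

definition torus :: "(real^3) measure" where
  "torus = lebesgue_on (cbox 0 One)"

definition spacetime :: "(real \<times> (real^3)) measure" where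
  "spacetime = lebesgue_on ({0..} \<times> cbox 0 One)"

definition loc_integrable :: "(real \<times> (real^3) \<Rightarrow> 'b::euclidean_space) \<Rightarrow> bool" where
  "loc_integrable f \<longleftrightarrow>
     (\<forall>a b. 0 < a \<longrightarrow> integrable (lebesgue_on ({a..b} \<times> cbox 0 One)) f)"

section \<open>Smooth functions and test functions\<close>

definition dir_deriv :: "'a::euclidean_space \<Rightarrow> ('a \<Rightarrow> real) \<Rightarrow> 'a \<Rightarrow> real" where
  "dir_deriv v f x = frechet_derivative f (at x) v"

primrec C_k :: "nat \<Rightarrow> ('a::euclidean_space \<Rightarrow> real) \<Rightarrow> bool" where
  "C_k 0 f \<longleftrightarrow> continuous_on UNIV f"
| "C_k (Suc k) f \<longleftrightarrow>
     (\<forall>x. f differentiable (at x)) \<and> (\<forall>b\<in>Basis. C_k k (dir_deriv b f))"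

definition smooth :: "('a::euclidean_space \<Rightarrow> real) \<Rightarrow> bool" where
  "smooth f \<longleftrightarrow> (\<forall>k. C_k k f)"

definition torus_test :: "(real^3 \<Rightarrow> real) \<Rightarrow> bool" where
  "torus_test \<psi> \<longleftrightarrow> smooth \<psi> \<and> periodic \<psi>"

text \<open>Test functions on the open set \<open>t > 0\<close>, with compact support in time.\<close>

definition spacetime_test :: "(real \<times> (real^3) \<Rightarrow> real) \<Rightarrow> bool" where
  "spacetime_test \<phi> \<longleftrightarrow> smooth \<phi> \<and> (\<forall>t. periodic (\<lambda>x. \<phi> (t, x))) \<and>
     (\<exists>a b. 0 < a \<and> (\<forall>t x. t \<notin> {a..b} \<longrightarrow> \<phi> (t, x) = 0))"

definition time_deriv :: "(real \<times> (real^3) \<Rightarrow> real) \<Rightarrow> real \<times> (real^3) \<Rightarrow> real" where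
  "time_deriv \<phi> = dir_deriv (1, 0) \<phi>"

definition space_grad :: "(real \<times> (real^3) \<Rightarrow> real) \<Rightarrow> real \<times> (real^3) \<Rightarrow> real^3" where
  "space_grad \<phi> p = (\<chi> k. dir_deriv (0, axis k 1) \<phi> p)"

section \<open>Sobolev spaces\<close>

text \<open>Multi-indices are functions \<open>3 \<Rightarrow> nat\<close>, where \<^typ>\<open>3\<close> is the index type of \<^typ>\<open>real^3\<close>.\<close>

definition multi_deriv :: "(3 \<Rightarrow> nat) \<Rightarrow> (real^3 \<Rightarrow> real) \<Rightarrow> real^3 \<Rightarrow> real" where
  "multi_deriv \<alpha> \<psi> =
     (dir_deriv (axis 1 1) ^^ \<alpha> 1)
       ((dir_deriv (axis 2 1) ^^ \<alpha> 2) ((dir_deriv (axis 3 1) ^^ \<alpha> 3) \<psi>))"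

definition has_weak_deriv ::
    "(3 \<Rightarrow> nat) \<Rightarrow> (real^3 \<Rightarrow> 'b::euclidean_space) \<Rightarrow> (real^3 \<Rightarrow> 'b) \<Rightarrow> bool" where
  "has_weak_deriv \<alpha> f g \<longleftrightarrow> integrable torus f \<and> integrable torus g \<and>
     (\<forall>\<psi>. torus_test \<psi> \<longrightarrow>
        (LINT x|torus. multi_deriv \<alpha> \<psi> x *\<^sub>R f x) =
        (- 1) ^ (\<Sum>k\<in>UNIV. \<alpha> k) *\<^sub>R (LINT x|torus. \<psi> x *\<^sub>R g x))"

definition weak_deriv ::
    "(3 \<Rightarrow> nat) \<Rightarrow> (real^3 \<Rightarrow> 'b::euclidean_space) \<Rightarrow> real^3 \<Rightarrow> 'b" where
  "weak_deriv \<alpha> f = (SOME g. has_weak_deriv \<alpha> f g)"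

definition L2 :: "(real^3 \<Rightarrow> 'b::euclidean_space) set" where
  "L2 = {f. f \<in> borel_measurable torus \<and> integrable torus (\<lambda>x. (norm (f x))\<^sup>2)}"

definition multi_indices :: "nat \<Rightarrow> (3 \<Rightarrow> nat) set" where
  "multi_indices s = {\<alpha>. (\<Sum>k\<in>UNIV. \<alpha> k) \<le> s}"

lemma finite_multi_indices: "finite (multi_indices s)"
proof -
  have "multi_indices s \<subseteq> (UNIV :: 3 set) \<rightarrow>\<^sub>E {..s}"
  proof
    fix \<alpha> assume "\<alpha> \<in> multi_indices s"
    then have "\<alpha> k \<le> s" for k
      unfolding multi_indices_def
      using member_le_sum[of k UNIV \<alpha>] by (simp add: order_trans)
    then show "\<alpha> \<in> UNIV \<rightarrow>\<^sub>E {..s}"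
      by (auto simp: PiE_def extensional_def)
  qed
  then show ?thesis
    by (rule finite_subset) (intro finite_PiE, auto)
qed

definition sobolev :: "nat \<Rightarrow> (real^3 \<Rightarrow> 'b::euclidean_space) set" where
  "sobolev s = {f. periodic f \<and> f \<in> L2 \<and>
     (\<forall>\<alpha>\<in>multi_indices s. \<exists>g\<in>L2. has_weak_deriv \<alpha> f g)}"

definition sobolev_norm :: "nat \<Rightarrow> (real^3 \<Rightarrow> 'b::euclidean_space) \<Rightarrow> real" where
  "sobolev_norm s f =
     sqrt (\<Sum>\<alpha>\<in>multi_indices s. LINT x|torus. (norm (weak_deriv \<alpha> f x))\<^sup>2)"

text \<open>
  The space \<open>L\<^sup>\<infinity>(\<real>\<^sub>+; H\<^sup>s)\<close>.  Since \<open>H\<^sup>s\<close> is separable, its strongly measurable elements are,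
  up to modification on a null set, the jointly measurable functions with almost every time
  slice in \<open>H\<^sup>s\<close>.
\<close>

definition Linf_sobolev :: "nat \<Rightarrow> (real \<times> (real^3) \<Rightarrow> 'b::euclidean_space) set" where
  "Linf_sobolev s = {f. f \<in> borel_measurable spacetime \<and>
     (\<forall>t\<ge>0. periodic (\<lambda>x. f (t, x))) \<and>
     (\<exists>M. AE t in lebesgue_on {0..}.
        (\<lambda>x. f (t, x)) \<in> sobolev s \<and> sobolev_norm s (\<lambda>x. f (t, x)) \<le> M)}"

text \<open>
  Elements of \<open>L\<^sup>\<infinity>(\<real>\<^sub>+; H\<^sup>s)\<close> are defined for almost every time only, so the initial datum is
  attained as an essential limit as \<open>t \<rightarrow> 0+\<close>, in the sense of distributions on the torus.
\<close>

definition has_initial_datum ::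
    "(real \<times> (real^3) \<Rightarrow> 'b::euclidean_space) \<Rightarrow> (real^3 \<Rightarrow> 'b) \<Rightarrow> bool" where
  "has_initial_datum f f0 \<longleftrightarrow>
     (\<forall>\<psi>. torus_test \<psi> \<longrightarrow>
       (\<forall>\<epsilon>>0. \<exists>\<delta>>0. AE t in lebesgue_on {0<..<\<delta>}.
          norm ((LINT x|torus. \<psi> x *\<^sub>R f (t, x)) - (LINT x|torus. \<psi> x *\<^sub>R f0 x)) < \<epsilon>))"

section \<open>Weak differential equations on space-time\<close>

definition has_weak_grad ::
    "(real \<times> (real^3) \<Rightarrow> real) \<Rightarrow> (real \<times> (real^3) \<Rightarrow> real^3) \<Rightarrow> bool" where
  "has_weak_grad f G \<longleftrightarrow> loc_integrable f \<and> loc_integrable G \<and>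
     (\<forall>\<phi>. spacetime_test \<phi> \<longrightarrow>
        (LINT p|spacetime. f p *\<^sub>R space_grad \<phi> p) = - (LINT p|spacetime. \<phi> p *\<^sub>R G p))"

definition weak_grad :: "(real \<times> (real^3) \<Rightarrow> real) \<Rightarrow> real \<times> (real^3) \<Rightarrow> real^3" where
  "weak_grad f = (SOME G. has_weak_grad f G)"

definition weak_div_free :: "(real \<times> (real^3) \<Rightarrow> real^3) \<Rightarrow> bool" where
  "weak_div_free F \<longleftrightarrow> loc_integrable F \<and>
     (\<forall>\<phi>. spacetime_test \<phi> \<longrightarrow> (LINT p|spacetime. F p \<bullet> space_grad \<phi> p) = 0)"

text \<open>\<open>weak_balance f F g\<close> is the weak form of \<open>\<partial>\<^sub>t f + \<nabla>\<^sub>x \<cdot> F + g = 0\<close>.\<close>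

definition weak_balance ::
    "(real \<times> (real^3) \<Rightarrow> real) \<Rightarrow> (real \<times> (real^3) \<Rightarrow> real^3) \<Rightarrow> (real \<times> (real^3) \<Rightarrow> real) \<Rightarrow> bool" where
  "weak_balance f F g \<longleftrightarrow> loc_integrable f \<and> loc_integrable F \<and> loc_integrable g \<and>
     (\<forall>\<phi>. spacetime_test \<phi> \<longrightarrow>
        (LINT p|spacetime. f p * time_deriv \<phi> p + F p \<bullet> space_grad \<phi> p - g p * \<phi> p) = 0)"

section \<open>The Maxwell-Stefan system\<close>

text \<open>The finite type \<open>'n\<close> indexes the species.\<close>

definition MS_matrix :: "('n::finite \<Rightarrow> 'n \<Rightarrow> real) \<Rightarrow> real^'n \<Rightarrow> real^'n^'n" where
  "MS_matrix \<Delta> c = (\<chi> i j.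
     c $ i * c $ j / \<Delta> i j - (\<Sum>k\<in>UNIV. c $ i * c $ k / \<Delta> i k) * (if i = j then 1 else 0))"

definition species_mult :: "real^'n^'n \<Rightarrow> real^3^'n \<Rightarrow> real^3^'n" where
  "species_mult A w = (\<chi> i. \<Sum>j\<in>UNIV. A $ i $ j *\<^sub>R w $ j)"

definition pairing :: "real^'n \<Rightarrow> real^3^'n \<Rightarrow> real^3" where
  "pairing c w = (\<Sum>i\<in>UNIV. c $ i *\<^sub>R w $ i)"

definition weak_gradient_relation ::
    "('n::finite \<Rightarrow> 'n \<Rightarrow> real) \<Rightarrow> (real \<times> (real^3) \<Rightarrow> real^'n) \<Rightarrow>
     (real \<times> (real^3) \<Rightarrow> real^3^'n) \<Rightarrow> bool" where
  "weak_gradient_relation \<Delta> c w \<longleftrightarrow>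
     (\<forall>i. has_weak_grad (\<lambda>p. c p $ i) (\<lambda>p. species_mult (MS_matrix \<Delta> (c p)) (w p) $ i))"

definition incompressible_MS_solution ::
    "('n::finite \<Rightarrow> 'n \<Rightarrow> real) \<Rightarrow> (real \<times> (real^3) \<Rightarrow> real^'n) \<Rightarrow>
     (real \<times> (real^3) \<Rightarrow> real^3^'n) \<Rightarrow> bool" where
  "incompressible_MS_solution \<Delta> c u \<longleftrightarrow>
     (\<forall>i. weak_balance (\<lambda>p. c p $ i) (\<lambda>p. c p $ i *\<^sub>R u p $ i) (\<lambda>p. 0)) \<and>
     weak_gradient_relation \<Delta> c u \<and>
     weak_div_free (\<lambda>p. pairing (c p) (u p))"

text \<open>The vector \<open>V\<^sub>U = U - (1/C\<^sub>0) \<langle>c, U\<rangle> 1\<close>, for the values of \<open>c\<close> and \<open>U\<close> at one point.\<close>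

definition V_field :: "real \<Rightarrow> real^'n \<Rightarrow> real^3^'n \<Rightarrow> real^3^'n" where
  "V_field C0 c U = U - (\<chi> i. (1 / C0) *\<^sub>R pairing c U)"

end

theory Submission
  imports Defs "HOL-Real_Asymp.Real_Asymp"
begin

text \<open>
The matrix \<open>A(c)\<close> and the field \<open>V\<^sub>U\<close> do not change when a common
velocity is added to all species.  Hence \<open>u\<close> may be split into the barycentric velocity
\<open>ubar = \<langle>c, u\<rangle> / C\<^sub>0\<close> and relative velocities \<open>U\<close> of zero mean, and \<open>u = ubar + V\<^sub>U\<close> holds because
\<open>\<Sum>c\<^sub>i = C\<^sub>0\<close>.  The latter holds in both directions (\<open>total_density_eq\<close>): the columns of \<open>A(c)\<close> sum
to zero, so \<open>\<Sum>c\<^sub>i\<close> has no spatial gradient, and its mean is conserved.  As \<open>ubar\<close> is divergence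
free, \<open>\<nabla> \<cdot> (c\<^sub>i ubar)\<close> and \<open>ubar \<cdot> \<nabla>c\<^sub>i\<close> are the same distribution (\<open>advection\<close>); this turns one
form of the balance law into the other.

The difficult point is that \<open>\<langle>c, u\<rangle>\<close> belongs to \<open>L\<^sup>\<infinity>(H\<^bsup>s-1\<^esup>)\<close>.  For \<open>s \<ge> 2\<close> it is the product
theorem \<open>H\<^sup>s \<cdot> H\<^bsup>s-1\<^esup> \<subseteq> H\<^bsup>s-1\<^esup>\<close> (\<open>Hbound_product\<close>), from the embeddings \<open>H\<^sup>2 \<subseteq> L\<^sup>\<infinity>\<close> and
\<open>H\<^sup>1 \<subseteq> L\<^sup>4\<close>, both proved on the Fourier side.  For \<open>s = 1\<close> no such product theorem exists; instead
\<open>0 \<le> c\<^sub>i \<le> C\<^sub>0\<close>, which requires that nonnegativity of the initial datum propagates although the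
velocities are only in \<open>L\<^sup>2\<close> (\<open>density_nonneg\<close>).  For this, \<open>c\<close> is mollified by a nonnegative kernel
\<open>K\<close>, a convex approximation of the negative part of \<open>K * c\<close> is integrated, and the time derivative
is a commutator.  It contains \<open>\<nabla>K\<close>, of order \<open>\<surd>n\<close>, times the oscillation of \<open>c \<in> H\<^sup>1\<close> on the
scale of \<open>K\<close>, of order \<open>1/\<surd>n\<close>, so that it is bounded by the square of the velocity near the level
set \<open>c = 0\<close> without the set itself, and vanishes in the limit (\<open>flux_commutator\<close>).

All functions are treated through Fourier coefficients.  Weak derivatives are Fourier multipliers
(\<open>fcoeff_weak_deriv\<close>, \<open>has_weak_derivI_fcoeff\<close>), so weak equations in space-time can be tested with
countably many waves and hold on almost every time slice (\<open>weak_divergence_slices\<close>); moments of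
solutions are primitives of bounded functions (\<open>weak_solution_is_primitive\<close>).
\<close>

section \<open>The unit cell\<close>

type_synonym event = "real \<times> (real^3)"

text \<open>The torus has total mass one, so this is also the mean value.\<close>

abbreviation torus_integral :: "(real^3 \<Rightarrow> 'b::{banach,second_countable_topology}) \<Rightarrow> 'b" (binder "TI " [60] 60) where
 "torus_integral f \<equiv> integral\<^sup>L torus f"

abbreviation partial :: "3 \<Rightarrow> (real^3 \<Rightarrow> real) \<Rightarrow> real^3 \<Rightarrow> real" where
 "partial j \<equiv> dir_deriv (axis j 1)"

abbreviation half_line :: "real measure" where "half_line \<equiv> lebesgue_on {0..}"

text \<open>Several facts about the Bochner integral share their names with facts about the
 Henstock-Kurzweil integral.\<close>

lemmas L1_add = Bochner_Integration.integrable_add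
 and L1_bound = Bochner_Integration.integrable_bound
 and L1_diff = Bochner_Integration.integrable_diff
 and L1_mult_right = Bochner_Integration.integrable_mult_right
 and L1_sum = Bochner_Integration.integrable_sum
 and LINT_add = Bochner_Integration.integral_add
 and LINT_cnj = Bochner_Integration.integral_cnj
 and LINT_cong = Bochner_Integration.integral_cong
 and LINT_cong_AE = Bochner_Integration.integral_cong_AE
 and LINT_diff = Bochner_Integration.integral_diff
 and LINT_minus = Bochner_Integration.integral_minus
 and LINT_nonneg = Bochner_Integration.integral_nonneg
 and LINT_sum = Bochner_Integration.integral_sum

lemma sum_Basis_nth [simp]: "(\<Sum>b\<in>(Basis :: (real^3) set). b $ i) = 1"
proof -
 have "(One :: real^3) \<bullet> axis i 1 = (\<Sum>b\<in>(Basis :: (real^3) set). b \<bullet> axis i 1)"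
  by (rule inner_sum_left)
 also have "\<dots> = (\<Sum>b\<in>(Basis :: (real^3) set). if b = axis i 1 then 1 else 0)"
  by (intro sum.cong) (auto simp: inner_Basis)
 finally have "(One :: real^3) \<bullet> axis i 1 = 1" by simp
 then have "(One :: real^3) $ i = 1" unfolding inner_axis by simp
 then show ?thesis by (simp add: sum_component)
qed

lemma mem_cell_iff: "x \<in> cbox 0 (One :: real^3) \<longleftrightarrow> (\<forall>j. 0 \<le> x $ j \<and> x $ j \<le> 1)"
 by (simp add: mem_box_cart)

lemma mem_open_cell_iff: "x \<in> box 0 (One :: real^3) \<longleftrightarrow> (\<forall>j. 0 < x $ j \<and> x $ j < 1)"
 by (simp add: mem_box_cart)

lemma space_torus [simp]: "space torus = cbox 0 One"
 by (simp add: torus_def)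

lemma finite_measure_torus: "finite_measure torus"
 unfolding torus_def by (rule finite_measure_lebesgue_on) auto

interpretation torus: finite_measure torus by (rule finite_measure_torus)

lemma measure_torus [simp]: "measure torus (cbox 0 One) = 1"
proof -
 have "measure torus (cbox 0 One) = measure lebesgue (cbox 0 (One::real^3))"
  unfolding torus_def by (subst measure_restrict_space) auto
 then show ?thesis by (simp add: content_cbox_if)
qed

lemma AE_torus_cell: "AE x in torus. x \<in> cbox 0 One"
 by (rule AE_I2) simp

lemma AE_torus_open_cell: "AE x in torus. x \<in> box 0 One"
proof -
 have "negligible (cbox 0 One - box 0 (One::real^3))"
  by (rule negligible_frontier_interval)
 then have "AE x in lebesgue. x \<notin> cbox 0 One - box 0 (One::real^3)"
  by (simp add: AE_iff_null_sets negligible_iff_null_sets null_setsD2 AE_not_in)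
 then show ?thesis
  unfolding torus_def by (subst AE_restrict_space_iff) auto
qed

lemma continuous_borel_torus:
 "continuous_on UNIV f \<Longrightarrow> f \<in> borel_measurable torus" for f :: "real^3 \<Rightarrow> 'b::euclidean_space"
 unfolding torus_def
 by (intro continuous_imp_measurable_on_sets_lebesgue) (auto intro: continuous_on_subset)

lemma continuous_integrable_torus:
 "continuous_on UNIV f \<Longrightarrow> integrable torus f" for f :: "real^3 \<Rightarrow> 'b::euclidean_space"
 unfolding torus_def by (rule continuous_imp_integrable) (auto intro: continuous_on_subset)

lemma bounded_integrable_torus:
 fixes f :: "real^3 \<Rightarrow> 'b::euclidean_space"
 assumes "f \<in> borel_measurable torus" "\<And>x. x \<in> cbox 0 One \<Longrightarrow> norm (f x) \<le> B"
 shows "integrable torus f"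
 using assms by (intro torus.integrable_const_bound[of _ B]) auto

lemma periodic_shift_nat:
 assumes "periodic f" shows "f (x + axis k (real n)) = f x"
proof (induction n)
 case (Suc n)
 have "x + axis k (real (Suc n)) = (x + axis k (real n)) + axis k 1"
  by (simp add: vec_eq_iff axis_def)
 then show ?case using assms Suc by (metis periodic_def)
qed (auto simp: axis_def vec_eq_iff intro!: arg_cong[where f=f])

lemma periodic_shift_int:
 assumes "periodic f" shows "f (x + axis k (of_int m)) = f x"
proof (cases "m \<ge> 0")
 case True
 then show ?thesis using periodic_shift_nat[OF assms, of x k "nat m"] by simp
next
 case False
 have "x + axis k (of_int m) + axis k (real (nat (-m))) = x"
  using False by (simp add: vec_eq_iff axis_def)
 then show ?thesis using periodic_shift_nat[OF assms, of "x + axis k (of_int m)" k "nat (-m)"] by metis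
qed

text \<open>The cell shifted by \<open>h \<in> [0,1]\<close> in one direction is cut along the face of the original
 cell, and the part sticking out is moved back by one period.\<close>

lemma integral_torus_shift_unit:
 fixes f :: "real^3 \<Rightarrow> 'b::euclidean_space"
 assumes cont: "continuous_on UNIV f" and per: "periodic f" and h: "0 \<le> h" "h \<le> 1"
 shows "(TI x. f (x + axis k h)) = (TI x. f x)"
proof -
 let ?One = "One :: real^3"
 let ?e = "axis k 1 :: real^3" and ?a = "axis k h :: real^3"
 let ?r = "?One - axis k (1 - h)"
 have io: "f integrable_on cbox a b" for a b
  by (intro integrable_continuous continuous_on_subset[OF cont]) auto
 have eB: "?e \<in> Basis" by simp
 have L: "(TI x. g x) = integral (cbox 0 ?One) g" if "continuous_on UNIV g"
  for g :: "real^3 \<Rightarrow> 'b"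
  unfolding torus_def using continuous_integrable_torus[OF that]
  by (intro lebesgue_integral_eq_integral) (auto simp: torus_def)
 have nth: "x \<bullet> ?e = x $ k" for x :: "real^3" by (simp add: inner_axis)
 have set_eq: "cbox a b \<inter> {x. P (x $ k)} = cbox a' b' \<inter> {x. Q (x $ k)}"
  if "\<And>i. i \<noteq> k \<Longrightarrow> a $ i = a' $ i" "\<And>i. i \<noteq> k \<Longrightarrow> b $ i = b' $ i"
   "\<And>t. a $ k \<le> t \<and> t \<le> b $ k \<and> P t \<longleftrightarrow> a' $ k \<le> t \<and> t \<le> b' $ k \<and> Q t"
  for a b a' b' :: "real^3" and P Q
  using that unfolding mem_box_cart set_eq_iff Int_iff mem_Collect_eq by metis
 have "(TI x. f (x + ?a)) = integral (cbox 0 ?One) (\<lambda>x. f (x + ?a))"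
  by (intro L continuous_on_compose2[OF cont]) (auto intro!: continuous_intros)
 also have "\<dots> = integral (cbox ?a (?One + ?a)) f"
  using integral_shift_cbox_plus[of 0 ?One f ?a] by (simp add: o_def add.commute)
 also have "\<dots> = integral (cbox ?a (?One + ?a) \<inter> {x. x \<bullet> ?e \<le> 1}) f
   + integral (cbox ?a (?One + ?a) \<inter> {x. x \<bullet> ?e \<ge> 1}) f"
  by (rule integral_split[OF io eB])
 also have "cbox ?a (?One + ?a) \<inter> {x. x \<bullet> ?e \<le> 1} = cbox 0 ?One \<inter> {x. x \<bullet> ?e \<ge> h}"
  unfolding nth by (rule set_eq) (use h in \<open>auto simp: axis_def\<close>)
 also have "cbox ?a (?One + ?a) \<inter> {x. x \<bullet> ?e \<ge> 1} = cbox (0 + ?e) (?r + ?e)"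
 proof -
  have "cbox ?a (?One + ?a) \<inter> {x. (\<lambda>t. t \<ge> 1) (x $ k)}
    = cbox (0 + ?e) (?r + ?e) \<inter> {x. (\<lambda>_. True) (x $ k)}"
   by (rule set_eq) (use h in \<open>auto simp: axis_def\<close>)
  then show ?thesis by (simp add: nth)
 qed
 also have "integral (cbox (0 + ?e) (?r + ?e)) f = integral (cbox 0 ?r) (f \<circ> ((+) ?e))"
  by (rule integral_shift_cbox_plus[symmetric])
 also have "f \<circ> ((+) ?e) = f" using per by (auto simp: periodic_def o_def add.commute)
 also have "cbox 0 ?r = cbox 0 ?One \<inter> {x. x \<bullet> ?e \<le> h}"
 proof -
  have "cbox 0 ?r \<inter> {x. (\<lambda>_. True) (x $ k)} = cbox 0 ?One \<inter> {x. (\<lambda>t. t \<le> h) (x $ k)}"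
   by (rule set_eq) (use h in \<open>auto simp: axis_def\<close>)
  then show ?thesis by (simp add: nth)
 qed
 also have "integral (cbox 0 ?One \<inter> {x. x \<bullet> ?e \<ge> h}) f
   + integral (cbox 0 ?One \<inter> {x. x \<bullet> ?e \<le> h}) f = integral (cbox 0 ?One) f"
  using integral_split[OF io eB, of 0 ?One h] by simp
 also have "\<dots> = (TI x. f x)" by (rule L[OF cont, symmetric])
 finally show ?thesis .
qed

lemma integral_torus_shift_axis:
 fixes f :: "real^3 \<Rightarrow> 'b::euclidean_space"
 assumes "continuous_on UNIV f" and per: "periodic f"
 shows "(TI x. f (x + axis k h)) = (TI x. f x)"
proof -
 have "f (x + axis k h) = f (x + axis k (frac h))" for x
 proof -
  have "x + axis k h = x + axis k (frac h) + axis k (of_int \<lfloor>h\<rfloor>)"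
   by (simp add: vec_eq_iff axis_def frac_def)
  then show ?thesis using periodic_shift_int[OF per] by metis
 qed
 then show ?thesis
  using integral_torus_shift_unit[OF assms, of "frac h" k] frac_lt_1[of h] by (simp add: less_imp_le)
qed

lemma periodic_translate: "periodic f \<Longrightarrow> periodic (\<lambda>x. f (x + a))"
 by (simp add: periodic_def add.assoc add.commute[of _ a]) (simp add: add.commute[of a] flip: add.assoc)

lemma continuous_translate:
 "continuous_on UNIV f \<Longrightarrow> continuous_on UNIV (\<lambda>x. f (x + a))" for f :: "real^3 \<Rightarrow> 'b::euclidean_space"
 by (rule continuous_on_compose2[of UNIV f]) (auto intro!: continuous_intros)

lemma vec3_axis_sum: "a = axis 1 (a $ 1) + axis 2 (a $ 2) + axis 3 (a $ 3)" for a :: "real^3"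
 by (simp add: vec_eq_iff axis_def forall_3)

lemma integral_torus_shift:
 fixes f :: "real^3 \<Rightarrow> 'b::euclidean_space"
 assumes c: "continuous_on UNIV f" and p: "periodic f"
 shows "(TI x. f (x + a)) = (TI x. f x)"
proof -
 have "(TI x. f (x + a)) = (TI x. (f (((x + axis 1 (a $ 1)) + axis 2 (a $ 2)) + axis 3 (a $ 3))))"
  by (subst vec3_axis_sum[of a]) (simp add: add.assoc)
 also have "\<dots> = (TI x. f ((x + axis 2 (a $ 2)) + axis 3 (a $ 3)))"
  by (rule integral_torus_shift_axis[where f="\<lambda>y. f ((y + axis 2 (a $ 2)) + axis 3 (a $ 3))"])
   (intro continuous_translate[of "\<lambda>y. f (y + _)"] continuous_translate c
    periodic_translate[of "\<lambda>y. f (y + _)"] periodic_translate p)+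
 also have "\<dots> = (TI x. f (x + axis 3 (a $ 3)))"
  by (rule integral_torus_shift_axis[where f="\<lambda>y. f (y + axis 3 (a $ 3))"])
   (intro continuous_translate c periodic_translate p)+
 also have "\<dots> = (TI x. f x)" by (rule integral_torus_shift_axis[OF c p])
 finally show ?thesis .
qed

text \<open>The integral of a periodic function does not change under translation, so the integrals
 of its difference quotients vanish, and with them the integral of the derivative.\<close>

lemma integral_torus_deriv_eq_0:
 fixes f :: "real^3 \<Rightarrow> real"
 assumes per: "periodic f" and diff: "\<And>x. f differentiable (at x)"
  and cont: "continuous_on UNIV (partial k f)"
 shows "(TI x. partial k f x) = 0"
proof -
 let ?e = "axis k 1 :: real^3" and ?D = "partial k f"
 have fc: "continuous_on UNIV f"
  using diff by (simp add: continuous_at_imp_continuous_on differentiable_imp_continuous_within)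
 have der: "((\<lambda>s. f (x + s *\<^sub>R ?e)) has_real_derivative ?D (x + s *\<^sub>R ?e)) (at s)" for x s
 proof -
  have "(f has_derivative frechet_derivative f (at (x + s *\<^sub>R ?e))) (at (x + s *\<^sub>R ?e))"
   using diff frechet_derivative_works by blast
  then have "((\<lambda>s. f (x + s *\<^sub>R ?e)) has_derivative
    (\<lambda>t. frechet_derivative f (at (x + s *\<^sub>R ?e)) (t *\<^sub>R ?e))) (at s)"
   by (rule has_derivative_compose[rotated]) (auto intro!: derivative_eq_intros)
  moreover have "linear (frechet_derivative f (at (x + s *\<^sub>R ?e)))"
   using diff by (rule linear_frechet_derivative)
  ultimately show ?thesis
   by (simp add: has_field_derivative_def dir_deriv_def linear_cmul mult.commute[of _ "_ (axis k 1)"])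
 qed
 have "compact (cbox 0 (2 *\<^sub>R One :: real^3))" by simp
 then have "bounded (?D ` cbox 0 (2 *\<^sub>R One))"
  by (intro compact_imp_bounded compact_continuous_image continuous_on_subset[OF cont]) auto
 then obtain B where B: "\<And>x. x \<in> cbox 0 (2 *\<^sub>R One) \<Longrightarrow> \<bar>?D x\<bar> \<le> B"
  by (auto simp: bounded_iff)
 define h where "h n = 1 / real (Suc n)" for n
 define q where "q n x = (f (x + h n *\<^sub>R ?e) - f x) / h n" for n x
 have h: "0 < h n" "h n \<le> 1" for n by (auto simp: h_def)
 have hlim: "h \<longlonglongrightarrow> 0" unfolding h_def by (rule LIMSEQ_Suc[OF lim_1_over_n])
 have qB: "\<bar>q n x\<bar> \<le> B" if "x \<in> cbox 0 One" for n x
 proof -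
  obtain s where s: "0 < s" "s < h n" and "f (x + h n *\<^sub>R ?e) - f (x + 0 *\<^sub>R ?e) = (h n - 0) * ?D (x + s *\<^sub>R ?e)"
   using MVT2[of 0 "h n" "\<lambda>s. f (x + s *\<^sub>R ?e)" "\<lambda>s. ?D (x + s *\<^sub>R ?e)"] der h by blast
  then have "q n x = ?D (x + s *\<^sub>R ?e)" using h[of n] by (simp add: q_def)
  moreover have "x + s *\<^sub>R ?e \<in> cbox 0 (2 *\<^sub>R One)"
   using that s h[of n] unfolding mem_box_cart
   by (auto simp: axis_def) (smt (verit))+
  ultimately show ?thesis using B by auto
 qed
 have qlim: "(\<lambda>n. q n x) \<longlonglongrightarrow> ?D x" for x
 proof -
  have "((\<lambda>s. (f (x + s *\<^sub>R ?e) - f x) / s) \<longlongrightarrow> ?D x) (at 0)"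
   using der[of x 0] by (simp add: has_field_derivative_iff)
  moreover have "filterlim h (at 0) sequentially"
   using hlim h by (auto simp: filterlim_at intro!: eventuallyI) (metis less_irrefl)
  ultimately show ?thesis unfolding q_def by (rule filterlim_compose)
 qed
 have qc: "continuous_on UNIV (q n)" for n
  unfolding q_def using h[of n] by (intro continuous_intros continuous_translate fc) auto
 have "(\<lambda>n. TI x. q n x) \<longlonglongrightarrow> (TI x. ?D x)"
 proof (rule integral_dominated_convergence[where w="\<lambda>_. B"])
  show "AE x in torus. norm (q n x) \<le> B" for n using qB by (intro AE_I2) auto
 qed (use qlim qc cont in \<open>auto intro!: continuous_borel_torus\<close>)
 moreover have "(TI x. q n x) = 0" for n
 proof -
  have "h n *\<^sub>R ?e = axis k (h n)" by (simp add: vec_eq_iff axis_def)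
  then have "(TI x. f (x + h n *\<^sub>R ?e)) = (TI x. f x)"
   using integral_torus_shift_axis[OF fc per] by simp
  then show ?thesis unfolding q_def
   by (subst integral_divide_zero, subst LINT_diff)
    (auto intro!: continuous_integrable_torus continuous_translate fc)
 qed
 ultimately show ?thesis by (simp add: LIMSEQ_const_iff)
qed

section \<open>Characters of the torus and Fourier coefficients\<close>

definition phase :: "(3 \<Rightarrow> int) \<Rightarrow> real^3 \<Rightarrow> real" where
 "phase k x = 2 * pi * (\<Sum>j\<in>UNIV. of_int (k j) * x $ j)"

definition char :: "(3 \<Rightarrow> int) \<Rightarrow> real^3 \<Rightarrow> complex" where
 "char k x = cis (phase k x)"

definition fcoeff :: "(real^3 \<Rightarrow> complex) \<Rightarrow> (3 \<Rightarrow> int) \<Rightarrow> complex" where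
 "fcoeff f k = (TI x. cnj (char k x) * f x)"

lemma phase_add: "phase k (x + y) = phase k x + phase k y"
 by (simp add: phase_def algebra_simps sum.distrib)

lemma phase_minus: "phase k (- x) = - phase k x"
 by (simp add: phase_def sum_negf)

lemma phase_diff: "phase k (x - y) = phase k x - phase k y"
 using phase_add[of k x "-y"] by (simp add: phase_minus)

lemma phase_minus_index: "phase (\<lambda>j. - k j) x = - phase k x"
 by (simp add: phase_def sum_negf)

lemma phase_diff_index: "phase (\<lambda>j. k j - l j) x = phase k x - phase l x"
 by (simp add: phase_def algebra_simps sum_subtractf)

lemma phase_axis: "phase k (axis j h) = 2 * pi * of_int (k j) * h"
 by (simp add: phase_def axis_def if_distrib cong: if_cong)

lemma char_add: "char k (x + y) = char k x * char k y"
 by (simp add: char_def phase_add cis_mult)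

lemma char_minus: "char k (- x) = cnj (char k x)"
 by (simp add: char_def phase_minus cis_cnj)

lemma char_diff: "char k (x - y) = char k x * cnj (char k y)"
 using char_add[of k x "-y"] by (simp add: char_minus)

lemma char_minus_index: "char (\<lambda>j. - k j) x = cnj (char k x)"
 by (simp add: char_def phase_minus_index cis_cnj)

lemma char_diff_index: "char (\<lambda>j. k j - l j) x = char k x * cnj (char l x)"
 by (simp add: char_def phase_diff_index cis_cnj cis_mult)

lemma char_0 [simp]: "char k 0 = 1" "char (\<lambda>_. 0) x = 1"
 by (simp_all add: char_def phase_def)

lemma norm_char [simp]: "cmod (char k x) = 1"
 by (simp add: char_def)

lemma char_mult_cnj [simp]: "char k x * cnj (char k x) = 1" "cnj (char k x) * char k x = 1"
 by (simp_all add: char_def cis_cnj cis_mult)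

lemma continuous_phase [continuous_intros]: "continuous_on A (phase k)"
 unfolding phase_def[abs_def] by (intro continuous_intros)

lemma continuous_char [continuous_intros]: "continuous_on A (char k)"
proof -
 have "char k = (\<lambda>x. exp (\<i> * of_real (phase k x)))"
  by (simp add: fun_eq_iff char_def cis_conv_exp)
 then show ?thesis by (auto intro!: continuous_intros)
qed

lemma char_measurable [measurable]: "char k \<in> borel_measurable torus" "char k \<in> borel_measurable borel"
 by (auto intro: continuous_borel_torus continuous_char borel_measurable_continuous_onI)

lemma periodic_char: "periodic (char k)"
proof -
 have "cis (2 * pi * of_int m) = 1" for m by (simp add: cis_multiple_2pi)
 then show ?thesis by (simp add: periodic_def char_add char_def phase_add phase_axis flip: cis_mult)
qed

lemma integral_char: "(TI x. char k x) = (if k = (\<lambda>_. 0) then 1 else 0)"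
proof (cases "k = (\<lambda>_. 0)")
 case False
 then obtain j where j: "k j \<noteq> 0" by auto
 \<comment> \<open>half a period in direction \<open>j\<close>: the character changes sign\<close>
 let ?a = "axis j (1 / (2 * of_int (k j))) :: real^3"
 have "char k ?a = -1" using j by (simp add: char_def phase_axis)
 then have "(TI x. char k (x + ?a)) = - (TI x. char k x)"
  by (simp add: char_add)
 moreover have "(TI x. char k (x + ?a)) = (TI x. char k x)"
  by (intro integral_torus_shift continuous_char periodic_char)
 ultimately show ?thesis using False by (simp add: eq_neg_iff_add_eq_0)
qed (simp add: torus_def[symmetric])

lemma integral_char_orthonormal:
 "(TI x. char k x * cnj (char l x)) = (if k = l then 1 else 0)"
proof -
 have "(\<lambda>j. k j - l j) = (\<lambda>_. 0) \<longleftrightarrow> k = l" by (auto simp: fun_eq_iff)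
 then show ?thesis by (simp add: char_diff_index[symmetric] integral_char)
qed

section \<open>Square-integrable functions on the torus\<close>

definition norm2 :: "(real^3 \<Rightarrow> 'b::euclidean_space) \<Rightarrow> real" where
 "norm2 f = (TI x. (norm (f x))\<^sup>2)"

abbreviation L2_le :: "(real^3 \<Rightarrow> 'b::euclidean_space) \<Rightarrow> real \<Rightarrow> bool" where
 "L2_le f M \<equiv> f \<in> L2 \<and> norm2 f \<le> M"

lemma norm2_nonneg [simp]: "0 \<le> norm2 f"
 by (simp add: norm2_def)

lemma L2_measurable: "f \<in> L2 \<Longrightarrow> f \<in> borel_measurable torus"
 and L2_integrable_sq: "f \<in> L2 \<Longrightarrow> integrable torus (\<lambda>x. (norm (f x))\<^sup>2)"
 by (simp_all add: L2_def)

lemma L2_integrable_mult_norm: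
 fixes f :: "real^3 \<Rightarrow> 'b::euclidean_space" and g :: "real^3 \<Rightarrow> 'c::euclidean_space"
 assumes "f \<in> L2" "g \<in> L2"
 shows "integrable torus (\<lambda>x. norm (f x) * norm (g x))"
proof (rule L1_bound)
 show "integrable torus (\<lambda>x. (norm (f x))\<^sup>2 + (norm (g x))\<^sup>2)"
  using assms by (auto simp: L2_def)
 show "AE x in torus. norm (norm (f x) * norm (g x)) \<le> norm ((norm (f x))\<^sup>2 + (norm (g x))\<^sup>2)"
 proof (rule AE_I2)
  fix x
  have "2 * (norm (f x) * norm (g x)) \<le> (norm (f x))\<^sup>2 + (norm (g x))\<^sup>2"
   using sum_squares_bound[of "norm (f x)" "norm (g x)"] by (simp add: mult.assoc)
  moreover have "0 \<le> norm (f x) * norm (g x)" by simp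
  ultimately have "norm (f x) * norm (g x) \<le> (norm (f x))\<^sup>2 + (norm (g x))\<^sup>2" by linarith
  then show "norm (norm (f x) * norm (g x)) \<le> norm ((norm (f x))\<^sup>2 + (norm (g x))\<^sup>2)"
   by (simp add: abs_mult)
 qed
qed (use assms in \<open>auto simp: L2_def\<close>)

lemma bounded_in_L2:
 fixes f :: "real^3 \<Rightarrow> 'b::euclidean_space"
 assumes m: "f \<in> borel_measurable torus" and B: "\<And>x. x \<in> cbox 0 One \<Longrightarrow> norm (f x) \<le> B"
 shows "f \<in> L2"
 unfolding L2_def using m
 by (auto intro!: bounded_integrable_torus[where B="B\<^sup>2"] power_mono B)

lemma continuous_in_L2: "continuous_on UNIV f \<Longrightarrow> f \<in> L2" for f :: "real^3 \<Rightarrow> 'b::euclidean_space"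
 unfolding L2_def
 by (auto intro!: continuous_borel_torus continuous_integrable_torus continuous_intros)

lemma L2_integrable:
 fixes f :: "real^3 \<Rightarrow> 'b::euclidean_space"
 assumes "f \<in> L2" shows "integrable torus f"
proof -
 have "(\<lambda>_. 1 :: real) \<in> L2" by (rule continuous_in_L2) simp
 from L2_integrable_mult_norm[OF assms this] have "integrable torus (\<lambda>x. norm (f x))" by simp
 then show ?thesis using L2_measurable[OF assms] by (simp add: integrable_norm_iff)
qed

lemma L2_add:
 fixes f g :: "real^3 \<Rightarrow> 'b::euclidean_space"
 assumes "f \<in> L2" "g \<in> L2" shows "(\<lambda>x. f x + g x) \<in> L2"
 unfolding L2_def mem_Collect_eq
proof
 show m: "(\<lambda>x. f x + g x) \<in> borel_measurable torus" using assms by (auto simp: L2_def)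
 show "integrable torus (\<lambda>x. (norm (f x + g x))\<^sup>2)"
 proof (rule L1_bound)
  show "integrable torus (\<lambda>x. 2 * (norm (f x))\<^sup>2 + 2 * (norm (g x))\<^sup>2)"
   using assms by (auto simp: L2_def)
  have "(norm (a + b))\<^sup>2 \<le> 2 * (norm a)\<^sup>2 + 2 * (norm b)\<^sup>2" for a b :: 'b
  proof -
   have "(norm (a + b))\<^sup>2 \<le> (norm a + norm b)\<^sup>2" by (intro power_mono norm_triangle_ineq) simp
   then show ?thesis using sum_squares_bound[of "norm a" "norm b"] by (simp add: power2_sum)
  qed
  then show "AE x in torus. norm ((norm (f x + g x))\<^sup>2) \<le> norm (2 * (norm (f x))\<^sup>2 + 2 * (norm (g x))\<^sup>2)"
   by (auto intro!: AE_I2)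
 qed (use m in auto)
qed

lemma L2_mult_bounded:
 fixes f :: "real^3 \<Rightarrow> 'b::euclidean_space" and m :: "real^3 \<Rightarrow> 'c::euclidean_space"
 assumes f: "f \<in> L2" and g: "g \<in> borel_measurable torus"
  and B: "AE x in torus. norm (g x) \<le> B * norm (f x)"
 shows "g \<in> L2"
 unfolding L2_def mem_Collect_eq
proof
 show "integrable torus (\<lambda>x. (norm (g x))\<^sup>2)"
 proof (rule L1_bound)
  show "integrable torus (\<lambda>x. B\<^sup>2 * (norm (f x))\<^sup>2)" using f by (auto simp: L2_def)
  show "AE x in torus. norm ((norm (g x))\<^sup>2) \<le> norm (B\<^sup>2 * (norm (f x))\<^sup>2)"
   using B by eventually_elim (use power_mono in \<open>fastforce simp flip: power_mult_distrib\<close>)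
 qed (use g in auto)
qed (rule g)

lemma L2_scaleR: "f \<in> L2 \<Longrightarrow> (\<lambda>x. c *\<^sub>R f x) \<in> L2" for f :: "real^3 \<Rightarrow> 'b::euclidean_space"
 by (rule L2_mult_bounded[where B="\<bar>c\<bar>" and f=f]) (auto dest: L2_measurable)

lemma L2_diff:
 fixes f g :: "real^3 \<Rightarrow> 'b::euclidean_space"
 assumes "f \<in> L2" "g \<in> L2" shows "(\<lambda>x. f x - g x) \<in> L2"
 using L2_add[OF assms(1) L2_scaleR[OF assms(2), of "-1"]] by simp

lemma L2_of_real: "f \<in> L2 \<Longrightarrow> (\<lambda>x. complex_of_real (f x)) \<in> L2"
 by (rule L2_mult_bounded[where B=1 and f=f]) (auto dest: L2_measurable)

lemma norm2_of_real: "norm2 (\<lambda>x. complex_of_real (f x)) = norm2 f"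
 by (simp add: norm2_def)

lemma norm2_triangle:
 fixes f g :: "real^3 \<Rightarrow> 'b::euclidean_space"
 assumes "f \<in> L2" "g \<in> L2"
 shows "norm2 (\<lambda>x. f x + g x) \<le> 2 * norm2 f + 2 * norm2 g"
proof -
 have p: "(norm (a + b))\<^sup>2 \<le> 2 * (norm a)\<^sup>2 + 2 * (norm b)\<^sup>2" for a b :: 'b
 proof -
  have "(norm (a + b))\<^sup>2 \<le> (norm a + norm b)\<^sup>2" by (intro power_mono norm_triangle_ineq) simp
  then show ?thesis using sum_squares_bound[of "norm a" "norm b"] by (simp add: power2_sum)
 qed
 have "norm2 (\<lambda>x. f x + g x) \<le> (TI x. 2 * (norm (f x))\<^sup>2 + 2 * (norm (g x))\<^sup>2)"
  unfolding norm2_def using L2_integrable_sq[OF L2_add[OF assms]] assms p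
  by (intro integral_mono) (auto simp: L2_def)
 also have "\<dots> = 2 * norm2 f + 2 * norm2 g"
  unfolding norm2_def using assms by (subst LINT_add) (auto simp: L2_def)
 finally show ?thesis .
qed

lemma integral_Cauchy_Schwarz:
 fixes f :: "real^3 \<Rightarrow> 'b::euclidean_space" and g :: "real^3 \<Rightarrow> 'c::euclidean_space"
 assumes "f \<in> L2" "g \<in> L2"
 shows "(TI x. norm (f x) * norm (g x)) \<le> sqrt (norm2 f) * sqrt (norm2 g)"
proof -
 define a b c where "a = norm2 f" and "b = (TI x. norm (f x) * norm (g x))" and "c = norm2 g"
 have q: "0 \<le> a * t\<^sup>2 - 2 * b * t + c" for t
 proof -
  have "0 \<le> (TI x. (t * norm (f x) - norm (g x))\<^sup>2)" by simp
  also have "\<dots> = (TI x. t\<^sup>2 * (norm (f x))\<^sup>2 - 2 * t * (norm (f x) * norm (g x)) + (norm (g x))\<^sup>2)"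
   by (intro LINT_cong refl) (simp add: power2_diff power_mult_distrib mult.assoc)
  also have "\<dots> = t\<^sup>2 * a - 2 * t * b + c"
   unfolding a_def b_def c_def norm2_def using assms L2_integrable_mult_norm[OF assms]
   by (simp add: L2_def)
  finally show ?thesis by (simp add: algebra_simps)
 qed
 have a: "a \<ge> 0" and c: "c \<ge> 0" by (auto simp: a_def c_def)
 have "b\<^sup>2 \<le> a * c"
 proof (cases "a = 0")
  case True
  have "b \<le> 0"
  proof (rule ccontr)
   assume "\<not> b \<le> 0"
   then show False using q[of "(c + 1) / (2 * b)"] True by (simp add: field_simps)
  qed
  moreover have "b \<ge> 0" by (simp add: b_def)
  ultimately show ?thesis using True by simp
 next
  case False
  then show ?thesis using q[of "b / a"] a by (simp add: field_simps power2_eq_square)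
 qed
 then have "b \<le> sqrt (a * c)" by (simp add: real_le_rsqrt)
 then show ?thesis by (simp add: a_def b_def c_def real_sqrt_mult)
qed

lemma L2_mult_integrable:
 fixes f g :: "real^3 \<Rightarrow> 'b::{euclidean_space,real_normed_algebra}"
 assumes "f \<in> L2" "g \<in> L2" shows "integrable torus (\<lambda>x. f x * g x)"
proof (rule L1_bound[OF L2_integrable_mult_norm[OF assms]])
 show "(\<lambda>x. f x * g x) \<in> borel_measurable torus"
  using assms by (auto simp: L2_def intro!: borel_measurable_times)
 show "AE x in torus. norm (f x * g x) \<le> norm (norm (f x) * norm (g x))"
  by (intro AE_I2) (simp add: norm_mult_ineq)
qed

lemma borel_measurable_cnj [measurable]:
 "f \<in> borel_measurable M \<Longrightarrow> (\<lambda>x. cnj (f x)) \<in> borel_measurable M"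
 by (rule borel_measurable_continuous_on[where f=cnj]) (auto intro!: continuous_intros)

lemma L2_cnj: "f \<in> L2 \<Longrightarrow> (\<lambda>x. cnj (f x)) \<in> L2"
 by (rule L2_mult_bounded[where B=1 and f=f]) (auto dest: L2_measurable)

lemma L2_char_mult: "f \<in> L2 \<Longrightarrow> (\<lambda>x. f x * char k x) \<in> L2"
 by (rule L2_mult_bounded[where B=1 and f=f]) (auto dest: L2_measurable simp: norm_mult)

lemma integral_Cauchy_Schwarz_complex:
 assumes "f \<in> L2" "g \<in> L2"
 shows "cmod (TI x. f x * cnj (g x)) \<le> sqrt (norm2 f) * sqrt (norm2 g)"
proof -
 have "cmod (TI x. f x * cnj (g x)) \<le> (TI x. cmod (f x * cnj (g x)))"
  by (rule integral_norm_bound)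
 also have "\<dots> = (TI x. norm (f x) * norm (g x))" by (simp add: norm_mult)
 also have "\<dots> \<le> sqrt (norm2 f) * sqrt (norm2 g)" by (rule integral_Cauchy_Schwarz[OF assms])
 finally show ?thesis .
qed

subsection \<open>Bessel's inequality\<close>

lemma integrable_char_mult: "integrable torus f \<Longrightarrow> integrable torus (\<lambda>x. cnj (char k x) * f x)"
 by (rule L1_bound[where f=f]) (auto simp: norm_mult intro!: AE_I2)

lemma fcoeff_add:
 "integrable torus f \<Longrightarrow> integrable torus g \<Longrightarrow> fcoeff (\<lambda>x. f x + g x) k = fcoeff f k + fcoeff g k"
 by (simp add: fcoeff_def distrib_left integrable_char_mult)

lemma fcoeff_diff:
 "integrable torus f \<Longrightarrow> integrable torus g \<Longrightarrow> fcoeff (\<lambda>x. f x - g x) k = fcoeff f k - fcoeff g k"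
 by (simp add: fcoeff_def right_diff_distrib integrable_char_mult)

lemma fcoeff_mult_left: "fcoeff (\<lambda>x. c * f x) k = c * fcoeff f k"
 by (simp add: fcoeff_def mult.left_commute[of _ c])

lemma fcoeff_mult_char: "fcoeff (\<lambda>x. f x * char l x) k = fcoeff f (\<lambda>j. k j - l j)"
 by (simp add: fcoeff_def char_diff_index mult_ac)

lemma norm_fcoeff_le: "integrable torus f \<Longrightarrow> cmod (fcoeff f k) \<le> (TI x. cmod (f x))"
 unfolding fcoeff_def by (rule order_trans[OF integral_norm_bound]) (simp add: norm_mult)

lemma integral_mult_cnj_trig:
 assumes "integrable torus f" "finite F"
 shows "(TI x. f x * cnj (\<Sum>k\<in>F. a k * char k x)) = (\<Sum>k\<in>F. fcoeff f k * cnj (a k))"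
proof -
 have "(TI x. f x * cnj (\<Sum>k\<in>F. a k * char k x))
   = (TI x. (\<Sum>k\<in>F. cnj (a k) * (cnj (char k x) * f x)))"
  by (simp add: sum_distrib_left mult_ac)
 also have "\<dots> = (\<Sum>k\<in>F. (TI x. cnj (a k) * (cnj (char k x) * f x)))"
  by (intro LINT_sum integrable_mult_right integrable_char_mult assms)
 finally show ?thesis by (simp add: fcoeff_def mult.commute)
qed

lemma fcoeff_trig:
 assumes "finite F" "l \<in> F" shows "fcoeff (\<lambda>x. \<Sum>k\<in>F. a k * char k x) l = a l"
proof -
 have "fcoeff (\<lambda>x. \<Sum>k\<in>F. a k * char k x) l = (TI x. (\<Sum>k\<in>F. a k * (char k x * cnj (char l x))))"
  by (simp add: fcoeff_def sum_distrib_left mult_ac)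
 also have "\<dots> = (\<Sum>k\<in>F. a k * (if k = l then 1 else 0))"
  by (subst LINT_sum)
   (auto simp: integral_char_orthonormal intro!: continuous_integrable_torus continuous_intros)
 also have "\<dots> = (\<Sum>k\<in>F. if k = l then a k else 0)" by (intro sum.cong) auto
 finally show ?thesis using assms by simp
qed

lemma norm2_trig:
 assumes "finite F"
 shows "norm2 (\<lambda>x. \<Sum>k\<in>F. a k * char k x) = (\<Sum>k\<in>F. (cmod (a k))\<^sup>2)"
proof -
 let ?P = "\<lambda>x. \<Sum>k\<in>F. a k * char k x"
 have "complex_of_real (norm2 ?P) = (TI x. ?P x * cnj (?P x))"
  unfolding norm2_def complex_norm_square[symmetric]
  by (simp only: integral_complex_of_real[symmetric] of_real_power)
 also have "\<dots> = (\<Sum>k\<in>F. fcoeff ?P k * cnj (a k))"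
  by (intro integral_mult_cnj_trig continuous_integrable_torus continuous_intros assms)
 also have "\<dots> = (\<Sum>k\<in>F. a k * cnj (a k))"
  by (intro sum.cong) (auto simp: fcoeff_trig assms)
 also have "\<dots> = complex_of_real (\<Sum>k\<in>F. (cmod (a k))\<^sup>2)" by (simp flip: complex_norm_square)
 finally show ?thesis by (simp only: of_real_eq_iff)
qed

lemma Bessel:
 assumes f: "f \<in> L2" and F: "finite F"
 shows "(\<Sum>k\<in>F. (cmod (fcoeff f k))\<^sup>2) \<le> norm2 f"
proof -
 let ?P = "\<lambda>x. \<Sum>k\<in>F. fcoeff f k * char k x" and ?S = "\<Sum>k\<in>F. (cmod (fcoeff f k))\<^sup>2"
 have P: "?P \<in> L2" by (intro continuous_in_L2 continuous_intros)
 have "(TI x. f x * cnj (?P x)) = complex_of_real ?S"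
  by (subst integral_mult_cnj_trig[OF L2_integrable[OF f] F]) (simp flip: complex_norm_square)
 then have "cmod (complex_of_real ?S) \<le> sqrt (norm2 f) * sqrt (norm2 ?P)"
  using integral_Cauchy_Schwarz_complex[OF f P] by simp
 then have le: "?S \<le> sqrt (norm2 f) * sqrt ?S"
  unfolding norm2_trig[OF F] norm_of_real by linarith
 have S: "?S \<ge> 0" by (intro sum_nonneg) auto
 show ?thesis
 proof (cases "?S = 0")
  case False
  then have "sqrt ?S > 0" using S by (simp add: less_le)
  moreover have "sqrt ?S * sqrt ?S \<le> sqrt (norm2 f) * sqrt ?S" using le S by simp
  ultimately have "sqrt ?S \<le> sqrt (norm2 f)" by (simp del: real_sqrt_mult_self)
  then show ?thesis by simp
 qed simp
qed

section \<open>The de la Vallee-Poussin kernel\<close>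

text \<open>The mean of \<open>cos (\<pi> z) ^ (2 p)\<close>.\<close>

definition wallis :: "nat \<Rightarrow> real" where
 "wallis p = real ((2 * p) choose p) / 4 ^ p"

definition cos_coeff :: "nat \<Rightarrow> int \<Rightarrow> real" where
 "cos_coeff p l = real ((2 * p) choose nat (int p + l)) / 4 ^ p"

lemma wallis_pos: "wallis p > 0"
 by (simp add: wallis_def)

lemma cos_coeff_0 [simp]: "cos_coeff p 0 = wallis p"
 by (simp add: cos_coeff_def wallis_def)

lemma wallis_Suc: "wallis (Suc p) = wallis p * (2 * real p + 1) / (2 * real p + 2)"
proof -
 have e: "real (2 * p choose p) = fact (2 * p) / (fact p * fact p)" for p
  using binomial_fact[of p "2 * p"] by (simp add: mult_2)
 have "fact (2 * Suc p) = (2 * real p + 2) * (2 * real p + 1) * (fact (2 * p) :: real)"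
  by (simp add: algebra_simps)
 moreover have "fact (Suc p) = (real p + 1) * (fact p :: real)" by (simp add: algebra_simps)
 ultimately have "wallis (Suc p) = ((2 * real p + 2) * (2 * real p + 1)) * fact (2 * p)
   / (((real p + 1) * fact p) * ((real p + 1) * fact p)) / (4 * 4 ^ p)"
  by (simp only: wallis_def e power_Suc)
 also have "\<dots> = fact (2 * p) / (fact p * fact p) / 4 ^ p * (2 * real p + 1) / (2 * real p + 2)"
  by (simp add: divide_simps) (simp add: algebra_simps)
 finally show ?thesis by (simp only: wallis_def e)
qed

lemma cos_power_expansion:
 "complex_of_real (cos (pi * t) ^ (2 * p))
  = (\<Sum>l\<in>{-int p..int p}. of_real (cos_coeff p l) * cis (2 * pi * of_int l * t))"
proof -
 have "complex_of_real (cos (pi * t)) = (cis (pi * t) + cis (- (pi * t))) / 2"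
  by (simp add: complex_eq_iff)
 moreover have "(2 :: complex) ^ (2 * p) = 4 ^ p" by (simp add: power_mult)
 ultimately have "complex_of_real (cos (pi * t) ^ (2 * p)) = (cis (pi * t) + cis (- (pi * t))) ^ (2 * p) / 4 ^ p"
  by (simp only: of_real_power power_divide)
 also have "(cis (pi * t) + cis (- (pi * t))) ^ (2 * p)
   = (\<Sum>q\<le>2 * p. of_nat ((2 * p) choose q) * cis (pi * t) ^ q * cis (- (pi * t)) ^ (2 * p - q))"
  by (rule binomial_ring)
 also have "\<dots> = (\<Sum>q\<le>2 * p. of_nat ((2 * p) choose q) * cis (2 * pi * of_int (int q - int p) * t))"
  by (intro sum.cong refl) (simp add: Complex.DeMoivre cis_mult mult.assoc of_nat_diff algebra_simps)
 also have "\<dots> = (\<Sum>l\<in>{-int p..int p}. of_nat ((2 * p) choose nat (int p + l)) * cis (2 * pi * of_int l * t))"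
  by (rule sum.reindex_bij_witness[where i="\<lambda>l. nat (int p + l)" and j="\<lambda>q. int q - int p"]) auto
 finally show ?thesis by (simp add: sum_divide_distrib cos_coeff_def)
qed

definition cos_kernel :: "(3 \<Rightarrow> nat) \<Rightarrow> real^3 \<Rightarrow> real" where
 "cos_kernel m z = (\<Prod>j\<in>UNIV. cos (pi * z $ j) ^ (2 * m j))"

definition freqs :: "(3 \<Rightarrow> nat) \<Rightarrow> (3 \<Rightarrow> int) set" where
 "freqs m = (\<Pi>\<^sub>E j\<in>UNIV. {- int (m j)..int (m j)})"

lemma finite_freqs [simp]: "finite (freqs m)"
 unfolding freqs_def by (intro finite_PiE) auto

lemma zero_in_freqs [simp]: "(\<lambda>_. 0) \<in> freqs m"
 by (auto simp: freqs_def PiE_def)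

lemma prod_3: "(\<Prod>j\<in>UNIV. f j) = f 1 * f 2 * f (3::3)"
 unfolding UNIV_3 by (simp add: mult.assoc)

lemma cos_kernel_expansion:
 "complex_of_real (cos_kernel m z)
  = (\<Sum>k\<in>freqs m. of_real (\<Prod>j\<in>UNIV. cos_coeff (m j) (k j)) * char k z)"
proof -
 have "complex_of_real (cos_kernel m z)
   = (\<Prod>j\<in>UNIV. \<Sum>l\<in>{-int (m j)..int (m j)}. of_real (cos_coeff (m j) l) * cis (2 * pi * of_int l * z $ j))"
  unfolding cos_kernel_def of_real_prod cos_power_expansion ..
 also have "\<dots> = (\<Sum>k\<in>freqs m. \<Prod>j\<in>UNIV. of_real (cos_coeff (m j) (k j)) * cis (2 * pi * of_int (k j) * z $ j))"
  unfolding freqs_def by (rule prod_sum_PiE) auto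
 also have "\<dots> = (\<Sum>k\<in>freqs m. of_real (\<Prod>j\<in>UNIV. cos_coeff (m j) (k j)) * char k z)"
 proof (intro sum.cong refl)
  fix k
  have "(\<Prod>j\<in>UNIV. cis (2 * pi * of_int (k j) * z $ j)) = char k z"
   unfolding prod_3 char_def phase_def sum_3 distrib_left mult.assoc[symmetric] cis_mult ..
  then show "(\<Prod>j\<in>UNIV. of_real (cos_coeff (m j) (k j)) * cis (2 * pi * of_int (k j) * z $ j))
    = of_real (\<Prod>j\<in>UNIV. cos_coeff (m j) (k j)) * char k z"
   by (simp only: prod.distrib of_real_prod)
 qed
 finally show ?thesis .
qed

lemma continuous_cos_kernel [continuous_intros]: "continuous_on A (cos_kernel m)"
 unfolding cos_kernel_def[abs_def] by (intro continuous_intros)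

lemma periodic_cos_kernel: "periodic (cos_kernel m)"
proof -
 have "complex_of_real (cos_kernel m (x + axis k 1)) = complex_of_real (cos_kernel m x)" for x k
  unfolding cos_kernel_expansion using periodic_char by (simp add: periodic_def)
 then show ?thesis by (simp add: periodic_def)
qed

lemma cos_kernel_nonneg: "cos_kernel m z \<ge> 0"
 unfolding cos_kernel_def by (intro prod_nonneg ballI zero_le_even_power) simp

lemma cos_kernel_even: "cos_kernel m (- z) = cos_kernel m z"
 by (simp add: cos_kernel_def)

lemma integral_cos_kernel: "(TI z. cos_kernel m z) = (\<Prod>j\<in>UNIV. wallis (m j))"
proof -
 have "complex_of_real (TI z. cos_kernel m z) = (TI z. complex_of_real (cos_kernel m z))"
  by (rule integral_complex_of_real[symmetric])
 also have "\<dots> = (\<Sum>k\<in>freqs m. of_real (\<Prod>j\<in>UNIV. cos_coeff (m j) (k j)) * (if k = (\<lambda>_. 0) then 1 else 0))"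
  unfolding cos_kernel_expansion
  by (subst LINT_sum)
   (auto simp: integral_char intro!: continuous_integrable_torus continuous_intros)
 also have "\<dots> = (\<Sum>k\<in>freqs m. if k = (\<lambda>_. 0) then of_real (\<Prod>j\<in>UNIV. cos_coeff (m j) (k j)) else 0)"
  by (intro sum.cong) auto
 also have "\<dots> = complex_of_real (\<Prod>j\<in>UNIV. wallis (m j))"
  by simp
 finally show ?thesis by (simp only: of_real_eq_iff)
qed

text \<open>Multiplying by \<open>sin\<^sup>2\<close> in one variable is a difference of two kernels, so that all moments of
 the kernel are explicit.\<close>

lemma cos_kernel_sin2:
 "cos_kernel m z * (sin (pi * z $ j))\<^sup>2 = cos_kernel m z - cos_kernel (m(j := Suc (m j))) z"
proof -
 have "cos_kernel (m(j := Suc (m j))) z = cos_kernel m z * (cos (pi * z $ j))\<^sup>2"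
  unfolding cos_kernel_def
  by (subst (1 2) prod.remove[of UNIV j]) (auto simp: power2_eq_square intro!: prod.cong)
 then show ?thesis by (simp add: sin_squared_eq algebra_simps)
qed

text \<open>A nonnegative trigonometric polynomial of mean one: convolution with it preserves signs and bounds.\<close>

definition vp_kernel :: "nat \<Rightarrow> real^3 \<Rightarrow> real" where
 "vp_kernel n z = cos_kernel (\<lambda>_. n) z / wallis n ^ 3"

definition vp_coeff :: "nat \<Rightarrow> (3 \<Rightarrow> int) \<Rightarrow> real" where
 "vp_coeff n k = (\<Prod>j\<in>UNIV. cos_coeff n (k j)) / wallis n ^ 3"

abbreviation vp_freqs :: "nat \<Rightarrow> (3 \<Rightarrow> int) set" where
 "vp_freqs n \<equiv> freqs (\<lambda>_. n)"

lemma vp_kernel_expansion: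
 "complex_of_real (vp_kernel n z) = (\<Sum>k\<in>vp_freqs n. of_real (vp_coeff n k) * char k z)"
 by (simp add: vp_kernel_def vp_coeff_def cos_kernel_expansion sum_divide_distrib)

lemma continuous_vp_kernel: "continuous_on A (vp_kernel n)"
 unfolding vp_kernel_def[abs_def] using wallis_pos[of n] by (intro continuous_intros) auto

lemma periodic_vp_kernel: "periodic (vp_kernel n)"
 using periodic_cos_kernel by (simp add: periodic_def vp_kernel_def)

lemma vp_kernel_nonneg [simp]: "vp_kernel n z \<ge> 0"
 using wallis_pos[of n] by (simp add: vp_kernel_def cos_kernel_nonneg)

lemma vp_kernel_even: "vp_kernel n (- z) = vp_kernel n z"
 by (simp add: vp_kernel_def cos_kernel_even)

lemma vp_kernel_minus_commute: "vp_kernel n (y - x) = vp_kernel n (x - y)"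
 using vp_kernel_even[of n "x - y"] by simp

lemma integral_vp_kernel: "(TI z. vp_kernel n z) = 1"
 using wallis_pos[of n] by (simp add: vp_kernel_def integral_cos_kernel)

lemma vp_coeff_nonneg [simp]: "vp_coeff n k \<ge> 0"
 using wallis_pos[of n] unfolding vp_coeff_def by (intro divide_nonneg_nonneg prod_nonneg) (auto simp: cos_coeff_def)

lemma vp_kernel_sin2_moment: "(TI z. vp_kernel n z * (sin (pi * z $ j))\<^sup>2) = 1 / (2 * (real n + 1))"
proof -
 have "vp_kernel n z * (sin (pi * z $ j))\<^sup>2
   = (cos_kernel (\<lambda>_. n) z - cos_kernel ((\<lambda>_. n)(j := Suc n)) z) / wallis n ^ 3" for z
  using cos_kernel_sin2[of "\<lambda>_. n" z j] by (simp add: vp_kernel_def)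
 then have "(TI z. vp_kernel n z * (sin (pi * z $ j))\<^sup>2)
   = (wallis n ^ 3 - (\<Prod>i\<in>UNIV. wallis (((\<lambda>_. n)(j := Suc n)) i))) / wallis n ^ 3"
  by (simp add: integral_cos_kernel continuous_integrable_torus continuous_cos_kernel)
 also have "(\<Prod>i\<in>UNIV. wallis (((\<lambda>_. n)(j := Suc n)) i)) = wallis (Suc n) * wallis n ^ 2"
  by (subst prod.remove[of UNIV j]) (auto simp: card_Diff_singleton)
 also have "(wallis n ^ 3 - wallis (Suc n) * wallis n ^ 2) / wallis n ^ 3 = 1 / (2 * (real n + 1))"
 proof -
  have "wallis n ^ 3 - wallis (Suc n) * wallis n ^ 2
    = wallis n ^ 3 * (1 - (2 * real n + 1) / (2 * real n + 2))"
   unfolding wallis_Suc by (simp add: power2_eq_square power3_eq_cube right_diff_distrib)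
  moreover have "1 - (2 * real n + 1) / (2 * real n + 2) = 1 / (2 * (real n + 1))"
   by (simp add: divide_simps)
  ultimately show ?thesis using wallis_pos[of n] by simp
 qed
 finally show ?thesis .
qed

lemma vp_freqs_iff: "k \<in> vp_freqs n \<longleftrightarrow> (\<forall>j. \<bar>k j\<bar> \<le> int n)"
 by (auto simp: freqs_def PiE_iff abs_le_iff) (metis minus_le_iff)+

lemma vp_coeff_eq_integral:
 assumes "k \<in> vp_freqs n"
 shows "complex_of_real (vp_coeff n k) = (TI z. of_real (vp_kernel n z) * cnj (char k z))"
 using fcoeff_trig[OF finite_freqs assms, of "\<lambda>k. of_real (vp_coeff n k)"]
 unfolding fcoeff_def vp_kernel_expansion[symmetric] by (simp add: mult.commute)

lemma vp_coeff_le_1: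
 assumes "k \<in> vp_freqs n" shows "vp_coeff n k \<le> 1"
proof -
 have "cmod (complex_of_real (vp_coeff n k)) \<le> (TI z. cmod (of_real (vp_kernel n z) * cnj (char k z)))"
  unfolding vp_coeff_eq_integral[OF assms] by (rule integral_norm_bound)
 then show ?thesis by (simp add: norm_mult integral_vp_kernel)
qed

lemma abs_sin_mult_le: "\<bar>sin (of_int m * t)\<bar> \<le> (\<bar>of_int m\<bar> * \<bar>sin t\<bar> :: real)" 
proof -
 have nat: "\<bar>sin (real q * t)\<bar> \<le> real q * \<bar>sin t\<bar>" for q
 proof (induction q)
  case (Suc q)
  have "\<bar>sin (real (Suc q) * t)\<bar> = \<bar>sin (real q * t) * cos t + cos (real q * t) * sin t\<bar>"
   by (simp add: algebra_simps sin_add)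
  also have "\<dots> \<le> \<bar>sin (real q * t)\<bar> * \<bar>cos t\<bar> + \<bar>cos (real q * t)\<bar> * \<bar>sin t\<bar>"
   by (metis abs_mult abs_triangle_ineq)
  also have "\<dots> \<le> \<bar>sin (real q * t)\<bar> * 1 + 1 * \<bar>sin t\<bar>"
   by (intro add_mono mult_mono) auto
  finally show ?case using Suc by (simp add: algebra_simps)
 qed simp
 have "\<bar>sin (of_int m * t)\<bar> = \<bar>sin (real (nat \<bar>m\<bar>) * t)\<bar>"
  by (cases "m \<ge> 0") auto
 then show ?thesis using nat[of "nat \<bar>m\<bar>"] by simp
qed

lemma cis_minus_1: "cmod (cis a - 1) = 2 * \<bar>sin (a / 2)\<bar>"
proof -
 have "(cmod (cis a - 1))\<^sup>2 = (2 * \<bar>sin (a / 2)\<bar>)\<^sup>2"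
  using cos_double_sin[of "a / 2"] sin_cos_squared_add[of a]
  by (simp add: cmod_power2 power2_diff power_mult_distrib)
 then show ?thesis by (rule power2_eq_imp_eq) auto
qed

lemma cis_sum3: "cmod (cis (a + b + c) - 1) \<le> cmod (cis a - 1) + cmod (cis b - 1) + cmod (cis c - 1)"
proof -
 have "cis (a + b + c) - 1 = (cis a - 1) * cis (b + c) + ((cis b - 1) * cis c + (cis c - 1))"
  by (simp add: algebra_simps cis_mult)
 then show ?thesis
  unfolding \<open>cis (a + b + c) - 1 = _\<close>
  using norm_triangle_ineq[of "(cis a - 1) * cis (b + c)" "(cis b - 1) * cis c + (cis c - 1)"]
   norm_triangle_ineq[of "(cis b - 1) * cis c" "cis c - 1"] by (simp add: norm_mult)
qed

lemma char_minus_1_le: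
 "(cmod (char k z - 1))\<^sup>2 \<le> 12 * (\<Sum>j\<in>UNIV. (of_int (k j))\<^sup>2 * (sin (pi * z $ j))\<^sup>2)"
proof -
 define s where "s j = \<bar>of_int (k j)\<bar> * \<bar>sin (pi * z $ j)\<bar>" for j
 have 1: "cmod (cis (2 * pi * (of_int (k j) * z $ j)) - 1) \<le> 2 * s j" for j
  using abs_sin_mult_le[of "k j" "pi * z $ j"] by (simp add: cis_minus_1 s_def mult_ac)
 have "cmod (char k z - 1) \<le> 2 * (s 1 + s 2 + s 3)"
  using cis_sum3[of "2 * pi * (of_int (k 1) * z $ 1)" "2 * pi * (of_int (k 2) * z $ 2)"
    "2 * pi * (of_int (k 3) * z $ 3)"] 1[of 1] 1[of 2] 1[of 3]
  by (simp add: char_def phase_def sum_3 distrib_left mult.assoc)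
 then have "(cmod (char k z - 1))\<^sup>2 \<le> (2 * (s 1 + s 2 + s 3))\<^sup>2" by (intro power_mono) auto
 also have "\<dots> \<le> 12 * ((s 1)\<^sup>2 + (s 2)\<^sup>2 + (s 3)\<^sup>2)"
  using sum_squares_bound[of "s 1" "s 2"] sum_squares_bound[of "s 1" "s 3"] sum_squares_bound[of "s 2" "s 3"]
  by (simp add: power2_eq_square algebra_simps)
 finally show ?thesis by (simp add: sum_3 s_def power_mult_distrib)
qed

text \<open>The defect is the mean of \<open>K (1 - Re char)\<close>, and \<open>1 - Re char\<close> is dominated by the \<open>sin\<^sup>2\<close> whose
 moments are known.\<close>

lemma one_minus_vp_coeff_le:
 assumes k: "k \<in> vp_freqs n"
 shows "1 - vp_coeff n k \<le> 3 * (\<Sum>j\<in>UNIV. (of_int (k j))\<^sup>2) / (real n + 1)"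
proof -
 have "vp_coeff n k = Re (TI z. of_real (vp_kernel n z) * cnj (char k z))"
  using vp_coeff_eq_integral[OF k] by (metis Re_complex_of_real)
 also have "\<dots> = (TI z. vp_kernel n z * Re (char k z))"
  by (subst integral_Re[symmetric])
   (auto intro!: continuous_integrable_torus continuous_intros continuous_vp_kernel)
 finally have "1 - vp_coeff n k = (TI z. vp_kernel n z - vp_kernel n z * Re (char k z))"
  by (subst LINT_diff)
   (auto simp: integral_vp_kernel intro!: continuous_integrable_torus continuous_intros continuous_vp_kernel)
 also have "\<dots> \<le> (TI z. 6 * (\<Sum>j\<in>UNIV. (of_int (k j))\<^sup>2 * (vp_kernel n z * (sin (pi * z $ j))\<^sup>2)))"
 proof (rule integral_mono)
  fix z
  have "(cmod (char k z - 1))\<^sup>2 = 2 * (1 - Re (char k z))"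
   using sin_cos_squared_add[of "phase k z"] by (simp add: cmod_power2 char_def power2_diff)
  then have "1 - Re (char k z) \<le> 6 * (\<Sum>j\<in>UNIV. (of_int (k j))\<^sup>2 * (sin (pi * z $ j))\<^sup>2)"
   using char_minus_1_le[of k z] by simp
  from mult_left_mono[OF this vp_kernel_nonneg[of n z]]
  show "vp_kernel n z - vp_kernel n z * Re (char k z)
    \<le> 6 * (\<Sum>j\<in>UNIV. (of_int (k j))\<^sup>2 * (vp_kernel n z * (sin (pi * z $ j))\<^sup>2))"
   by (simp add: sum_distrib_left algebra_simps)
 qed (auto intro!: continuous_integrable_torus continuous_intros continuous_vp_kernel)
 also have "\<dots> = 6 * (\<Sum>j\<in>UNIV. (of_int (k j))\<^sup>2 * (1 / (2 * (real n + 1))))"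
  by (subst integral_mult_right_zero, subst LINT_sum)
   (auto simp: vp_kernel_sin2_moment intro!: continuous_integrable_torus continuous_intros continuous_vp_kernel)
 also have "\<dots> = 3 * (\<Sum>j\<in>UNIV. (of_int (k j))\<^sup>2) / (real n + 1)"
  by (simp add: sum_divide_distrib[symmetric] field_simps flip: sum_distrib_left)
 finally show ?thesis .
qed

section \<open>Convolution with the kernel\<close>

definition vp_conv :: "nat \<Rightarrow> (real^3 \<Rightarrow> complex) \<Rightarrow> real^3 \<Rightarrow> complex" where
 "vp_conv n f y = (\<Sum>k\<in>vp_freqs n. of_real (vp_coeff n k) * fcoeff f k * char k y)"

lemma vp_conv_eq_integral:
 assumes f: "integrable torus f"
 shows "vp_conv n f y = (TI x. of_real (vp_kernel n (y - x)) * f x)"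
proof -
 have "of_real (vp_kernel n (y - x)) * f x
   = (\<Sum>k\<in>vp_freqs n. of_real (vp_coeff n k) * char k y * (cnj (char k x) * f x))" for x
  unfolding vp_kernel_expansion char_diff sum_distrib_right
  by (intro sum.cong refl) (simp add: mult_ac)
 then have "(TI x. of_real (vp_kernel n (y - x)) * f x)
   = (\<Sum>k\<in>vp_freqs n. of_real (vp_coeff n k) * char k y * fcoeff f k)"
  using integrable_char_mult[OF f] by (simp add: fcoeff_def)
 then show ?thesis by (simp add: vp_conv_def mult_ac)
qed

lemma continuous_vp_conv [continuous_intros]: "continuous_on A (vp_conv n f)"
 unfolding vp_conv_def[abs_def] by (intro continuous_intros)

lemma continuous_vp_kernel_diff: "continuous_on A (\<lambda>x. vp_kernel n (y - x))"
 by (rule continuous_on_compose2[OF continuous_vp_kernel[of UNIV]]) (auto intro!: continuous_intros)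

lemma integral_vp_kernel_diff: "(TI x. vp_kernel n (y - x)) = 1"
 using integral_torus_shift[OF continuous_vp_kernel periodic_vp_kernel, of n "-y"]
 by (simp add: vp_kernel_minus_commute[of n y] integral_vp_kernel)

lemma periodic_sin_sq: "periodic (\<lambda>z :: real^3. (sin (pi * z $ j))\<^sup>2)"
proof -
 have "sin (pi * (x + axis k 1) $ j) = sin (pi * x $ j) \<or> sin (pi * (x + axis k 1) $ j) = - sin (pi * x $ j)"
  for x :: "real^3" and k by (cases "k = j") (auto simp: axis_def distrib_left)
 then have "(sin (pi * (x + axis k 1) $ j))\<^sup>2 = (sin (pi * x $ j))\<^sup>2" for x :: "real^3" and k
  by (metis power2_minus)
 then show ?thesis by (simp add: periodic_def)
qed

lemma integral_vp_kernel_sin2_diff: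
 "(TI x. vp_kernel n (y - x) * (sin (pi * (y - x) $ j))\<^sup>2) = 1 / (2 * (real n + 1))"
proof -
 have "vp_kernel n (y - x) * (sin (pi * (y - x) $ j))\<^sup>2
   = vp_kernel n (x + (- y)) * (sin (pi * (x + (- y)) $ j))\<^sup>2" for x
 proof -
  have yx: "y - x = - (x + (- y))" by simp
  show ?thesis
   unfolding yx vp_kernel_even vector_uminus_component mult_minus_right sin_minus power2_minus ..
 qed
 then have "(TI x. vp_kernel n (y - x) * (sin (pi * (y - x) $ j))\<^sup>2)
   = (TI x. vp_kernel n (x + (- y)) * (sin (pi * (x + (- y)) $ j))\<^sup>2)"
  by simp
 also have "\<dots> = (TI x. vp_kernel n x * (sin (pi * x $ j))\<^sup>2)"
  using periodic_vp_kernel periodic_sin_sq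
  by (intro integral_torus_shift[where f="\<lambda>x. vp_kernel n x * (sin (pi * x $ j))\<^sup>2"] continuous_intros continuous_vp_kernel)
   (simp add: periodic_def)
 finally show ?thesis by (simp add: vp_kernel_sin2_moment)
qed

lemma sin_sq_lower:
 assumes d: "0 < d" and a: "d \<le> \<bar>a\<bar>" "\<bar>a\<bar> \<le> 1 - d"
 shows "(sin (pi * d))\<^sup>2 \<le> (sin (pi * a))\<^sup>2"
proof -
 have pos: "0 \<le> sin (pi * d)" using d a by (intro sin_ge_zero) auto
 have mono: "sin (pi * d) \<le> sin (pi * b)" if "d \<le> b" "b \<le> 1 / 2" for b
 proof (rule sin_monotone_2pi_le)
  show "- (pi / 2) \<le> pi * d" using mult_pos_pos[OF pi_gt_zero d] pi_gt_zero by linarith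
 qed (use that in auto)
 have "sin (pi * d) \<le> sin (pi * \<bar>a\<bar>)"
 proof (cases "\<bar>a\<bar> \<le> 1 / 2")
  case False
  have "sin (pi * d) \<le> sin (pi * (1 - \<bar>a\<bar>))" using False a by (intro mono) auto
  also have "pi * (1 - \<bar>a\<bar>) = pi - pi * \<bar>a\<bar>" by (simp add: algebra_simps)
  finally show ?thesis by simp
 qed (use a mono in auto)
 moreover have "(sin (pi * a))\<^sup>2 = (sin (pi * \<bar>a\<bar>))\<^sup>2" by (cases "a \<ge> 0") auto
 ultimately show ?thesis using pos by (simp add: power_mono)
qed

lemma vp_conv_bound:
 assumes m: "f \<in> borel_measurable torus" and B: "\<And>x. x \<in> cbox 0 One \<Longrightarrow> cmod (f x) \<le> B"
 shows "cmod (vp_conv n f y) \<le> B"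
proof -
 have i: "integrable torus f" by (rule bounded_integrable_torus[OF m B])
 have "cmod (vp_conv n f y) \<le> (TI x. cmod (of_real (vp_kernel n (y - x)) * f x))"
  unfolding vp_conv_eq_integral[OF i] by (rule integral_norm_bound)
 also have "\<dots> \<le> (TI x. vp_kernel n (y - x) * B)"
 proof (rule integral_mono_AE)
  have k: "(\<lambda>x. vp_kernel n (y - x)) \<in> L2" by (intro continuous_in_L2 continuous_vp_kernel_diff)
  show "integrable torus (\<lambda>x. cmod (of_real (vp_kernel n (y - x)) * f x))"
   using L2_integrable_mult_norm[OF k bounded_in_L2[OF m B]] by (simp add: norm_mult)
  show "integrable torus (\<lambda>x. vp_kernel n (y - x) * B)"
   by (intro continuous_integrable_torus continuous_intros continuous_vp_kernel_diff)
  show "AE x in torus. cmod (of_real (vp_kernel n (y - x)) * f x) \<le> vp_kernel n (y - x) * B"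
   using B by (intro AE_I2) (auto simp: norm_mult intro!: mult_left_mono)
 qed
 finally show ?thesis by (simp add: integral_vp_kernel_diff)
qed

text \<open>Off the diagonal some coordinate difference stays away from the integers, where \<open>sin\<^sup>2\<close> is
 bounded below; the second moment of the kernel then controls the tail.\<close>

lemma vp_conv_pointwise:
 assumes m: "f \<in> borel_measurable torus" and B: "\<And>x. x \<in> cbox 0 One \<Longrightarrow> cmod (f x) \<le> B"
  and y: "y \<in> box 0 One" and cont: "isCont f y"
 shows "(\<lambda>n. vp_conv n f y) \<longlonglongrightarrow> f y"
proof -
 have i: "integrable torus f" by (rule bounded_integrable_torus[OF m B])
 have By: "cmod (f y) \<le> B" using B y box_subset_cbox by blast
 then have B0: "B \<ge> 0" using norm_ge_zero order_trans by blast
 have *: "\<exists>C. \<forall>n. cmod (vp_conv n f y - f y) \<le> e + C / (real n + 1)" if e: "e > 0" for e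
 proof -
  obtain d0 where d0: "d0 > 0" "\<And>x. norm (x - y) < d0 \<Longrightarrow> cmod (f x - f y) < e"
   using cont e unfolding continuous_at_eps_delta dist_norm by metis
  define d where "d = Min (insert (d0 / 4) ((\<lambda>j. min (y $ j) (1 - y $ j)) ` UNIV))"
  have dpos: "d > 0" unfolding d_def using y d0 by (subst Min_gr_iff) (auto simp: mem_open_cell_iff)
  have dle: "d \<le> d0 / 4" "d \<le> y $ j" "d \<le> 1 - y $ j" for j
  proof -
   have "d \<le> min (y $ j) (1 - y $ j)" unfolding d_def by (intro Min_le) auto
   then show "d \<le> y $ j" "d \<le> 1 - y $ j" by auto
  qed (simp add: d_def)
  have dhalf: "d \<le> 1 / 2" using dle(2)[of 1] dle(3)[of 1] by linarith
  define s where "s = (sin (pi * d))\<^sup>2"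
  have s: "s > 0" unfolding s_def using dpos dhalf by (intro zero_less_power sin_gt_zero) auto
  have le: "cmod (f x - f y) \<le> e + (\<Sum>j\<in>UNIV. 2 * B / s * (sin (pi * (y - x) $ j))\<^sup>2)"
   if x: "x \<in> cbox 0 One" for x
  proof (cases "\<forall>j. \<bar>(y - x) $ j\<bar> < d")
   case True
   have "norm (x - y) \<le> (\<Sum>j\<in>UNIV. \<bar>(x - y) $ j\<bar>)" by (rule norm_le_l1_cart)
   also have "\<dots> \<le> (\<Sum>j\<in>(UNIV :: 3 set). d)" using True by (intro sum_mono) (auto simp: abs_minus_commute less_imp_le)
   also have "\<dots> < d0" using dle(1) dpos by (simp add: sum_3)
   finally have "cmod (f x - f y) < e" by (rule d0)
   moreover have "0 \<le> (\<Sum>j\<in>UNIV. 2 * B / s * (sin (pi * (y - x) $ j))\<^sup>2)"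
    using B0 s by (intro sum_nonneg) auto
   ultimately show ?thesis by linarith
  next
   case False
   then obtain j where j: "d \<le> \<bar>(y - x) $ j\<bar>" by (auto simp: not_less)
   have "\<bar>(y - x) $ j\<bar> \<le> 1 - d" using x dle(2,3)[of j] by (auto simp: mem_cell_iff abs_le_iff) (smt (verit))+
   then have "s \<le> (sin (pi * (y - x) $ j))\<^sup>2" unfolding s_def by (intro sin_sq_lower dpos j)
   then have "2 * B / s * s \<le> 2 * B / s * (sin (pi * (y - x) $ j))\<^sup>2"
    using B0 s by (intro mult_left_mono) auto
   also have "\<dots> \<le> (\<Sum>j\<in>UNIV. 2 * B / s * (sin (pi * (y - x) $ j))\<^sup>2)"
    using B0 s by (intro member_le_sum) auto
   finally have "2 * B \<le> (\<Sum>j\<in>UNIV. 2 * B / s * (sin (pi * (y - x) $ j))\<^sup>2)" using s by simp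
   moreover have "cmod (f x - f y) \<le> 2 * B" using norm_triangle_ineq4[of "f x" "f y"] B[OF x] By by linarith
   ultimately show ?thesis using e by linarith
  qed
  have "cmod (vp_conv n f y - f y) \<le> e + (3 * (2 * B / s) / 2) / (real n + 1)" for n
  proof -
   have k: "(\<lambda>x. complex_of_real (vp_kernel n (y - x))) \<in> L2"
    by (intro continuous_in_L2 continuous_intros continuous_vp_kernel_diff)
   have "(TI x. complex_of_real (vp_kernel n (y - x)) * f y) = f y"
    by (simp add: integral_vp_kernel_diff integral_complex_of_real)
   then have "vp_conv n f y - f y = (TI x. of_real (vp_kernel n (y - x)) * (f x - f y))"
    unfolding vp_conv_eq_integral[OF i] using L2_mult_integrable[OF k bounded_in_L2[OF m B]] L2_integrable[OF k]
    by (simp add: right_diff_distrib)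
   then have "cmod (vp_conv n f y - f y) \<le> (TI x. cmod (of_real (vp_kernel n (y - x)) * (f x - f y)))"
    by (simp add: integral_norm_bound)
   also have "\<dots> \<le> (TI x. e * vp_kernel n (y - x)
     + (\<Sum>j\<in>UNIV. 2 * B / s * (vp_kernel n (y - x) * (sin (pi * (y - x) $ j))\<^sup>2)))"
   proof (rule integral_mono_AE)
    have "(\<lambda>x. f x - f y) \<in> L2"
     by (intro L2_diff bounded_in_L2[OF m B] continuous_in_L2) auto
    from L2_integrable_mult_norm[OF k this]
    show "integrable torus (\<lambda>x. cmod (of_real (vp_kernel n (y - x)) * (f x - f y)))" by (simp add: norm_mult)
    show "AE x in torus. cmod (of_real (vp_kernel n (y - x)) * (f x - f y)) \<le> e * vp_kernel n (y - x)
     + (\<Sum>j\<in>UNIV. 2 * B / s * (vp_kernel n (y - x) * (sin (pi * (y - x) $ j))\<^sup>2))"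
    proof (rule AE_I2)
     fix x assume "x \<in> space torus"
     then have "vp_kernel n (y - x) * cmod (f x - f y)
       \<le> vp_kernel n (y - x) * (e + (\<Sum>j\<in>UNIV. 2 * B / s * (sin (pi * (y - x) $ j))\<^sup>2))"
      by (intro mult_left_mono le) auto
     then show "cmod (of_real (vp_kernel n (y - x)) * (f x - f y)) \<le> e * vp_kernel n (y - x)
       + (\<Sum>j\<in>UNIV. 2 * B / s * (vp_kernel n (y - x) * (sin (pi * (y - x) $ j))\<^sup>2))"
      by (simp add: norm_mult distrib_left sum_distrib_left mult_ac)
    qed
   qed (use s in \<open>auto intro!: continuous_integrable_torus continuous_intros continuous_vp_kernel_diff\<close>)
   also have "\<dots> = e + (\<Sum>j\<in>(UNIV :: 3 set). 2 * B / s * (1 / (2 * (real n + 1))))"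
   proof -
    have i1: "integrable torus (\<lambda>x. e * vp_kernel n (y - x))"
     by (intro continuous_integrable_torus continuous_intros continuous_vp_kernel_diff)
    have i2: "integrable torus (\<lambda>x. 2 * B / s * (vp_kernel n (y - x) * (sin (pi * (y - x) $ j))\<^sup>2))" for j
     using s by (intro continuous_integrable_torus continuous_intros continuous_vp_kernel_diff) auto
    show ?thesis
     by (simp only: LINT_add[OF i1 L1_sum[OF i2]]
       LINT_sum[OF i2] integral_mult_right_zero integral_vp_kernel_diff
       integral_vp_kernel_sin2_diff mult_1_right)
   qed
   also have "\<dots> = e + (3 * (2 * B / s) / 2) / (real n + 1)"
   proof -
    have "3 * (b * (1 / (2 * r))) = 3 * b / 2 / r" for b r :: real by simp
    from this[of "2 * B / s" "real n + 1"] show ?thesis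
     using s by (simp only: sum_3) simp
   qed
   finally show ?thesis .
  qed
  then show ?thesis by blast
 qed
 show ?thesis
 proof (rule LIMSEQ_I)
  fix r :: real assume r: "r > 0"
  obtain C where C: "\<And>n. cmod (vp_conv n f y - f y) \<le> r / 2 + C / (real n + 1)" using *[of "r / 2"] r by auto
  have "(\<lambda>n. C / (real n + 1)) \<longlonglongrightarrow> 0" by real_asymp
  then have "\<forall>\<^sub>F n in sequentially. C / (real n + 1) < r / 2" using r by (intro order_tendstoD(2)) auto
  then obtain N where "\<And>n. n \<ge> N \<Longrightarrow> C / (real n + 1) < r / 2" by (auto simp: eventually_sequentially)
  then show "\<exists>N. \<forall>n\<ge>N. cmod (vp_conv n f y - f y) < r" using C by (smt (verit) field_sum_of_halves)
 qed
qed

text \<open>The pairing of \<open>K * f\<close> with \<open>g\<close>: a summation method for Parseval's identity that also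
 converges when \<open>g\<close> is merely integrable and \<open>f\<close> is bounded and continuous.\<close>

definition vp_form :: "nat \<Rightarrow> (real^3 \<Rightarrow> complex) \<Rightarrow> (real^3 \<Rightarrow> complex) \<Rightarrow> complex" where
 "vp_form n f g = (\<Sum>k\<in>vp_freqs n. of_real (vp_coeff n k) * fcoeff f k * cnj (fcoeff g k))"

lemma cnj_fcoeff: "cnj (fcoeff g k) = (TI x. char k x * cnj (g x))"
 unfolding fcoeff_def by (subst LINT_cnj[symmetric]) simp

lemma vp_form_eq_integral:
 assumes "integrable torus g"
 shows "vp_form n f g = (TI y. vp_conv n f y * cnj (g y))"
proof -
 have cg: "(\<lambda>x. cnj (g x)) \<in> borel_measurable torus"
  using assms by (intro borel_measurable_cnj borel_measurable_integrable)
 have "integrable torus (\<lambda>x. char k x * cnj (g x))" for k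
 proof (rule L1_bound[OF assms])
  show "(\<lambda>x. char k x * cnj (g x)) \<in> borel_measurable torus"
   by (intro borel_measurable_times cg char_measurable)
 qed (simp add: norm_mult)
 then have i: "integrable torus (\<lambda>x. (of_real (vp_coeff n k) * fcoeff f k) * (char k x * cnj (g x)))" for k
  by (rule integrable_mult_right)
 have "vp_form n f g = (\<Sum>k\<in>vp_freqs n. (TI y. (of_real (vp_coeff n k) * fcoeff f k) * (char k y * cnj (g y))))"
  unfolding vp_form_def cnj_fcoeff integral_mult_right_zero ..
 also have "\<dots> = (TI y. (\<Sum>k\<in>vp_freqs n. (of_real (vp_coeff n k) * fcoeff f k) * (char k y * cnj (g y))))"
  by (rule LINT_sum[symmetric]) (rule i)
 also have "\<dots> = (TI y. vp_conv n f y * cnj (g y))"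
  unfolding vp_conv_def sum_distrib_right by (simp only: mult.assoc)
 finally show ?thesis .
qed

lemma vp_form_tendsto_continuous:
 assumes h: "continuous_on UNIV h" and B: "\<And>x. x \<in> cbox 0 One \<Longrightarrow> cmod (h x) \<le> B" and g: "integrable torus g"
 shows "(\<lambda>n. vp_form n h g) \<longlonglongrightarrow> (TI x. h x * cnj (g x))"
 unfolding vp_form_eq_integral[OF g]
proof (rule integral_dominated_convergence[where w="\<lambda>x. B * cmod (g x)"])
 have hm: "h \<in> borel_measurable torus" using h by (rule continuous_borel_torus)
 show "AE x in torus. (\<lambda>n. vp_conv n h x * cnj (g x)) \<longlonglongrightarrow> h x * cnj (g x)"
  using AE_torus_open_cell
 proof eventually_elim
  case (elim x)
  have "isCont h x" using h by (simp add: continuous_on_eq_continuous_at)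
  then show ?case by (intro tendsto_intros vp_conv_pointwise[OF hm B elim])
 qed
 show "AE x in torus. norm (vp_conv n h x * cnj (g x)) \<le> B * cmod (g x)" for n
  using vp_conv_bound[OF hm B] by (auto intro!: AE_I2 mult_right_mono simp: norm_mult)
next
 have gm: "(\<lambda>x. cnj (g x)) \<in> borel_measurable torus"
  using g by (intro borel_measurable_cnj borel_measurable_integrable)
 show "(\<lambda>x. h x * cnj (g x)) \<in> borel_measurable torus"
  by (intro borel_measurable_times gm continuous_borel_torus h)
 show "(\<lambda>x. vp_conv n h x * cnj (g x)) \<in> borel_measurable torus" for n
  by (intro borel_measurable_times gm continuous_borel_torus continuous_vp_conv)
qed (use g in auto)

section \<open>Approximation by continuous functions, uniqueness and Parseval\<close>

lemma AE_torus_notin_negligible: "negligible N \<Longrightarrow> AE x in torus. x \<notin> N"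
 unfolding torus_def negligible_iff_null_sets
 by (subst AE_restrict_space_iff) (auto dest: AE_not_in)

text \<open>Projecting continuous approximations onto the ball keeps the bound.\<close>

lemma bounded_approx_continuous:
 fixes f :: "real^3 \<Rightarrow> complex"
 assumes m: "f \<in> borel_measurable torus" and R: "\<And>x. x \<in> cbox 0 One \<Longrightarrow> cmod (f x) \<le> R"
 obtains h where "\<And>n. continuous_on UNIV (h n)" "\<And>n x. cmod (h n x) \<le> R"
  "AE x in torus. (\<lambda>n. h n x) \<longlonglongrightarrow> f x"
proof -
 have "R \<ge> 0" using R[of 0] norm_ge_zero[of "f 0"] by (simp add: mem_cell_iff del: norm_ge_zero)
 then have ne: "cball (0::complex) R \<noteq> {}" by simp
 have "f measurable_on cbox 0 One"
  using m unfolding torus_def by (subst measurable_on_iff_borel_measurable) auto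
 then obtain N g where N: "negligible N" and gc: "\<And>n. continuous_on UNIV (g n)"
  and gl: "\<And>x. x \<notin> N \<Longrightarrow> (\<lambda>n. g n x) \<longlonglongrightarrow> (if x \<in> cbox 0 One then f x else 0)"
  unfolding measurable_on_def by blast
 let ?P = "closest_point (cball (0::complex) R)"
 have Pc: "continuous_on UNIV ?P" by (intro continuous_on_closest_point ne) auto
 show thesis
 proof
  show "continuous_on UNIV (\<lambda>x. ?P (g n x))" for n
   by (rule continuous_on_compose2[OF Pc gc]) auto
  show "cmod (?P (g n x)) \<le> R" for n x
   using closest_point_in_set[OF _ ne, of "g n x"] by simp
  show "AE x in torus. (\<lambda>n. ?P (g n x)) \<longlonglongrightarrow> f x"
   using AE_torus_notin_negligible[OF N] AE_torus_cell
  proof eventually_elim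
   case (elim x)
   have "(\<lambda>n. ?P (g n x)) \<longlonglongrightarrow> ?P (f x)"
    using gl[OF elim(1)] elim(2) Pc
    by (intro isCont_tendsto_compose[of _ ?P]) (auto simp: continuous_on_eq_continuous_at)
   also have "?P (f x) = f x" using R[OF elim(2)] by (intro closest_point_self) simp
   finally show ?case .
  qed
 qed
qed

text \<open>Parseval against continuous approximations of the sign of \<open>g\<close> gives \<open>\<integral>\<bar>g\<bar> = 0\<close>.\<close>

lemma fcoeff_unique:
 assumes g: "integrable torus g" and 0: "\<And>k. fcoeff g k = 0"
 shows "AE x in torus. g x = 0"
proof -
 have gm: "g \<in> borel_measurable torus" using g by auto
 have sgn: "(\<lambda>x. sgn (g x)) \<in> borel_measurable torus" using gm by measurable
 obtain h where hc: "\<And>n. continuous_on UNIV (h n)" and hb: "\<And>n x. cmod (h n x) \<le> 1"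
  and hl: "AE x in torus. (\<lambda>n. h n x) \<longlonglongrightarrow> sgn (g x)"
  by (rule bounded_approx_continuous[OF sgn, of 1]) (auto simp: norm_sgn)
 have z: "(TI x. h n x * cnj (g x)) = 0" for n
  using vp_form_tendsto_continuous[OF hc[of n] _ g, of 1] hb[of n] by (simp add: vp_form_def 0 LIMSEQ_const_iff)
 have "(\<lambda>n. TI x. h n x * cnj (g x)) \<longlonglongrightarrow> (TI x. sgn (g x) * cnj (g x))"
 proof (rule integral_dominated_convergence[where w="\<lambda>x. cmod (g x)"])
  show "AE x in torus. (\<lambda>n. h n x * cnj (g x)) \<longlonglongrightarrow> sgn (g x) * cnj (g x)"
   using hl by eventually_elim (intro tendsto_intros)
  show "AE x in torus. norm (h n x * cnj (g x)) \<le> cmod (g x)" for n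
   using hb[of n] by (auto intro!: AE_I2 mult_left_le_one_le simp: norm_mult)
  have cg: "(\<lambda>x. cnj (g x)) \<in> borel_measurable torus" using gm by (rule borel_measurable_cnj)
  show "(\<lambda>x. sgn (g x) * cnj (g x)) \<in> borel_measurable torus"
   by (intro borel_measurable_times cg sgn)
  show "(\<lambda>x. h n x * cnj (g x)) \<in> borel_measurable torus" for n
   by (intro borel_measurable_times cg continuous_borel_torus hc)
 qed (use g in auto)
 moreover have "sgn (g x) * cnj (g x) = complex_of_real (cmod (g x))" for x
  by (cases "g x = 0") (simp_all add: sgn_div_norm scaleR_conv_of_real complex_norm_square[symmetric] power2_eq_square field_simps)
 ultimately have "(TI x. cmod (g x)) = 0" by (simp add: z LIMSEQ_const_iff)
 then show ?thesis using g by (simp add: integral_nonneg_eq_0_iff_AE)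
qed

lemma fcoeff_eq_imp_AE_eq:
 assumes "integrable torus f" "integrable torus g" "\<And>k. fcoeff f k = fcoeff g k"
 shows "AE x in torus. f x = g x"
 using fcoeff_unique[of "\<lambda>x. f x - g x"] assms by (simp add: fcoeff_diff)

lemma L2_approx_continuous:
 fixes f :: "real^3 \<Rightarrow> complex"
 assumes f: "f \<in> L2" and e: "e > 0"
 obtains h where "continuous_on UNIV h" "bounded (range h)" "norm2 (\<lambda>x. f x - h x) < e"
proof -
 have fm: "f \<in> borel_measurable torus" using f by (rule L2_measurable)
 define t where "t R x = (if cmod (f x) \<le> real R then f x else 0)" for R x
 have tm: "t R \<in> borel_measurable torus" for R unfolding t_def[abs_def] using fm by measurable
 have tb: "cmod (t R x) \<le> real R" for R x by (simp add: t_def)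
 have tL: "t R \<in> L2" for R by (rule bounded_in_L2[OF tm tb])
 have "(\<lambda>R. TI x. (cmod (f x - t R x))\<^sup>2) \<longlonglongrightarrow> (TI x. 0)"
 proof (rule integral_dominated_convergence[where w="\<lambda>x. (cmod (f x))\<^sup>2"])
  show "AE x in torus. (\<lambda>R. (cmod (f x - t R x))\<^sup>2) \<longlonglongrightarrow> 0"
  proof (rule AE_I2)
   fix x
   obtain R0 where "cmod (f x) \<le> real R0" using real_arch_simple by blast
   then have "\<forall>\<^sub>F R in sequentially. (cmod (f x - t R x))\<^sup>2 = 0"
    unfolding eventually_sequentially t_def by (intro exI[of _ R0]) (auto intro: order_trans)
   then show "(\<lambda>R. (cmod (f x - t R x))\<^sup>2) \<longlonglongrightarrow> 0" by (rule tendsto_eventually)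
  qed
 qed (use f fm tm in \<open>auto simp: t_def L2_def\<close>)
 then have "\<forall>\<^sub>F R in sequentially. norm2 (\<lambda>x. f x - t R x) < e / 4"
  unfolding norm2_def using e by (intro order_tendstoD(2)) auto
 then obtain R where R: "norm2 (\<lambda>x. f x - t R x) < e / 4" by (auto simp: eventually_sequentially)
 obtain h where hc: "\<And>n. continuous_on UNIV (h n)" and hb: "\<And>n x. cmod (h n x) \<le> real R"
  and hl: "AE x in torus. (\<lambda>n. h n x) \<longlonglongrightarrow> t R x"
  by (rule bounded_approx_continuous[OF tm tb]) auto
 have "(\<lambda>n. TI x. (cmod (t R x - h n x))\<^sup>2) \<longlonglongrightarrow> (TI x. 0)"
 proof (rule integral_dominated_convergence[where w="\<lambda>x. (2 * real R)\<^sup>2"])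
  show "AE x in torus. (\<lambda>n. (cmod (t R x - h n x))\<^sup>2) \<longlonglongrightarrow> 0"
   using hl
  proof eventually_elim
   case (elim x)
   have "(\<lambda>n. (cmod (t R x - h n x))\<^sup>2) \<longlonglongrightarrow> (cmod (t R x - t R x))\<^sup>2" by (intro tendsto_intros elim)
   then show ?case by simp
  qed
  have "cmod (t R x - h n x) \<le> 2 * real R" for n x
   using norm_triangle_ineq4[of "t R x" "h n x"] hb[of n x] tb[of R x] by linarith
  then have "norm ((cmod (t R x - h n x))\<^sup>2) \<le> (2 * real R)\<^sup>2" for n x
   using power_mono[of "cmod (t R x - h n x)" "2 * real R" 2] by simp
  then show "AE x in torus. norm ((cmod (t R x - h n x))\<^sup>2) \<le> (2 * real R)\<^sup>2" for n
   by (intro AE_I2)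
  show "(\<lambda>x. (cmod (t R x - h n x))\<^sup>2) \<in> borel_measurable torus" for n
   by (intro borel_measurable_power borel_measurable_norm[THEN measurable_compose[rotated]]
     borel_measurable_diff tm continuous_borel_torus hc)
 qed auto
 then have "\<forall>\<^sub>F n in sequentially. norm2 (\<lambda>x. t R x - h n x) < e / 4"
  unfolding norm2_def using e by (intro order_tendstoD(2)) auto
 then obtain n where n: "norm2 (\<lambda>x. t R x - h n x) < e / 4" by (auto simp: eventually_sequentially)
 have "norm2 (\<lambda>x. f x - h n x) = norm2 (\<lambda>x. (f x - t R x) + (t R x - h n x))" by simp
 also have "\<dots> \<le> 2 * norm2 (\<lambda>x. f x - t R x) + 2 * norm2 (\<lambda>x. t R x - h n x)"
  by (intro norm2_triangle L2_diff f tL continuous_in_L2 hc)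
 finally have "norm2 (\<lambda>x. f x - h n x) < e" using R n by linarith
 moreover have "bounded (range (h n))" using hb[of n] by (auto simp: bounded_iff)
 ultimately show thesis using that hc[of n] by blast
qed

lemma norm_vp_form_le_sum: "cmod (vp_form n f g) \<le> (\<Sum>k\<in>vp_freqs n. cmod (fcoeff f k) * cmod (fcoeff g k))"
 unfolding vp_form_def
proof (rule sum_norm_le)
 fix k assume "k \<in> vp_freqs n"
 then have "\<bar>vp_coeff n k\<bar> * (cmod (fcoeff f k) * cmod (fcoeff g k)) \<le> 1 * (cmod (fcoeff f k) * cmod (fcoeff g k))"
  using vp_coeff_le_1 by (intro mult_right_mono) auto
 then show "cmod (of_real (vp_coeff n k) * fcoeff f k * cnj (fcoeff g k)) \<le> cmod (fcoeff f k) * cmod (fcoeff g k)"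
  by (simp add: norm_mult mult.assoc)
qed

lemma norm_vp_form_le:
 assumes f: "f \<in> L2" and g: "g \<in> L2"
 shows "cmod (vp_form n f g) \<le> sqrt (norm2 f) * sqrt (norm2 g)"
proof -
 let ?F = "vp_freqs n"
 have "cmod (vp_form n f g) \<le> (\<Sum>k\<in>?F. \<bar>cmod (fcoeff f k)\<bar> * \<bar>cmod (fcoeff g k)\<bar>)"
  using norm_vp_form_le_sum by simp
 also have "\<dots> \<le> L2_set (\<lambda>k. cmod (fcoeff f k)) ?F * L2_set (\<lambda>k. cmod (fcoeff g k)) ?F"
  by (rule L2_set_mult_ineq)
 also have "\<dots> \<le> sqrt (norm2 f) * sqrt (norm2 g)"
  unfolding L2_set_def by (intro mult_mono real_sqrt_le_mono Bessel f g) (auto intro!: sum_nonneg)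
 finally show ?thesis .
qed

lemma vp_form_tendsto_L2:
 assumes f: "f \<in> L2" and g: "g \<in> L2"
 shows "(\<lambda>n. vp_form n f g) \<longlonglongrightarrow> (TI x. f x * cnj (g x))"
proof (rule LIMSEQ_I)
 fix r :: real assume r: "r > 0"
 define G where "G = sqrt (norm2 g) + 1"
 have G: "G > 0" unfolding G_def using real_sqrt_ge_zero[of "norm2 g"] by (smt (verit) norm2_nonneg)
 have "(r / (4 * G))\<^sup>2 > 0" using r G by simp
 then obtain h where hc: "continuous_on UNIV h" and hb: "bounded (range h)" and fh: "norm2 (\<lambda>x. f x - h x) < (r / (4 * G))\<^sup>2"
  by (rule L2_approx_continuous[OF f])
 have h: "h \<in> L2" by (rule continuous_in_L2[OF hc])
 have d: "(\<lambda>x. f x - h x) \<in> L2" by (intro L2_diff f h)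
 have small: "sqrt (norm2 (\<lambda>x. f x - h x)) * sqrt (norm2 g) \<le> r / 4"
 proof -
  have "sqrt (norm2 (\<lambda>x. f x - h x)) \<le> r / (4 * G)"
   using fh r G by (intro real_le_lsqrt) auto
  then have "sqrt (norm2 (\<lambda>x. f x - h x)) * sqrt (norm2 g) \<le> r / (4 * G) * G"
   using r G by (intro mult_mono) (auto simp: G_def)
  then show ?thesis using G by simp
 qed
 obtain B where B: "\<And>x. cmod (h x) \<le> B" using hb by (auto simp: bounded_iff)
 have "(\<lambda>n. vp_form n h g) \<longlonglongrightarrow> (TI x. h x * cnj (g x))"
  by (rule vp_form_tendsto_continuous[OF hc B L2_integrable[OF g]])
 then obtain N where N: "\<And>n. n \<ge> N \<Longrightarrow> cmod (vp_form n h g - (TI x. h x * cnj (g x))) < r / 4"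
  using LIMSEQ_D[of "\<lambda>n. vp_form n h g" _ "r / 4"] r by auto
 have "cmod (vp_form n f g - (TI x. f x * cnj (g x))) < r" if n: "n \<ge> N" for n
 proof -
  let ?d = "\<lambda>x. f x - h x"
  have 1: "vp_form n f g - vp_form n h g = vp_form n ?d g"
   unfolding vp_form_def sum_subtractf[symmetric] fcoeff_diff[OF L2_integrable[OF f] L2_integrable[OF h]]
   by (intro sum.cong refl) (simp add: algebra_simps)
  have i: "integrable torus (\<lambda>x. f x * cnj (g x))" "integrable torus (\<lambda>x. h x * cnj (g x))"
   by (rule L2_mult_integrable[OF f L2_cnj[OF g]] L2_mult_integrable[OF h L2_cnj[OF g]])+
  have 2: "(TI x. f x * cnj (g x)) - (TI x. h x * cnj (g x)) = (TI x. ?d x * cnj (g x))"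
   unfolding left_diff_distrib by (rule LINT_diff[OF i, symmetric])
  have tri: "cmod (a - b) \<le> cmod (a - a') + cmod (a' - b') + cmod (b - b')" for a b a' b' :: complex
  proof -
   have "cmod (a - b) = cmod ((a - a') + (a' - b') - (b - b'))" by simp
   then show ?thesis
    using norm_triangle_ineq4[of "(a - a') + (a' - b')" "b - b'"] norm_triangle_ineq[of "a - a'" "a' - b'"]
    by linarith
  qed
  have "cmod (vp_form n f g - (TI x. f x * cnj (g x)))
   \<le> cmod (vp_form n ?d g) + cmod (vp_form n h g - (TI x. h x * cnj (g x))) + cmod (TI x. ?d x * cnj (g x))"
   using tri[of "vp_form n f g" "TI x. f x * cnj (g x)" "vp_form n h g" "TI x. h x * cnj (g x)"]
   unfolding 1 2 .
  also have "\<dots> < r / 4 + r / 4 + r / 4 + r / 4"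
   using norm_vp_form_le[OF d g, of n] integral_Cauchy_Schwarz_complex[OF d g] small N[OF n] r by linarith
  finally show ?thesis by simp
 qed
 then show "\<exists>N. \<forall>n\<ge>N. cmod (vp_form n f g - (TI x. f x * cnj (g x))) < r" by blast
qed

lemma Parseval_le:
 assumes f: "f \<in> L2" and B: "\<And>n. (\<Sum>k\<in>vp_freqs n. (cmod (fcoeff f k))\<^sup>2) \<le> B"
 shows "norm2 f \<le> B"
proof -
 have "(\<lambda>n. cmod (vp_form n f f)) \<longlonglongrightarrow> cmod (TI x. f x * cnj (f x))"
  by (intro tendsto_norm vp_form_tendsto_L2 f)
 moreover have "(TI x. f x * cnj (f x)) = complex_of_real (norm2 f)"
  unfolding norm2_def complex_norm_square[symmetric] by (simp only: integral_complex_of_real[symmetric] of_real_power)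
 moreover have "cmod (vp_form n f f) \<le> B" for n
  using norm_vp_form_le_sum[of n f f] B[of n] by (simp add: power2_eq_square)
 ultimately have "cmod (complex_of_real (norm2 f)) \<le> B"
  by (intro LIMSEQ_le_const2[of _ _ B]) (auto simp only:)
 then show ?thesis by simp
qed

section \<open>Weak derivatives as Fourier multipliers\<close>

abbreviation rcoeff :: "(real^3 \<Rightarrow> real) \<Rightarrow> (3 \<Rightarrow> int) \<Rightarrow> complex" where
 "rcoeff f \<equiv> fcoeff (\<lambda>x. complex_of_real (f x))"

definition symbol :: "(3 \<Rightarrow> nat) \<Rightarrow> (3 \<Rightarrow> int) \<Rightarrow> complex" where
 "symbol \<alpha> k = (\<Prod>j\<in>UNIV. (2 * pi * of_int (k j) * \<i>) ^ \<alpha> j)"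

definition wave :: "(3 \<Rightarrow> int) \<Rightarrow> real \<Rightarrow> real^3 \<Rightarrow> real" where
 "wave k \<theta> x = cos (phase k x + \<theta>)"

lemma dir_deriv_eqI: "(f has_derivative f') (at x) \<Longrightarrow> dir_deriv b f x = f' b"
 unfolding dir_deriv_def using frechet_derivative_at by metis

lemma has_derivative_phase: "(phase k has_derivative phase k) (at x)"
proof -
 have "linear (phase k)"
  by (rule linearI) (auto simp: phase_add, simp add: phase_def sum_distrib_left mult_ac)
 then show ?thesis by (simp add: linear_imp_has_derivative)
qed

lemma has_derivative_wave:
 "((\<lambda>x. a * wave k \<theta> x) has_derivative (\<lambda>h. a * phase k h * wave k (\<theta> + pi / 2) x)) (at x)"
 unfolding wave_def
 by (auto intro!: derivative_eq_intros has_derivative_phase simp: add.assoc[symmetric] cos_add[of _ "pi/2"])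

lemma dir_deriv_wave:
 "dir_deriv b (\<lambda>x. a * wave k \<theta> x) = (\<lambda>x. (a * phase k b) * wave k (\<theta> + pi / 2) x)"
 using dir_deriv_eqI[OF has_derivative_wave] by (simp add: fun_eq_iff mult_ac)

lemma C_k_wave: "C_k n (\<lambda>x. a * wave k \<theta> x)"
proof (induction n arbitrary: a \<theta>)
 case 0
 show ?case by (auto simp: wave_def intro!: continuous_intros)
next
 case (Suc n)
 then show ?case
  unfolding C_k.simps dir_deriv_wave using has_derivative_wave differentiable_def by blast
qed

lemma wave_eq_Re: "wave k \<theta> x = Re (cis \<theta> * char k x)"
 by (simp add: wave_def char_def cis_mult add.commute)

lemma torus_test_wave: "torus_test (wave k \<theta>)"
proof -
 have "periodic (wave k \<theta>)" using periodic_char by (simp add: periodic_def wave_eq_Re)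
 then show ?thesis using C_k_wave[of _ 1 k \<theta>] by (simp add: torus_test_def smooth_def)
qed

lemma dir_deriv_pow_wave:
 "(partial j ^^ m) (\<lambda>x. a * wave k \<theta> x)
  = (\<lambda>x. (a * (2 * pi * of_int (k j)) ^ m) * wave k (\<theta> + m * (pi / 2)) x)"
proof (induction m)
 case (Suc m)
 have "\<theta> + real m * (pi / 2) + pi / 2 = \<theta> + real (Suc m) * (pi / 2)" by (simp add: distrib_right)
 moreover have "(a * (2 * pi * of_int (k j)) ^ m) * (2 * pi * of_int (k j) * 1) = a * (2 * pi * of_int (k j)) ^ Suc m"
  by (simp only: power_Suc mult_1_right mult_ac)
 ultimately show ?case
  unfolding funpow.simps o_apply Suc dir_deriv_wave phase_axis by (simp only:)
qed simp

lemma multi_deriv_wave: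
 "multi_deriv \<alpha> (wave k \<theta>)
  = (\<lambda>x. (\<Prod>j\<in>UNIV. (2 * pi * of_int (k j)) ^ \<alpha> j) * wave k (\<theta> + real (\<Sum>j\<in>UNIV. \<alpha> j) * (pi / 2)) x)"
proof -
 have "multi_deriv \<alpha> (\<lambda>x. 1 * wave k \<theta> x)
   = (\<lambda>x. (1 * (2 * pi * of_int (k 3)) ^ \<alpha> 3 * (2 * pi * of_int (k 2)) ^ \<alpha> 2 * (2 * pi * of_int (k 1)) ^ \<alpha> 1)
     * wave k (\<theta> + \<alpha> 3 * (pi / 2) + \<alpha> 2 * (pi / 2) + \<alpha> 1 * (pi / 2)) x)"
  unfolding multi_deriv_def dir_deriv_pow_wave ..
 also have "\<theta> + \<alpha> 3 * (pi / 2) + \<alpha> 2 * (pi / 2) + \<alpha> 1 * (pi / 2) = \<theta> + real (\<Sum>j\<in>UNIV. \<alpha> j) * (pi / 2)"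
  by (simp only: sum_3 of_nat_add distrib_right add.assoc add.commute add.left_commute)
 also have "1 * (2 * pi * of_int (k 3)) ^ \<alpha> 3 * (2 * pi * of_int (k 2)) ^ \<alpha> 2 * (2 * pi * of_int (k 1)) ^ \<alpha> 1
   = (\<Prod>j\<in>UNIV. (2 * pi * of_int (k j)) ^ \<alpha> j)"
  by (simp only: prod_3 mult_1 mult.assoc mult.commute mult.left_commute)
 finally show ?thesis by simp
qed

lemma integral_wave_mult:
 assumes "integrable torus f"
 shows "(TI x. wave k \<theta> x * f x) = Re (cis \<theta> * cnj (rcoeff f k))"
proof -
 have i: "integrable torus (\<lambda>x. cnj (char k x) * complex_of_real (f x))"
  by (intro integrable_char_mult integrable_of_real assms)
 have "(TI x. wave k \<theta> x * f x) = (TI x. Re (cis (- \<theta>) * (cnj (char k x) * of_real (f x))))"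
  by (intro LINT_cong refl) (simp add: wave_eq_Re algebra_simps)
 also have "\<dots> = Re (TI x. cis (- \<theta>) * (cnj (char k x) * of_real (f x)))"
  by (rule integral_Re) (rule integrable_mult_right[OF i])
 also have "\<dots> = Re (cis (- \<theta>) * rcoeff f k)" by (simp add: fcoeff_def)
 also have "\<dots> = Re (cnj (cis \<theta> * cnj (rcoeff f k)))" by (simp only: complex_cnj_mult cis_cnj complex_cnj_cnj)
 finally show ?thesis by (simp only: cnj.simps)
qed

lemma Re_cis_mult_eqD:
 assumes "\<And>\<theta>. \<theta> \<in> {0, - (pi / 2)} \<Longrightarrow> Re (cis \<theta> * z) = Re (cis \<theta> * w)" shows "z = w"
 using assms[of 0] assms[of "- (pi / 2)"] by (simp add: complex_eq_iff)

lemma ii_power_cis: "\<i> ^ n = cis (real n * (pi / 2))"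
 using Complex.DeMoivre[of "pi / 2" n] by (simp add: cis_pi_half)

lemma symbol_eq: "symbol \<alpha> k = \<i> ^ (\<Sum>j\<in>UNIV. \<alpha> j) * of_real (\<Prod>j\<in>UNIV. (2 * pi * of_int (k j)) ^ \<alpha> j)"
 unfolding symbol_def by (simp add: prod_3 sum_3 power_mult_distrib power_add mult_ac)

lemma cnj_symbol: "cnj (symbol \<alpha> k) = (-1) ^ (\<Sum>j\<in>UNIV. \<alpha> j) * symbol \<alpha> k"
proof -
 have "cnj \<i> ^ n = (-1) ^ n * \<i> ^ n" for n by (simp flip: power_mult_distrib)
 then show ?thesis by (simp add: symbol_eq mult_ac)
qed

lemma cis_add_half_pi: "cis (\<theta> + real n * (pi / 2)) = cis \<theta> * \<i> ^ n"
 by (simp add: ii_power_cis cis_mult)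

lemma fcoeff_weak_deriv:
 assumes "has_weak_deriv \<alpha> f g" shows "rcoeff g k = symbol \<alpha> k * rcoeff f k"
proof -
 define n where "n = (\<Sum>j\<in>UNIV. \<alpha> j)"
 define P where "P = (\<Prod>j\<in>UNIV. (2 * pi * of_int (k j)) ^ \<alpha> j)"
 have f: "integrable torus f" and g: "integrable torus g" using assms by (auto simp: has_weak_deriv_def)
 have "(-1) ^ n * cnj (rcoeff g k) = \<i> ^ n * of_real P * cnj (rcoeff f k)"
 proof (rule Re_cis_mult_eqD)
  fix \<theta>
  have "(TI x. P * (wave k (\<theta> + real n * (pi / 2)) x * f x)) = (-1) ^ n * (TI x. wave k \<theta> x * g x)"
  proof -
   have "(TI x. multi_deriv \<alpha> (wave k \<theta>) x *\<^sub>R f x) = (-1) ^ n *\<^sub>R (TI x. wave k \<theta> x *\<^sub>R g x)"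
    using assms torus_test_wave[of k \<theta>] unfolding has_weak_deriv_def n_def by blast
   then show ?thesis unfolding multi_deriv_wave n_def P_def real_scaleR_def mult.assoc .
  qed
  then have "P * Re (cis \<theta> * \<i> ^ n * cnj (rcoeff f k)) = (-1) ^ n * Re (cis \<theta> * cnj (rcoeff g k))"
   by (simp only: integral_mult_right_zero integral_wave_mult[OF f] integral_wave_mult[OF g] cis_add_half_pi)
  moreover have "Re (of_real P * z) = P * Re z" "Re ((-1) ^ n * z) = (-1) ^ n * Re z" for z
   by (simp, cases "even n", auto)
  ultimately show "Re (cis \<theta> * ((-1) ^ n * cnj (rcoeff g k))) = Re (cis \<theta> * (\<i> ^ n * of_real P * cnj (rcoeff f k)))"
   by (metis (no_types, lifting) mult.assoc mult.left_commute)
 qed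
 then have "(-1) ^ n * ((-1) ^ n * cnj (rcoeff g k)) = (-1) ^ n * (symbol \<alpha> k * cnj (rcoeff f k))"
  by (simp add: symbol_eq n_def P_def)
 then have "cnj (rcoeff g k) = cnj (symbol \<alpha> k) * cnj (rcoeff f k)"
  by (simp add: cnj_symbol n_def mult.assoc[symmetric] flip: power_mult_distrib)
 then show ?thesis by (metis complex_cnj_cnj complex_cnj_mult)
qed

lemma C_k_SucD: "C_k (Suc n) f \<Longrightarrow> C_k n f"
proof (induction n arbitrary: f)
 case 0
 then show ?case
  by (simp add: continuous_at_imp_continuous_on differentiable_imp_continuous_within)
qed auto

lemma smooth_differentiable: "smooth f \<Longrightarrow> f differentiable (at x)"
 unfolding smooth_def using C_k.simps(2)[of 0 f] by blast

lemma smooth_continuous: "smooth f \<Longrightarrow> continuous_on A f"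
 unfolding smooth_def using C_k.simps(1)[of f] continuous_on_subset by blast

lemma smooth_dir_deriv: "smooth f \<Longrightarrow> b \<in> Basis \<Longrightarrow> smooth (dir_deriv b f)"
 unfolding smooth_def by (metis C_k.simps(2))

lemma periodic_dir_deriv:
 fixes f :: "real^3 \<Rightarrow> real"
 assumes p: "periodic f" and d: "\<And>x. f differentiable (at x)"
 shows "periodic (dir_deriv b f)"
 unfolding periodic_def
proof (intro allI)
 fix x k
 have "(f has_derivative frechet_derivative f (at (x + axis k 1))) (at (x + axis k 1))"
  using d frechet_derivative_works by blast
 then have "((\<lambda>y. f (y + axis k 1)) has_derivative (\<lambda>h. frechet_derivative f (at (x + axis k 1)) h)) (at x)"
  by (rule has_derivative_compose[rotated]) (auto intro!: derivative_eq_intros)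
 then have "(f has_derivative frechet_derivative f (at (x + axis k 1))) (at x)"
  using p by (simp add: periodic_def)
 then show "dir_deriv b f (x + axis k 1) = dir_deriv b f x"
  using dir_deriv_eqI by (metis dir_deriv_def)
qed

lemma torus_test_dir_deriv: "torus_test \<psi> \<Longrightarrow> torus_test (partial j \<psi>)"
 by (simp add: torus_test_def smooth_dir_deriv periodic_dir_deriv smooth_differentiable)

lemma has_derivative_dir_deriv:
 "f differentiable (at x) \<Longrightarrow> (f has_derivative (\<lambda>h. dir_deriv h f x)) (at x)"
 by (simp add: dir_deriv_def frechet_derivative_works[symmetric])

lemma dir_deriv_mult:
 assumes "f differentiable (at x)" "g differentiable (at x)"
 shows "dir_deriv b (\<lambda>x. f x * g x) x = f x * dir_deriv b g x + dir_deriv b f x * g x"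
 by (rule dir_deriv_eqI) (rule has_derivative_mult[OF assms[THEN has_derivative_dir_deriv]])

lemma fcoeff_dir_deriv:
 assumes \<psi>: "torus_test \<psi>"
 shows "rcoeff (partial j \<psi>) k = 2 * pi * of_int (k j) * \<i> * rcoeff \<psi> k"
proof -
 let ?D = "(partial j)"
 have d: "\<psi> differentiable (at x)" for x using \<psi> by (simp add: torus_test_def smooth_differentiable)
 have dw: "wave k \<theta> differentiable (at x)" for \<theta> x
  using torus_test_wave by (simp add: torus_test_def smooth_differentiable)
 have c: "continuous_on A \<psi>" "continuous_on A (?D \<psi>)" "continuous_on A (wave k \<theta>)" for A \<theta>
  using \<psi> torus_test_dir_deriv[OF \<psi>] torus_test_wave by (auto simp: torus_test_def intro: smooth_continuous)
 have "cnj (rcoeff (?D \<psi>) k) = - (2 * pi * of_int (k j)) * \<i> * cnj (rcoeff \<psi> k)"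
 proof (rule Re_cis_mult_eqD)
  fix \<theta>
  let ?p = "\<lambda>x. wave k \<theta> x * \<psi> x"
  have w': "?D (wave k \<theta>) x = 2 * pi * of_int (k j) * wave k (\<theta> + pi / 2) x" for x
   using dir_deriv_wave[of "axis j 1" 1 k \<theta>] by (simp add: phase_axis)
  have D: "?D ?p = (\<lambda>x. wave k \<theta> x * ?D \<psi> x + (2 * pi * of_int (k j)) * (wave k (\<theta> + pi / 2) x * \<psi> x))"
   by (simp add: fun_eq_iff dir_deriv_mult d dw w' mult_ac)
  have "(TI x. ?D ?p x) = 0"
  proof (rule integral_torus_deriv_eq_0)
   show "periodic ?p" using \<psi> torus_test_wave[of k \<theta>] by (simp add: periodic_def torus_test_def)
   show "?p differentiable (at x)" for x by (intro differentiable_mult d dw)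
   show "continuous_on UNIV (?D ?p)" unfolding D by (intro continuous_intros c)
  qed
  then have "(TI x. wave k \<theta> x * ?D \<psi> x) + (2 * pi * of_int (k j)) * (TI x. wave k (\<theta> + pi / 2) x * \<psi> x) = 0"
   unfolding D by (subst (asm) LINT_add)
    (auto intro!: continuous_integrable_torus continuous_intros c)
  then have "Re (cis \<theta> * cnj (rcoeff (?D \<psi>) k)) = - (2 * pi * of_int (k j)) * Re (cis (\<theta> + pi / 2) * cnj (rcoeff \<psi> k))"
   using integral_wave_mult[OF continuous_integrable_torus[OF c(2)]] integral_wave_mult[OF continuous_integrable_torus[OF c(1)]]
   by (simp del: times_complex.simps)
  moreover have "cis (\<theta> + pi / 2) = cis \<theta> * \<i>" using cis_add_half_pi[of \<theta> 1] by simp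
  moreover have "Re (of_real r * z) = r * Re z" for r z by simp
  ultimately show "Re (cis \<theta> * cnj (rcoeff (?D \<psi>) k))
    = Re (cis \<theta> * (- (2 * pi * of_int (k j)) * \<i> * cnj (rcoeff \<psi> k)))"
   by (simp add: algebra_simps)
 qed
 from arg_cong[OF this, of cnj] show ?thesis by simp
qed

lemma torus_test_dir_deriv_pow: "torus_test \<psi> \<Longrightarrow> torus_test ((partial j ^^ m) \<psi>)"
 by (induction m) (auto intro: torus_test_dir_deriv)

lemma fcoeff_dir_deriv_pow:
 "torus_test \<psi> \<Longrightarrow> rcoeff ((partial j ^^ m) \<psi>) k = (2 * pi * of_int (k j) * \<i>) ^ m * rcoeff \<psi> k"
 by (induction m) (auto simp: fcoeff_dir_deriv torus_test_dir_deriv_pow)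

lemma torus_test_multi_deriv: "torus_test \<psi> \<Longrightarrow> torus_test (multi_deriv \<alpha> \<psi>)"
 unfolding multi_deriv_def by (intro torus_test_dir_deriv_pow)

lemma fcoeff_multi_deriv:
 "torus_test \<psi> \<Longrightarrow> rcoeff (multi_deriv \<alpha> \<psi>) k = symbol \<alpha> k * rcoeff \<psi> k"
 unfolding multi_deriv_def by (simp add: fcoeff_dir_deriv_pow torus_test_dir_deriv_pow symbol_def prod_3 mult_ac)

lemma bounded_on_cell: "continuous_on UNIV f \<Longrightarrow> \<exists>B. \<forall>x\<in>cbox 0 One. norm (f x) \<le> B"
 for f :: "real^3 \<Rightarrow> 'b::euclidean_space"
proof -
 assume "continuous_on UNIV f"
 then have "bounded (f ` cbox 0 One)"
  by (intro compact_imp_bounded compact_continuous_image) (auto intro: continuous_on_subset)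
 then show ?thesis by (auto simp: bounded_iff)
qed

lemma vp_form_tendsto_test:
 assumes "continuous_on UNIV \<psi>" "integrable torus g"
 shows "(\<lambda>n. vp_form n (\<lambda>x. of_real (\<psi> x)) (\<lambda>x. of_real (g x))) \<longlonglongrightarrow> of_real (TI x. \<psi> x * g x)"
proof -
 obtain B where "\<And>x. x \<in> cbox 0 One \<Longrightarrow> norm (\<psi> x) \<le> B" using bounded_on_cell[OF assms(1)] by blast
 then have "(\<lambda>n. vp_form n (\<lambda>x. of_real (\<psi> x)) (\<lambda>x. of_real (g x)))
   \<longlonglongrightarrow> (TI x. of_real (\<psi> x) * cnj (of_real (g x)))"
  using assms by (intro vp_form_tendsto_continuous[where B=B] continuous_intros) auto
 then show ?thesis by (simp flip: of_real_mult)
qed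

text \<open>A test function is recovered from its Fourier coefficients by the kernel, so it suffices
 to compare Fourier coefficients.\<close>

lemma has_weak_derivI_fcoeff:
 assumes f: "integrable torus f" and g: "integrable torus g"
  and eq: "\<And>k. rcoeff g k = symbol \<alpha> k * rcoeff f k"
 shows "has_weak_deriv \<alpha> f g"
 unfolding has_weak_deriv_def
proof (intro conjI allI impI f g)
 fix \<psi> :: "real^3 \<Rightarrow> real" assume \<psi>: "torus_test \<psi>"
 let ?n = "\<Sum>j\<in>UNIV. \<alpha> j"
 let ?D = "multi_deriv \<alpha> \<psi>"
 have "continuous_on UNIV \<psi>" "continuous_on UNIV ?D"
  using \<psi> torus_test_multi_deriv[OF \<psi>] by (auto simp: torus_test_def intro: smooth_continuous)
 then have lim: "(\<lambda>n. vp_form n (\<lambda>x. of_real (?D x)) (\<lambda>x. of_real (f x))) \<longlonglongrightarrow> of_real (TI x. ?D x * f x)"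
  "(\<lambda>n. (-1) ^ ?n * vp_form n (\<lambda>x. of_real (\<psi> x)) (\<lambda>x. of_real (g x))) \<longlonglongrightarrow> (-1) ^ ?n * of_real (TI x. \<psi> x * g x)"
  by (intro vp_form_tendsto_test f g tendsto_mult_left; simp)+
 have form_eq: "vp_form n (\<lambda>x. of_real (?D x)) (\<lambda>x. of_real (f x)) = (-1) ^ ?n * vp_form n (\<lambda>x. of_real (\<psi> x)) (\<lambda>x. of_real (g x))" for n
  unfolding vp_form_def sum_distrib_left
  by (intro sum.cong refl)
   (simp add: fcoeff_multi_deriv[OF \<psi>] eq cnj_symbol mult_ac flip: power_mult_distrib mult.assoc[of "(-1)^_" "(-1)^_"])
 have "complex_of_real (TI x. ?D x * f x) = (-1) ^ ?n * of_real (TI x. \<psi> x * g x)"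
  by (rule LIMSEQ_unique[OF lim(1)[unfolded form_eq] lim(2)])
 also have "\<dots> = complex_of_real ((-1) ^ ?n * (TI x. \<psi> x * g x))" by simp
 finally show "(TI x. ?D x *\<^sub>R f x) = (-1) ^ ?n *\<^sub>R (TI x. \<psi> x *\<^sub>R g x)"
  by (simp only: of_real_eq_iff real_scaleR_def)
qed

lemma rcoeff_eq_imp_AE_eq:
 assumes "integrable torus f" "integrable torus g" "\<And>k. rcoeff f k = rcoeff g k"
 shows "AE x in torus. f x = g x"
 using fcoeff_eq_imp_AE_eq[of "\<lambda>x. of_real (f x)" "\<lambda>x. of_real (g x)"] assms by simp

lemma weak_deriv_unique:
 fixes f g h :: "real^3 \<Rightarrow> real"
 assumes "has_weak_deriv \<alpha> f g" "has_weak_deriv \<alpha> f h"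
 shows "AE x in torus. g x = h x"
 by (rule rcoeff_eq_imp_AE_eq)
  (use assms fcoeff_weak_deriv[OF assms(1)] fcoeff_weak_deriv[OF assms(2)] in \<open>auto simp: has_weak_deriv_def\<close>)

lemma symbol_0 [simp]: "symbol (\<lambda>_. 0) k = 1"
 by (simp add: symbol_def)

lemma symbol_add: "symbol (\<lambda>j. \<alpha> j + \<beta> j) k = symbol \<alpha> k * symbol \<beta> k"
 by (simp add: symbol_def power_add prod.distrib)

definition unit_index :: "3 \<Rightarrow> 3 \<Rightarrow> nat" where
 "unit_index j = (\<lambda>i. if i = j then 1 else 0)"

abbreviation weak_partial :: "3 \<Rightarrow> (real^3 \<Rightarrow> 'b::euclidean_space) \<Rightarrow> (real^3 \<Rightarrow> 'b) \<Rightarrow> bool" where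
 "weak_partial l \<equiv> has_weak_deriv  (unit_index l)"

lemma symbol_unit: "symbol (unit_index j) k = 2 * pi * of_int (k j) * \<i>"
 unfolding symbol_def unit_index_def by (subst prod.remove[of UNIV j]) auto

lemma has_weak_deriv_0: "integrable torus f \<Longrightarrow> has_weak_deriv (\<lambda>_. 0) f f" for f :: "real^3 \<Rightarrow> real"
 by (rule has_weak_derivI_fcoeff) auto

lemma has_weak_deriv_0D: "has_weak_deriv (\<lambda>_. 0) f g \<Longrightarrow> AE x in torus. f x = g x" for f :: "real^3 \<Rightarrow> real"
 using weak_deriv_unique[OF has_weak_deriv_0] by (simp add: has_weak_deriv_def)

lemma has_weak_deriv_trans:
 fixes f g h :: "real^3 \<Rightarrow> real"
 assumes "has_weak_deriv \<alpha> f g" "has_weak_deriv \<beta> g h"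
 shows "has_weak_deriv (\<lambda>j. \<beta> j + \<alpha> j) f h"
 by (rule has_weak_derivI_fcoeff)
  (use assms in \<open>auto simp: has_weak_deriv_def fcoeff_weak_deriv[OF assms(1)] fcoeff_weak_deriv[OF assms(2)] symbol_add\<close>)

lemma has_weak_deriv_split:
 fixes f g h :: "real^3 \<Rightarrow> real"
 assumes "has_weak_deriv \<alpha> f g" "has_weak_deriv (\<lambda>j. \<beta> j + \<alpha> j) f h"
 shows "has_weak_deriv \<beta> g h"
 by (rule has_weak_derivI_fcoeff)
  (use assms in \<open>auto simp: has_weak_deriv_def fcoeff_weak_deriv[OF assms(1)] fcoeff_weak_deriv[OF assms(2)] symbol_add\<close>)

lemma has_weak_deriv_linear:
 fixes f g f' g' :: "real^3 \<Rightarrow> real"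
 assumes "has_weak_deriv \<alpha> f f'" "has_weak_deriv \<alpha> g g'"
 shows "has_weak_deriv \<alpha> (\<lambda>x. a * f x + b * g x) (\<lambda>x. a * f' x + b * g' x)"
proof -
 have i: "integrable torus f" "integrable torus f'" "integrable torus g" "integrable torus g'"
  using assms by (auto simp: has_weak_deriv_def)
 have "rcoeff (\<lambda>x. a * u x + b * v x) k = a * rcoeff u k + b * rcoeff v k"
  if "integrable torus u" "integrable torus v" for u v :: "real^3 \<Rightarrow> real" and k
  using that by (simp add: fcoeff_add integrable_mult_right fcoeff_mult_left)
 then show ?thesis using i
  by (intro has_weak_derivI_fcoeff)
   (auto simp: fcoeff_weak_deriv[OF assms(1)] fcoeff_weak_deriv[OF assms(2)] algebra_simps)
qed

section \<open>Sobolev bounds for scalar functions\<close>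

text \<open>Membership in \<open>H\<^sup>s\<close> with a bound on each derivative separately, which survives linear combinations
 and products without the choice of derivatives in \<^const>\<open>sobolev_norm\<close>.\<close>

definition Hbound :: "nat \<Rightarrow> (real^3 \<Rightarrow> real) \<Rightarrow> real \<Rightarrow> bool" where
 "Hbound s f M \<longleftrightarrow> (\<forall>\<alpha>\<in>multi_indices s. \<exists>g. has_weak_deriv \<alpha> f g \<and> g \<in> L2 \<and> norm2 g \<le> M)"

lemma norm2_cong_AE:
 fixes f g :: "real^3 \<Rightarrow> 'b::euclidean_space"
 assumes "AE x in torus. f x = g x" "f \<in> borel_measurable torus" "g \<in> borel_measurable torus"
 shows "norm2 f = norm2 g" "f \<in> L2 \<longleftrightarrow> g \<in> L2"
proof -
 show "norm2 f = norm2 g" unfolding norm2_def using assms by (intro integral_cong_AE) auto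
 have "integrable torus (\<lambda>x. (norm (f x))\<^sup>2) \<longleftrightarrow> integrable torus (\<lambda>x. (norm (g x))\<^sup>2)"
  using assms by (intro integrable_cong_AE) auto
 then show "f \<in> L2 \<longleftrightarrow> g \<in> L2" using assms by (simp add: L2_def)
qed

lemma Hbound_L2:
 assumes "Hbound s f M" shows "f \<in> L2" "norm2 f \<le> M" "integrable torus f" "0 \<le> M"
proof -
 have "(\<lambda>_. 0) \<in> multi_indices s" by (simp add: multi_indices_def)
 then obtain g where g: "has_weak_deriv (\<lambda>_. 0) f g" "g \<in> L2" "norm2 g \<le> M"
  using assms unfolding Hbound_def by blast
 then have "AE x in torus. f x = g x" by (intro has_weak_deriv_0D)
 then show "f \<in> L2" "norm2 f \<le> M" using norm2_cong_AE[of f g] g by (auto simp: has_weak_deriv_def)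
 then show "integrable torus f" "0 \<le> M" using L2_integrable norm2_nonneg[of f] by (blast, linarith)
qed

lemma multi_indices_mono: "t \<le> s \<Longrightarrow> multi_indices t \<subseteq> multi_indices s"
 by (auto simp: multi_indices_def)

lemma Hbound_mono: "Hbound s f M \<Longrightarrow> t \<le> s \<Longrightarrow> M \<le> M' \<Longrightarrow> Hbound t f M'"
 unfolding Hbound_def by (metis order_trans multi_indices_mono subsetD)

lemma Hbound_0I: "f \<in> L2 \<Longrightarrow> norm2 f \<le> M \<Longrightarrow> Hbound 0 f M"
proof -
 assume f: "f \<in> L2" "norm2 f \<le> M"
 have "\<alpha> = (\<lambda>_. 0)" if "\<alpha> \<in> multi_indices 0" for \<alpha> using that by (auto simp: multi_indices_def)
 then show ?thesis unfolding Hbound_def using f has_weak_deriv_0 L2_integrable by blast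
qed

lemma sum_unit_index [simp]: "(\<Sum>i\<in>UNIV. unit_index j i) = 1"
 by (simp add: unit_index_def)

lemma Hbound_deriv:
 assumes "Hbound (Suc s) f M"
 obtains g where "weak_partial j f g" "Hbound s g M"
proof -
 have "unit_index j \<in> multi_indices (Suc s)" by (simp add: multi_indices_def)
 then obtain g where g: "weak_partial j f g" using assms unfolding Hbound_def by blast
 have "Hbound s g M" unfolding Hbound_def
 proof
  fix \<beta> assume "\<beta> \<in> multi_indices s"
  then have "(\<lambda>i. \<beta> i + unit_index j i) \<in> multi_indices (Suc s)" by (simp add: multi_indices_def sum.distrib)
  then obtain h where "has_weak_deriv (\<lambda>i. \<beta> i + unit_index j i) f h" "h \<in> L2" "norm2 h \<le> M"
   using assms unfolding Hbound_def by blast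
  then show "\<exists>h. has_weak_deriv \<beta> g h \<and> h \<in> L2 \<and> norm2 h \<le> M" using has_weak_deriv_split[OF g] by blast
 qed
 then show thesis using that g by blast
qed

lemma Hbound_SucI:
 assumes f: "f \<in> L2" "norm2 f \<le> M" and d: "\<And>j. \<exists>g. weak_partial j f g \<and> Hbound s g M"
 shows "Hbound (Suc s) f M"
 unfolding Hbound_def
proof
 fix \<alpha> assume \<alpha>: "\<alpha> \<in> multi_indices (Suc s)"
 show "\<exists>g. has_weak_deriv \<alpha> f g \<and> g \<in> L2 \<and> norm2 g \<le> M"
 proof (cases "\<alpha> = (\<lambda>_. 0)")
  case True
  then show ?thesis using f has_weak_deriv_0 L2_integrable by blast
 next
  case False
  then obtain j where j: "\<alpha> j \<noteq> 0" by auto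
  define \<beta> where "\<beta> i = \<alpha> i - unit_index j i" for i
  have e: "\<alpha> = (\<lambda>i. \<beta> i + unit_index j i)" using j by (auto simp: \<beta>_def unit_index_def fun_eq_iff)
  then have "(\<Sum>i\<in>UNIV. \<alpha> i) = (\<Sum>i\<in>UNIV. \<beta> i) + 1" by (simp add: sum.distrib)
  then have "\<beta> \<in> multi_indices s" using \<alpha> by (simp add: multi_indices_def)
  moreover obtain g where g: "weak_partial j f g" "Hbound s g M" using d by blast
  ultimately obtain h where "has_weak_deriv \<beta> g h" "h \<in> L2" "norm2 h \<le> M" unfolding Hbound_def by blast
  then show ?thesis using has_weak_deriv_trans[OF g(1)] e by auto
 qed
qed

lemma norm2_linear:
 assumes "f \<in> L2" "g \<in> L2"
 shows "norm2 (\<lambda>x. a * f x + b * g x) \<le> 2 * a\<^sup>2 * norm2 f + 2 * b\<^sup>2 * norm2 (g :: real^3 \<Rightarrow> real)"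
  and "(\<lambda>x. a * f x + b * g x) \<in> L2"
proof -
 have L: "(\<lambda>x. a * f x) \<in> L2" "(\<lambda>x. b * g x) \<in> L2" using L2_scaleR[OF assms(1), of a] L2_scaleR[OF assms(2), of b] by auto
 then show "(\<lambda>x. a * f x + b * g x) \<in> L2" by (rule L2_add)
 have "norm2 (\<lambda>x. c * h x) = c\<^sup>2 * norm2 h" for c and h :: "real^3 \<Rightarrow> real"
  by (simp add: norm2_def power_mult_distrib)
 then show "norm2 (\<lambda>x. a * f x + b * g x) \<le> 2 * a\<^sup>2 * norm2 f + 2 * b\<^sup>2 * norm2 g"
  using norm2_triangle[OF L] by simp
qed

lemma Hbound_linear:
 assumes "Hbound s f M" "Hbound s g M'"
 shows "Hbound s (\<lambda>x. a * f x + b * g x) (2 * a\<^sup>2 * M + 2 * b\<^sup>2 * M')"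
 unfolding Hbound_def
proof
 fix \<alpha> assume "\<alpha> \<in> multi_indices s"
 then obtain f' g' where f': "has_weak_deriv \<alpha> f f'" "f' \<in> L2" "norm2 f' \<le> M"
  and g': "has_weak_deriv \<alpha> g g'" "g' \<in> L2" "norm2 g' \<le> M'"
  using assms unfolding Hbound_def by blast
 have "norm2 (\<lambda>x. a * f' x + b * g' x) \<le> 2 * a\<^sup>2 * norm2 f' + 2 * b\<^sup>2 * norm2 g'"
  by (rule norm2_linear[OF f'(2) g'(2)])
 also have "\<dots> \<le> 2 * a\<^sup>2 * M + 2 * b\<^sup>2 * M'" using f' g' by (intro add_mono mult_left_mono) auto
 finally show "\<exists>h. has_weak_deriv \<alpha> (\<lambda>x. a * f x + b * g x) h \<and> h \<in> L2 \<and> norm2 h \<le> 2 * a\<^sup>2 * M + 2 * b\<^sup>2 * M'"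
  using has_weak_deriv_linear[OF f'(1) g'(1)] norm2_linear(2)[OF f'(2) g'(2)] by blast
qed

section \<open>Sobolev embeddings and products\<close>

definition freq_weight :: "(3 \<Rightarrow> int) \<Rightarrow> real" where
 "freq_weight k = 1 + (\<Sum>j\<in>UNIV. (of_int (k j))\<^sup>2)"

lemma freq_weight_ge_1: "freq_weight k \<ge> 1"
 unfolding freq_weight_def by (simp add: sum_nonneg)

lemma freq_weight_pos: "freq_weight k > 0"
 using freq_weight_ge_1[of k] by linarith

text \<open>In three dimensions the weights \<open>(1 + \<bar>k\<bar>\<^sup>2)\<^sup>-\<^sup>2\<close> are summable; comparing with the product of the
 one-dimensional weights \<open>(1 + k\<^sub>j\<^sup>2)\<close> to the power \<open>-2/3\<close> reduces this to one dimension.\<close>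

lemma freq_weight_summable:
 obtains Z where "Z > 0" "\<And>n. (\<Sum>k\<in>vp_freqs n. 1 / (freq_weight k)\<^sup>2) \<le> Z"
proof -
 define z :: "int \<Rightarrow> real" where "z l = (1 + (of_int l)\<^sup>2) powr (- 2 / 3)" for l
 have z0: "z l \<ge> 0" for l by (simp add: z_def)
 have "summable (\<lambda>i. z (int i))"
 proof (rule summable_comparison_test_ev)
  show "summable (\<lambda>i. real i powr (- 4 / 3))" by (simp add: summable_real_powr_iff)
  show "\<forall>\<^sub>F i in sequentially. norm (z (int i)) \<le> real i powr (- 4 / 3)"
   using eventually_gt_at_top[of 0]
  proof eventually_elim
   case (elim i)
   have "z (int i) \<le> ((real i)\<^sup>2) powr (- 2 / 3)"
    unfolding z_def using elim by (intro powr_mono2') auto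
   also have "\<dots> = real i powr (- 4 / 3)"
    using elim by (simp add: powr_powr flip: powr_numeral)
   finally show ?case using z0[of "int i"] by simp
  qed
 qed
 then have S: "(\<Sum>i\<in>A. z (int i)) \<le> (\<Sum>i. z (int i))" if "finite A" for A
  using that z0 by (intro sum_le_suminf) auto
 define S where "S = (\<Sum>i. z (int i))"
 have one: "(\<Sum>l\<in>{- int n..int n}. z l) \<le> 2 * S" for n
 proof -
  have "{- int n..int n} = int ` {..n} \<union> (\<lambda>i. - int i) ` {..n}"
  proof (intro equalityI subsetI)
   fix l assume "l \<in> {- int n..int n}"
   then show "l \<in> int ` {..n} \<union> (\<lambda>i. - int i) ` {..n}"
    by (cases "l \<ge> 0") (auto simp: image_iff intro: bexI[of _ "nat l"] bexI[of _ "nat (- l)"])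
  qed auto
  then have "(\<Sum>l\<in>{- int n..int n}. z l) \<le> (\<Sum>l\<in>int ` {..n}. z l) + (\<Sum>l\<in>(\<lambda>i. - int i) ` {..n}. z l)"
   by (simp add: sum_Un z0 sum_nonneg)
  also have "\<dots> = (\<Sum>i\<le>n. z (int i)) + (\<Sum>i\<le>n. z (int i))"
   by (subst (1 2) sum.reindex) (auto simp: inj_on_def z_def)
  also have "\<dots> \<le> 2 * S" using S[of "{..n}"] by (simp add: S_def)
  finally show ?thesis .
 qed
 have le_prod: "1 / (freq_weight k)\<^sup>2 \<le> (\<Prod>j\<in>UNIV. z (k j))" for k
 proof -
  let ?w = "freq_weight k"
  have le: "?w powr (- 2 / 3) \<le> z (k j)" for j
  proof -
   have "1 + (of_int (k j))\<^sup>2 \<le> ?w"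
    unfolding freq_weight_def by (intro add_left_mono member_le_sum) auto
   then show ?thesis unfolding z_def by (intro powr_mono2') (auto simp: add_pos_nonneg)
  qed
  have "1 / ?w\<^sup>2 = ?w powr (- 2)"
   using freq_weight_pos[of k] by (simp add: powr_minus_divide)
  also have "\<dots> = ?w powr (- 2 / 3) * ?w powr (- 2 / 3) * ?w powr (- 2 / 3)"
   by (simp flip: powr_add)
  also have "\<dots> \<le> z (k 1) * z (k 2) * z (k 3)"
   using z0 by (intro mult_mono le mult_nonneg_nonneg) auto
  finally show ?thesis by (simp add: prod_3)
 qed
 have "(\<Sum>k\<in>vp_freqs n. 1 / (freq_weight k)\<^sup>2) \<le> (2 * S) ^ 3 + 1" for n
 proof -
  have "(\<Sum>k\<in>vp_freqs n. 1 / (freq_weight k)\<^sup>2) \<le> (\<Sum>k\<in>vp_freqs n. \<Prod>j\<in>UNIV. z (k j))"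
   by (intro sum_mono le_prod)
  also have "\<dots> = (\<Prod>j\<in>(UNIV :: 3 set). \<Sum>l\<in>{- int n..int n}. z l)"
   unfolding freqs_def by (rule prod_sum_PiE[symmetric]) auto
  also have "\<dots> \<le> (\<Prod>j\<in>(UNIV :: 3 set). 2 * S)"
   using one z0 by (intro prod_mono) (auto intro!: sum_nonneg)
  finally show ?thesis by simp
 qed
 moreover have "(2 * S) ^ 3 + 1 > 0" using S[of "{}"] by (simp add: S_def add_nonneg_pos)
 ultimately show thesis using that by blast
qed

definition lattice_const :: real where
 "lattice_const = (SOME Z. Z > 0 \<and> (\<forall>n. (\<Sum>k\<in>vp_freqs n. 1 / (freq_weight k)\<^sup>2) \<le> Z))"

lemma lattice_const: "lattice_const > 0" "(\<Sum>k\<in>vp_freqs n. 1 / (freq_weight k)\<^sup>2) \<le> lattice_const"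
proof -
 have "\<exists>Z. Z > 0 \<and> (\<forall>n. (\<Sum>k\<in>vp_freqs n. 1 / (freq_weight k)\<^sup>2) \<le> Z)" using freq_weight_summable by metis
 from someI_ex[OF this] show "lattice_const > 0" "(\<Sum>k\<in>vp_freqs n. 1 / (freq_weight k)\<^sup>2) \<le> lattice_const"
  unfolding lattice_const_def by blast+
qed

lemma Bessel_real:
 assumes "f \<in> L2" "finite F" shows "(\<Sum>k\<in>F. (cmod (rcoeff f k))\<^sup>2) \<le> norm2 f"
 using Bessel[OF L2_of_real[OF assms(1)] assms(2)] by (simp add: norm2_of_real)

lemma Hbound_symbol_sum:
 assumes "Hbound s f M" "\<alpha> \<in> multi_indices s" "finite F"
 shows "(\<Sum>k\<in>F. (cmod (symbol \<alpha> k))\<^sup>2 * (cmod (rcoeff f k))\<^sup>2) \<le> M"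
proof -
 obtain g where g: "has_weak_deriv \<alpha> f g" "g \<in> L2" "norm2 g \<le> M" using assms unfolding Hbound_def by blast
 have "(\<Sum>k\<in>F. (cmod (rcoeff g k))\<^sup>2) \<le> norm2 g" by (rule Bessel_real[OF g(2) assms(3)])
 then show ?thesis using g(3) by (simp add: fcoeff_weak_deriv[OF g(1)] norm_mult power_mult_distrib)
qed

lemma freq_le_symbol_unit: "(of_int (k j))\<^sup>2 \<le> (cmod (symbol (unit_index j) k))\<^sup>2"
proof -
 have "1 * \<bar>real_of_int (k j)\<bar> \<le> (2 * pi) * \<bar>real_of_int (k j)\<bar>" using pi_gt3 by (intro mult_right_mono) auto
 then have "\<bar>real_of_int (k j)\<bar> \<le> cmod (symbol (unit_index j) k)" by (simp add: symbol_unit norm_mult)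
 then show ?thesis using power_mono[of "\<bar>real_of_int (k j)\<bar>" _ 2] by simp
qed

lemma Hbound_1_deriv_sum:
 assumes f: "Hbound 1 f M" and F: "finite F"
 shows "(\<Sum>k\<in>F. (of_int (k j))\<^sup>2 * (cmod (rcoeff f k))\<^sup>2) \<le> M"
proof -
 have "(\<Sum>k\<in>F. (of_int (k j))\<^sup>2 * (cmod (rcoeff f k))\<^sup>2) \<le> (\<Sum>k\<in>F. (cmod (symbol (unit_index j) k))\<^sup>2 * (cmod (rcoeff f k))\<^sup>2)"
  by (intro sum_mono mult_right_mono freq_le_symbol_unit) auto
 also have "\<dots> \<le> M" by (rule Hbound_symbol_sum[OF f _ F]) (simp add: multi_indices_def)
 finally show ?thesis .
qed

lemma Hbound_1_weighted:
 assumes f: "Hbound 1 f M" and F: "finite F"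
 shows "(\<Sum>k\<in>F. freq_weight k * (cmod (rcoeff f k))\<^sup>2) \<le> 4 * M"
proof -
 let ?a = "\<lambda>k. (cmod (rcoeff f k))\<^sup>2"
 have "(\<Sum>k\<in>F. freq_weight k * ?a k) = (\<Sum>k\<in>F. ?a k) + (\<Sum>j\<in>UNIV. \<Sum>k\<in>F. (of_int (k j))\<^sup>2 * ?a k)"
  unfolding freq_weight_def distrib_right sum.distrib sum_distrib_right by (simp add: sum.swap[of _ F])
 also have "\<dots> \<le> M + (\<Sum>j\<in>(UNIV :: 3 set). M)"
 proof (intro add_mono sum_mono)
  show "(\<Sum>k\<in>F. ?a k) \<le> M" using Bessel_real[OF Hbound_L2(1)[OF f] F] Hbound_L2(2)[OF f] by linarith
  fix j
  show "(\<Sum>k\<in>F. (of_int (k j))\<^sup>2 * ?a k) \<le> M" by (rule Hbound_1_deriv_sum[OF f F])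
 qed
 finally show ?thesis by simp
qed

lemma Hbound_2_weighted:
 assumes f: "Hbound 2 f M" and F: "finite F"
 shows "(\<Sum>k\<in>F. (freq_weight k)\<^sup>2 * (cmod (rcoeff f k))\<^sup>2) \<le> 16 * M"
proof -
 let ?a = "\<lambda>k. (cmod (rcoeff f k))\<^sup>2"
 have w: "(freq_weight k)\<^sup>2 \<le> 4 * (1 + (\<Sum>j\<in>UNIV. (of_int (k j)) ^ 4))" for k
 proof -
  have "(1 + x + y + z)\<^sup>2 \<le> 4 * (1 + (x\<^sup>2 + y\<^sup>2 + z\<^sup>2))" for x y z :: real
   using sum_squares_bound[of x y] sum_squares_bound[of x z] sum_squares_bound[of y z]
    sum_squares_bound[of x 1] sum_squares_bound[of y 1] sum_squares_bound[of z 1]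
   by (simp add: power2_eq_square algebra_simps)
  from this[of "(of_int (k 1))\<^sup>2" "(of_int (k 2))\<^sup>2" "(of_int (k 3))\<^sup>2"]
  show ?thesis by (simp add: freq_weight_def sum_3 add.assoc)
 qed
 have "(\<Sum>k\<in>F. (freq_weight k)\<^sup>2 * ?a k) \<le> (\<Sum>k\<in>F. 4 * (1 + (\<Sum>j\<in>UNIV. (of_int (k j)) ^ 4)) * ?a k)"
  by (intro sum_mono mult_right_mono w) auto
 also have "\<dots> = 4 * ((\<Sum>k\<in>F. ?a k) + (\<Sum>j\<in>UNIV. \<Sum>k\<in>F. (of_int (k j)) ^ 4 * ?a k))"
  unfolding mult.assoc sum_distrib_left[symmetric] distrib_right sum.distrib sum_distrib_right
  by (simp add: sum.swap[of _ F])
 also have "\<dots> \<le> 4 * (M + (\<Sum>j\<in>(UNIV :: 3 set). M))"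
 proof (intro mult_left_mono add_mono sum_mono)
  show "(\<Sum>k\<in>F. ?a k) \<le> M" using Bessel_real[OF Hbound_L2(1)[OF f] F] Hbound_L2(2)[OF f] by linarith
  fix j
  let ?\<alpha> = "\<lambda>i. unit_index j i + unit_index j i"
  have "(of_int (k j)) ^ 4 \<le> (cmod (symbol ?\<alpha> k))\<^sup>2" for k
  proof -
   have "((of_int (k j))\<^sup>2)\<^sup>2 \<le> ((cmod (symbol (unit_index j) k))\<^sup>2)\<^sup>2"
    by (intro power_mono freq_le_symbol_unit) auto
   then show ?thesis by (simp add: symbol_add norm_mult power2_eq_square power4_eq_xxxx mult_ac)
  qed
  then have "(\<Sum>k\<in>F. (of_int (k j)) ^ 4 * ?a k) \<le> (\<Sum>k\<in>F. (cmod (symbol ?\<alpha> k))\<^sup>2 * ?a k)"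
   by (intro sum_mono mult_right_mono) auto
  also have "\<dots> \<le> M" by (rule Hbound_symbol_sum[OF f _ F]) (simp add: multi_indices_def sum.distrib)
  finally show "(\<Sum>k\<in>F. (of_int (k j)) ^ 4 * ?a k) \<le> M" .
 qed auto
 finally show ?thesis by simp
qed

lemma L2_set_sq: "L2_set f A = sqrt (\<Sum>i\<in>A. (f i)\<^sup>2)"
 by (simp add: L2_set_def)

text \<open>\<open>H\<^sup>2\<close> functions have absolutely summable Fourier coefficients, hence are bounded; the bound is
 transferred to the function by testing with the sign of \<open>f\<close> on the set where it fails.\<close>

lemma Hbound_2_bounded:
 assumes f: "Hbound 2 f M"
 shows "AE x in torus. (f x)\<^sup>2 \<le> 16 * lattice_const * M"
proof -
 define A where "A = sqrt (16 * lattice_const * M)"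
 have M0: "0 \<le> M" by (rule Hbound_L2(4)[OF f])
 then have A0: "A \<ge> 0" using lattice_const(1) by (simp add: A_def)
 have fm: "f \<in> borel_measurable torus" using Hbound_L2(3)[OF f] by auto
 have coef: "(\<Sum>k\<in>vp_freqs n. cmod (rcoeff f k)) \<le> A" for n
 proof -
  have "(\<Sum>k\<in>vp_freqs n. cmod (rcoeff f k))
    = (\<Sum>k\<in>vp_freqs n. \<bar>freq_weight k * cmod (rcoeff f k)\<bar> * \<bar>1 / freq_weight k\<bar>)"
   using freq_weight_pos less_imp_neq[OF freq_weight_pos] by (intro sum.cong refl) (auto simp: abs_mult abs_of_pos)
  also have "\<dots> \<le> L2_set (\<lambda>k. freq_weight k * cmod (rcoeff f k)) (vp_freqs n) * L2_set (\<lambda>k. 1 / freq_weight k) (vp_freqs n)"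
   by (rule L2_set_mult_ineq)
  also have "\<dots> \<le> sqrt (16 * M) * sqrt lattice_const"
   unfolding L2_set_sq power_mult_distrib power_divide one_power2
   by (intro mult_mono real_sqrt_le_mono Hbound_2_weighted[OF f] lattice_const)
    (use M0 in \<open>auto intro!: sum_nonneg\<close>)
  finally show ?thesis by (simp add: A_def real_sqrt_mult mult_ac)
 qed
 define h where "h x = (if \<bar>f x\<bar> > A then sgn (f x) else 0)" for x
 have hm: "h \<in> borel_measurable torus" unfolding h_def[abs_def] using fm by measurable
 have hb: "\<bar>h x\<bar> \<le> 1" for x by (simp add: h_def sgn_if)
 have hL: "h \<in> L2" by (rule bounded_in_L2[OF hm, of 1]) (use hb in auto)
 have fL: "f \<in> L2" by (rule Hbound_L2(1)[OF f])
 have hi: "integrable torus (\<lambda>x. \<bar>h x\<bar>)" using L2_integrable[OF hL] by simp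
 have fh: "integrable torus (\<lambda>x. f x * h x)" by (rule L2_mult_integrable[OF fL hL])
 have "(\<lambda>n. cmod (vp_form n (\<lambda>x. of_real (f x)) (\<lambda>x. of_real (h x)))) \<longlonglongrightarrow> \<bar>TI x. f x * h x\<bar>"
  using tendsto_norm[OF vp_form_tendsto_L2[OF L2_of_real[OF fL] L2_of_real[OF hL]]]
  by (simp flip: of_real_mult)
 moreover have "cmod (vp_form n (\<lambda>x. of_real (f x)) (\<lambda>x. of_real (h x))) \<le> A * (TI x. \<bar>h x\<bar>)" for n
 proof -
  have "cmod (vp_form n (\<lambda>x. of_real (f x)) (\<lambda>x. of_real (h x))) \<le> (\<Sum>k\<in>vp_freqs n. cmod (rcoeff f k) * cmod (rcoeff h k))"
   by (rule norm_vp_form_le_sum)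
  also have "\<dots> \<le> (\<Sum>k\<in>vp_freqs n. cmod (rcoeff f k) * (TI x. \<bar>h x\<bar>))"
   using norm_fcoeff_le[of "\<lambda>x. of_real (h x)"] L2_integrable[OF hL] by (intro sum_mono mult_left_mono) auto
  also have "\<dots> \<le> A * (TI x. \<bar>h x\<bar>)"
   unfolding sum_distrib_right[symmetric] by (intro mult_right_mono coef) simp
  finally show ?thesis .
 qed
 ultimately have "\<bar>TI x. f x * h x\<bar> \<le> A * (TI x. \<bar>h x\<bar>)"
  by (intro LIMSEQ_le_const2[where a="A * (TI x. \<bar>h x\<bar>)"]) auto
 then have "(TI x. f x * h x - A * \<bar>h x\<bar>) \<le> 0" using fh hi by simp
 moreover have pos: "0 \<le> f x * h x - A * \<bar>h x\<bar>" for x by (auto simp: h_def sgn_if)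
 moreover have "0 \<le> (TI x. f x * h x - A * \<bar>h x\<bar>)"
  by (rule LINT_nonneg) (rule pos)
 ultimately have "(TI x. f x * h x - A * \<bar>h x\<bar>) = 0" by linarith
 then have "AE x in torus. f x * h x - A * \<bar>h x\<bar> = 0"
  using fh hi pos by (subst (asm) integral_nonneg_eq_0_iff_AE) auto
 then show ?thesis
 proof eventually_elim
  case (elim x)
  have "\<bar>f x\<bar> \<le> A"
  proof (rule ccontr)
   assume "\<not> \<bar>f x\<bar> \<le> A"
   then show False using elim A0 by (auto simp: h_def sgn_if split: if_splits)
  qed
  then have "\<bar>f x\<bar>\<^sup>2 \<le> A\<^sup>2" by (intro power_mono) auto
  then show ?case using M0 lattice_const(1) by (simp add: A_def)
 qed
qed

lemma L2_of_truncated: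
 fixes f :: "real^3 \<Rightarrow> real"
 assumes m: "f \<in> borel_measurable torus"
  and K: "\<And>R::nat. (TI x. (if \<bar>f x\<bar> \<le> real R then (f x)\<^sup>2 else 0)) \<le> K"
 shows "f \<in> L2" "norm2 f \<le> K"
proof -
 define t where "t R x = (if \<bar>f x\<bar> \<le> real R then (f x)\<^sup>2 else 0)" for R x
 have tm: "t R \<in> borel_measurable torus" for R unfolding t_def[abs_def] using m by measurable
 have ti: "integrable torus (t R)" for R
 proof (rule bounded_integrable_torus[OF tm, of _ "(real R)\<^sup>2"])
  show "norm (t R x) \<le> (real R)\<^sup>2" for x
   using power_mono[of "\<bar>f x\<bar>" "real R" 2] by (auto simp: t_def)
 qed
 have mono: "incseq (\<lambda>R. t R x)" for x
  by (intro incseq_SucI) (auto simp: t_def)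
 have lim: "(\<lambda>R. t R x) \<longlonglongrightarrow> (f x)\<^sup>2" for x
 proof -
  obtain R0 where "\<bar>f x\<bar> \<le> real R0" using real_arch_simple by blast
  then have "\<forall>\<^sub>F R in sequentially. t R x = (f x)\<^sup>2"
   unfolding eventually_sequentially t_def by (intro exI[of _ R0]) (auto intro: order_trans)
  then show ?thesis by (rule tendsto_eventually)
 qed
 have bi: "incseq (\<lambda>R. TI x. t R x)"
  by (intro incseq_SucI integral_mono ti) (use mono in \<open>auto simp: incseq_Suc_iff\<close>)
 have tK: "(TI x. t R x) \<le> K" for R unfolding t_def by (rule K)
 obtain L where L1: "(\<lambda>R. TI x. t R x) \<longlonglongrightarrow> L"
  using incseq_convergent[OF bi, of K] tK by blast
 have "L \<le> K" by (rule LIMSEQ_le_const2[OF L1]) (use tK in blast)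
 note L = L1 this
 have "integrable torus (\<lambda>x. (f x)\<^sup>2)" "(TI x. (f x)\<^sup>2) = L"
  by (rule integrable_monotone_convergence[where f=t] integral_monotone_convergence[where f=t];
    use ti mono lim L m in \<open>auto\<close>)+
 then show "f \<in> L2" "norm2 f \<le> K" using m L(2) by (auto simp: L2_def norm2_def)
qed

text \<open>The trilinear estimate behind the embedding \<open>H\<^sup>1 \<subseteq> L\<^sup>4\<close>: on the Fourier side one distributes the
 weights by Cauchy-Schwarz, and \<open>1/(w\<^sub>k w\<^sub>l) \<le> (1/w\<^sub>k\<^sup>2 + 1/w\<^sub>l\<^sup>2)/2\<close> leaves a single lattice sum.\<close>

lemma trilinear_freq_bound:
 assumes f: "Hbound 1 f M1" and g: "Hbound 1 g M2" and h: "h \<in> L2"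
 shows "(\<Sum>k\<in>vp_freqs n. \<Sum>l\<in>vp_freqs m. cmod (rcoeff f k) * cmod (rcoeff g l) * cmod (rcoeff h (\<lambda>j. l j - k j)))
  \<le> sqrt (16 * M1 * M2 * lattice_const * norm2 h)"
proof -
 let ?A = "vp_freqs n" and ?B = "vp_freqs m" and ?w = freq_weight
 let ?h = "\<lambda>k l. rcoeff h (\<lambda>j. l j - k j)"
 have M: "0 \<le> M1" "0 \<le> M2" using Hbound_L2(4)[OF f] Hbound_L2(4)[OF g] by auto
 have w0: "?w k > 0" for k by (rule freq_weight_pos)
 define a where "a p = sqrt (?w (fst p)) * cmod (rcoeff f (fst p)) * (sqrt (?w (snd p)) * cmod (rcoeff g (snd p)))" for p
 define b where "b p = cmod (?h (fst p) (snd p)) / (sqrt (?w (fst p)) * sqrt (?w (snd p)))" for p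
 have hc: "(\<lambda>x. of_real (h x) * char k x) \<in> L2" for k by (intro L2_char_mult L2_of_real h)
 have hn: "norm2 (\<lambda>x. of_real (h x) * char k x) = norm2 h" for k by (simp add: norm2_def norm_mult)
 have sum_l: "(\<Sum>l\<in>F. (cmod (?h k l))\<^sup>2) \<le> norm2 h" if "finite F" for F k
  using Bessel[OF hc[of k] that] by (simp add: fcoeff_mult_char hn)
 have sum_k: "(\<Sum>k\<in>F. (cmod (?h k l))\<^sup>2) \<le> norm2 h" if "finite F" for F l
 proof -
  have "rcoeff h (\<lambda>j. - q j) = cnj (rcoeff h q)" for q
   unfolding fcoeff_def by (subst LINT_cnj[symmetric]) (simp add: char_minus_index)
  from this[of "\<lambda>j. l j - k j" for k] have "cmod (?h k l) = cmod (rcoeff h (\<lambda>j. k j - l j))" for k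
   by (metis (no_types, lifting) complex_mod_cnj minus_diff_eq ext)
  then show ?thesis using Bessel[OF hc[of l] that] by (simp add: fcoeff_mult_char hn)
 qed
 have "(\<Sum>k\<in>?A. \<Sum>l\<in>?B. cmod (rcoeff f k) * cmod (rcoeff g l) * cmod (?h k l)) = (\<Sum>p\<in>?A \<times> ?B. \<bar>a p\<bar> * \<bar>b p\<bar>)"
  unfolding sum.cartesian_product
  by (intro sum.cong refl) (use w0 less_imp_neq[OF w0] in \<open>auto simp: a_def b_def abs_mult abs_of_pos field_simps\<close>)
 also have "\<dots> \<le> L2_set a (?A \<times> ?B) * L2_set b (?A \<times> ?B)" by (rule L2_set_mult_ineq)
 also have "\<dots> \<le> sqrt (16 * M1 * M2) * sqrt (lattice_const * norm2 h)"
 proof (rule mult_mono)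
  have "(\<Sum>p\<in>?A \<times> ?B. (a p)\<^sup>2) = (\<Sum>k\<in>?A. ?w k * (cmod (rcoeff f k))\<^sup>2) * (\<Sum>l\<in>?B. ?w l * (cmod (rcoeff g l))\<^sup>2)"
   unfolding sum_product sum.cartesian_product
   by (intro sum.cong refl) (use w0 in \<open>auto simp: a_def power_mult_distrib less_imp_le\<close>)
  also have "\<dots> \<le> (4 * M1) * (4 * M2)"
   using M less_imp_le[OF w0] by (intro mult_mono Hbound_1_weighted f g) (auto intro!: sum_nonneg mult_nonneg_nonneg)
  finally show "L2_set a (?A \<times> ?B) \<le> sqrt (16 * M1 * M2)" unfolding L2_set_sq by (intro real_sqrt_le_mono) simp
  have "(\<Sum>p\<in>?A \<times> ?B. (b p)\<^sup>2) \<le> (\<Sum>p\<in>?A \<times> ?B. (cmod (?h (fst p) (snd p)))\<^sup>2 * (1 / (?w (fst p))\<^sup>2) / 2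
    + (cmod (?h (fst p) (snd p)))\<^sup>2 * (1 / (?w (snd p))\<^sup>2) / 2)"
  proof (rule sum_mono)
   fix p
   have "1 / (u * v) \<le> (1 / u\<^sup>2) / 2 + (1 / v\<^sup>2) / 2" if "u > 0" "v > 0" for u v :: real
    using sum_squares_bound[of "1 / u" "1 / v"] by (simp add: power_divide)
   from mult_left_mono[OF this[OF w0 w0], of "(cmod (?h (fst p) (snd p)))\<^sup>2" "fst p" "snd p"]
   show "(b p)\<^sup>2 \<le> (cmod (?h (fst p) (snd p)))\<^sup>2 * (1 / (?w (fst p))\<^sup>2) / 2
    + (cmod (?h (fst p) (snd p)))\<^sup>2 * (1 / (?w (snd p))\<^sup>2) / 2"
    using w0[of "fst p"] w0[of "snd p"] by (simp add: b_def power_divide power_mult_distrib distrib_left less_imp_le)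
  qed
  also have "\<dots> = (\<Sum>k\<in>?A. (1 / (?w k)\<^sup>2) / 2 * (\<Sum>l\<in>?B. (cmod (?h k l))\<^sup>2))
    + (\<Sum>l\<in>?B. (1 / (?w l)\<^sup>2) / 2 * (\<Sum>k\<in>?A. (cmod (?h k l))\<^sup>2))"
  proof -
   have row: "(\<Sum>p\<in>?A \<times> ?B. G (fst p) (snd p)) = (\<Sum>k\<in>?A. \<Sum>l\<in>?B. G k l)" for G :: "(3 \<Rightarrow> int) \<Rightarrow> (3 \<Rightarrow> int) \<Rightarrow> real"
    by (simp add: sum.cartesian_product case_prod_unfold)
   have col: "(\<Sum>p\<in>?A \<times> ?B. G (fst p) (snd p)) = (\<Sum>l\<in>?B. \<Sum>k\<in>?A. G k l)" for G :: "(3 \<Rightarrow> int) \<Rightarrow> (3 \<Rightarrow> int) \<Rightarrow> real"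
    unfolding row by (rule sum.swap)
   show ?thesis
    unfolding sum.distrib sum_distrib_left
     row[of "\<lambda>k l. (cmod (?h k l))\<^sup>2 * (1 / (?w k)\<^sup>2) / 2"] col[of "\<lambda>k l. (cmod (?h k l))\<^sup>2 * (1 / (?w l)\<^sup>2) / 2"]
    by (simp add: mult.commute)
  qed
  also have "\<dots> \<le> (\<Sum>k\<in>?A. (1 / (?w k)\<^sup>2) / 2 * norm2 h) + (\<Sum>l\<in>?B. (1 / (?w l)\<^sup>2) / 2 * norm2 h)"
   by (intro add_mono sum_mono mult_left_mono sum_l sum_k) auto
  also have "\<dots> = ((\<Sum>k\<in>?A. 1 / (?w k)\<^sup>2) + (\<Sum>l\<in>?B. 1 / (?w l)\<^sup>2)) / 2 * norm2 h"
   by (simp add: sum_distrib_right add_divide_distrib distrib_right sum_divide_distrib)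
  also have "\<dots> \<le> lattice_const * norm2 h"
   using lattice_const(2)[of n] lattice_const(2)[of m] by (intro mult_right_mono) auto
  finally show "L2_set b (?A \<times> ?B) \<le> sqrt (lattice_const * norm2 h)" unfolding L2_set_sq by (rule real_sqrt_le_mono)
 qed (use M in auto)
 also have "\<dots> = sqrt (16 * M1 * M2 * lattice_const * norm2 h)" by (simp flip: real_sqrt_mult add: mult.assoc)
 finally show ?thesis .
qed

lemma trilinear_bound:
 assumes f: "Hbound 1 f M1" and g: "Hbound 1 g M2"
  and hm: "h \<in> borel_measurable torus" and hb: "\<And>x. \<bar>h x\<bar> \<le> R"
 shows "\<bar>TI x. f x * (g x * h x)\<bar> \<le> sqrt (16 * M1 * M2 * lattice_const * norm2 h)"
proof -
 let ?c = "\<lambda>f x. complex_of_real (f x)"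
 let ?K = "sqrt (16 * M1 * M2 * lattice_const * norm2 h)"
 have h: "h \<in> L2" by (rule bounded_in_L2[OF hm, of R]) (use hb in auto)
 have fL: "f \<in> L2" and gL: "g \<in> L2" using Hbound_L2(1)[OF f] Hbound_L2(1)[OF g] by auto
 have ghL: "(\<lambda>x. g x * h x) \<in> L2"
 proof (rule L2_mult_bounded[OF gL, of _ R])
  show "(\<lambda>x. g x * h x) \<in> borel_measurable torus" using L2_measurable[OF gL] hm by auto
  show "AE x in torus. norm (g x * h x) \<le> R * norm (g x)"
   using hb by (intro AE_I2) (auto simp: abs_mult mult.commute[of "\<bar>g _\<bar>"] intro!: mult_right_mono)
 qed
 have inner: "(\<lambda>m. vp_form m (?c g) (\<lambda>x. ?c h x * char k x)) \<longlonglongrightarrow> rcoeff (\<lambda>x. g x * h x) k" for k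
 proof -
  have "(\<lambda>m. vp_form m (?c g) (\<lambda>x. ?c h x * char k x)) \<longlonglongrightarrow> (TI x. ?c g x * cnj (?c h x * char k x))"
   by (intro vp_form_tendsto_L2 L2_of_real gL L2_char_mult h)
  then show ?thesis by (simp add: fcoeff_def mult_ac)
 qed
 have "cmod (vp_form n (?c f) (?c (\<lambda>x. g x * h x))) \<le> ?K" for n
 proof -
  have "(\<lambda>m. \<Sum>k\<in>vp_freqs n. of_real (vp_coeff n k) * rcoeff f k * cnj (vp_form m (?c g) (\<lambda>x. ?c h x * char k x)))
    \<longlonglongrightarrow> vp_form n (?c f) (?c (\<lambda>x. g x * h x))"
   unfolding vp_form_def[of n] by (intro tendsto_sum tendsto_mult_left tendsto_cnj inner)
  then have "(\<lambda>m. cmod (\<Sum>k\<in>vp_freqs n. of_real (vp_coeff n k) * rcoeff f k * cnj (vp_form m (?c g) (\<lambda>x. ?c h x * char k x))))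
    \<longlonglongrightarrow> cmod (vp_form n (?c f) (?c (\<lambda>x. g x * h x)))" by (rule tendsto_norm)
  moreover have "cmod (\<Sum>k\<in>vp_freqs n. of_real (vp_coeff n k) * rcoeff f k * cnj (vp_form m (?c g) (\<lambda>x. ?c h x * char k x))) \<le> ?K" for m
  proof -
   have "cmod (\<Sum>k\<in>vp_freqs n. of_real (vp_coeff n k) * rcoeff f k * cnj (vp_form m (?c g) (\<lambda>x. ?c h x * char k x)))
    \<le> (\<Sum>k\<in>vp_freqs n. \<Sum>l\<in>vp_freqs m. cmod (rcoeff f k) * cmod (rcoeff g l) * cmod (rcoeff h (\<lambda>j. l j - k j)))"
   proof (rule sum_norm_le)
    fix k assume k: "k \<in> vp_freqs n"
    have "cmod (vp_form m (?c g) (\<lambda>x. ?c h x * char k x)) \<le> (\<Sum>l\<in>vp_freqs m. cmod (rcoeff g l) * cmod (rcoeff h (\<lambda>j. l j - k j)))"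
     using norm_vp_form_le_sum[of m "?c g" "\<lambda>x. ?c h x * char k x"] unfolding fcoeff_mult_char .
    then have "(vp_coeff n k * cmod (rcoeff f k)) * cmod (vp_form m (?c g) (\<lambda>x. ?c h x * char k x))
      \<le> (1 * cmod (rcoeff f k)) * (\<Sum>l\<in>vp_freqs m. cmod (rcoeff g l) * cmod (rcoeff h (\<lambda>j. l j - k j)))"
     using vp_coeff_le_1[OF k] by (intro mult_mono) auto
    then show "cmod (of_real (vp_coeff n k) * rcoeff f k * cnj (vp_form m (?c g) (\<lambda>x. ?c h x * char k x)))
     \<le> (\<Sum>l\<in>vp_freqs m. cmod (rcoeff f k) * cmod (rcoeff g l) * cmod (rcoeff h (\<lambda>j. l j - k j)))"
     by (simp add: norm_mult sum_distrib_left mult.assoc)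
   qed
   also have "\<dots> \<le> ?K" by (rule trilinear_freq_bound[OF f g h])
   finally show ?thesis .
  qed
  ultimately show ?thesis by (intro LIMSEQ_le_const2[where a="?K"]) auto
 qed
 moreover have "(\<lambda>n. cmod (vp_form n (?c f) (?c (\<lambda>x. g x * h x)))) \<longlonglongrightarrow> \<bar>TI x. f x * (g x * h x)\<bar>"
  using tendsto_norm[OF vp_form_tendsto_L2[OF L2_of_real[OF fL] L2_of_real[OF ghL]]]
  by (simp flip: of_real_mult)
 ultimately show ?thesis by (intro LIMSEQ_le_const2[where a="?K"]) auto
qed

lemma Hbound_1_mult_L2:
 assumes f: "Hbound 1 f M1" and g: "Hbound 1 g M2"
 shows "(\<lambda>x. f x * g x) \<in> L2" "norm2 (\<lambda>x. f x * g x) \<le> 16 * lattice_const * M1 * M2"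
proof -
 let ?p = "\<lambda>x. f x * g x"
 have M: "0 \<le> M1" "0 \<le> M2" using Hbound_L2(4)[OF f] Hbound_L2(4)[OF g] by auto
 have m: "?p \<in> borel_measurable torus" using Hbound_L2(3)[OF f] Hbound_L2(3)[OF g] by auto
 have "(TI x. (if \<bar>?p x\<bar> \<le> real R then (?p x)\<^sup>2 else 0)) \<le> 16 * lattice_const * M1 * M2" for R :: nat
 proof -
  define h where "h x = (if \<bar>?p x\<bar> \<le> real R then ?p x else 0)" for x
  have hm: "h \<in> borel_measurable torus" unfolding h_def[abs_def] using m by measurable
  have eq: "f x * (g x * h x) = (h x)\<^sup>2" for x by (simp add: h_def power2_eq_square mult_ac)
  have N: "norm2 h = (TI x. (if \<bar>?p x\<bar> \<le> real R then (?p x)\<^sup>2 else 0))"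
   unfolding norm2_def by (intro LINT_cong refl) (simp add: h_def)
  have "norm2 h \<le> sqrt (16 * M1 * M2 * lattice_const * norm2 h)"
  proof -
   have hb: "\<bar>h x\<bar> \<le> real R" for x by (simp add: h_def)
   have "norm2 h = (TI x. f x * (g x * h x))" by (simp add: eq norm2_def)
   then show ?thesis using trilinear_bound[OF f g hm hb] by simp
  qed
  then have "(norm2 h)\<^sup>2 \<le> (sqrt (16 * M1 * M2 * lattice_const * norm2 h))\<^sup>2" by (intro power_mono) auto
  then have "norm2 h * norm2 h \<le> 16 * M1 * M2 * lattice_const * norm2 h"
   using M lattice_const(1) by (simp add: power2_eq_square)
  then have "norm2 h \<le> 16 * M1 * M2 * lattice_const \<or> norm2 h = 0"
   by (metis mult_right_le_imp_le norm2_nonneg order_le_less)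
  then show ?thesis using M lattice_const(1) unfolding N by (auto simp: mult_ac)
 qed
 from L2_of_truncated[OF m this] show "?p \<in> L2" "norm2 ?p \<le> 16 * lattice_const * M1 * M2" by auto
qed

text \<open>Leibniz' rule, because the multipliers of \<open>f\<close> and \<open>g\<close> add up under convolution.\<close>

lemma weak_deriv_product:
 fixes f g f' g' :: "real^3 \<Rightarrow> real"
 assumes f: "weak_partial j f f'" and g: "weak_partial j g g'"
  and L: "f \<in> L2" "f' \<in> L2" "g \<in> L2" "g' \<in> L2"
 shows "weak_partial j (\<lambda>x. f x * g x) (\<lambda>x. f x * g' x + f' x * g x)"
proof (rule has_weak_derivI_fcoeff)
 let ?c = "\<lambda>f x. complex_of_real (f x)"
 have i: "integrable torus (\<lambda>x. u x * v x)" if "u \<in> L2" "v \<in> L2" for u v :: "real^3 \<Rightarrow> real"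
  by (rule L2_mult_integrable[OF that])
 show "integrable torus (\<lambda>x. f x * g x)" "integrable torus (\<lambda>x. f x * g' x + f' x * g x)"
  by (intro i L L1_add)+
 fix l
 have lim: "(\<lambda>n. vp_form n (?c u) (\<lambda>x. ?c v x * char l x)) \<longlonglongrightarrow> rcoeff (\<lambda>x. u x * v x) l"
  if "u \<in> L2" "v \<in> L2" for u v
 proof -
  have "(\<lambda>n. vp_form n (?c u) (\<lambda>x. ?c v x * char l x)) \<longlonglongrightarrow> (TI x. ?c u x * cnj (?c v x * char l x))"
   by (intro vp_form_tendsto_L2 L2_of_real L2_char_mult that)
  then show ?thesis by (simp add: fcoeff_def mult_ac)
 qed
 have "vp_form n (?c f) (\<lambda>x. ?c g' x * char l x) + vp_form n (?c f') (\<lambda>x. ?c g x * char l x)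
   = symbol (unit_index j) l * vp_form n (?c f) (\<lambda>x. ?c g x * char l x)" for n
  unfolding vp_form_def sum_distrib_left sum.distrib[symmetric] fcoeff_mult_char
   fcoeff_weak_deriv[OF f] fcoeff_weak_deriv[OF g]
  by (intro sum.cong refl) (simp add: symbol_unit algebra_simps)
 moreover have "(\<lambda>n. vp_form n (?c f) (\<lambda>x. ?c g' x * char l x) + vp_form n (?c f') (\<lambda>x. ?c g x * char l x))
  \<longlonglongrightarrow> rcoeff (\<lambda>x. f x * g' x) l + rcoeff (\<lambda>x. f' x * g x) l"
  by (intro tendsto_add lim L)
 moreover have "(\<lambda>n. symbol (unit_index j) l * vp_form n (?c f) (\<lambda>x. ?c g x * char l x))
  \<longlonglongrightarrow> symbol (unit_index j) l * rcoeff (\<lambda>x. f x * g x) l"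
  by (intro tendsto_mult_left lim L)
 ultimately have "rcoeff (\<lambda>x. f x * g' x) l + rcoeff (\<lambda>x. f' x * g x) l = symbol (unit_index j) l * rcoeff (\<lambda>x. f x * g x) l"
  using LIMSEQ_unique by (simp only:) blast
 then show "rcoeff (\<lambda>x. f x * g' x + f' x * g x) l = symbol (unit_index j) l * rcoeff (\<lambda>x. f x * g x) l"
  using fcoeff_add[of "?c (\<lambda>x. f x * g' x)" "?c (\<lambda>x. f' x * g x)" l]
   integrable_of_real[OF i[OF L(1,4)], where 'a=complex] integrable_of_real[OF i[OF L(2,3)], where 'a=complex]
  by simp
qed

lemma AE_bounded_mult_L2:
 fixes f g :: "real^3 \<Rightarrow> real"
 assumes fm: "f \<in> borel_measurable torus" and b: "AE x in torus. (f x)\<^sup>2 \<le> B" and g: "g \<in> L2" "norm2 g \<le> M" and B: "0 \<le> B"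
 shows "(\<lambda>x. f x * g x) \<in> L2" "norm2 (\<lambda>x. f x * g x) \<le> B * M"
proof -
 have b': "AE x in torus. (f x * g x)\<^sup>2 \<le> B * (g x)\<^sup>2"
  using b by eventually_elim (auto simp: power_mult_distrib intro!: mult_right_mono)
 have m: "(\<lambda>x. f x * g x) \<in> borel_measurable torus" using fm L2_measurable[OF g(1)] by auto
 have gi: "integrable torus (\<lambda>x. B * (g x)\<^sup>2)" using L2_integrable_sq[OF g(1)] by simp
 have i: "integrable torus (\<lambda>x. (f x * g x)\<^sup>2)"
  by (rule L1_bound[OF gi]) (use m b' B in \<open>auto\<close>)
 then show "(\<lambda>x. f x * g x) \<in> L2" using m by (simp add: L2_def)
 have "norm2 (\<lambda>x. f x * g x) \<le> (TI x. B * (g x)\<^sup>2)"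
  unfolding norm2_def using i b' gi by (intro integral_mono_AE) auto
 also have "\<dots> = B * norm2 g" by (simp add: norm2_def)
 also have "\<dots> \<le> B * M" using g B by (intro mult_left_mono) auto
 finally show "norm2 (\<lambda>x. f x * g x) \<le> B * M" .
qed

text \<open>By Leibniz' rule a derivative of the product is a sum of products with \<open>s\<close> lowered by one; for
 \<open>s = 0\<close> the two terms are covered by \<open>H\<^sup>1 \<subseteq> L\<^sup>4\<close> and \<open>H\<^sup>2 \<subseteq> L\<^sup>\<infinity>\<close>.\<close>

lemma Hbound_product:
 "\<exists>C\<ge>0. \<forall>f g M1 M2. Hbound (s + 2) f M1 \<longrightarrow> Hbound (s + 1) g M2 \<longrightarrow> Hbound (s + 1) (\<lambda>x. f x * g x) (C * M1 * M2)"
proof (induction s)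
 case 0
 show ?case
 proof (intro exI[of _ "64 * lattice_const"] conjI allI impI)
  show "64 * lattice_const \<ge> 0" using lattice_const(1) by simp
  fix f g M1 M2 assume f: "Hbound (0 + 2) f M1" and g: "Hbound (0 + 1) g M2"
  then have f2: "Hbound 2 f M1" and f1: "Hbound 1 f M1" and g1: "Hbound 1 g M2"
   by (auto intro: Hbound_mono)
  have M: "0 \<le> M1" "0 \<le> M2" using Hbound_L2(4)[OF f] Hbound_L2(4)[OF g] by auto
  have Z: "0 < lattice_const" by (rule lattice_const)
  let ?B = "16 * lattice_const * M1"
  have fb: "AE x in torus. (f x)\<^sup>2 \<le> ?B" by (rule Hbound_2_bounded[OF f2])
  have fm: "f \<in> borel_measurable torus" using Hbound_L2(3)[OF f] by auto
  have B: "0 \<le> ?B" using M Z by simp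
  have le: "?B * M2 \<le> 64 * lattice_const * M1 * M2" "2 * (1::real)\<^sup>2 * (?B * M2) + 2 * 1\<^sup>2 * (?B * M2) \<le> 64 * lattice_const * M1 * M2"
   using M Z by (auto intro!: mult_right_mono)
  have fg: "(\<lambda>x. f x * g x) \<in> L2" "norm2 (\<lambda>x. f x * g x) \<le> ?B * M2"
   using AE_bounded_mult_L2[OF fm fb Hbound_L2(1,2)[OF g] B] by auto
  have "Hbound (Suc 0) (\<lambda>x. f x * g x) (64 * lattice_const * M1 * M2)"
  proof (rule Hbound_SucI[OF fg(1)])
   show "norm2 (\<lambda>x. f x * g x) \<le> 64 * lattice_const * M1 * M2" using fg(2) le(1) by linarith
   fix j
   have "Hbound (Suc 1) f M1" using f2 by (simp add: numeral_2_eq_2)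
   then obtain f' where f': "weak_partial j f f'" "Hbound 1 f' M1" by (rule Hbound_deriv)
   have "Hbound (Suc 0) g M2" using g1 by simp
   then obtain g' where g': "weak_partial j g g'" "Hbound 0 g' M2" by (rule Hbound_deriv)
   have 1: "(\<lambda>x. f x * g' x) \<in> L2" "norm2 (\<lambda>x. f x * g' x) \<le> ?B * M2"
    using AE_bounded_mult_L2[OF fm fb Hbound_L2(1,2)[OF g'(2)] B] by auto
   have 2: "(\<lambda>x. f' x * g x) \<in> L2" "norm2 (\<lambda>x. f' x * g x) \<le> ?B * M2"
    using Hbound_1_mult_L2[OF f'(2) g1] by auto
   have "Hbound 0 (\<lambda>x. 1 * (f x * g' x) + 1 * (f' x * g x)) (2 * 1\<^sup>2 * (?B * M2) + 2 * 1\<^sup>2 * (?B * M2))"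
    by (intro Hbound_linear Hbound_0I 1 2)
   then have "Hbound 0 (\<lambda>x. f x * g' x + f' x * g x) (64 * lattice_const * M1 * M2)"
    using Hbound_mono[OF _ le_refl le(2)] by simp
   then show "\<exists>h. weak_partial j (\<lambda>x. f x * g x) h \<and> Hbound 0 h (64 * lattice_const * M1 * M2)"
    using weak_deriv_product[OF f'(1) g'(1)] Hbound_L2(1)[OF f] Hbound_L2(1)[OF g] Hbound_L2(1)[OF f'(2)] Hbound_L2(1)[OF g'(2)]
    by blast
  qed
  then show "Hbound (0 + 1) (\<lambda>x. f x * g x) (64 * lattice_const * M1 * M2)" by simp
 qed
next
 case (Suc s)
 then obtain C where C: "C \<ge> 0"
  and prod: "\<And>f g M1 M2. Hbound (s + 2) f M1 \<Longrightarrow> Hbound (s + 1) g M2 \<Longrightarrow> Hbound (s + 1) (\<lambda>x. f x * g x) (C * M1 * M2)"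
  by blast
 show ?case
 proof (intro exI[of _ "4 * C"] conjI allI impI)
  show "4 * C \<ge> 0" using C by simp
  fix f g M1 M2 assume f: "Hbound (Suc s + 2) f M1" and g: "Hbound (Suc s + 1) g M2"
  have M: "0 \<le> M1" "0 \<le> M2" using Hbound_L2(4)[OF f] Hbound_L2(4)[OF g] by auto
  have fl: "Hbound (s + 2) f M1" and gl: "Hbound (s + 1) g M2"
   using Hbound_mono[OF f] Hbound_mono[OF g] by auto
  have le: "C * M1 * M2 \<le> 4 * C * M1 * M2" "2 * (1::real)\<^sup>2 * (C * M1 * M2) + 2 * 1\<^sup>2 * (C * M1 * M2) \<le> 4 * C * M1 * M2"
   using M C by (auto intro!: mult_right_mono)
  have fg: "Hbound (s + 1) (\<lambda>x. f x * g x) (C * M1 * M2)" by (rule prod[OF fl gl])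
  have "Hbound (Suc (s + 1)) (\<lambda>x. f x * g x) (4 * C * M1 * M2)"
  proof (rule Hbound_SucI)
   show "(\<lambda>x. f x * g x) \<in> L2" "norm2 (\<lambda>x. f x * g x) \<le> 4 * C * M1 * M2"
    using Hbound_L2(1,2)[OF fg] le(1) by (auto intro: order_trans)
   fix j
   have "Hbound (Suc (s + 2)) f M1" using f by simp
   then obtain f' where f': "weak_partial j f f'" "Hbound (s + 2) f' M1" by (rule Hbound_deriv)
   have "Hbound (Suc (s + 1)) g M2" using g by simp
   then obtain g' where g': "weak_partial j g g'" "Hbound (s + 1) g' M2" by (rule Hbound_deriv)
   have "Hbound (s + 1) (\<lambda>x. 1 * (f x * g' x) + 1 * (f' x * g x)) (2 * 1\<^sup>2 * (C * M1 * M2) + 2 * 1\<^sup>2 * (C * M1 * M2))"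
    by (intro Hbound_linear prod fl gl f' g')
   then have "Hbound (s + 1) (\<lambda>x. f x * g' x + f' x * g x) (4 * C * M1 * M2)"
    using Hbound_mono[OF _ le_refl le(2)] by simp
   then show "\<exists>h. weak_partial j (\<lambda>x. f x * g x) h \<and> Hbound (s + 1) h (4 * C * M1 * M2)"
    using weak_deriv_product[OF f'(1) g'(1)] Hbound_L2(1)[OF f] Hbound_L2(1)[OF g] Hbound_L2(1)[OF f'(2)] Hbound_L2(1)[OF g'(2)]
    by blast
  qed
  then show "Hbound (Suc s + 1) (\<lambda>x. f x * g x) (4 * C * M1 * M2)" by simp
 qed
qed

section \<open>Vector-valued Sobolev functions by components\<close>

lemma integrable_continuous_mult_torus:
 fixes f :: "real^3 \<Rightarrow> real"
 assumes \<psi>: "continuous_on UNIV \<psi>" and f: "integrable torus f"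
 shows "integrable torus (\<lambda>x. \<psi> x * f x)"
proof -
 obtain B where B: "\<And>x. x \<in> cbox 0 One \<Longrightarrow> \<bar>\<psi> x\<bar> \<le> B" using bounded_on_cell[OF \<psi>] by auto
 show ?thesis
 proof (rule L1_bound)
  show "integrable torus (\<lambda>x. B * f x)" using f by simp
  show "(\<lambda>x. \<psi> x * f x) \<in> borel_measurable torus"
   using continuous_borel_torus[OF \<psi>] f by auto
  show "AE x in torus. norm (\<psi> x * f x) \<le> norm (B * f x)"
  proof (rule AE_I2)
   fix x assume "x \<in> space torus"
   then have "\<bar>\<psi> x\<bar> \<le> \<bar>B\<bar>" using B[of x] by auto
   then show "norm (\<psi> x * f x) \<le> norm (B * f x)" by (simp add: abs_mult mult_right_mono)
  qed
 qed
qed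

lemma integrable_componentwise:
 fixes f :: "'a \<Rightarrow> 'b::euclidean_space"
 shows "integrable M f \<longleftrightarrow> (\<forall>b\<in>Basis. integrable M (\<lambda>x. f x \<bullet> b))"
proof
 assume "\<forall>b\<in>Basis. integrable M (\<lambda>x. f x \<bullet> b)"
 then have "integrable M (\<lambda>x. \<Sum>b\<in>Basis. (f x \<bullet> b) *\<^sub>R b)" by (intro L1_sum) auto
 then show "integrable M f" by (simp add: euclidean_representation)
qed auto

lemma integrable_scaleR_continuous_torus:
 fixes f :: "real^3 \<Rightarrow> 'b::euclidean_space"
 assumes "continuous_on UNIV \<psi>" "integrable torus f"
 shows "integrable torus (\<lambda>x. \<psi> x *\<^sub>R f x)"
 by (subst integrable_componentwise) (use integrable_continuous_mult_torus[OF assms(1)] assms(2) in simp)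

lemma has_weak_deriv_componentwise:
 fixes f g :: "real^3 \<Rightarrow> 'b::euclidean_space"
 shows "has_weak_deriv \<alpha> f g \<longleftrightarrow> (\<forall>b\<in>Basis. has_weak_deriv \<alpha> (\<lambda>x. f x \<bullet> b) (\<lambda>x. g x \<bullet> b))"
proof -
 have I: "integrable torus f \<and> integrable torus g \<longleftrightarrow>
   (\<forall>b\<in>Basis. integrable torus (\<lambda>x. f x \<bullet> b) \<and> integrable torus (\<lambda>x. g x \<bullet> b))"
  using integrable_componentwise[of torus f] integrable_componentwise[of torus g] by blast
 have E: "(TI x. multi_deriv \<alpha> \<psi> x *\<^sub>R f x) = r *\<^sub>R (TI x. \<psi> x *\<^sub>R g x) \<longleftrightarrow>
   (\<forall>b\<in>Basis. (TI x. multi_deriv \<alpha> \<psi> x * (f x \<bullet> b)) = r * (TI x. \<psi> x * (g x \<bullet> b)))"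
  if i: "integrable torus f" "integrable torus g" and \<psi>: "torus_test \<psi>" for \<psi> r
 proof -
  have c: "continuous_on UNIV \<psi>" "continuous_on UNIV (multi_deriv \<alpha> \<psi>)"
   using \<psi> torus_test_multi_deriv[OF \<psi>] by (auto simp: torus_test_def intro: smooth_continuous)
  have "(TI x. p x *\<^sub>R h x) \<bullet> b = (TI x. p x * (h x \<bullet> b))"
   if "continuous_on UNIV p" "integrable torus h" for p and h :: "real^3 \<Rightarrow> 'b" and b
   using integral_inner_left[of b torus "\<lambda>x. p x *\<^sub>R h x"] integrable_scaleR_continuous_torus[OF that] by simp
  then show ?thesis using c i by (subst euclidean_eq_iff) simp
 qed
 show ?thesis
 proof (cases "integrable torus f \<and> integrable torus g")
  case True
  then show ?thesis unfolding has_weak_deriv_def real_scaleR_def using I E by auto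
 next
  case False
  then show ?thesis unfolding has_weak_deriv_def using I by blast
 qed
qed

lemma weak_deriv_unique_vector:
 fixes f g h :: "real^3 \<Rightarrow> 'b::euclidean_space"
 assumes "has_weak_deriv \<alpha> f g" "has_weak_deriv \<alpha> f h"
 shows "AE x in torus. g x = h x"
proof -
 have "AE x in torus. \<forall>b\<in>Basis. g x \<bullet> b = h x \<bullet> b"
  using assms[unfolded has_weak_deriv_componentwise[of \<alpha> f]] weak_deriv_unique
  by (intro AE_finite_allI) (auto intro: weak_deriv_unique)
 then show ?thesis by eventually_elim (simp add: euclidean_eq_iff[where 'a='b])
qed

lemma has_weak_deriv_weak_deriv: "has_weak_deriv \<alpha> f g \<Longrightarrow> has_weak_deriv \<alpha> f (weak_deriv \<alpha> f)"
 unfolding weak_deriv_def by (rule someI[of "has_weak_deriv \<alpha> f"])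

lemma sobolev_imp_Hbound:
 fixes f :: "real^3 \<Rightarrow> 'b::euclidean_space"
 assumes f: "f \<in> sobolev s" and M: "sobolev_norm s f \<le> M" and b: "b \<in> Basis"
 shows "Hbound s (\<lambda>x. f x \<bullet> b) (M\<^sup>2)"
 unfolding Hbound_def
proof
 fix \<alpha> assume \<alpha>: "\<alpha> \<in> multi_indices s"
 then obtain g where g: "g \<in> L2" "has_weak_deriv \<alpha> f g" using f unfolding sobolev_def by blast
 let ?w = "weak_deriv \<alpha> f"
 have w: "has_weak_deriv \<alpha> f ?w" by (rule has_weak_deriv_weak_deriv[OF g(2)])
 have wm: "?w \<in> borel_measurable torus" "g \<in> borel_measurable torus" using w g by (auto simp: has_weak_deriv_def)
 have wL: "?w \<in> L2" using norm2_cong_AE(2)[OF weak_deriv_unique_vector[OF w g(2)] wm] g by simp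
 have m: "(\<lambda>x. ?w x \<bullet> b) \<in> borel_measurable torus" using wm by auto
 have L: "(\<lambda>x. ?w x \<bullet> b) \<in> L2"
  by (rule L2_mult_bounded[OF wL m, of 1]) (auto intro!: AE_I2 Basis_le_norm[OF b])
 have le: "(?w x \<bullet> b)\<^sup>2 \<le> (norm (?w x))\<^sup>2" for x
  using power_mono[OF Basis_le_norm[OF b, of "?w x"], of 2] by simp
 have "norm2 (\<lambda>x. ?w x \<bullet> b) \<le> norm2 ?w"
  unfolding norm2_def using L2_integrable_sq[OF L] L2_integrable_sq[OF wL] le by (intro integral_mono) auto
 also have "\<dots> \<le> (\<Sum>\<alpha>\<in>multi_indices s. norm2 (weak_deriv \<alpha> f))"
  by (intro member_le_sum \<alpha> finite_multi_indices) auto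
 also have "\<dots> = (sobolev_norm s f)\<^sup>2"
  unfolding sobolev_norm_def norm2_def by (subst real_sqrt_pow2) (auto intro!: sum_nonneg)
 also have "\<dots> \<le> M\<^sup>2"
  using M unfolding sobolev_norm_def by (intro power_mono) (auto intro!: sum_nonneg)
 finally have "norm2 (\<lambda>x. ?w x \<bullet> b) \<le> M\<^sup>2" .
 then show "\<exists>g. has_weak_deriv \<alpha> (\<lambda>x. f x \<bullet> b) g \<and> g \<in> L2 \<and> norm2 g \<le> M\<^sup>2"
  using w L b unfolding has_weak_deriv_componentwise[of \<alpha> f] by blast
qed

lemma sobolevI_Hbound:
 fixes f :: "real^3 \<Rightarrow> 'b::euclidean_space" and M :: real
 assumes per: "periodic f" and H: "\<And>b. b \<in> Basis \<Longrightarrow> Hbound s (\<lambda>x. f x \<bullet> b) M"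
 shows "f \<in> sobolev s" "sobolev_norm s f \<le> sqrt (real (card (multi_indices s)) * (real DIM('b) * M))"
proof -
 have ex: "\<exists>g. g \<in> L2 \<and> has_weak_deriv \<alpha> f g \<and> norm2 g \<le> real DIM('b) * M" if \<alpha>: "\<alpha> \<in> multi_indices s" for \<alpha>
 proof -
  have "\<forall>b\<in>Basis. \<exists>g. has_weak_deriv \<alpha> (\<lambda>x. f x \<bullet> b) g \<and> g \<in> L2 \<and> norm2 g \<le> M"
   using H \<alpha> unfolding Hbound_def by blast
  then obtain G where G: "\<And>b. b \<in> Basis \<Longrightarrow> has_weak_deriv \<alpha> (\<lambda>x. f x \<bullet> b) (G b) \<and> G b \<in> L2 \<and> norm2 (G b) \<le> M"
   by metis
  let ?g = "\<lambda>x. \<Sum>b\<in>Basis. G b x *\<^sub>R b"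
  have comp: "?g x \<bullet> b = G b x" if "b \<in> Basis" for b x
   using that by (simp add: inner_sum_left_Basis)
  have "has_weak_deriv \<alpha> f ?g"
   unfolding has_weak_deriv_componentwise[of \<alpha> f] using G by (simp add: comp)
  moreover have sq: "(norm (?g x))\<^sup>2 = (\<Sum>b\<in>Basis. (G b x)\<^sup>2)" for x
  proof -
   have "(norm (?g x))\<^sup>2 = ?g x \<bullet> ?g x" by (simp add: power2_norm_eq_inner)
   also have "\<dots> = (\<Sum>b\<in>Basis. (?g x \<bullet> b) * (?g x \<bullet> b))" by (rule euclidean_inner)
   finally show ?thesis by (simp add: comp power2_eq_square)
  qed
  have i: "integrable torus (\<lambda>x. (G b x)\<^sup>2)" if "b \<in> Basis" for b
   using G[OF that] L2_integrable_sq[of "G b"] by simp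
  have "?g \<in> borel_measurable torus"
   using G L2_measurable by (intro borel_measurable_sum borel_measurable_scaleR) auto
  then have "?g \<in> L2" unfolding L2_def mem_Collect_eq sq using i by auto
  moreover have "norm2 ?g = (\<Sum>b\<in>Basis. norm2 (G b))"
   unfolding norm2_def sq using i by simp
  moreover have "(\<Sum>b\<in>Basis. norm2 (G b)) \<le> (\<Sum>b\<in>(Basis :: 'b set). M)"
   by (intro sum_mono) (use G in auto)
  ultimately show ?thesis by (intro exI[of _ ?g]) simp
 qed
 have zero: "(\<lambda>_. 0) \<in> multi_indices s" by (simp add: multi_indices_def)
 from ex[OF zero] obtain g0 where g0: "g0 \<in> L2" "has_weak_deriv (\<lambda>_. 0) f g0" by blast
 have ff: "has_weak_deriv (\<lambda>_. 0) f f"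
  unfolding has_weak_deriv_componentwise[of _ f]
  using has_weak_deriv_0 Hbound_L2(3)[OF H] by blast
 have "f \<in> L2"
  using norm2_cong_AE(2)[OF weak_deriv_unique_vector[OF ff g0(2)]] ff g0 by (auto simp: has_weak_deriv_def)
 then show "f \<in> sobolev s" unfolding sobolev_def using per ex by blast
 have "norm2 (weak_deriv \<alpha> f) \<le> real DIM('b) * M" if \<alpha>: "\<alpha> \<in> multi_indices s" for \<alpha>
 proof -
  obtain g where g: "has_weak_deriv \<alpha> f g" "norm2 g \<le> real DIM('b) * M" using ex[OF \<alpha>] by blast
  note w = has_weak_deriv_weak_deriv[OF g(1)]
  have "norm2 (weak_deriv \<alpha> f) = norm2 g"
   using norm2_cong_AE(1)[OF weak_deriv_unique_vector[OF w g(1)]] w g(1) by (auto simp: has_weak_deriv_def)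
  then show ?thesis using g(2) by simp
 qed
 then have "(\<Sum>\<alpha>\<in>multi_indices s. norm2 (weak_deriv \<alpha> f)) \<le> (\<Sum>\<alpha>\<in>multi_indices s. real DIM('b) * M)"
  by (rule sum_mono)
 then show "sobolev_norm s f \<le> sqrt (real (card (multi_indices s)) * (real DIM('b) * M))"
  unfolding sobolev_norm_def norm2_def[symmetric] by (intro real_sqrt_le_mono) simp
qed

definition Linf_Hbound :: "nat \<Rightarrow> (event \<Rightarrow> real) \<Rightarrow> bool" where
 "Linf_Hbound s f \<longleftrightarrow> (\<exists>M. AE t in half_line. Hbound s (\<lambda>x. f (t, x)) M)"

lemma Linf_sobolevD:
 fixes f :: "event \<Rightarrow> 'b::euclidean_space"
 assumes "f \<in> Linf_sobolev s"
 shows "f \<in> borel_measurable spacetime" "t \<ge> 0 \<Longrightarrow> periodic (\<lambda>x. f (t, x))"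
  "b \<in> Basis \<Longrightarrow> Linf_Hbound s (\<lambda>p. f p \<bullet> b)"
proof -
 show "f \<in> borel_measurable spacetime" "t \<ge> 0 \<Longrightarrow> periodic (\<lambda>x. f (t, x))"
  using assms by (auto simp: Linf_sobolev_def)
 assume b: "b \<in> Basis"
 obtain M where "AE t in half_line. (\<lambda>x. f (t, x)) \<in> sobolev s \<and> sobolev_norm s (\<lambda>x. f (t, x)) \<le> M"
  using assms by (auto simp: Linf_sobolev_def)
 then have "AE t in half_line. Hbound s (\<lambda>x. f (t, x) \<bullet> b) (M\<^sup>2)"
  by eventually_elim (auto intro: sobolev_imp_Hbound b)
 then show "Linf_Hbound s (\<lambda>p. f p \<bullet> b)" unfolding Linf_Hbound_def by blast
qed

lemma Linf_sobolevI:
 fixes f :: "event \<Rightarrow> 'b::euclidean_space"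
 assumes m: "f \<in> borel_measurable spacetime" and p: "\<And>t. t \<ge> 0 \<Longrightarrow> periodic (\<lambda>x. f (t, x))"
  and H: "\<And>b. b \<in> Basis \<Longrightarrow> Linf_Hbound s (\<lambda>p. f p \<bullet> b)"
 shows "f \<in> Linf_sobolev s"
proof -
 obtain M where M: "\<And>b. b \<in> Basis \<Longrightarrow> AE t in half_line. Hbound s (\<lambda>x. f (t, x) \<bullet> b) (M b)"
  using H unfolding Linf_Hbound_def by metis
 let ?M = "\<Sum>b\<in>Basis. \<bar>M b\<bar>"
 have le: "M b \<le> ?M" if "b \<in> Basis" for b
  using member_le_sum[of b Basis "\<lambda>b. \<bar>M b\<bar>"] that by (simp add: abs_le_iff)
 have "AE t in half_line. \<forall>b\<in>Basis. Hbound s (\<lambda>x. f (t, x) \<bullet> b) ?M"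
 proof (intro AE_finite_allI finite_Basis)
  fix b :: 'b assume b: "b \<in> Basis"
  show "AE t in half_line. Hbound s (\<lambda>x. f (t, x) \<bullet> b) ?M"
   using M[OF b] by eventually_elim (rule Hbound_mono[OF _ le_refl le[OF b]])
 qed
 moreover have "AE t in half_line. t \<ge> 0" by (intro AE_I2) auto
 ultimately have "AE t in half_line. (\<lambda>x. f (t, x)) \<in> sobolev s \<and>
   sobolev_norm s (\<lambda>x. f (t, x)) \<le> sqrt (real (card (multi_indices s)) * (real DIM('b) * ?M))"
  by eventually_elim (auto intro!: sobolevI_Hbound p)
 then show ?thesis unfolding Linf_sobolev_def using m p by blast
qed

lemma Linf_Hbound_linear:
 assumes "Linf_Hbound s f" "Linf_Hbound s g"
 shows "Linf_Hbound s (\<lambda>p. a * f p + b * g p)"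
proof -
 obtain M1 M2 where "AE t in half_line. Hbound s (\<lambda>x. f (t, x)) M1"
  "AE t in half_line. Hbound s (\<lambda>x. g (t, x)) M2" using assms unfolding Linf_Hbound_def by blast
 then have "AE t in half_line. Hbound s (\<lambda>x. a * f (t, x) + b * g (t, x)) (2 * a\<^sup>2 * M1 + 2 * b\<^sup>2 * M2)"
  by eventually_elim (rule Hbound_linear)
 then show ?thesis unfolding Linf_Hbound_def by blast
qed

lemma Linf_Hbound_sum:
 assumes "finite A" "A \<noteq> {}" "\<And>i. i \<in> A \<Longrightarrow> Linf_Hbound s (f i)"
 shows "Linf_Hbound s (\<lambda>p. \<Sum>i\<in>A. f i p)"
 using assms
proof (induction A rule: finite_ne_induct)
 case (insert i A)
 then show ?case using Linf_Hbound_linear[of s "f i" "\<lambda>p. \<Sum>i\<in>A. f i p" 1 1] by simp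
qed auto

lemma Linf_Hbound_mono: "Linf_Hbound s f \<Longrightarrow> t \<le> s \<Longrightarrow> Linf_Hbound t f"
proof -
 assume "Linf_Hbound s f" and t: "t \<le> s"
 then obtain M where "AE t in half_line. Hbound s (\<lambda>x. f (t, x)) M" unfolding Linf_Hbound_def by blast
 then have "AE \<tau> in half_line. Hbound t (\<lambda>x. f (\<tau>, x)) M"
  by eventually_elim (rule Hbound_mono[OF _ t order_refl])
 then show "Linf_Hbound t f" unfolding Linf_Hbound_def by blast
qed

lemma Linf_Hbound_product:
 assumes f: "Linf_Hbound (s + 2) f" and g: "Linf_Hbound (s + 1) g"
 shows "Linf_Hbound (s + 1) (\<lambda>p. f p * g p)"
proof -
 obtain C where prod: "\<And>f g M1 M2. Hbound (s + 2) f M1 \<Longrightarrow> Hbound (s + 1) g M2 \<Longrightarrow> Hbound (s + 1) (\<lambda>x. f x * g x) (C * M1 * M2)"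
  using Hbound_product[of s] by blast
 obtain M1 M2 where "AE t in half_line. Hbound (s + 2) (\<lambda>x. f (t, x)) M1"
  "AE t in half_line. Hbound (s + 1) (\<lambda>x. g (t, x)) M2" using assms unfolding Linf_Hbound_def by blast
 then have "AE t in half_line. Hbound (s + 1) (\<lambda>x. f (t, x) * g (t, x)) (C * M1 * M2)"
  by eventually_elim (rule prod)
 then show ?thesis unfolding Linf_Hbound_def by blast
qed

section \<open>Fubini's theorem on space-time cylinders\<close>

lemma AE_lebesgue_on_iff:
 "S \<in> sets lebesgue \<Longrightarrow> (AE x in lebesgue_on S. P x) \<longleftrightarrow> (AE x in lborel. x \<in> S \<longrightarrow> P x)"
 by (subst AE_restrict_space_iff) (auto simp: AE_completion_iff)

text \<open>Integration over a Lebesgue measurable set, expressed through a Borel representative of the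
 extension by zero.\<close>

lemma lebesgue_on_borel_rep:
 fixes f :: "'a::euclidean_space \<Rightarrow> real"
 assumes S: "S \<in> sets lebesgue" and g: "g \<in> borel_measurable borel"
  and eq: "AE x in lborel. g x = (if x \<in> S then f x else 0)"
 shows "f \<in> borel_measurable (lebesgue_on S)"
  "integrable (lebesgue_on S) f \<longleftrightarrow> integrable lborel g"
  "(LINT x|lebesgue_on S. f x) = (LINT x|lborel. g x)"
proof -
 let ?e = "\<lambda>x. if x \<in> S then f x else 0"
 have ind: "(\<lambda>x. indicator S x *\<^sub>R f x) = ?e" by (auto simp: indicator_def)
 have ae: "AE x in lebesgue. g x = ?e x" using eq by (simp add: AE_completion_iff)
 have gl: "g \<in> borel_measurable lebesgue" "g \<in> borel_measurable lborel" using g by (auto intro: measurable_completion)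
 have em: "?e \<in> borel_measurable lebesgue" by (rule borel_measurable_AE[OF gl(1) ae])
 moreover have "f \<in> borel_measurable (lebesgue_on S) \<longleftrightarrow> (\<lambda>x. indicator S x *\<^sub>R f x) \<in> borel_measurable lebesgue"
  by (rule borel_measurable_restrict_space_iff) (use S in auto)
 ultimately show "f \<in> borel_measurable (lebesgue_on S)" unfolding ind by simp
 have "integrable (lebesgue_on S) f \<longleftrightarrow> integrable lebesgue ?e"
  unfolding ind[symmetric] by (rule integrable_restrict_space) (use S in auto)
 also have "\<dots> \<longleftrightarrow> integrable lebesgue g" using ae em gl by (intro integrable_cong_AE) auto
 also have "\<dots> \<longleftrightarrow> integrable lborel g" using gl by (intro integrable_completion) auto
 finally show "integrable (lebesgue_on S) f \<longleftrightarrow> integrable lborel g" .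
 have "(LINT x|lebesgue_on S. f x) = (LINT x|lebesgue. ?e x)"
  unfolding ind[symmetric] by (rule integral_restrict_space) (use S in auto)
 also have "\<dots> = (LINT x|lebesgue. g x)" using ae em gl by (intro integral_cong_AE) auto
 also have "\<dots> = (LINT x|lborel. g x)" using gl by (intro integral_completion) auto
 finally show "(LINT x|lebesgue_on S. f x) = (LINT x|lborel. g x)" .
qed

lemma lebesgue_on_borel_rep_exists:
 fixes f :: "'a::euclidean_space \<Rightarrow> real"
 assumes S: "S \<in> sets lebesgue" and f: "f \<in> borel_measurable (lebesgue_on S)"
 obtains g where "g \<in> borel_measurable borel" "AE x in lborel. g x = (if x \<in> S then f x else 0)"
proof -
 have "(\<lambda>x. indicator S x *\<^sub>R f x) \<in> borel_measurable lebesgue"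
  using f S by (subst (asm) borel_measurable_restrict_space_iff) auto
 from completion_ex_borel_measurable_real[OF this[simplified]]
 obtain g where "g \<in> borel_measurable lborel" "AE x in lborel. indicator S x * f x = g x" by auto
 moreover have "AE x in lborel. g x = (if x \<in> S then f x else 0)"
  using \<open>AE x in lborel. indicator S x * f x = g x\<close> by eventually_elim (auto simp: indicator_def)
 ultimately show thesis using that by simp
qed

abbreviation cyl :: "real set \<Rightarrow> (event) measure" where
 "cyl A \<equiv> lebesgue_on (A \<times> cbox 0 One)"

lemma cyl_sets: "closed A \<Longrightarrow> A \<times> cbox 0 (One :: real^3) \<in> sets lebesgue"
 by (intro borel_closed[THEN sets_completionI_sets[of _ lborel, simplified]] closed_Times) auto

lemma cell_sets: "cbox 0 (One :: real^3) \<in> sets lebesgue" by simp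

lemma closed_sets_lebesgue: "closed A \<Longrightarrow> A \<in> sets (lebesgue :: real measure)"
 by (intro borel_closed[THEN sets_completionI_sets[of _ lborel, simplified]])

lemma slice_borel: "g \<in> borel_measurable borel \<Longrightarrow> (\<lambda>x. g (t, x)) \<in> borel_measurable borel"
 for g :: "event \<Rightarrow> real"
 by (rule measurable_compose[of "Pair t" borel borel]) (auto intro!: borel_measurable_continuous_onI continuous_intros)

lemma AE_lborel_pair: "AE p in lborel. P p \<Longrightarrow> AE t in lborel. AE x in lborel. P (t, x)"
 for P :: "event \<Rightarrow> bool"
 using lborel_pair.AE_pair[where Q=P] unfolding lborel_prod by simp

lemma cyl_slices:
 fixes f :: "event \<Rightarrow> real"
 assumes A: "closed A" and f: "f \<in> borel_measurable (cyl A)"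
 obtains g where "g \<in> borel_measurable borel"
  "AE p in lborel. g p = (if p \<in> A \<times> cbox 0 One then f p else 0)"
  "AE t in lborel. AE x in lborel. g (t, x) = (if t \<in> A \<and> x \<in> cbox 0 One then f (t, x) else 0)"
  "AE t in lborel. t \<in> A \<longrightarrow> (integrable torus (\<lambda>x. f (t, x)) \<longleftrightarrow> integrable lborel (\<lambda>x. g (t, x)))"
  "AE t in lborel. (LINT x|lborel. g (t, x)) = (if t \<in> A then TI x. f (t, x) else 0)"
proof -
 obtain g where g: "g \<in> borel_measurable borel"
  and eq: "AE p in lborel. g p = (if p \<in> A \<times> cbox 0 One then f p else 0)"
  by (rule lebesgue_on_borel_rep_exists[OF cyl_sets[OF A] f])
 have sl: "AE t in lborel. AE x in lborel. g (t, x) = (if t \<in> A \<and> x \<in> cbox 0 One then f (t, x) else 0)"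
  using AE_lborel_pair[OF eq] by simp
 show thesis
 proof (rule that[OF g eq sl])
  show "AE t in lborel. t \<in> A \<longrightarrow> (integrable torus (\<lambda>x. f (t, x)) \<longleftrightarrow> integrable lborel (\<lambda>x. g (t, x)))"
   using sl
  proof eventually_elim
   case (elim t)
   show ?case
   proof
    assume "t \<in> A"
    then have "AE x in lborel. g (t, x) = (if x \<in> cbox 0 One then f (t, x) else 0)" using elim by simp
    from lebesgue_on_borel_rep[OF cell_sets slice_borel[OF g] this]
    show "(integrable torus (\<lambda>x. f (t, x)) \<longleftrightarrow> integrable lborel (\<lambda>x. g (t, x)))"
     unfolding torus_def by blast
   qed
  qed
  show "AE t in lborel. (LINT x|lborel. g (t, x)) = (if t \<in> A then TI x. f (t, x) else 0)"
   using sl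
  proof eventually_elim
   case (elim t)
   show ?case
   proof (cases "t \<in> A")
    case True
    then have "AE x in lborel. g (t, x) = (if x \<in> cbox 0 One then f (t, x) else 0)" using elim by simp
    from lebesgue_on_borel_rep(3)[OF cell_sets slice_borel[OF g] this]
    show ?thesis using True unfolding torus_def by simp
   next
    case False
    then have "AE x in lborel. g (t, x) = 0" using elim by simp
    then have "(LINT x|lborel. g (t, x)) = (LINT x|(lborel :: (real^3) measure). 0)"
     using slice_borel[OF g, of t] by (intro integral_cong_AE) auto
    then show ?thesis using False by simp
   qed
  qed
 qed
qed

lemma cyl_Fubini:
 fixes f :: "event \<Rightarrow> real"
 assumes A: "closed A" and f: "integrable (cyl A) f"
 shows "AE t in lebesgue_on A. integrable torus (\<lambda>x. f (t, x))"
  "integrable (lebesgue_on A) (\<lambda>t. TI x. f (t, x))"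
  "(LINT p|cyl A. f p) = (LINT t|lebesgue_on A. (TI x. f (t, x)))"
proof -
 have As: "A \<in> sets lebesgue" by (rule closed_sets_lebesgue[OF A])
 obtain g where g: "g \<in> borel_measurable borel"
  and eq: "AE p in lborel. g p = (if p \<in> A \<times> cbox 0 One then f p else 0)"
  and s1: "AE t in lborel. t \<in> A \<longrightarrow> (integrable torus (\<lambda>x. f (t, x)) \<longleftrightarrow> integrable lborel (\<lambda>x. g (t, x)))"
  and s2: "AE t in lborel. (LINT x|lborel. g (t, x)) = (if t \<in> A then TI x. f (t, x) else 0)"
  by (rule cyl_slices[OF A borel_measurable_integrable[OF f]])
 note rep = lebesgue_on_borel_rep[OF cyl_sets[OF A] g eq]
 have gi: "integrable (lborel \<Otimes>\<^sub>M lborel) g" using rep(2) f by (simp add: lborel_prod)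
 have "AE t in lborel. integrable lborel (\<lambda>x. g (t, x))" using lborel_pair.AE_integrable_fst'[OF gi] by simp
 then show "AE t in lebesgue_on A. integrable torus (\<lambda>x. f (t, x))"
  unfolding AE_lebesgue_on_iff[OF As] using s1 by eventually_elim auto
 have hi: "integrable lborel (\<lambda>t. LINT x|lborel. g (t, x))" using lborel_pair.integrable_fst'[OF gi] by simp
 have hm: "(\<lambda>t. LINT x|lborel. g (t, x)) \<in> borel_measurable borel" using borel_measurable_integrable[OF hi] by simp
 note rep2 = lebesgue_on_borel_rep[OF As hm s2]
 show "integrable (lebesgue_on A) (\<lambda>t. TI x. f (t, x))" using rep2(2) hi by simp
 show "(LINT p|cyl A. f p) = (LINT t|lebesgue_on A. (TI x. f (t, x)))"
  using rep(3) rep2(3) lborel_pair.integral_fst'[OF gi] by (simp add: lborel_prod)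
qed

lemma cyl_integrableI:
 fixes f :: "event \<Rightarrow> real" and M :: real
 assumes f: "f \<in> borel_measurable (cyl {a..b})"
  and i: "AE t in lebesgue_on {a..b}. integrable torus (\<lambda>x. f (t, x)) \<and> (TI x. \<bar>f (t, x)\<bar>) \<le> M"
 shows "integrable (cyl {a..b}) f"
proof -
 let ?A = "{a..b}"
 have A: "closed ?A" by simp
 have As: "?A \<in> sets lebesgue" by simp
 obtain g where g: "g \<in> borel_measurable borel"
  and eq: "AE p in lborel. g p = (if p \<in> ?A \<times> cbox 0 One then f p else 0)"
  and sl: "AE t in lborel. AE x in lborel. g (t, x) = (if t \<in> ?A \<and> x \<in> cbox 0 One then f (t, x) else 0)"
  and s1: "AE t in lborel. t \<in> ?A \<longrightarrow> (integrable torus (\<lambda>x. f (t, x)) \<longleftrightarrow> integrable lborel (\<lambda>x. g (t, x)))"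
  by (rule cyl_slices[OF A f])
 have gp: "g \<in> borel_measurable (lborel \<Otimes>\<^sub>M lborel)" using g by (simp add: lborel_prod)
 have key: "AE t in lborel. integrable lborel (\<lambda>x. g (t, x)) \<and> (LINT x|lborel. \<bar>g (t, x)\<bar>) \<le> indicator ?A t * \<bar>M\<bar>"
  using sl s1 i[unfolded AE_lebesgue_on_iff[OF As]]
 proof eventually_elim
  case (elim t)
  show ?case
  proof (cases "t \<in> ?A")
   case True
   then have "AE x in lborel. \<bar>g (t, x)\<bar> = (if x \<in> cbox 0 One then \<bar>f (t, x)\<bar> else 0)"
    using elim(1) by (auto elim!: eventually_mono)
   moreover have "(\<lambda>x. \<bar>g (t, x)\<bar>) \<in> borel_measurable borel" using slice_borel[OF g, of t] by simp
   ultimately have "(TI x. \<bar>f (t, x)\<bar>) = (LINT x|lborel. \<bar>g (t, x)\<bar>)"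
    unfolding torus_def by (intro lebesgue_on_borel_rep(3)) auto
   then show ?thesis using True elim by auto
  next
   case False
   then have ae: "AE x in lborel. g (t, x) = 0" using elim(1) by auto
   have "integrable lborel (\<lambda>x. g (t, x)) \<longleftrightarrow> integrable (lborel :: (real^3) measure) (\<lambda>x. 0 :: real)"
    using ae slice_borel[OF g, of t] by (intro integrable_cong_AE) auto
   moreover have "(LINT x|lborel. \<bar>g (t, x)\<bar>) = (LINT x|(lborel :: (real^3) measure). 0)"
    using ae slice_borel[OF g, of t] by (intro integral_cong_AE) (auto elim!: eventually_mono)
   ultimately show ?thesis using False by simp
  qed
 qed
 have "integrable (lborel \<Otimes>\<^sub>M lborel) g"
 proof (rule lborel_pair.Fubini_integrable[OF gp])
  show "integrable lborel (\<lambda>t. LINT x|lborel. norm (g (t, x)))"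
  proof (rule L1_bound)
   show "integrable lborel (\<lambda>t. indicator ?A t * \<bar>M\<bar>)"
    by (intro integrable_mult_left integrable_real_indicator) (auto simp: emeasure_lborel_Icc_eq)
   show "(\<lambda>t. LINT x|lborel. norm (g (t, x))) \<in> borel_measurable lborel"
    using gp by measurable
   show "AE t in lborel. norm (LINT x|lborel. norm (g (t, x))) \<le> norm (indicator ?A t * \<bar>M\<bar>)"
    using key by eventually_elim (auto simp: abs_mult)
  qed
  show "AE t in lborel. integrable lborel (\<lambda>x. g (t, x))" using key by eventually_elim auto
 qed
 then show ?thesis using lebesgue_on_borel_rep(2)[OF cyl_sets[OF A] g eq] by (simp add: lborel_prod)
qed

lemma AE_cyl_slices:
 assumes A: "closed A" and P: "AE p in cyl A. P p"
 shows "AE t in lebesgue_on A. AE x in torus. P (t, x)"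
proof -
 have "AE p in lborel. p \<in> A \<times> cbox 0 One \<longrightarrow> P p" using P by (simp only: AE_lebesgue_on_iff[OF cyl_sets[OF A]])
 from AE_lborel_pair[OF this] show ?thesis
  unfolding AE_lebesgue_on_iff[OF closed_sets_lebesgue[OF A]] torus_def AE_lebesgue_on_iff[OF cell_sets]
  by (auto elim!: eventually_mono)
qed

lemma AE_cylI:
 fixes f :: "event \<Rightarrow> real"
 assumes A: "closed A" and f: "f \<in> borel_measurable (cyl A)"
  and z: "AE t in lebesgue_on A. AE x in torus. f (t, x) = (0::real)"
 shows "AE p in cyl A. f p = 0"
proof -
 obtain g where g: "g \<in> borel_measurable borel"
  and eq: "AE p in lborel. g p = (if p \<in> A \<times> cbox 0 One then f p else 0)"
  and sl: "AE t in lborel. AE x in lborel. g (t, x) = (if t \<in> A \<and> x \<in> cbox 0 One then f (t, x) else 0)"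
  by (rule cyl_slices[OF A f])
 have gp: "g \<in> borel_measurable (lborel \<Otimes>\<^sub>M lborel)" using g by (simp add: lborel_prod)
 have "AE t in lborel. AE x in lborel. g (t, x) = 0"
  using sl z[unfolded AE_lebesgue_on_iff[OF closed_sets_lebesgue[OF A]] torus_def AE_lebesgue_on_iff[OF cell_sets]]
 proof eventually_elim
  case (elim t)
  show ?case
  proof (cases "t \<in> A")
   case True
   then have "AE x in lborel. x \<in> cbox 0 One \<longrightarrow> f (t, x) = 0" using elim(2) by simp
   then show ?thesis using elim(1) by eventually_elim auto
  next
   case False
   show ?thesis using elim(1) by eventually_elim (use False in auto)
  qed
 qed
 moreover have "{p \<in> space (lborel \<Otimes>\<^sub>M lborel). g p = 0} \<in> sets (lborel \<Otimes>\<^sub>M lborel)"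
  using gp by measurable
 ultimately have "AE p in lborel \<Otimes>\<^sub>M lborel. g p = 0"
  by (intro lborel_pair.AE_pair_measure)
 then have "AE p in lborel. g p = 0" unfolding lborel_prod .
 then show ?thesis
  unfolding AE_lebesgue_on_iff[OF cyl_sets[OF A]] using eq by eventually_elim (auto split: if_splits)
qed

section \<open>Test functions\<close>

lemma C_k_const: "C_k n (\<lambda>_. c)"
proof (induction n arbitrary: c)
 case (Suc n)
 have "dir_deriv b (\<lambda>_::'a. c) = (\<lambda>_. 0)" for b by (intro ext dir_deriv_eqI) auto
 then show ?case using Suc by simp
qed simp

lemma C_k_add: "C_k n f \<Longrightarrow> C_k n g \<Longrightarrow> C_k n (\<lambda>x. f x + g x)"
proof (induction n arbitrary: f g)
 case (Suc n)
 have "dir_deriv b (\<lambda>x. f x + g x) = (\<lambda>x. dir_deriv b f x + dir_deriv b g x)" for b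
  by (intro ext dir_deriv_eqI has_derivative_add has_derivative_dir_deriv) (use Suc.prems in auto)
 then show ?case using Suc by auto
qed (auto intro: continuous_intros)

lemma C_k_mult: "C_k n f \<Longrightarrow> C_k n g \<Longrightarrow> C_k n (\<lambda>x. f x * g x)"
proof (induction n arbitrary: f g)
 case (Suc n)
 have "dir_deriv b (\<lambda>x. f x * g x) = (\<lambda>x. f x * dir_deriv b g x + dir_deriv b f x * g x)" for b
  by (intro ext dir_deriv_mult) (use Suc.prems in auto)
 moreover have "C_k n (\<lambda>x. f x * dir_deriv b g x + dir_deriv b f x * g x)" if "b \<in> Basis" for b
  using Suc.prems that by (intro C_k_add Suc.IH C_k_SucD[OF Suc.prems(1)] C_k_SucD[OF Suc.prems(2)]) auto
 ultimately show ?case using Suc.prems by auto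
qed (auto intro: continuous_intros)

lemma C_k_compose:
 fixes L :: "'a::euclidean_space \<Rightarrow> 'b::euclidean_space"
 assumes L: "\<And>x. (L has_derivative A) (at x)" and B: "\<And>b. b \<in> Basis \<Longrightarrow> \<exists>b'\<in>insert 0 Basis. \<exists>r. A b = r *\<^sub>R b'"
 shows "C_k n f \<Longrightarrow> C_k n (\<lambda>x. f (L x))"
proof (induction n arbitrary: f)
 case 0
 have "continuous_on UNIV L" using L by (intro has_derivative_continuous_on) (auto intro: has_derivative_at_withinI)
 then show ?case using 0 by (auto intro: continuous_on_compose2)
next
 case (Suc n)
 have d: "((\<lambda>x. f (L x)) has_derivative (\<lambda>h. dir_deriv (A h) f (L x))) (at x)" for x
  by (rule has_derivative_compose[OF L has_derivative_dir_deriv]) (use Suc.prems in auto)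
 have "C_k n (dir_deriv b (\<lambda>x. f (L x)))" if b: "b \<in> Basis" for b
 proof -
  obtain b' r where b': "b' \<in> insert 0 Basis" "A b = r *\<^sub>R b'" using B[OF b] by blast
  have lin: "linear (\<lambda>h. dir_deriv h f y)" for y
   using has_derivative_dir_deriv[of f y] Suc.prems by (auto dest: has_derivative_linear)
  have eq: "dir_deriv b (\<lambda>x. f (L x)) = (\<lambda>x. r * dir_deriv b' f (L x))"
  proof
   fix x
   have "dir_deriv b (\<lambda>x. f (L x)) x = dir_deriv (r *\<^sub>R b') f (L x)" using dir_deriv_eqI[OF d] b' by simp
   then show "dir_deriv b (\<lambda>x. f (L x)) x = r * dir_deriv b' f (L x)" using linear_cmul[OF lin, of r b'] by simp
  qed
  show ?thesis
  proof (cases "b' = 0")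
   case True
   then have "dir_deriv b (\<lambda>x. f (L x)) = (\<lambda>x. 0)" unfolding eq using linear_0[OF lin] by simp
   then show ?thesis by (simp add: C_k_const)
  next
   case False
   then have "C_k n (dir_deriv b' f)" using b' Suc.prems by auto
   then show ?thesis unfolding eq by (intro C_k_mult C_k_const Suc.IH)
  qed
 qed
 then show ?case using d by (auto simp: differentiable_def)
qed

lemma smooth_mult: "smooth f \<Longrightarrow> smooth g \<Longrightarrow> smooth (\<lambda>x. f x * g x)"
 by (simp add: smooth_def C_k_mult)

lemma smooth_fst: "smooth f \<Longrightarrow> smooth (\<lambda>p :: event. f (fst p))"
 unfolding smooth_def
proof (intro allI C_k_compose[of fst fst])
 fix b :: "event" assume "b \<in> Basis"
 then have "fst b \<in> insert 0 Basis" by (auto simp: Basis_prod_def)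
 then show "\<exists>b'\<in>insert 0 Basis. \<exists>r. fst b = r *\<^sub>R b'" by (intro bexI[of _ "fst b"] exI[of _ 1]) simp_all
qed (auto intro!: derivative_eq_intros)

lemma smooth_snd: "smooth f \<Longrightarrow> smooth (\<lambda>p :: event. f (snd p))"
 unfolding smooth_def
proof (intro allI C_k_compose[of snd snd])
 fix b :: "event" assume "b \<in> Basis"
 then have "snd b \<in> insert 0 Basis" by (auto simp: Basis_prod_def)
 then show "\<exists>b'\<in>insert 0 Basis. \<exists>r. snd b = r *\<^sub>R b'" by (intro bexI[of _ "snd b"] exI[of _ 1]) simp_all
qed (auto intro!: derivative_eq_intros)

lemma smooth_affine: "smooth f \<Longrightarrow> smooth (\<lambda>t::real. f (c * t + d))"
 unfolding smooth_def
 by (intro allI C_k_compose[of "\<lambda>t. c * t + d" "\<lambda>t. c * t"]) (auto intro!: derivative_eq_intros)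

lemma smooth_slice: "smooth \<phi> \<Longrightarrow> smooth (\<lambda>x. \<phi> (t, x))" for \<phi> :: "event \<Rightarrow> real"
 unfolding smooth_def
proof (intro allI C_k_compose[of "Pair t" "Pair 0"])
 fix b :: "real^3" assume "b \<in> Basis"
 then have "(0, b) \<in> (Basis :: (event) set)" by (simp add: Basis_prod_def)
 then show "\<exists>b'\<in>insert 0 Basis. \<exists>r. (0 :: real, b) = r *\<^sub>R b'" by (intro bexI[of _ "(0, b)"] exI[of _ 1]) auto
qed (auto intro!: derivative_eq_intros)

lemma dir_deriv_slice:
 fixes \<phi> :: "event \<Rightarrow> real"
 assumes "smooth \<phi>" shows "dir_deriv b (\<lambda>x. \<phi> (t, x)) x = dir_deriv (0, b) \<phi> (t, x)"
 by (rule dir_deriv_eqI)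
  (rule has_derivative_compose[of "Pair t" "Pair 0", OF _ has_derivative_dir_deriv],
   auto intro!: derivative_eq_intros smooth_differentiable assms)

subsection \<open>Smooth cutoffs in time\<close>

text \<open>The functions \<open>exp (-1/t) / t\<^sup>m\<close>, extended by zero to \<open>t \<le> 0\<close>; the derivative of one of them
 is a combination of two others, so they are all smooth.\<close>

definition flat :: "nat \<Rightarrow> real \<Rightarrow> real" where
 "flat m t = (if t > 0 then exp (- 1 / t) / t ^ m else 0)"

lemma flat_tendsto_0: "(flat m \<longlongrightarrow> 0) (at 0)"
proof (rule filterlim_split_at)
 have "\<forall>\<^sub>F t in at_left 0. flat m t = 0" by (auto simp: flat_def eventually_at_filter)
 then show "(flat m \<longlongrightarrow> 0) (at_left 0)" by (rule tendsto_eventually)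
 have "((\<lambda>t. inverse t ^ m / exp (inverse t)) \<longlongrightarrow> (0::real)) (at_right 0)"
  by (rule filterlim_compose[OF tendsto_power_div_exp_0 filterlim_inverse_at_top_right])
 moreover have "\<forall>\<^sub>F t in at_right (0::real). inverse t ^ m / exp (inverse t) = flat m t"
  unfolding eventually_at_filter
  by (auto simp: flat_def power_inverse exp_minus divide_simps intro!: always_eventually)
 ultimately show "(flat m \<longlongrightarrow> 0) (at_right 0)" by (rule Lim_transform_eventually)
qed

lemma flat_deriv: "(flat m has_real_derivative (- real m * flat (Suc m) t + flat (Suc (Suc m)) t)) (at t)"
proof -
 consider "t < 0" | "t = 0" | "t > 0" by linarith
 then show ?thesis
 proof cases
  case 1
  have "((\<lambda>t. 0) has_real_derivative 0) (at t)" by simp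
  moreover have "\<forall>\<^sub>F s in nhds t. flat m s = 0"
   using eventually_nhds_in_open[of "{..<0}" t] 1 by (auto elim!: eventually_mono simp: flat_def)
  ultimately have "(flat m has_real_derivative 0) (at t)" by (subst DERIV_cong_ev[OF refl _ refl]) auto
  then show ?thesis using 1 by (simp add: flat_def)
 next
  case 2
  have "(\<lambda>h. (flat m (0 + h) - flat m 0) / h) = flat (Suc m)"
   by (auto simp: flat_def fun_eq_iff)
  then show ?thesis using 2 flat_tendsto_0[of "Suc m"] by (simp add: DERIV_def flat_def)
 next
  case 3
  have "((\<lambda>t. exp (- 1 / t) / t ^ m) has_real_derivative
    ((exp (- 1 / t) * (1 / t\<^sup>2)) * t ^ m - exp (- 1 / t) * (real m * t ^ (m - 1))) / (t ^ m * t ^ m)) (at t)"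
   using 3 by (auto intro!: derivative_eq_intros simp: power2_eq_square divide_simps)
  also have "((exp (- 1 / t) * (1 / t\<^sup>2)) * t ^ m - exp (- 1 / t) * (real m * t ^ (m - 1))) / (t ^ m * t ^ m)
    = - real m * flat (Suc m) t + flat (Suc (Suc m)) t"
   using 3 by (cases m) (simp_all add: flat_def power2_eq_square divide_simps, simp_all add: algebra_simps)
  finally have "((\<lambda>t. exp (- 1 / t) / t ^ m) has_real_derivative (- real m * flat (Suc m) t + flat (Suc (Suc m)) t)) (at t)" .
  moreover have "\<forall>\<^sub>F s in nhds t. flat m s = exp (- 1 / s) / s ^ m"
   using eventually_nhds_in_open[of "{0<..}" t] 3 by (auto elim!: eventually_mono simp: flat_def)
  ultimately show ?thesis by (subst DERIV_cong_ev[OF refl _ refl]) auto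
 qed
qed

lemma dir_deriv_real: "(f has_real_derivative f') (at t) \<Longrightarrow> dir_deriv 1 f t = f'"
 using dir_deriv_eqI[of f "\<lambda>h. h * f'" t 1] by (simp add: has_field_derivative_def mult_commute_abs)

lemma C_k_SucI_real:
 assumes "\<And>t. (f has_real_derivative f' t) (at t)" "C_k n f'" shows "C_k (Suc n) f"
proof -
 have "dir_deriv 1 f = f'" using assms(1) by (intro ext dir_deriv_real)
 then show ?thesis using assms real_differentiable_def by auto
qed

lemma C_k_flat: "C_k n (flat m)"
proof (induction n arbitrary: m)
 case 0
 show ?case by (auto simp: continuous_on_eq_continuous_at intro!: DERIV_isCont[OF flat_deriv])
next
 case (Suc n)
 show ?case by (rule C_k_SucI_real[OF flat_deriv]) (intro C_k_add C_k_mult C_k_const Suc)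
qed

definition time_test :: "(real \<Rightarrow> real) \<Rightarrow> bool" where
 "time_test \<theta> \<longleftrightarrow> smooth \<theta> \<and> (\<exists>a b. 0 < a \<and> (\<forall>t. t \<notin> {a..b} \<longrightarrow> \<theta> t = 0))"

lemma time_test_approx_indicator:
 assumes "0 < a" "a < b"
 obtains \<theta> where "\<And>n. time_test (\<theta> n)" "\<And>n t. 0 \<le> \<theta> n t \<and> \<theta> n t \<le> 1" "\<And>n t. t \<notin> {a..b} \<Longrightarrow> \<theta> n t = 0"
  "\<And>t. a < t \<Longrightarrow> t < b \<Longrightarrow> (\<lambda>n. \<theta> n t) \<longlonglongrightarrow> 1" "\<And>n t. a < t \<Longrightarrow> t < b \<Longrightarrow> \<theta> n t > 0"
proof -
 define \<theta> where "\<theta> n t = flat 0 (real (Suc n) * t + - (real (Suc n) * a)) * flat 0 (- real (Suc n) * t + real (Suc n) * b)" for n t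
 have sm: "smooth (flat 0)" using C_k_flat by (simp add: smooth_def)
 have pos: "flat 0 t > 0 \<longleftrightarrow> t > 0" "0 \<le> flat 0 t" "flat 0 t \<le> 1" for t by (auto simp: flat_def)
 have z: "\<theta> n t = 0" if "t \<notin> {a..b}" for n t
 proof -
  have "real (Suc n) * (t - a) \<le> 0 \<or> real (Suc n) * (b - t) \<le> 0" using that by (auto simp: mult_le_0_iff)
  then show ?thesis by (auto simp: \<theta>_def flat_def algebra_simps)
 qed
 have lim: "(\<lambda>n. flat 0 (real (Suc n) * s)) \<longlonglongrightarrow> 1" if "s > 0" for s
 proof -
  have "(\<lambda>n. exp (- 1 / (real (Suc n) * s))) \<longlonglongrightarrow> 1" using that by real_asymp
  then show ?thesis using that by (simp add: flat_def)
 qed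
 have eq: "\<theta> n t = flat 0 (real (Suc n) * (t - a)) * flat 0 (real (Suc n) * (b - t))" for n t
  by (simp add: \<theta>_def algebra_simps)
 show thesis
 proof
  show "time_test (\<theta> n)" for n
  proof -
   have "smooth (\<theta> n)" unfolding \<theta>_def[abs_def] by (intro smooth_mult smooth_affine sm)
   then show ?thesis unfolding time_test_def using z assms by blast
  qed
  show "0 \<le> \<theta> n t \<and> \<theta> n t \<le> 1" for n t
   unfolding \<theta>_def using pos by (intro conjI mult_nonneg_nonneg mult_le_one) auto
  show "(\<lambda>n. \<theta> n t) \<longlonglongrightarrow> 1" if "a < t" "t < b" for t
   unfolding eq using tendsto_mult[OF lim[of "t - a"] lim[of "b - t"]] that by simp
  show "\<theta> n t > 0" if "a < t" "t < b" for n t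
   unfolding eq using that by (intro mult_pos_pos) (auto simp: pos)
 qed (rule z)
qed

lemma time_test_continuous: "time_test \<theta> \<Longrightarrow> continuous_on A \<theta>"
 by (simp add: time_test_def smooth_continuous)

lemma time_test_has_derivative: "time_test \<theta> \<Longrightarrow> (\<theta> has_real_derivative dir_deriv 1 \<theta> t) (at t)"
proof -
 assume "time_test \<theta>"
 then have d: "\<theta> differentiable (at t)" by (simp add: time_test_def smooth_differentiable)
 then obtain D where D: "(\<theta> has_real_derivative D) (at t)" using real_differentiable_def by blast
 then show ?thesis using dir_deriv_real by metis
qed

definition torus_grad :: "(real^3 \<Rightarrow> real) \<Rightarrow> real^3 \<Rightarrow> real^3" where
 "torus_grad \<psi> x = (\<chi> k. partial k \<psi> x)"

lemma spacetime_test_product: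
 assumes \<theta>: "time_test \<theta>" and \<psi>: "torus_test \<psi>"
 shows "spacetime_test (\<lambda>p. \<theta> (fst p) * \<psi> (snd p))"
  "time_deriv (\<lambda>p. \<theta> (fst p) * \<psi> (snd p)) (t, x) = dir_deriv 1 \<theta> t * \<psi> x"
  "space_grad (\<lambda>p. \<theta> (fst p) * \<psi> (snd p)) (t, x) = \<theta> t *\<^sub>R torus_grad \<psi> x"
proof -
 have s: "smooth \<theta>" "smooth \<psi>" using assms by (auto simp: time_test_def torus_test_def)
 obtain a b where ab: "0 < a" "\<And>t. t \<notin> {a..b} \<Longrightarrow> \<theta> t = 0" using \<theta> unfolding time_test_def by blast
 show "spacetime_test (\<lambda>p. \<theta> (fst p) * \<psi> (snd p))"
  unfolding spacetime_test_def
 proof (intro conjI)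
  show "smooth (\<lambda>p. \<theta> (fst p) * \<psi> (snd p))" by (intro smooth_mult smooth_fst smooth_snd s)
  show "\<forall>t. periodic (\<lambda>x. \<theta> (fst (t, x)) * \<psi> (snd (t, x)))" using \<psi> by (simp add: torus_test_def periodic_def)
  show "\<exists>a b. 0 < a \<and> (\<forall>t x. t \<notin> {a..b} \<longrightarrow> \<theta> (fst (t, x)) * \<psi> (snd (t, x)) = 0)"
   using ab by (intro exI[of _ a] exI[of _ b]) auto
 qed
 have "(\<theta> has_derivative (\<lambda>h. dir_deriv h \<theta> t)) (at t)" "(\<psi> has_derivative (\<lambda>h. dir_deriv h \<psi> x)) (at x)"
  using s by (auto intro!: has_derivative_dir_deriv smooth_differentiable)
 then have D: "((\<lambda>p. \<theta> (fst p) * \<psi> (snd p)) has_derivative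
   (\<lambda>h. \<theta> t * dir_deriv (snd h) \<psi> x + dir_deriv (fst h) \<theta> t * \<psi> x)) (at (t, x))"
  by (auto intro!: has_derivative_mult[of "\<lambda>p. \<theta> (fst p)" _ "(t, x)" UNIV "\<lambda>p. \<psi> (snd p)", simplified]
    has_derivative_compose[of fst fst "(t, x)" UNIV \<theta>] has_derivative_compose[of snd snd "(t, x)" UNIV \<psi>]
    derivative_eq_intros)
 have lin: "linear (\<lambda>h. dir_deriv h \<psi> x)" "linear (\<lambda>h. dir_deriv h \<theta> t)"
  using s by (auto intro!: has_derivative_linear has_derivative_dir_deriv smooth_differentiable)
 show "time_deriv (\<lambda>p. \<theta> (fst p) * \<psi> (snd p)) (t, x) = dir_deriv 1 \<theta> t * \<psi> x"
  unfolding time_deriv_def dir_deriv_eqI[OF D] using linear_0[OF lin(1)] by simp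
 show "space_grad (\<lambda>p. \<theta> (fst p) * \<psi> (snd p)) (t, x) = \<theta> t *\<^sub>R torus_grad \<psi> x"
  unfolding space_grad_def torus_grad_def dir_deriv_eqI[OF D] using linear_0[OF lin(2)] by (simp add: vec_eq_iff)
qed

section \<open>Functions of time determined by test functions\<close>

lemma interval_integrals_zero:
 fixes p :: "real \<Rightarrow> real"
 assumes p: "integrable (lebesgue_on {a..b}) p"
  and z: "\<And>c. a \<le> c \<Longrightarrow> c < b \<Longrightarrow> (LINT t|lebesgue_on {c..b}. p t) = 0"
 shows "AE t in lebesgue_on {a..b}. p t = 0"
proof -
 obtain g where g: "g \<in> borel_measurable borel" and eq: "AE t in lborel. g t = (if t \<in> {a..b} then p t else 0)"
  by (rule lebesgue_on_borel_rep_exists[of "{a..b}" p]) (use p in auto)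
 have gi: "integrable lborel g" using lebesgue_on_borel_rep(2)[OF _ g eq] p by simp
 have fin: "(\<integral>\<^sup>+t. ennreal (g t) \<partial>lborel) < \<infinity>" "(\<integral>\<^sup>+t. ennreal (- g t) \<partial>lborel) < \<infinity>"
  using gi unfolding real_integrable_def by (auto simp: top.not_eq_extremum)
 have tail: "(LINT t|lborel. indicator {s<..} t * g t) = 0" for s
 proof (cases "s < b")
  case True
  define c where "c = max a s"
  have m: "(\<lambda>t. indicator {s<..} t * g t) \<in> borel_measurable borel" using g by measurable
  have "AE t in lborel. t \<noteq> s" by (rule AE_lborel_singleton)
  then have "AE t in lborel. indicator {s<..} t * g t = (if t \<in> {c..b} then p t else 0)"
   using eq by eventually_elim (auto simp: c_def indicator_def)
  then have "(LINT t|lborel. indicator {s<..} t * g t) = (LINT t|lebesgue_on {c..b}. p t)"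
   using lebesgue_on_borel_rep(3)[OF _ m, of "{c..b}" p] by simp
  also have "\<dots> = 0"
  proof (cases "c < b")
   case False
   then have "negligible {c..b}" by (cases "c = b") auto
   then have "{c..b} \<in> null_sets lborel" by (simp add: negligible_iff_null_sets null_sets_completion_iff)
   then have "AE t in lborel. t \<notin> {c..b}" by (rule AE_not_in)
   then have "AE t in lebesgue_on {c..b}. p t = 0" by (subst AE_lebesgue_on_iff) (auto elim: eventually_mono)
   then show ?thesis by (intro integral_eq_zero_AE)
  qed (use z[of c] in \<open>auto simp: c_def\<close>)
  finally show ?thesis .
 next
  case False
  have "AE t in lborel. indicator {s<..} t * g t = 0"
   using eq by eventually_elim (use False in \<open>auto simp: indicator_def\<close>)
  then show ?thesis by (rule integral_eq_zero_AE)
 qed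
 have "density lborel (\<lambda>t. ennreal (g t)) = density lborel (\<lambda>t. ennreal (- g t))"
 proof (rule measure_eqI_lessThan)
  fix s :: real
  let ?i = "\<lambda>t. indicator {s<..} t * g t"
  have ii: "integrable lborel ?i" using integrable_mult_indicator[OF _ gi, of "{s<..}"] by simp
  have e: "emeasure (density lborel (\<lambda>t. ennreal (h t))) {s<..} = (\<integral>\<^sup>+t. ennreal (indicator {s<..} t * h t) \<partial>lborel)"
   if "h \<in> borel_measurable borel" for h :: "real \<Rightarrow> real"
   using that by (subst emeasure_density) (auto intro!: nn_integral_cong simp: indicator_def)
  have f1: "(\<integral>\<^sup>+t. ennreal (?i t) \<partial>lborel) < \<infinity>" "(\<integral>\<^sup>+t. ennreal (- ?i t) \<partial>lborel) < \<infinity>"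
   using ii unfolding real_integrable_def by (auto simp: top.not_eq_extremum)
  have "enn2real (\<integral>\<^sup>+t. ennreal (?i t) \<partial>lborel) = enn2real (\<integral>\<^sup>+t. ennreal (- ?i t) \<partial>lborel)"
   using tail[of s] real_lebesgue_integral_def[OF ii] by simp
  then have "(\<integral>\<^sup>+t. ennreal (?i t) \<partial>lborel) = (\<integral>\<^sup>+t. ennreal (- ?i t) \<partial>lborel)"
   using f1 by (metis ennreal_enn2real infinity_ennreal_def)
  then show "emeasure (density lborel (\<lambda>t. ennreal (g t))) {s<..} = emeasure (density lborel (\<lambda>t. ennreal (- g t))) {s<..}"
   using e[OF g] e[of "\<lambda>t. - g t"] g by simp
  show "emeasure (density lborel (\<lambda>t. ennreal (g t))) {s<..} < \<infinity>" using e[OF g] f1 by simp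
 qed auto
 then have "AE t in lborel. ennreal (g t) = ennreal (- g t)"
  using g by (subst (asm) sigma_finite_measure.density_unique_iff[OF sigma_finite_lborel]) auto
 then have "AE t in lborel. g t = 0"
 proof eventually_elim
  case (elim t)
  show ?case
  proof (cases "g t \<ge> 0")
   case True
   then have "ennreal (- g t) = 0" by (simp add: ennreal_eq_0_iff)
   then have "ennreal (g t) = 0" by (rule trans[OF elim])
   then show ?thesis using True by (simp add: ennreal_eq_0_iff)
  next
   case False
   then have "ennreal (g t) = 0" by (simp add: ennreal_eq_0_iff)
   then have "ennreal (- g t) = 0" by (rule trans[OF elim[symmetric]])
   then show ?thesis using False by (simp add: ennreal_eq_0_iff)
  qed
 qed
 then show ?thesis
  by (subst AE_lebesgue_on_iff) (use eq in \<open>auto elim: eventually_elim2\<close>)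
qed

lemma AE_half_line:
 assumes "\<And>n::nat. AE t in lebesgue_on {1 / (real n + 1)..real n + 1}. P t"
 shows "AE t in half_line. P t"
proof -
 have "AE t in lborel. \<forall>n::nat. t \<in> {1 / (real n + 1)..real n + 1} \<longrightarrow> P t"
  unfolding AE_all_countable using assms by (simp only: AE_lebesgue_on_iff[OF closed_sets_lebesgue[OF closed_atLeastAtMost]] simp_thms)
 moreover have "AE t in lborel. t \<noteq> (0::real)" by (rule AE_lborel_singleton)
 ultimately have "AE t in lborel. t \<in> {0..} \<longrightarrow> P t"
 proof eventually_elim
  case (elim t)
  show ?case
  proof
   assume "t \<in> {0..}"
   then have t: "t > 0" using elim by simp
   obtain n where n: "max t (1 / t) \<le> real n" using real_arch_simple by blast
   then have "t \<le> real n + 1" "1 / t \<le> real n + 1" by auto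
   then have "t \<in> {1 / (real n + 1)..real n + 1}" using t by (auto simp: field_simps)
   then show "P t" using elim by blast
  qed
 qed
 then show ?thesis by (subst AE_lebesgue_on_iff) auto
qed

text \<open>Test functions converging to the indicators of intervals show that all integrals over intervals vanish.\<close>

lemma time_fundamental:
 fixes p :: "real \<Rightarrow> real"
 assumes p: "\<And>a b. 0 < a \<Longrightarrow> integrable (lebesgue_on {a..b}) p"
  and z: "\<And>\<theta> a b. time_test \<theta> \<Longrightarrow> 0 < a \<Longrightarrow> (\<And>t. t \<notin> {a..b} \<Longrightarrow> \<theta> t = 0) \<Longrightarrow> (LINT t|lebesgue_on {a..b}. \<theta> t * p t) = 0"
 shows "AE t in half_line. p t = 0"
proof (rule AE_half_line, rule interval_integrals_zero)
 fix n :: nat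
 show "integrable (lebesgue_on {1 / (real n + 1)..real n + 1}) p" by (rule p) simp
 fix c assume "1 / (real n + 1) \<le> c" and cb: "c < real n + 1"
 then have c: "0 < c" by (meson less_le_trans of_nat_0_le_iff add_nonneg_pos zero_less_divide_1_iff zero_less_one)
 let ?b = "real n + 1"
 obtain \<theta> where \<theta>: "\<And>n. time_test (\<theta> n)" "\<And>n t. 0 \<le> \<theta> n t \<and> \<theta> n t \<le> 1" "\<And>n t. t \<notin> {c..?b} \<Longrightarrow> \<theta> n t = 0"
  "\<And>t. c < t \<Longrightarrow> t < ?b \<Longrightarrow> (\<lambda>n. \<theta> n t) \<longlonglongrightarrow> 1" using time_test_approx_indicator[OF c cb] by metis
 have pi: "integrable (lebesgue_on {c..?b}) p" by (rule p[OF c])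
 have "(\<lambda>m. LINT t|lebesgue_on {c..?b}. \<theta> m t * p t) \<longlonglongrightarrow> (LINT t|lebesgue_on {c..?b}. p t)"
 proof (rule integral_dominated_convergence[where w="\<lambda>t. \<bar>p t\<bar>"])
  show "(\<lambda>t. \<theta> m t * p t) \<in> borel_measurable (lebesgue_on {c..?b})" for m
  proof (rule borel_measurable_times)
   show "\<theta> m \<in> borel_measurable (lebesgue_on {c..?b})"
    by (intro continuous_imp_measurable_on_sets_lebesgue time_test_continuous \<theta>(1)) simp
  qed (use pi in auto)
  show "AE t in lebesgue_on {c..?b}. norm (\<theta> m t * p t) \<le> \<bar>p t\<bar>" for m
   using \<theta>(2)[of m] by (auto intro!: AE_I2 mult_left_le_one_le simp: abs_mult)
  have "AE t in lborel. t \<noteq> c" "AE t in lborel. t \<noteq> ?b" by (rule AE_lborel_singleton)+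
  then show "AE t in lebesgue_on {c..?b}. (\<lambda>m. \<theta> m t * p t) \<longlonglongrightarrow> p t"
   unfolding AE_lebesgue_on_iff[OF closed_sets_lebesgue[OF closed_atLeastAtMost]]
  proof eventually_elim
   case (elim t)
   then show ?case using tendsto_mult[OF \<theta>(4)[of t] tendsto_const[of "p t"]] by auto
  qed
 qed (use pi in auto)
 then show "(LINT t|lebesgue_on {c..?b}. p t) = 0"
  using z[OF \<theta>(1) c \<theta>(3)] by (simp add: LIMSEQ_const_iff)
qed

lemma lebesgue_on_zero_outside:
 fixes f :: "'a::euclidean_space \<Rightarrow> real"
 assumes S: "S \<in> sets lebesgue" and T: "T \<in> sets lebesgue" and ST: "S \<subseteq> T"
  and z: "\<And>x. x \<in> T \<Longrightarrow> x \<notin> S \<Longrightarrow> f x = 0"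
 shows "(LINT x|lebesgue_on T. f x) = (LINT x|lebesgue_on S. f x)"
  "integrable (lebesgue_on T) f \<longleftrightarrow> integrable (lebesgue_on S) f"
proof -
 have e: "(\<lambda>x. indicator T x *\<^sub>R f x) = (\<lambda>x. indicator S x *\<^sub>R f x)"
  using ST z by (fastforce simp: indicator_def fun_eq_iff)
 have sp: "S \<inter> space lebesgue \<in> sets lebesgue" "T \<inter> space lebesgue \<in> sets lebesgue" using S T by auto
 show "(LINT x|lebesgue_on T. f x) = (LINT x|lebesgue_on S. f x)"
  unfolding integral_restrict_space[OF sp(1)] integral_restrict_space[OF sp(2)] e ..
 show "integrable (lebesgue_on T) f \<longleftrightarrow> integrable (lebesgue_on S) f"
  unfolding integrable_restrict_space[OF sp(1)] integrable_restrict_space[OF sp(2)] e ..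
qed

lemma integrable_lebesgue_on_subset:
 fixes f :: "'a::euclidean_space \<Rightarrow> real"
 assumes S: "S \<in> sets lebesgue" and T: "T \<in> sets lebesgue" and ST: "S \<subseteq> T"
  and f: "integrable (lebesgue_on T) f"
 shows "integrable (lebesgue_on S) f"
proof -
 have sp: "S \<inter> space lebesgue \<in> sets lebesgue" "T \<inter> space lebesgue \<in> sets lebesgue" using S T by auto
 have "integrable lebesgue (\<lambda>x. indicator T x *\<^sub>R f x)" using f unfolding integrable_restrict_space[OF sp(2)] .
 from integrable_mult_indicator[OF S this]
 have "integrable lebesgue (\<lambda>x. indicator S x *\<^sub>R (indicator T x *\<^sub>R f x))" .
 also have "(\<lambda>x. indicator S x *\<^sub>R (indicator T x *\<^sub>R f x)) = (\<lambda>x. indicator S x *\<^sub>R f x)"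
  using ST by (auto simp: indicator_def fun_eq_iff)
 finally show ?thesis unfolding integrable_restrict_space[OF sp(1)] .
qed

lemma ident_measurable_lebesgue_on: "S \<in> sets lebesgue \<Longrightarrow> (\<lambda>t::real. t) \<in> borel_measurable (lebesgue_on S)"
 by (intro continuous_imp_measurable_on_sets_lebesgue continuous_on_id)

lemma continuous_bounded_Icc:
 fixes f :: "real \<Rightarrow> real"
 assumes "continuous_on UNIV f" shows "\<exists>C. \<forall>t\<in>{a..b}. \<bar>f t\<bar> \<le> C"
proof -
 have "bounded (f ` {a..b})"
  by (intro compact_imp_bounded compact_continuous_image continuous_on_subset[OF assms]) auto
 then show ?thesis by (auto simp: bounded_iff)
qed

subsection \<open>Primitives in time\<close>

lemma integral_singleton_0: "(LINT t|lebesgue_on {a..a}. f t) = (0::real)" for a :: real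
proof (rule integral_eq_zero_AE)
 show "AE t in lebesgue_on {a..a}. f t = 0"
  unfolding AE_lebesgue_on_iff[OF closed_sets_lebesgue[OF closed_atLeastAtMost]]
  using AE_lborel_singleton[of a] by eventually_elim auto
qed

lemma integrable_mult_continuous_interval:
 fixes d F :: "real \<Rightarrow> real"
 assumes d: "integrable (lebesgue_on {a..b}) d" and F: "continuous_on UNIV F"
 shows "integrable (lebesgue_on {a..b}) (\<lambda>t. d t * F t)"
proof -
 obtain K where K: "\<And>t. t \<in> {a..b} \<Longrightarrow> \<bar>F t\<bar> \<le> K" using continuous_bounded_Icc[OF F] by blast
 show ?thesis
 proof (rule L1_bound)
  show "integrable (lebesgue_on {a..b}) (\<lambda>t. K * d t)" using d by auto
  show "(\<lambda>t. d t * F t) \<in> borel_measurable (lebesgue_on {a..b})"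
   by (intro borel_measurable_times borel_measurable_integrable[OF d] continuous_imp_measurable_on_sets_lebesgue continuous_on_subset[OF F]) auto
  show "AE t in lebesgue_on {a..b}. norm (d t * F t) \<le> norm (K * d t)"
  proof (rule AE_I2)
   fix t assume "t \<in> space (lebesgue_on {a..b})"
   then have "\<bar>F t\<bar> \<le> \<bar>K\<bar>" using K[of t] by auto
   from mult_left_mono[OF this, of "\<bar>d t\<bar>"] show "norm (d t * F t) \<le> norm (K * d t)" by (simp add: abs_mult mult.commute)
  qed
 qed
qed

locale time_primitive =
 fixes d :: "real \<Rightarrow> real" and B :: real
 assumes d: "\<And>b. integrable (lebesgue_on {0..b}) d"
  and B: "AE t in half_line. \<bar>d t\<bar> \<le> B"
begin

definition D :: "real \<Rightarrow> real" where
 "D t = (LINT \<tau>|lebesgue_on {0..t}. d \<tau>)"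

lemma d_on: "0 \<le> a \<Longrightarrow> integrable (lebesgue_on {a..b}) d"
 by (rule integrable_lebesgue_on_subset[OF _ _ _ d[of b]]) auto

lemma B_on: "0 \<le> a \<Longrightarrow> AE t in lebesgue_on {a..b}. \<bar>d t\<bar> \<le> \<bar>B\<bar>"
 using B by (simp add: AE_lebesgue_on_iff closed_sets_lebesgue) (auto elim!: eventually_mono)

lemma D_diff:
 assumes "0 \<le> s" "s \<le> t" shows "D t - D s = (LINT \<tau>|lebesgue_on {s..t}. d \<tau>)"
proof -
 have I: "(LINT \<tau>|lebesgue_on {a..b}. d \<tau>) = integral {a..b} d" "d integrable_on {a..b}" if "0 \<le> a" for a b
  using d_on[OF that, of b] by (auto intro: lebesgue_integral_eq_integral integrable_on_lebesgue_on)
 show ?thesis unfolding D_def using I assms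
  by (simp add: algebra_simps Henstock_Kurzweil_Integration.integral_combine[symmetric, of 0 s t d])
qed

lemma D_bound_aux:
 assumes "0 \<le> s" "s \<le> t" shows "\<bar>D t - D s\<bar> \<le> \<bar>B\<bar> * (t - s)"
proof -
 have "\<bar>D t - D s\<bar> \<le> (LINT \<tau>|lebesgue_on {s..t}. \<bar>d \<tau>\<bar>)"
  unfolding D_diff[OF assms] using integral_norm_bound[of "lebesgue_on {s..t}" d] by simp
 also have "\<dots> \<le> (LINT \<tau>|lebesgue_on {s..t}. \<bar>B\<bar>)"
  using d_on[OF assms(1), of t] B_on[OF assms(1), of t]
  by (intro integral_mono_AE) (auto intro!: finite_measure.integrable_const finite_measure_lebesgue_on)
 also have "\<dots> = \<bar>B\<bar> * (t - s)"
  using assms by (simp add: measure_restrict_space)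
 finally show ?thesis .
qed

lemma D_nonpos:
 assumes "t \<le> 0" shows "D t = 0"
proof (cases "t = 0")
 case True
 then show ?thesis unfolding D_def using integral_singleton_0[of 0 d] by simp
next
 case False
 then have "{0..t} = {}" using assms by auto
 then show ?thesis unfolding D_def by (simp add: integral_eq_zero_AE AE_I2)
qed

lemma D_Lipschitz: "\<bar>D t - D s\<bar> \<le> \<bar>B\<bar> * \<bar>t - s\<bar>"
proof -
 note neg = D_nonpos
 have le: "\<bar>D t - D s\<bar> \<le> \<bar>B\<bar> * (t - s)" if "s \<le> t" for s t
 proof (cases "0 \<le> s")
  case False
  show ?thesis
  proof (cases "0 \<le> t")
   case True
   have "\<bar>D t - D s\<bar> = \<bar>D t - D 0\<bar>" using neg[of s] neg[of 0] False by simp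
   also have "\<dots> \<le> \<bar>B\<bar> * (t - 0)" by (rule D_bound_aux) (use True in auto)
   also have "\<dots> \<le> \<bar>B\<bar> * (t - s)" using False by (intro mult_left_mono) auto
   finally show ?thesis .
  qed (use neg[of s] neg[of t] that False in auto)
 qed (use D_bound_aux that in auto)
 show ?thesis using le[of s t] le[of t s] by (cases "s \<le> t") (auto simp: abs_minus_commute)
qed

lemma continuous_D: "continuous_on A D"
proof (rule continuous_on_subset[OF lipschitz_on_continuous_on[of "\<bar>B\<bar>" UNIV]])
 show "\<bar>B\<bar>-lipschitz_on UNIV D" by (rule lipschitz_onI) (auto simp: dist_real_def D_Lipschitz)
qed simp

text \<open>Integration by parts against the primitive of a merely integrable function is Fubini's
 theorem on the triangle \<open>\<tau> \<le> t\<close>.\<close>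

lemma D_parts:
 assumes \<theta>: "time_test \<theta>" and a: "0 < a" "a \<le> b" and supp: "\<And>t. t \<notin> {a..b} \<Longrightarrow> \<theta> t = 0"
 shows "(LINT t|lebesgue_on {a..b}. dir_deriv 1 \<theta> t * D t) = - (LINT t|lebesgue_on {a..b}. \<theta> t * d t)"
proof -
 let ?M = "lebesgue_on {a..b}" and ?N = "lebesgue_on {0..b}"
 let ?\<theta>' = "dir_deriv 1 \<theta>"
 interpret M: finite_measure ?M by (rule finite_measure_lebesgue_on) auto
 interpret N: finite_measure ?N by (rule finite_measure_lebesgue_on) auto
 interpret P: pair_sigma_finite ?M ?N ..
 have \<theta>c: "continuous_on A \<theta>" "continuous_on A ?\<theta>'" for A
  using \<theta> by (auto simp: time_test_def intro!: smooth_continuous smooth_dir_deriv)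
 have end0: "\<theta> a = 0" "\<theta> b = 0"
 proof -
  have "(\<theta> \<longlongrightarrow> \<theta> t) (at t)" for t using \<theta>c(1)[of UNIV] by (auto simp: continuous_on_def)
  then have "(\<theta> \<longlongrightarrow> \<theta> a) (at_left a)" "(\<theta> \<longlongrightarrow> \<theta> b) (at_right b)" by (auto intro: tendsto_within_subset)
  moreover have "(\<theta> \<longlongrightarrow> 0) (at_left a)" "(\<theta> \<longlongrightarrow> 0) (at_right b)"
   using supp by (auto intro!: tendsto_eventually simp: eventually_at_filter)
  ultimately show "\<theta> a = 0" "\<theta> b = 0" by (auto intro: tendsto_unique[rotated 1])
 qed
 obtain C where C: "\<And>t. t \<in> {a..b} \<Longrightarrow> \<bar>?\<theta>' t\<bar> \<le> C"
  using continuous_bounded_Icc[OF \<theta>c(2)] by blast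
 have C0: "0 \<le> C" using C[of a] a by auto
 define F where "F p = ?\<theta>' (fst p) * ((if snd p \<le> fst p then 1 else 0) * d (snd p))" for p
 have tm: "?\<theta>' \<in> borel_measurable ?M" by (intro continuous_imp_measurable_on_sets_lebesgue \<theta>c) simp
 have dm: "d \<in> borel_measurable ?N" using d by auto
 have idM: "(\<lambda>t. t) \<in> borel_measurable ?M" and idN: "(\<lambda>t. t) \<in> borel_measurable ?N"
  by (auto intro: ident_measurable_lebesgue_on)
 have Fm: "F \<in> borel_measurable (?M \<Otimes>\<^sub>M ?N)"
 proof -
  have 1: "(\<lambda>p. ?\<theta>' (fst p)) \<in> borel_measurable (?M \<Otimes>\<^sub>M ?N)" by (rule measurable_compose[OF measurable_fst tm])
  have 2: "(\<lambda>p. d (snd p)) \<in> borel_measurable (?M \<Otimes>\<^sub>M ?N)" by (rule measurable_compose[OF measurable_snd dm])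
  have f: "fst \<in> borel_measurable (?M \<Otimes>\<^sub>M ?N)" by (rule measurable_compose[OF measurable_fst idM])
  have s: "snd \<in> borel_measurable (?M \<Otimes>\<^sub>M ?N)" by (rule measurable_compose[OF measurable_snd idN])
  have 3: "(\<lambda>p. if snd p \<le> fst p then 1 else 0 :: real) \<in> borel_measurable (?M \<Otimes>\<^sub>M ?N)"
   using f s by measurable
  show ?thesis unfolding F_def[abs_def] by (intro borel_measurable_times 1 2 3)
 qed
 have Fb: "\<bar>F (t, \<tau>)\<bar> \<le> C * \<bar>d \<tau>\<bar>" if "t \<in> {a..b}" for t \<tau>
  using C[OF that] C0 by (auto simp: F_def abs_mult intro: mult_right_mono)
 have Fi2: "integrable ?N (\<lambda>\<tau>. F (t, \<tau>))" if t: "t \<in> {a..b}" for t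
 proof (rule L1_bound)
  show "integrable ?N (\<lambda>\<tau>. C * \<bar>d \<tau>\<bar>)" using d[of b] by auto
  show "(\<lambda>\<tau>. F (t, \<tau>)) \<in> borel_measurable ?N" using Fm t by (auto intro!: measurable_Pair2)
 qed (use Fb[OF t] C0 in \<open>auto simp: abs_mult\<close>)
 have FI: "integrable (?M \<Otimes>\<^sub>M ?N) F"
 proof (rule P.Fubini_integrable[OF Fm])
  show "AE t in ?M. integrable ?N (\<lambda>\<tau>. F (t, \<tau>))" using Fi2 by (intro AE_I2) auto
  show "integrable ?M (\<lambda>t. LINT \<tau>|?N. norm (F (t, \<tau>)))"
  proof (rule M.integrable_const_bound[where B="LINT \<tau>|?N. C * \<bar>d \<tau>\<bar>"])
   show "(\<lambda>t. LINT \<tau>|?N. norm (F (t, \<tau>))) \<in> borel_measurable ?M"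
    using Fm by (intro N.borel_measurable_lebesgue_integral) auto
   show "AE t in ?M. norm (LINT \<tau>|?N. norm (F (t, \<tau>))) \<le> (LINT \<tau>|?N. C * \<bar>d \<tau>\<bar>)"
   proof (rule AE_I2)
    fix t assume "t \<in> space ?M"
    then have t: "t \<in> {a..b}" by simp
    have "(LINT \<tau>|?N. norm (F (t, \<tau>))) \<le> (LINT \<tau>|?N. C * \<bar>d \<tau>\<bar>)"
     by (rule integral_mono) (use Fi2[OF t] d[of b] Fb[OF t] in \<open>auto intro!: integrable_mult_right\<close>)
    then show "norm (LINT \<tau>|?N. norm (F (t, \<tau>))) \<le> (LINT \<tau>|?N. C * \<bar>d \<tau>\<bar>)" by simp
   qed
  qed
 qed
 have "(LINT t|?M. ?\<theta>' t * D t) = (LINT t|?M. (LINT \<tau>|?N. F (t, \<tau>)))"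
 proof (rule LINT_cong[OF refl])
  fix t assume "t \<in> space ?M"
  then have t: "t \<in> {a..b}" by simp
  have "(LINT \<tau>|?N. F (t, \<tau>)) = ?\<theta>' t * (LINT \<tau>|?N. (if \<tau> \<le> t then d \<tau> else 0))"
   by (subst integral_mult_right_zero[symmetric], intro LINT_cong) (auto simp: F_def)
  also have "(LINT \<tau>|?N. (if \<tau> \<le> t then d \<tau> else 0)) = (LINT \<tau>|lebesgue_on {0..t}. (if \<tau> \<le> t then d \<tau> else 0))"
   by (rule lebesgue_on_zero_outside) (use t in auto)
  also have "\<dots> = D t" unfolding D_def by (intro LINT_cong) auto
  finally show "?\<theta>' t * D t = (LINT \<tau>|?N. F (t, \<tau>))" by simp
 qed
 also have "\<dots> = (LINT \<tau>|?N. (LINT t|?M. F (t, \<tau>)))"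
  using P.Fubini_integral[of "\<lambda>t \<tau>. F (t, \<tau>)"] FI by simp
 also have "\<dots> = (LINT \<tau>|?N. - (\<theta> \<tau> * d \<tau>))"
 proof (rule LINT_cong[OF refl])
  fix \<tau> assume "\<tau> \<in> space ?N"
  then have \<tau>: "0 \<le> \<tau>" "\<tau> \<le> b" by auto
  let ?m = "max a \<tau>"
  have "(LINT t|?M. F (t, \<tau>)) = d \<tau> * (LINT t|?M. (if \<tau> \<le> t then ?\<theta>' t else 0))"
   unfolding F_def by (subst integral_mult_right_zero[symmetric], intro LINT_cong) auto
  also have "(LINT t|?M. (if \<tau> \<le> t then ?\<theta>' t else 0)) = (LINT t|lebesgue_on {?m..b}. (if \<tau> \<le> t then ?\<theta>' t else 0))"
   by (rule lebesgue_on_zero_outside) auto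
  also have "\<dots> = (LINT t|lebesgue_on {?m..b}. ?\<theta>' t)" by (intro LINT_cong) auto
  also have "\<dots> = integral {?m..b} ?\<theta>'"
   by (intro lebesgue_integral_eq_integral continuous_imp_integrable_real \<theta>c) auto
  also have "\<dots> = \<theta> b - \<theta> ?m"
   using \<tau> a time_test_has_derivative[OF \<theta>]
   by (intro integral_unique fundamental_theorem_of_calculus)
    (auto simp: has_real_derivative_iff_has_vector_derivative[symmetric] intro: has_field_derivative_at_within)
  also have "\<dots> = - \<theta> \<tau>"
  proof (cases "\<tau> < a")
   case True
   then show ?thesis using end0 supp[of \<tau>] by (auto simp: max_def)
  qed (use end0 in \<open>auto simp: max_def\<close>)
  finally show "(LINT t|?M. F (t, \<tau>)) = - (\<theta> \<tau> * d \<tau>)" by simp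
 qed
 also have "\<dots> = - (LINT t|?M. \<theta> t * d t)"
  using lebesgue_on_zero_outside(1)[of "{a..b}" "{0..b}" "\<lambda>t. \<theta> t * d t"] supp a by simp
 finally show ?thesis .
qed

text \<open>The difference \<open>q - D\<close> has zero derivative as a distribution, so it is constant: a test function
 minus a multiple of a fixed bump is the derivative of a test function.  The initial value fixes the
 constant.\<close>

lemma weak_solution_is_primitive:
 assumes q: "\<And>a b. 0 < a \<Longrightarrow> integrable (lebesgue_on {a..b}) q"
  and weak: "\<And>\<theta> a b. time_test \<theta> \<Longrightarrow> 0 < a \<Longrightarrow> a \<le> b \<Longrightarrow> (\<And>t. t \<notin> {a..b} \<Longrightarrow> \<theta> t = 0) \<Longrightarrow>
   (LINT t|lebesgue_on {a..b}. dir_deriv 1 \<theta> t * q t + \<theta> t * d t) = 0"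
  and init: "\<And>\<epsilon>. \<epsilon> > 0 \<Longrightarrow> \<exists>\<delta>>0. AE t in lebesgue_on {0<..<\<delta>}. \<bar>q t - q0\<bar> < \<epsilon>"
 shows "AE t in half_line. q t = q0 + D t"
proof -
 define h where "h t = q t - D t" for t
 have Dm: "integrable (lebesgue_on {a..b}) D" for a b by (intro continuous_imp_integrable_real continuous_D)
 have mult: "integrable (lebesgue_on {a..b}) (\<lambda>t. \<theta> t * p t)"
  if "integrable (lebesgue_on {a..b}) p" "continuous_on UNIV \<theta>" for a b \<theta> and p :: "real \<Rightarrow> real"
  using integrable_mult_continuous_interval[OF that] by (simp add: mult.commute)
 have hi: "integrable (lebesgue_on {a..b}) h" if "0 < a" for a b
  unfolding h_def by (intro L1_diff q that Dm)
 have tc: "continuous_on UNIV \<theta>" "continuous_on UNIV (dir_deriv 1 \<theta>)" if "time_test \<theta>" for \<theta>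
  using that by (auto simp: time_test_def intro!: smooth_continuous smooth_dir_deriv)
 have h0: "(LINT t|lebesgue_on {a..b}. dir_deriv 1 \<theta> t * h t) = 0"
  if "time_test \<theta>" "0 < a" "a \<le> b" "\<And>t. t \<notin> {a..b} \<Longrightarrow> \<theta> t = 0" for \<theta> a b
 proof -
  note c = tc[OF that(1)]
  have "(LINT t|lebesgue_on {a..b}. dir_deriv 1 \<theta> t * q t) + (LINT t|lebesgue_on {a..b}. \<theta> t * d t) = 0"
  proof -
   have "(LINT t|lebesgue_on {a..b}. dir_deriv 1 \<theta> t * q t + \<theta> t * d t) = 0"
    by (rule weak) (use that in auto)
   moreover have "(LINT t|lebesgue_on {a..b}. dir_deriv 1 \<theta> t * q t + \<theta> t * d t)
     = (LINT t|lebesgue_on {a..b}. dir_deriv 1 \<theta> t * q t) + (LINT t|lebesgue_on {a..b}. \<theta> t * d t)"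
    using that(2) by (intro LINT_add mult q c d_on) auto
   ultimately show ?thesis by simp
  qed
  moreover have "(LINT t|lebesgue_on {a..b}. dir_deriv 1 \<theta> t * h t)
    = (LINT t|lebesgue_on {a..b}. dir_deriv 1 \<theta> t * q t) - (LINT t|lebesgue_on {a..b}. dir_deriv 1 \<theta> t * D t)"
   unfolding h_def right_diff_distrib by (intro LINT_diff mult q Dm c that)
  moreover have "(LINT t|lebesgue_on {a..b}. dir_deriv 1 \<theta> t * D t) = - (LINT t|lebesgue_on {a..b}. \<theta> t * d t)"
   by (rule D_parts) (use that in auto)
  ultimately show ?thesis by simp
 qed
 obtain \<theta>0 :: "real \<Rightarrow> real" where \<theta>0: "time_test \<theta>0" "\<And>t. 0 \<le> \<theta>0 t" "\<And>t. t \<notin> {1..2} \<Longrightarrow> \<theta>0 t = 0" "\<And>t. 1 < t \<Longrightarrow> t < 2 \<Longrightarrow> \<theta>0 t > 0"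
  using time_test_approx_indicator[of 1 2] by (metis zero_less_one one_less_numeral_iff semiring_norm(76))
 have ti: "integrable (lebesgue_on {a..b}) \<theta>" if "time_test \<theta>" for a b \<theta>
  by (intro continuous_imp_integrable_real continuous_on_subset[OF tc(1)[OF that]]) auto
 define I0 where "I0 = (LINT t|lebesgue_on {1..2}. \<theta>0 t)"
 have I0: "I0 \<noteq> 0"
 proof
  assume "I0 = 0"
  then have "AE t in lebesgue_on {1..2}. \<theta>0 t = 0"
   using ti[OF \<theta>0(1)] \<theta>0(2) unfolding I0_def by (subst (asm) integral_nonneg_eq_0_iff_AE) auto
  then have "AE t in lborel. t \<notin> {1<..<2::real}"
   using \<theta>0(4) by (subst (asm) AE_lebesgue_on_iff) (force elim!: eventually_mono)+
  then have "emeasure lborel {1<..<2::real} = 0" by (subst (asm) AE_iff_null_sets[symmetric]) auto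
  then show False by simp
 qed
 define \<kappa> where "\<kappa> = (LINT t|lebesgue_on {1..2}. \<theta>0 t * h t) / I0"
 have "AE t in half_line. h t - \<kappa> = 0"
 proof (rule time_fundamental)
  show "integrable (lebesgue_on {a..b}) (\<lambda>t. h t - \<kappa>)" if "0 < a" for a b
   by (intro L1_diff hi that continuous_imp_integrable_real continuous_intros)
  fix \<xi> a b assume \<xi>: "time_test \<xi>" and a: "0 < a" and supp: "\<And>t. t \<notin> {a..b} \<Longrightarrow> \<xi> t = 0"
  define a' b' where "a' = min a 1" and "b' = max b 2"
  have a': "0 < a'" "a' \<le> b'" "a' \<le> 1" "2 \<le> b'" "{a..b} \<subseteq> {a'..b'}" "{1..2} \<subseteq> {a'..b'}" using a by (auto simp: a'_def b'_def)
  define r where "r = (LINT t|lebesgue_on {a..b}. \<xi> t) / I0"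
  define \<eta> where "\<eta> t = \<xi> t + (- r) * \<theta>0 t" for t
  have \<eta>s: "smooth \<eta>" using \<xi> \<theta>0(1) unfolding \<eta>_def[abs_def] time_test_def smooth_def by (intro allI C_k_add C_k_mult C_k_const) auto
  have \<eta>c: "continuous_on A \<eta>" for A using \<eta>s by (rule smooth_continuous)
  have \<eta>0: "\<eta> t = 0" if "t \<notin> {a'..b'}" for t using that a' supp[of t] \<theta>0(3)[of t] unfolding \<eta>_def by auto
  define \<Theta> where "\<Theta> t = integral {0..t} \<eta>" for t
  have \<Theta>neg: "\<Theta> t = 0" if "t < a'" for t
  proof -
   have "\<Theta> t = integral {0..t} (\<lambda>_. 0)" unfolding \<Theta>_def using that by (intro Henstock_Kurzweil_Integration.integral_cong \<eta>0) auto
   then show ?thesis by simp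
  qed
  have \<Theta>d: "(\<Theta> has_real_derivative \<eta> t) (at t)" for t
  proof (cases "t < a'")
   case True
   have "((\<lambda>_. 0) has_real_derivative 0) (at t)" by simp
   moreover have "\<forall>\<^sub>F s in nhds t. \<Theta> s = 0"
    using eventually_nhds_in_open[of "{..<a'}" t] True by (auto elim!: eventually_mono simp: \<Theta>neg)
   ultimately show ?thesis using \<eta>0[of t] True by (subst DERIV_cong_ev[OF refl _ refl]) auto
  next
   case False
   then have t: "0 < t" using a' by simp
   have "((\<lambda>x. integral {0..x} \<eta>) has_real_derivative \<eta> t) (at t within {0..t + 1})"
    by (rule integral_has_real_derivative[OF \<eta>c]) (use t in auto)
   then show ?thesis unfolding \<Theta>_def[abs_def] using t by (simp add: at_within_Icc_at)
  qed
  have tot: "(LINT t|lebesgue_on {a'..b'}. \<eta> t) = 0"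
  proof -
   have "(LINT t|lebesgue_on {a'..b'}. \<eta> t) = (LINT t|lebesgue_on {a'..b'}. \<xi> t) + (- r) * (LINT t|lebesgue_on {a'..b'}. \<theta>0 t)"
    unfolding \<eta>_def using ti[OF \<xi>] ti[OF \<theta>0(1)] by simp
   also have "(LINT t|lebesgue_on {a'..b'}. \<xi> t) = (LINT t|lebesgue_on {a..b}. \<xi> t)"
    by (rule lebesgue_on_zero_outside) (use a' supp in auto)
   also have "(LINT t|lebesgue_on {a'..b'}. \<theta>0 t) = I0"
    unfolding I0_def by (rule lebesgue_on_zero_outside) (use a' \<theta>0(3) in auto)
   finally show ?thesis using I0 by (simp add: r_def)
  qed
  have \<Theta>pos: "\<Theta> t = 0" if "t > b'" for t
  proof -
   have "\<Theta> t = (LINT s|lebesgue_on {0..t}. \<eta> s)"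
    unfolding \<Theta>_def by (intro lebesgue_integral_eq_integral[symmetric] continuous_imp_integrable_real \<eta>c) auto
   also have "\<dots> = (LINT s|lebesgue_on {a'..b'}. \<eta> s)"
    by (rule lebesgue_on_zero_outside) (use a' that \<eta>0 in auto)
   finally show ?thesis using tot by simp
  qed
  have "C_k (Suc n) \<Theta>" for n by (rule C_k_SucI_real[OF \<Theta>d]) (use \<eta>s in \<open>simp add: smooth_def\<close>)
  then have "smooth \<Theta>" unfolding smooth_def using C_k_SucD by blast
  moreover have \<Theta>0: "\<Theta> t = 0" if "t \<notin> {a'..b'}" for t using that \<Theta>neg[of t] \<Theta>pos[of t] by auto
  ultimately have \<Theta>t: "time_test \<Theta>" unfolding time_test_def using a' by blast
  have "(LINT t|lebesgue_on {a'..b'}. dir_deriv 1 \<Theta> t * h t) = 0"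
   by (rule h0[OF \<Theta>t a'(1,2)]) (rule \<Theta>0)
  then have "(LINT t|lebesgue_on {a'..b'}. \<eta> t * h t) = 0"
   using dir_deriv_real[OF \<Theta>d] by simp
  moreover have "(LINT t|lebesgue_on {a'..b'}. \<eta> t * h t)
    = (LINT t|lebesgue_on {a'..b'}. \<xi> t * h t) - r * (LINT t|lebesgue_on {a'..b'}. \<theta>0 t * h t)"
  proof -
   have "(LINT t|lebesgue_on {a'..b'}. \<eta> t * h t) = (LINT t|lebesgue_on {a'..b'}. \<xi> t * h t - r * (\<theta>0 t * h t))"
    unfolding \<eta>_def by (simp add: algebra_simps)
   also have "\<dots> = (LINT t|lebesgue_on {a'..b'}. \<xi> t * h t) - (LINT t|lebesgue_on {a'..b'}. r * (\<theta>0 t * h t))"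
    by (intro LINT_diff integrable_mult_right mult hi a'(1) tc(1) \<xi> \<theta>0(1))
   finally show ?thesis by simp
  qed
  moreover have "(LINT t|lebesgue_on {a'..b'}. \<xi> t * h t) = (LINT t|lebesgue_on {a..b}. \<xi> t * h t)"
   by (rule lebesgue_on_zero_outside) (use a' supp in auto)
  moreover have "(LINT t|lebesgue_on {a'..b'}. \<theta>0 t * h t) = \<kappa> * I0"
   using lebesgue_on_zero_outside(1)[of "{1..2}" "{a'..b'}" "\<lambda>t. \<theta>0 t * h t"] a' \<theta>0(3) I0 by (simp add: \<kappa>_def)
  ultimately have "(LINT t|lebesgue_on {a..b}. \<xi> t * h t) = \<kappa> * (LINT t|lebesgue_on {a..b}. \<xi> t)"
   using I0 by (simp add: r_def)
  moreover have "(LINT t|lebesgue_on {a..b}. \<xi> t * (h t - \<kappa>))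
    = (LINT t|lebesgue_on {a..b}. \<xi> t * h t) - (LINT t|lebesgue_on {a..b}. \<xi> t * \<kappa>)"
   unfolding right_diff_distrib by (intro LINT_diff mult hi a tc(1) \<xi> integrable_mult_left ti)
  ultimately show "(LINT t|lebesgue_on {a..b}. \<xi> t * (h t - \<kappa>)) = 0" by simp
 qed
 then have h\<kappa>: "AE t in lborel. t \<in> {0..} \<longrightarrow> q t = \<kappa> + D t"
  by (subst (asm) AE_lebesgue_on_iff) (auto simp: h_def closed_sets_lebesgue elim!: eventually_mono)
 have "\<kappa> = q0"
 proof (rule ccontr)
  assume ne: "\<kappa> \<noteq> q0"
  define \<epsilon> where "\<epsilon> = \<bar>\<kappa> - q0\<bar> / 2"
  have \<epsilon>: "\<epsilon> > 0" using ne by (simp add: \<epsilon>_def)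
  obtain \<delta> where \<delta>: "\<delta> > 0" "AE t in lebesgue_on {0<..<\<delta>}. \<bar>q t - q0\<bar> < \<epsilon>" using init[OF \<epsilon>] by blast
  define \<delta>' where "\<delta>' = min \<delta> (\<epsilon> / (\<bar>B\<bar> + 1))"
  have \<delta>': "\<delta>' > 0" using \<delta> \<epsilon> by (simp add: \<delta>'_def)
  have "AE t in lborel. t \<in> {0<..<\<delta>} \<longrightarrow> \<bar>q t - q0\<bar> < \<epsilon>" using \<delta>(2) by (subst (asm) AE_lebesgue_on_iff) auto
  with h\<kappa> have "AE t in lborel. t \<notin> {0<..<\<delta>'}"
  proof eventually_elim
   case (elim t)
   show ?case
   proof
    assume t: "t \<in> {0<..<\<delta>'}"
    then have "\<bar>D t\<bar> \<le> \<bar>B\<bar> * t" using D_Lipschitz[of t 0] by (simp add: D_nonpos)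
    also have "\<dots> \<le> (\<bar>B\<bar> + 1) * t" using t by (intro mult_right_mono) auto
    also have "\<dots> < (\<bar>B\<bar> + 1) * (\<epsilon> / (\<bar>B\<bar> + 1))" using t by (intro mult_strict_left_mono) (auto simp: \<delta>'_def)
    also have "\<dots> = \<epsilon>" by simp
    finally have "\<bar>D t\<bar> < \<epsilon>" .
    moreover have "\<bar>q t - q0\<bar> < \<epsilon>" "q t = \<kappa> + D t" using elim t by (auto simp: \<delta>'_def)
    ultimately show False unfolding \<epsilon>_def by (auto simp: abs_if split: if_splits)
   qed
  qed
  then have "emeasure lborel {0<..<\<delta>'} = 0" by (subst (asm) AE_iff_null_sets[symmetric]) auto
  then show False using \<delta>' by simp
 qed
 then show ?thesis using h\<kappa> by (subst AE_lebesgue_on_iff) (auto simp: closed_sets_lebesgue)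
qed

end

section \<open>Time slices of weak equations\<close>

lemma AE_time_subset:
 fixes P :: "real \<Rightarrow> bool"
 shows "AE t in half_line. P t \<Longrightarrow> 0 \<le> a \<Longrightarrow> AE t in lebesgue_on {a..b}. P t"
 unfolding AE_lebesgue_on_iff[OF closed_sets_lebesgue[OF closed_atLeast]]
  AE_lebesgue_on_iff[OF closed_sets_lebesgue[OF closed_atLeastAtMost]]
 by (auto elim!: eventually_mono)

lemma continuous_bounded_cyl:
 fixes g :: "event \<Rightarrow> real"
 assumes "continuous_on UNIV g" shows "\<exists>C. \<forall>p\<in>{a..b} \<times> cbox 0 One. \<bar>g p\<bar> \<le> C"
proof -
 have "bounded (g ` ({a..b} \<times> cbox 0 One))"
  by (intro compact_imp_bounded compact_continuous_image continuous_on_subset[OF assms] compact_Times) auto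
 then show ?thesis by (auto simp: bounded_iff)
qed

lemma continuous_measurable_cyl:
 fixes g :: "event \<Rightarrow> real"
 assumes "continuous_on UNIV g" "closed A" shows "g \<in> borel_measurable (cyl A)"
 by (intro continuous_imp_measurable_on_sets_lebesgue continuous_on_subset[OF assms(1)] cyl_sets assms(2)) auto

lemma cyl_mult_continuous:
 fixes f g :: "event \<Rightarrow> real"
 assumes f: "integrable (cyl {a..b}) f" and g: "continuous_on UNIV g"
 shows "integrable (cyl {a..b}) (\<lambda>p. g p * f p)"
proof -
 obtain C where C: "\<And>p. p \<in> {a..b} \<times> cbox 0 One \<Longrightarrow> \<bar>g p\<bar> \<le> C" using continuous_bounded_cyl[OF g] by blast
 show ?thesis
 proof (rule L1_bound)
  show "integrable (cyl {a..b}) (\<lambda>p. C * f p)" using f by auto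
  show "(\<lambda>p. g p * f p) \<in> borel_measurable (cyl {a..b})"
   by (intro borel_measurable_times continuous_measurable_cyl[OF g] borel_measurable_integrable[OF f]) auto
  show "AE p in cyl {a..b}. norm (g p * f p) \<le> norm (C * f p)"
  proof (rule AE_I2)
   fix p assume "p \<in> space (cyl {a..b})"
   then have "\<bar>g p\<bar> \<le> \<bar>C\<bar>" using C[of p] by (auto intro: order_trans[OF _ abs_ge_self])
   then show "norm (g p * f p) \<le> norm (C * f p)" by (simp add: abs_mult mult_right_mono)
  qed
 qed
qed

lemma spacetime_cyl: "spacetime = cyl {0..}"
 by (simp add: spacetime_def)

lemma spacetime_supported:
 fixes F :: "event \<Rightarrow> real"
 assumes a: "0 \<le> a" and z: "\<And>t x. t \<notin> {a..b} \<Longrightarrow> F (t, x) = 0"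
 shows "(LINT p|spacetime. F p) = (LINT p|cyl {a..b}. F p)" "integrable spacetime F \<longleftrightarrow> integrable (cyl {a..b}) F"
proof -
 have S: "{a..b} \<times> cbox 0 One \<in> sets (lebesgue :: (event) measure)" by (rule cyl_sets) simp
 have T: "{0..} \<times> cbox 0 One \<in> sets (lebesgue :: (event) measure)" by (rule cyl_sets) simp
 have sub: "{a..b} \<times> cbox 0 One \<subseteq> {0..} \<times> cbox 0 (One :: real^3)" using a by auto
 have z': "F p = 0" if "p \<in> {0..} \<times> cbox 0 One" "p \<notin> {a..b} \<times> cbox 0 One" for p
  using that z by (cases p) auto
 show "(LINT p|spacetime. F p) = (LINT p|cyl {a..b}. F p)" "integrable spacetime F \<longleftrightarrow> integrable (cyl {a..b}) F"
  unfolding spacetime_cyl by (rule lebesgue_on_zero_outside[OF S T sub z']; assumption)+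
qed

lemma time_test_deriv_support:
 assumes "time_test \<theta>" "\<And>t. t \<notin> {a..b} \<Longrightarrow> \<theta> t = 0" "t \<notin> {a..b}"
 shows "dir_deriv 1 \<theta> t = 0"
proof (rule dir_deriv_real)
 have "((\<lambda>_. 0) has_real_derivative 0) (at t)" by simp
 moreover have "\<forall>\<^sub>F s in nhds t. \<theta> s = 0"
  using eventually_nhds_in_open[of "- {a..b}" t] assms by (auto elim!: eventually_mono simp: open_Compl)
 ultimately show "(\<theta> has_real_derivative 0) (at t)" by (subst DERIV_cong_ev[OF refl _ refl]) auto
qed

lemma time_test_continuous_deriv: "time_test \<theta> \<Longrightarrow> continuous_on A (dir_deriv 1 \<theta>)"
 by (auto simp: time_test_def intro!: smooth_continuous smooth_dir_deriv)

lemma continuous_fst_snd: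
 "continuous_on UNIV \<theta> \<Longrightarrow> continuous_on UNIV (\<lambda>p :: event. (\<theta> (fst p) :: real))"
 "continuous_on UNIV \<psi> \<Longrightarrow> continuous_on UNIV (\<lambda>p :: event. (\<psi> (snd p) :: real))"
 by (auto intro!: continuous_on_compose2[of UNIV \<theta>] continuous_on_compose2[of UNIV \<psi>] continuous_intros)

lemma cyl_time_weighted_integral:
 fixes H :: "event \<Rightarrow> real"
 assumes H: "integrable (cyl {a..b}) H" and c: "continuous_on UNIV \<theta>"
 shows "(LINT p|cyl {a..b}. \<theta> (fst p) * H p) = (LINT t|lebesgue_on {a..b}. \<theta> t * (TI x. H (t, x)))"
  "integrable (lebesgue_on {a..b}) (\<lambda>t. \<theta> t * (TI x. H (t, x)))"
 using cyl_Fubini(2,3)[OF _ cyl_mult_continuous[OF H continuous_fst_snd(1)[OF c]]] by simp_all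

lemma spacetime_slices_zero:
 fixes H :: "event \<Rightarrow> real"
 assumes H: "\<And>a b. 0 < a \<Longrightarrow> integrable (cyl {a..b}) H"
  and z: "\<And>\<theta>. time_test \<theta> \<Longrightarrow> (LINT p|spacetime. \<theta> (fst p) * H p) = 0"
 shows "AE t in half_line. (TI x. H (t, x)) = 0"
proof (rule time_fundamental)
 show "integrable (lebesgue_on {a..b}) (\<lambda>t. TI x. H (t, x))" if "0 < a" for a b
  by (rule cyl_Fubini(2)[OF _ H[OF that]]) simp
 fix \<theta> a b assume \<theta>: "time_test \<theta>" and a: "0 < a" and supp: "\<And>t. t \<notin> {a..b} \<Longrightarrow> \<theta> t = 0"
 have "(LINT t|lebesgue_on {a..b}. \<theta> t * (TI x. H (t, x))) = (LINT p|cyl {a..b}. \<theta> (fst p) * H p)"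
  by (rule cyl_time_weighted_integral(1)[OF H[OF a] time_test_continuous[OF \<theta>], symmetric])
 also have "\<dots> = (LINT p|spacetime. \<theta> (fst p) * H p)"
  by (rule spacetime_supported(1)[symmetric]) (use a supp in auto)
 finally show "(LINT t|lebesgue_on {a..b}. \<theta> t * (TI x. H (t, x))) = 0" using z[OF \<theta>] by simp
qed

lemma loc_integrable_nth: "loc_integrable F \<Longrightarrow> 0 < a \<Longrightarrow> integrable (cyl {a..b}) (\<lambda>p. F p $ j)"
 for F :: "event \<Rightarrow> real^3"
proof -
 assume "loc_integrable F" "0 < a"
 then have "integrable (cyl {a..b}) F" by (simp add: loc_integrable_def)
 then have "integrable (cyl {a..b}) (\<lambda>p. F p \<bullet> axis j 1)" by simp
 then show ?thesis by (simp add: inner_axis)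
qed

lemma integrable_vec3:
 fixes F :: "'a \<Rightarrow> real^3"
 assumes "\<And>j. integrable M (\<lambda>p. F p $ j)" shows "integrable M F"
 unfolding integrable_componentwise[of M F] using assms by (auto simp: Basis_vec_def inner_axis)

lemma integral_nth:
 fixes F :: "'a \<Rightarrow> real^3"
 assumes "integrable M F" shows "(LINT p|M. F p) $ j = (LINT p|M. F p $ j)"
 using integral_bounded_linear[OF bounded_linear_vec_nth[of j] assms] by simp

lemma continuous_torus_test: "torus_test \<psi> \<Longrightarrow> continuous_on A \<psi>"
 "torus_test \<psi> \<Longrightarrow> continuous_on A (partial j \<psi>)"
 using torus_test_dir_deriv[of \<psi> j] by (auto simp: torus_test_def intro: smooth_continuous)

lemma AE_loc_integrable_slices:
 fixes f :: "event \<Rightarrow> real"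
 assumes "\<And>a b. 0 < a \<Longrightarrow> integrable (cyl {a..b}) f"
 shows "AE t in half_line. integrable torus (\<lambda>x. f (t, x))"
 by (intro AE_half_line cyl_Fubini(1) assms) auto

lemma dir_deriv_wave_axis:
 "partial j (wave k \<theta>) x = 2 * pi * of_int (k j) * wave k (\<theta> + pi / 2) x"
 using dir_deriv_wave[of "axis j 1" 1 k \<theta>] by (simp add: phase_axis)

lemma borel_measurable_nth:
 fixes f :: "'a \<Rightarrow> 'b::euclidean_space ^ 'n"
 shows "f \<in> borel_measurable M \<Longrightarrow> (\<lambda>p. f p $ j) \<in> borel_measurable M"
 by (rule borel_measurable_continuous_on[where f="\<lambda>x. x $ j"]) (auto intro!: continuous_intros)

lemma cyl_measurable_mono:
 fixes f :: "event \<Rightarrow> 'b::euclidean_space"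
 assumes f: "f \<in> borel_measurable spacetime" and a: "0 \<le> a"
 shows "f \<in> borel_measurable (cyl {a..b})"
proof -
 have "{a..b} \<times> cbox 0 One \<subseteq> {0..} \<times> cbox 0 (One :: real^3)" using a by auto
 then show ?thesis
  using f unfolding spacetime_cyl by (metis (no_types, lifting) measurable_restrict_mono)
qed

lemma spacetime_test_slice:
 assumes "spacetime_test \<phi>" shows "torus_test (\<lambda>x. \<phi> (t, x))"
  "partial j (\<lambda>x. \<phi> (t, x)) x = space_grad \<phi> (t, x) $ j"
 using assms by (auto simp: spacetime_test_def torus_test_def smooth_slice dir_deriv_slice space_grad_def)

lemma continuous_spacetime_test:
 assumes "spacetime_test \<phi>"
 shows "continuous_on A \<phi>" "continuous_on A (\<lambda>p. space_grad \<phi> p $ j)" "continuous_on A (time_deriv \<phi>)"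
proof -
 have s: "smooth \<phi>" using assms by (simp add: spacetime_test_def)
 have "(0, axis j 1) \<in> (Basis :: (event) set)" "(1, 0) \<in> (Basis :: (event) set)"
  by (auto simp: Basis_prod_def)
 then show "continuous_on A \<phi>" "continuous_on A (\<lambda>p. space_grad \<phi> p $ j)" "continuous_on A (time_deriv \<phi>)"
  using smooth_continuous[OF s] smooth_continuous[OF smooth_dir_deriv[OF s]] by (auto simp: space_grad_def time_deriv_def)
qed

lemma spacetime_test_support:
 assumes \<phi>: "spacetime_test \<phi>"
 obtains a b where "0 < a" "\<And>t x. t \<notin> {a..b} \<Longrightarrow> \<phi> (t, x) = 0" "\<And>t x. t \<notin> {a..b} \<Longrightarrow> time_deriv \<phi> (t, x) = 0"
  "\<And>t x. t \<notin> {a..b} \<Longrightarrow> space_grad \<phi> (t, x) = 0"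
proof -
 obtain a b where a: "0 < a" and supp: "\<And>t x. t \<notin> {a..b} \<Longrightarrow> \<phi> (t, x) = 0" using \<phi> unfolding spacetime_test_def by blast
 have d: "dir_deriv h \<phi> (t, x) = 0" if t: "t \<notin> {a..b}" for t x h
 proof -
  have "(\<phi> has_derivative (\<lambda>_. 0)) (at (t, x))"
  proof (rule has_derivative_transform_within_open[of "\<lambda>_. 0"])
   show "open ((- {a..b}) \<times> (UNIV :: (real^3) set))" by (intro open_Times) auto
  qed (use supp t in auto)
  then show ?thesis by (rule dir_deriv_eqI)
 qed
 show thesis
  by (rule that[OF a supp]) (auto simp: time_deriv_def space_grad_def vec_eq_iff d)
qed

lemma integrable_against_test:
 fixes f g :: "event \<Rightarrow> real"
 assumes f: "loc_integrable f" and g: "continuous_on UNIV g" and a: "0 < a" and supp: "\<And>t x. t \<notin> {a..b} \<Longrightarrow> g (t, x) = 0"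
 shows "integrable spacetime (\<lambda>p. g p * f p)"
proof -
 have "integrable (cyl {a..b}) (\<lambda>p. g p * f p)"
  using f a by (intro cyl_mult_continuous g) (simp add: loc_integrable_def)
 then show ?thesis using spacetime_supported(2)[of a b "\<lambda>p. g p * f p"] a supp by simp
qed

lemma integrable_flux_test:
 assumes F: "loc_integrable F" and \<phi>: "spacetime_test \<phi>" shows "integrable spacetime (\<lambda>p. F p \<bullet> space_grad \<phi> p)"
proof -
 obtain a b where a: "0 < a" "\<And>t x. t \<notin> {a..b} \<Longrightarrow> space_grad \<phi> (t, x) = 0" by (rule spacetime_test_support[OF \<phi>]) blast
 have "loc_integrable (\<lambda>p. F p $ j)" for j unfolding loc_integrable_def using loc_integrable_nth[OF F] by blast
 then have "integrable spacetime (\<lambda>p. \<Sum>j\<in>UNIV. space_grad \<phi> p $ j * F p $ j)"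
  by (intro L1_sum integrable_against_test[OF _ continuous_spacetime_test(2)[OF \<phi>] a(1), of _ b]) (auto simp: a(2))
 then show ?thesis by (simp add: inner_vec_def mult.commute)
qed

lemma integrable_scalar_test:
 assumes f: "loc_integrable f" and \<phi>: "spacetime_test \<phi>"
 shows "integrable spacetime (\<lambda>p. f p * time_deriv \<phi> p)" "integrable spacetime (\<lambda>p. f p * \<phi> p)"
proof -
 obtain a b where a: "0 < a" "\<And>t x. t \<notin> {a..b} \<Longrightarrow> \<phi> (t, x) = 0" "\<And>t x. t \<notin> {a..b} \<Longrightarrow> time_deriv \<phi> (t, x) = 0"
  by (rule spacetime_test_support[OF \<phi>]) blast
 show "integrable spacetime (\<lambda>p. f p * time_deriv \<phi> p)"
  using integrable_against_test[OF f continuous_spacetime_test(3)[OF \<phi>] a(1,3)] by (simp add: mult.commute)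
 show "integrable spacetime (\<lambda>p. f p * \<phi> p)"
  using integrable_against_test[OF f continuous_spacetime_test(1)[OF \<phi>] a(1,2)] by (simp add: mult.commute)
qed

lemma integrable_grad_test:
 fixes f :: "event \<Rightarrow> real"
 assumes f: "loc_integrable f" and \<phi>: "spacetime_test \<phi>" shows "integrable spacetime (\<lambda>p. f p *\<^sub>R space_grad \<phi> p)"
proof (rule integrable_vec3)
 fix k
 have "loc_integrable (\<lambda>p. f p *\<^sub>R axis k 1 :: real^3)" using f by (simp add: loc_integrable_def)
 from integrable_flux_test[OF this \<phi>] show "integrable spacetime (\<lambda>p. (f p *\<^sub>R space_grad \<phi> p) $ k)"
  by (simp add: inner_axis')
qed

text \<open>Waves with the two phases \<open>0\<close> and \<open>-\<pi>/2\<close> suffice to determine a Fourier coefficient, so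
 countably many test functions characterise a slice.\<close>

lemma weak_divergence_slices:
 fixes F :: "event \<Rightarrow> real^3" and g :: "event \<Rightarrow> real"
 assumes F: "loc_integrable F" and g: "loc_integrable g"
  and eq: "\<And>\<phi>. spacetime_test \<phi> \<Longrightarrow> (LINT p|spacetime. F p \<bullet> space_grad \<phi> p + g p * \<phi> p) = 0"
 shows "AE t in half_line. \<forall>k. rcoeff (\<lambda>x. g (t, x)) k = (\<Sum>j\<in>UNIV. 2 * pi * of_int (k j) * \<i> * rcoeff (\<lambda>x. F (t, x) $ j) k)"
proof -
 have Fi: "integrable (cyl {a..b}) (\<lambda>p. F p $ j)" and gi: "integrable (cyl {a..b}) g" if "0 < a" for a b j
  using that F g by (auto simp: loc_integrable_def[of g] intro: loc_integrable_nth)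
 have test: "AE t in half_line. (TI x. (\<Sum>j\<in>UNIV. partial j \<psi> x * F (t, x) $ j) + \<psi> x * g (t, x)) = 0"
  if \<psi>: "torus_test \<psi>" for \<psi>
 proof -
  let ?H = "\<lambda>p. (\<Sum>j\<in>UNIV. partial j \<psi> (snd p) * F p $ j) + \<psi> (snd p) * g p"
  have Hi: "integrable (cyl {a..b}) ?H" if "0 < a" for a b
   by (intro L1_add L1_sum cyl_mult_continuous Fi gi that
     continuous_fst_snd continuous_torus_test \<psi>)
  have "AE t in half_line. (TI x. ?H (t, x)) = 0"
  proof (rule spacetime_slices_zero[OF Hi])
   fix \<theta> assume \<theta>: "time_test \<theta>"
   let ?\<phi> = "\<lambda>p. \<theta> (fst p) * \<psi> (snd p)"
   have grad: "space_grad ?\<phi> p = \<theta> (fst p) *\<^sub>R torus_grad \<psi> (snd p)" for p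
    using spacetime_test_product(3)[OF \<theta> \<psi>, of "fst p" "snd p"] by simp
   have "\<theta> (fst p) * ?H p = F p \<bullet> space_grad ?\<phi> p + g p * ?\<phi> p" for p
    unfolding grad inner_vec_def distrib_left sum_distrib_left
    by (intro arg_cong2[of _ _ _ _ "(+)"] sum.cong refl) (simp_all add: torus_grad_def mult_ac)
   then show "(LINT p|spacetime. \<theta> (fst p) * ?H p) = 0" using eq[OF spacetime_test_product(1)[OF \<theta> \<psi>]] by simp
  qed
  then show ?thesis by simp
 qed
 have "AE t in half_line. \<forall>k. \<forall>\<theta>\<in>{0, - (pi / 2)}.
   (TI x. (\<Sum>j\<in>UNIV. partial j (wave k \<theta>) x * F (t, x) $ j) + wave k \<theta> x * g (t, x)) = 0"
  by (intro AE_all_countable[THEN iffD2] allI AE_finite_allI test torus_test_wave) auto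
 moreover have "AE t in half_line. \<forall>j. integrable torus (\<lambda>x. F (t, x) $ j)"
  unfolding AE_all_countable by (intro allI AE_loc_integrable_slices[OF Fi])
 moreover have "AE t in half_line. integrable torus (\<lambda>x. g (t, x))" by (rule AE_loc_integrable_slices[OF gi])
 ultimately show ?thesis
 proof eventually_elim
  case (elim t)
  show ?case
  proof
   fix k
   have F: "integrable torus (\<lambda>x. F (t, x) $ j)" and g: "integrable torus (\<lambda>x. g (t, x))" for j using elim by blast+
   let ?F = "\<lambda>j. cnj (rcoeff (\<lambda>x. F (t, x) $ j) k)" and ?g = "cnj (rcoeff (\<lambda>x. g (t, x)) k)"
   have "(\<Sum>j\<in>UNIV. (2 * pi * of_int (k j)) * \<i> * ?F j) + ?g = 0"
   proof (rule Re_cis_mult_eqD)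
    fix \<theta> :: real assume "\<theta> \<in> {0, - (pi / 2)}"
    then have z: "(TI x. (\<Sum>j\<in>UNIV. partial j (wave k \<theta>) x * F (t, x) $ j) + wave k \<theta> x * g (t, x)) = 0"
     using elim by blast
    have w: "continuous_on UNIV (wave k \<theta>)" for \<theta> using torus_test_wave by (rule continuous_torus_test)
    have "(TI x. (\<Sum>j\<in>UNIV. partial j (wave k \<theta>) x * F (t, x) $ j) + wave k \<theta> x * g (t, x))
      = (\<Sum>j\<in>UNIV. (2 * pi * of_int (k j)) * (TI x. wave k (\<theta> + pi / 2) x * F (t, x) $ j)) + (TI x. wave k \<theta> x * g (t, x))"
     unfolding dir_deriv_wave_axis mult.assoc
     using integrable_continuous_mult_torus[OF w F] integrable_continuous_mult_torus[OF w g]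
     by (subst LINT_add) (auto simp: mult.assoc)
    also have "\<dots> = (\<Sum>j\<in>UNIV. (2 * pi * of_int (k j)) * Re (cis (\<theta> + pi / 2) * ?F j)) + Re (cis \<theta> * ?g)"
     unfolding integral_wave_mult[OF F] integral_wave_mult[OF g] ..
    also have "\<dots> = Re (cis \<theta> * ((\<Sum>j\<in>UNIV. (2 * pi * of_int (k j)) * \<i> * ?F j) + ?g))"
    proof -
     have "cis (\<theta> + pi / 2) = cis \<theta> * \<i>" using cis_add_half_pi[of \<theta> 1] by simp
     moreover have "Re (of_real r * z) = r * Re z" for r z by simp
     ultimately show ?thesis by (simp add: sum_distrib_left algebra_simps)
    qed
    finally show "Re (cis \<theta> * ((\<Sum>j\<in>UNIV. (2 * pi * of_int (k j)) * \<i> * ?F j) + ?g)) = Re (cis \<theta> * 0)" using z by simp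
   qed
   from arg_cong[OF this, of cnj]
   have "rcoeff (\<lambda>x. g (t, x)) k - (\<Sum>j\<in>UNIV. 2 * pi * of_int (k j) * \<i> * rcoeff (\<lambda>x. F (t, x) $ j) k) = 0"
    by (simp add: sum_negf)
   then show "rcoeff (\<lambda>x. g (t, x)) k = (\<Sum>j\<in>UNIV. 2 * pi * of_int (k j) * \<i> * rcoeff (\<lambda>x. F (t, x) $ j) k)" by simp
  qed
 qed
qed

lemma weak_grad_slices:
 assumes w: "has_weak_grad f G"
 shows "AE t in half_line. \<forall>j. weak_partial j (\<lambda>x. f (t, x)) (\<lambda>x. G (t, x) $ j)"
 unfolding AE_all_countable
proof
 fix j
 have f: "loc_integrable f" and G: "loc_integrable (\<lambda>p. G p $ j)" for j
  using w by (auto simp: has_weak_grad_def loc_integrable_def[of "\<lambda>p. G p $ _"] intro: loc_integrable_nth)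
 have "AE t in half_line. \<forall>k. rcoeff (\<lambda>x. G (t, x) $ j) k
   = (\<Sum>i\<in>UNIV. 2 * pi * of_int (k i) * \<i> * rcoeff (\<lambda>x. (f (t, x) *\<^sub>R axis j 1) $ i) k)"
 proof (rule weak_divergence_slices[OF _ G])
  show "loc_integrable (\<lambda>p. f p *\<^sub>R axis j 1 :: real^3)" using f by (simp add: loc_integrable_def)
  fix \<phi> assume \<phi>: "spacetime_test \<phi>"
  have fi: "integrable spacetime (\<lambda>p. f p *\<^sub>R space_grad \<phi> p)" by (rule integrable_grad_test[OF f \<phi>])
  have Gi: "integrable spacetime (\<lambda>p. \<phi> p *\<^sub>R G p)"
   using integrable_scalar_test(2)[OF G \<phi>] by (intro integrable_vec3) (simp add: mult.commute)
  have "(LINT p|spacetime. f p *\<^sub>R space_grad \<phi> p) $ j = - ((LINT p|spacetime. \<phi> p *\<^sub>R G p) $ j)"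
   using w \<phi> by (simp add: has_weak_grad_def)
  then have "(LINT p|spacetime. f p * space_grad \<phi> p $ j) + (LINT p|spacetime. \<phi> p * G p $ j) = 0"
   unfolding integral_nth[OF fi] integral_nth[OF Gi] by simp
  moreover have "integrable spacetime (\<lambda>p. f p * space_grad \<phi> p $ j)" "integrable spacetime (\<lambda>p. \<phi> p * G p $ j)"
   using integrable_bounded_linear[OF bounded_linear_vec_nth fi, of j] integrable_bounded_linear[OF bounded_linear_vec_nth Gi, of j] by simp_all
  ultimately show "(LINT p|spacetime. (f p *\<^sub>R axis j 1) \<bullet> space_grad \<phi> p + G p $ j * \<phi> p) = 0"
   by (simp add: inner_axis' mult.commute[of "G _ $ j"])
 qed
 moreover have "AE t in half_line. integrable torus (\<lambda>x. f (t, x))" "AE t in half_line. integrable torus (\<lambda>x. G (t, x) $ j)"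
  using f G by (auto intro!: AE_loc_integrable_slices simp: loc_integrable_def)
 ultimately show "AE t in half_line. weak_partial j (\<lambda>x. f (t, x)) (\<lambda>x. G (t, x) $ j)"
 proof eventually_elim
  case (elim t)
  have rc: "rcoeff (\<lambda>x. (f (t, x) *\<^sub>R axis j 1) $ i) k = (if i = j then rcoeff (\<lambda>x. f (t, x)) k else 0)" for i k
   by (simp add: axis_def fcoeff_def)
  show ?case
  proof (rule has_weak_derivI_fcoeff)
   fix k
   have "rcoeff (\<lambda>x. G (t, x) $ j) k = (\<Sum>i\<in>UNIV. if i = j then symbol (unit_index j) k * rcoeff (\<lambda>x. f (t, x)) k else 0)"
    unfolding elim(1)[rule_format, of k] rc symbol_unit by (intro sum.cong refl) auto
   then show "rcoeff (\<lambda>x. G (t, x) $ j) k = symbol (unit_index j) k * rcoeff (\<lambda>x. f (t, x)) k" by simp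
  qed (use elim in auto)
 qed
qed

lemma weak_div_free_slices:
 assumes "weak_div_free F"
 shows "AE t in half_line. \<forall>k. (\<Sum>j\<in>UNIV. of_int (k j) * rcoeff (\<lambda>x. F (t, x) $ j) k) = 0"
proof -
 have "AE t in half_line. \<forall>k. rcoeff (\<lambda>x. 0) k = (\<Sum>j\<in>UNIV. 2 * pi * of_int (k j) * \<i> * rcoeff (\<lambda>x. F (t, x) $ j) k)"
  using weak_divergence_slices[of F "\<lambda>_. 0"] assms by (simp add: weak_div_free_def loc_integrable_def[of "\<lambda>_. 0"])
 then show ?thesis
 proof (eventually_elim, intro allI)
  fix t k assume "\<forall>k. rcoeff (\<lambda>x. 0) k = (\<Sum>j\<in>UNIV. 2 * pi * of_int (k j) * \<i> * rcoeff (\<lambda>x. F (t, x) $ j) k)"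
  then have "2 * pi * \<i> * (\<Sum>j\<in>UNIV. of_int (k j) * rcoeff (\<lambda>x. F (t, x) $ j) k) = 0"
   by (simp add: fcoeff_def sum_distrib_left mult_ac)
  then show "(\<Sum>j\<in>UNIV. of_int (k j) * rcoeff (\<lambda>x. F (t, x) $ j) k) = 0" by simp
 qed
qed

lemma AE_spacetimeI:
 fixes f :: "event \<Rightarrow> real"
 assumes f: "\<And>a b. 0 < a \<Longrightarrow> f \<in> borel_measurable (cyl {a..b})"
  and z: "AE t in half_line. AE x in torus. f (t, x) = 0"
 shows "AE p in spacetime. f p = 0"
proof -
 let ?A = "\<lambda>n::nat. {1 / (real n + 1)..real n + 1}"
 have "AE p in cyl (?A n). f p = 0" for n
  by (rule AE_cylI) (auto intro!: f AE_time_subset[OF z])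
 then have "AE p in lborel. \<forall>n. p \<in> ?A n \<times> cbox 0 One \<longrightarrow> f p = 0"
  unfolding AE_all_countable by (simp only: AE_lebesgue_on_iff[OF cyl_sets[OF closed_atLeastAtMost]] simp_thms)
 moreover have "AE p in (lborel :: (event) measure). fst p \<noteq> 0"
 proof -
  have "AE t in (lborel :: real measure). AE x in (lborel :: (real^3) measure). fst (t, x) \<noteq> 0"
   using AE_lborel_singleton[of 0] by eventually_elim auto
  moreover have "{p \<in> space ((lborel :: real measure) \<Otimes>\<^sub>M (lborel :: (real^3) measure)). fst p \<noteq> 0}
    \<in> sets ((lborel :: real measure) \<Otimes>\<^sub>M (lborel :: (real^3) measure))"
   by measurable
  ultimately have "AE p in (lborel :: real measure) \<Otimes>\<^sub>M (lborel :: (real^3) measure). fst p \<noteq> 0"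
   by (intro lborel_pair.AE_pair_measure)
  then show ?thesis unfolding lborel_prod .
 qed
 ultimately have "AE p in lborel. p \<in> {0..} \<times> cbox 0 One \<longrightarrow> f p = 0"
 proof eventually_elim
  case (elim p)
  show ?case
  proof
   assume p: "p \<in> {0..} \<times> cbox 0 One"
   then have t: "fst p > 0" using elim by auto
   obtain n where n: "max (fst p) (1 / fst p) \<le> real n" using real_arch_simple by blast
   then have "fst p \<le> real n + 1" "1 / fst p \<le> real n + 1" by auto
   then have "p \<in> ?A n \<times> cbox 0 One" using t p by (auto simp: field_simps)
   then show "f p = 0" using elim by blast
  qed
 qed
 then show ?thesis unfolding spacetime_cyl by (subst AE_lebesgue_on_iff) (auto intro: cyl_sets)
qed

lemma has_weak_grad_weak_grad: "has_weak_grad f G \<Longrightarrow> has_weak_grad f (weak_grad f)"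
 unfolding weak_grad_def by (rule someI[of "has_weak_grad f"])

section \<open>Transport by a divergence-free field\<close>

lemma weak_deriv_torus_test: "torus_test \<psi> \<Longrightarrow> weak_partial j \<psi> (partial j \<psi>)"
 by (rule has_weak_derivI_fcoeff)
  (auto intro!: continuous_integrable_torus continuous_torus_test simp: fcoeff_dir_deriv symbol_unit)

lemma L2_continuous_mult: "continuous_on UNIV \<psi> \<Longrightarrow> f \<in> L2 \<Longrightarrow> (\<lambda>x. \<psi> x * f x) \<in> L2" for f :: "real^3 \<Rightarrow> real"
proof -
 assume c: "continuous_on UNIV \<psi>" and f: "f \<in> L2"
 obtain B where B: "\<And>x. x \<in> cbox 0 One \<Longrightarrow> norm (\<psi> x) \<le> B" using bounded_on_cell[OF c] by blast
 show ?thesis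
 proof (rule L2_mult_bounded[OF f, of _ B])
  show "(\<lambda>x. \<psi> x * f x) \<in> borel_measurable torus"
   by (intro borel_measurable_times continuous_borel_torus c L2_measurable f)
  show "AE x in torus. norm (\<psi> x * f x) \<le> B * norm (f x)"
   using B by (intro AE_I2) (auto simp: abs_mult intro!: mult_right_mono)
 qed
qed

text \<open>A divergence-free field is orthogonal in \<open>L\<^sup>2\<close> to every gradient; applied to the gradient of
 \<open>\<psi> f\<close> this is the weak form of \<open>\<nabla> \<cdot> (f v) = v \<cdot> \<nabla> f\<close>.\<close>

lemma advection_slice:
 assumes f: "f \<in> L2" and g: "\<And>j. g j \<in> L2" and fg: "\<And>j. weak_partial j f (g j)"
  and v: "\<And>j. v j \<in> L2" and dv: "\<And>k. (\<Sum>j\<in>UNIV. of_int (k j) * rcoeff (v j) k) = 0"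
  and \<psi>: "torus_test \<psi>"
 shows "(TI x. (\<Sum>j\<in>UNIV. v j x * (f x * partial j \<psi> x + g j x * \<psi> x))) = 0"
proof -
 let ?D = "\<lambda>j. partial j \<psi>" and ?c = "\<lambda>f x. complex_of_real (f x)"
 define h where "h j x = \<psi> x * g j x + ?D j x * f x" for j x
 have \<psi>L: "\<psi> \<in> L2" "?D j \<in> L2" for j by (intro continuous_in_L2 continuous_torus_test \<psi>)+
 have pf: "(\<lambda>x. \<psi> x * f x) \<in> L2" by (intro L2_continuous_mult continuous_torus_test \<psi> f)
 have hL: "h j \<in> L2" for j unfolding h_def by (intro L2_add L2_continuous_mult continuous_torus_test \<psi> f g)
 have hd: "weak_partial j (\<lambda>x. \<psi> x * f x) (h j)" for j
  unfolding h_def by (intro weak_deriv_product weak_deriv_torus_test fg \<psi> \<psi>L f g)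
 have z: "(\<Sum>j\<in>UNIV. vp_form n (?c (h j)) (?c (v j))) = 0" for n
 proof -
  have "(\<Sum>j\<in>UNIV. vp_form n (?c (h j)) (?c (v j)))
    = (\<Sum>k\<in>vp_freqs n. \<Sum>j\<in>UNIV. of_real (vp_coeff n k) * rcoeff (h j) k * cnj (rcoeff (v j) k))"
   unfolding vp_form_def by (rule sum.swap)
  also have "\<dots> = (\<Sum>k\<in>vp_freqs n. of_real (vp_coeff n k) * (2 * pi * \<i>) * rcoeff (\<lambda>x. \<psi> x * f x) k
    * cnj (\<Sum>j\<in>UNIV. of_int (k j) * rcoeff (v j) k))"
   by (intro sum.cong refl) (simp add: fcoeff_weak_deriv[OF hd] symbol_unit sum_distrib_left mult_ac)
  finally show ?thesis by (simp add: dv)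
 qed
 have "(\<lambda>n. \<Sum>j\<in>UNIV. vp_form n (?c (h j)) (?c (v j))) \<longlonglongrightarrow> (\<Sum>j\<in>UNIV. (TI x. ?c (h j) x * cnj (?c (v j) x)))"
  by (intro tendsto_sum vp_form_tendsto_L2 L2_of_real hL v)
 then have "(\<Sum>j\<in>UNIV. (TI x. ?c (h j) x * cnj (?c (v j) x))) = 0"
  unfolding z by (simp add: LIMSEQ_const_iff)
 moreover have "(TI x. ?c (h j) x * cnj (?c (v j) x)) = of_real (TI x. h j x * v j x)" for j
  by (simp flip: of_real_mult)
 ultimately have "complex_of_real (\<Sum>j\<in>UNIV. (TI x. h j x * v j x)) = 0" by simp
 then have "(\<Sum>j\<in>UNIV. (TI x. h j x * v j x)) = 0" by (simp only: of_real_eq_0_iff)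
 moreover have "(TI x. (\<Sum>j\<in>UNIV. h j x * v j x)) = (\<Sum>j\<in>UNIV. (TI x. h j x * v j x))"
  by (intro LINT_sum L2_mult_integrable hL v)
 ultimately show ?thesis by (simp add: h_def algebra_simps)
qed

lemma cyl_product_integrable:
 fixes f g :: "event \<Rightarrow> real"
 assumes m: "f \<in> borel_measurable (cyl {a..b})" "g \<in> borel_measurable (cyl {a..b})"
  and f: "AE t in lebesgue_on {a..b}. L2_le (\<lambda>x. f (t, x)) M1"
  and g: "AE t in lebesgue_on {a..b}. L2_le (\<lambda>x. g (t, x)) M2"
 shows "integrable (cyl {a..b}) (\<lambda>p. f p * g p)"
proof (rule cyl_integrableI[where M="sqrt M1 * sqrt M2"])
 show "(\<lambda>p. f p * g p) \<in> borel_measurable (cyl {a..b})" using m by (rule borel_measurable_times)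
 show "AE t in lebesgue_on {a..b}. integrable torus (\<lambda>x. f (t, x) * g (t, x)) \<and>
   (TI x. \<bar>f (t, x) * g (t, x)\<bar>) \<le> sqrt M1 * sqrt M2"
  using f g
 proof eventually_elim
  case (elim t)
  have "(TI x. \<bar>f (t, x) * g (t, x)\<bar>) \<le> sqrt (norm2 (\<lambda>x. f (t, x))) * sqrt (norm2 (\<lambda>x. g (t, x)))"
   using integral_Cauchy_Schwarz[of "\<lambda>x. f (t, x)" "\<lambda>x. g (t, x)"] elim by (simp add: abs_mult)
  also have "\<dots> \<le> sqrt M1 * sqrt M2"
   using elim by (intro mult_mono real_sqrt_le_mono) (auto intro: order_trans[OF norm2_nonneg])
  finally show ?case using elim L2_mult_integrable by blast
 qed
qed

lemma Linf_HboundE: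
 assumes "Linf_Hbound s f"
 obtains M where "AE t in half_line. Hbound s (\<lambda>x. f (t, x)) M"
  "AE t in half_line. L2_le (\<lambda>x. f (t, x)) M"
proof -
 obtain M where M: "AE t in half_line. Hbound s (\<lambda>x. f (t, x)) M" using assms unfolding Linf_Hbound_def by blast
 then have "AE t in half_line. L2_le (\<lambda>x. f (t, x)) M"
  by eventually_elim (auto dest: Hbound_L2)
 then show thesis using that M by blast
qed

lemma weak_grad_L2_slices:
 assumes c: "Linf_Hbound 1 c" and G: "has_weak_grad c G"
 obtains M where "AE t in half_line. \<forall>j. L2_le (\<lambda>x. G (t, x) $ j) M"
proof -
 obtain M where M: "AE t in half_line. Hbound 1 (\<lambda>x. c (t, x)) M" by (rule Linf_HboundE[OF c])
 have "AE t in half_line. \<forall>j. L2_le (\<lambda>x. G (t, x) $ j) M"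
  using M weak_grad_slices[OF G]
 proof eventually_elim
  case (elim t)
  show ?case
  proof
   fix j
   have "Hbound (Suc 0) (\<lambda>x. c (t, x)) M" using elim by simp
   then obtain g where g: "weak_partial j (\<lambda>x. c (t, x)) g" "Hbound 0 g M" by (rule Hbound_deriv)
   have w: "weak_partial j (\<lambda>x. c (t, x)) (\<lambda>x. G (t, x) $ j)" using elim by blast
   have "(\<lambda>x. G (t, x) $ j) \<in> borel_measurable torus" "g \<in> borel_measurable torus"
    using w g(1) by (auto simp: has_weak_deriv_def)
   from norm2_cong_AE[OF weak_deriv_unique[OF w g(1)] this]
   show "L2_le (\<lambda>x. G (t, x) $ j) M" using Hbound_L2[OF g(2)] by auto
  qed
 qed
 then show thesis by (rule that)
qed

lemma AE_all_finite: "(\<And>i::'i::finite. AE x in M. P i x) \<Longrightarrow> AE x in M. \<forall>i. P i x"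
 using AE_finite_allI[of "UNIV :: 'i set" "\<lambda>i x. P i x" M] by auto

lemma Linf_Hbound_0_uniform:
 fixes v :: "event \<Rightarrow> real^3"
 assumes "\<And>j. Linf_Hbound 0 (\<lambda>p. v p $ j)"
 obtains M where "AE t in half_line. \<forall>j. L2_le (\<lambda>x. v (t, x) $ j) M"
proof -
 have "\<forall>j. \<exists>M. AE t in half_line. L2_le (\<lambda>x. v (t, x) $ j) M"
 proof
  fix j
  obtain M where "AE t in half_line. L2_le (\<lambda>x. v (t, x) $ j) M"
   by (rule Linf_HboundE[OF assms[of j]])
  then show "\<exists>M. AE t in half_line. L2_le (\<lambda>x. v (t, x) $ j) M" ..
 qed
 from choice[OF this] obtain M
  where M: "\<forall>j. AE t in half_line. (\<lambda>x. v (t, x) $ j) \<in> L2 \<and> norm2 (\<lambda>x. v (t, x) $ j) \<le> M j" ..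
 have "AE t in half_line. \<forall>j. (\<lambda>x. v (t, x) $ j) \<in> L2 \<and> norm2 (\<lambda>x. v (t, x) $ j) \<le> M j"
  by (rule AE_all_finite) (use M in blast)
 then have "AE t in half_line. \<forall>j. (\<lambda>x. v (t, x) $ j) \<in> L2 \<and> norm2 (\<lambda>x. v (t, x) $ j) \<le> (\<Sum>j\<in>UNIV. \<bar>M j\<bar>)"
 proof eventually_elim
  case (elim t)
  have "M j \<le> (\<Sum>j\<in>UNIV. \<bar>M j\<bar>)" for j
   using member_le_sum[of j UNIV "\<lambda>j. \<bar>M j\<bar>"] by simp
  then show ?case using elim by (meson order_trans)
 qed
 then show thesis by (rule that)
qed

lemma advection:
 assumes c: "Linf_Hbound 1 c" "c \<in> borel_measurable spacetime"
  and v: "\<And>j. Linf_Hbound 0 (\<lambda>p. v p $ j)" "v \<in> borel_measurable spacetime"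
  and dv: "weak_div_free v" and G: "has_weak_grad c G"
 shows "loc_integrable (\<lambda>p. v p \<bullet> G p)" "loc_integrable (\<lambda>p. c p *\<^sub>R v p)"
  "\<And>\<phi>. spacetime_test \<phi> \<Longrightarrow> integrable spacetime (\<lambda>p. (c p *\<^sub>R v p) \<bullet> space_grad \<phi> p + (v p \<bullet> G p) * \<phi> p)"
  "\<And>\<phi>. spacetime_test \<phi> \<Longrightarrow> (LINT p|spacetime. (c p *\<^sub>R v p) \<bullet> space_grad \<phi> p + (v p \<bullet> G p) * \<phi> p) = 0"
proof -
 obtain Mg where Mg: "AE t in half_line. \<forall>j. L2_le (\<lambda>x. G (t, x) $ j) Mg"
  by (rule weak_grad_L2_slices[OF c(1) G])
 obtain Mc where Mc: "AE t in half_line. L2_le (\<lambda>x. c (t, x)) Mc"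
  by (rule Linf_HboundE[OF c(1)])
 obtain Mv where Mv: "AE t in half_line. \<forall>j. L2_le (\<lambda>x. v (t, x) $ j) Mv"
  by (rule Linf_Hbound_0_uniform[of v, OF v(1)])
 have vm: "(\<lambda>p. v p $ j) \<in> borel_measurable (cyl {a..b})" and cm: "c \<in> borel_measurable (cyl {a..b})"
  and Gm: "(\<lambda>p. G p $ j) \<in> borel_measurable (cyl {a..b})" if "0 < a" for a b j
  using G that borel_measurable_nth[OF cyl_measurable_mono[OF v(2)]] cyl_measurable_mono[OF c(2)]
  by (auto simp: has_weak_grad_def intro!: borel_measurable_integrable loc_integrable_nth)
 have nth: "AE t in lebesgue_on {a..b}. L2_le (\<lambda>x. H (t, x) $ j) M"
  if "AE t in half_line. \<forall>j. L2_le (\<lambda>x. H (t, x) $ j) M" "0 < a"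
  for H :: "event \<Rightarrow> real^3" and M a b j
  using AE_time_subset[OF that(1), of a b] that(2) by (auto elim!: eventually_mono)
 show lv: "loc_integrable (\<lambda>p. v p \<bullet> G p)" unfolding loc_integrable_def inner_vec_def inner_real_def
  by (intro allI impI L1_sum cyl_product_integrable[OF vm Gm nth[OF Mv] nth[OF Mg]])
 show lc: "loc_integrable (\<lambda>p. c p *\<^sub>R v p)" unfolding loc_integrable_def
 proof (intro allI impI integrable_vec3)
  fix a b :: real and j assume a: "0 < a"
  then show "integrable (cyl {a..b}) (\<lambda>p. (c p *\<^sub>R v p) $ j)"
   using cyl_product_integrable[OF cm[OF a] vm[OF a] AE_time_subset[OF Mc] nth[OF Mv a]] by simp
 qed
 fix \<phi> assume \<phi>: "spacetime_test \<phi>"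
 let ?F = "\<lambda>p. (c p *\<^sub>R v p) \<bullet> space_grad \<phi> p + (v p \<bullet> G p) * \<phi> p"
 show Fi: "integrable spacetime ?F"
  by (intro L1_add integrable_flux_test integrable_scalar_test lv lc \<phi>)
 have F: "?F p = (\<Sum>j\<in>UNIV. v p $ j * (c p * space_grad \<phi> p $ j + G p $ j * \<phi> p))" for p
  by (simp add: inner_vec_def sum_distrib_left sum_distrib_right sum.distrib algebra_simps)
 have "AE t in half_line. (TI x. ?F (t, x)) = 0"
  using weak_div_free_slices[OF dv] weak_grad_slices[OF G] Mg Mc Mv
 proof eventually_elim
  case (elim t)
  have "(TI x. (\<Sum>j\<in>UNIV. v (t, x) $ j * (c (t, x) * partial j (\<lambda>x. \<phi> (t, x)) x + G (t, x) $ j * \<phi> (t, x)))) = 0"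
   by (rule advection_slice[of "\<lambda>x. c (t, x)" "\<lambda>j x. G (t, x) $ j" "\<lambda>j x. v (t, x) $ j"])
    (use elim spacetime_test_slice(1)[OF \<phi>] in auto)
  then show ?case unfolding F spacetime_test_slice(2)[OF \<phi>] .
 qed
 then have "(LINT t|half_line. (TI x. ?F (t, x))) = 0" by (rule integral_eq_zero_AE)
 then show "(LINT p|spacetime. ?F p) = 0" using cyl_Fubini(3)[OF closed_atLeast Fi[unfolded spacetime_cyl]] unfolding spacetime_cyl by simp
qed

section \<open>Moment estimates for the kernel\<close>

lemma C_k_sum: "finite A \<Longrightarrow> (\<And>i. i \<in> A \<Longrightarrow> C_k n (f i)) \<Longrightarrow> C_k n (\<lambda>x. \<Sum>i\<in>A. f i x)"
 by (induction A rule: finite_induct) (auto intro: C_k_const C_k_add)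

lemma vp_kernel_wave: "vp_kernel n z = (\<Sum>k\<in>vp_freqs n. vp_coeff n k * wave k 0 z)"
proof -
 have "vp_kernel n z = Re (\<Sum>k\<in>vp_freqs n. of_real (vp_coeff n k) * char k z)"
  using vp_kernel_expansion[of n z] by (metis Re_complex_of_real)
 then show ?thesis by (simp add: wave_eq_Re)
qed

lemma torus_test_vp_kernel: "torus_test (vp_kernel n)"
proof -
 have "smooth (\<lambda>z. \<Sum>k\<in>vp_freqs n. vp_coeff n k * wave k 0 z)"
  unfolding smooth_def by (intro allI C_k_sum C_k_wave finite_freqs)
 then show ?thesis unfolding torus_test_def using periodic_vp_kernel by (simp flip: vp_kernel_wave)
qed

definition vp_deriv :: "3 \<Rightarrow> nat \<Rightarrow> real^3 \<Rightarrow> real" where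
 "vp_deriv j n = partial j (vp_kernel n)"

text \<open>The square of a derivative of the kernel is the product of this weight with \<open>n\<close> times the
 kernel; the weight and the kernel have bounded mass and second moments of order \<open>1/n\<close>.\<close>

definition vp_weight :: "3 \<Rightarrow> nat \<Rightarrow> real^3 \<Rightarrow> real" where
 "vp_weight j n z = 4 * real n * pi\<^sup>2 * (cos_kernel ((\<lambda>_. n)(j := n - 1)) z * (sin (pi * z $ j))\<^sup>2) / wallis n ^ 3"

lemma vp_weight_nonneg [simp]: "0 \<le> vp_weight j n z"
 using wallis_pos[of n] by (simp add: vp_weight_def cos_kernel_nonneg)

lemma continuous_vp_deriv: "continuous_on A (vp_deriv j n)"
 unfolding vp_deriv_def by (intro continuous_torus_test torus_test_vp_kernel)

lemma periodic_vp_deriv: "periodic (vp_deriv j n)"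
 unfolding vp_deriv_def using torus_test_dir_deriv[OF torus_test_vp_kernel] by (simp add: torus_test_def)

lemma continuous_vp_weight: "continuous_on A (vp_weight j n)"
 unfolding vp_weight_def[abs_def] using wallis_pos[of n] by (intro continuous_intros) auto

lemma periodic_vp_weight: "periodic (vp_weight j n)"
 using periodic_cos_kernel periodic_sin_sq[of j] by (simp add: periodic_def vp_weight_def)

lemma vp_weight_even: "vp_weight j n (- z) = vp_weight j n z"
 by (simp add: vp_weight_def cos_kernel_even)

lemma vp_deriv_sq:
 assumes "n = Suc p" shows "(vp_deriv j n z)\<^sup>2 = vp_weight j n z * (real n * vp_kernel n z)"
proof -
 let ?R = "\<Prod>i\<in>UNIV - {j}. cos (pi * z $ i) ^ (2 * n)" and ?W = "wallis n ^ 3"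
 let ?c = "cos (pi * z $ j)" and ?s = "sin (pi * z $ j)"
 have W: "?W > 0" using wallis_pos by simp
 have line: "vp_kernel n (z + h *\<^sub>R axis j 1) = cos (pi * (z $ j + h)) ^ (2 * n) * ?R / ?W" for h
  unfolding vp_kernel_def cos_kernel_def
  by (subst prod.remove[of UNIV j]) (auto simp: axis_def intro!: prod.cong)
 have "((\<lambda>h. cos (pi * (z $ j + h)) ^ (2 * n)) has_real_derivative
   real (2 * n) * ?c ^ (2 * n - 1) * (- ?s * pi)) (at 0)"
  by (auto intro!: derivative_eq_intros)
 then have "((\<lambda>h. cos (pi * (z $ j + h)) ^ (2 * n) * ?R / ?W) has_real_derivative
   (real (2 * n) * ?c ^ (2 * n - 1) * (- ?s * pi)) * ?R / ?W) (at 0)"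
  by (intro DERIV_cdivide DERIV_cmult_right)
 then have D1: "((\<lambda>h. vp_kernel n (z + h *\<^sub>R axis j 1)) has_real_derivative
   (real (2 * n) * ?c ^ (2 * n - 1) * (- ?s * pi)) * ?R / ?W) (at 0)"
  unfolding line .
 have d: "vp_kernel n differentiable (at z)"
  using torus_test_vp_kernel by (simp add: torus_test_def smooth_differentiable)
 have "((\<lambda>h. vp_kernel n (z + h *\<^sub>R axis j 1)) has_derivative (\<lambda>t. dir_deriv (t *\<^sub>R axis j 1) (vp_kernel n) (z + 0 *\<^sub>R axis j 1))) (at 0)"
  by (rule has_derivative_compose[of "\<lambda>h. z + h *\<^sub>R axis j 1" "\<lambda>t. t *\<^sub>R axis j 1"])
   (auto intro!: derivative_eq_intros has_derivative_dir_deriv d)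
 moreover have "linear (\<lambda>h. dir_deriv h (vp_kernel n) z)"
  by (rule has_derivative_linear[OF has_derivative_dir_deriv[OF d]])
 then have "(\<lambda>t. dir_deriv (t *\<^sub>R axis j 1) (vp_kernel n) z) = (\<lambda>t. t * partial j (vp_kernel n) z)"
  using linear_cmul[OF \<open>linear (\<lambda>h. dir_deriv h (vp_kernel n) z)\<close>] by simp
 ultimately have "((\<lambda>h. vp_kernel n (z + h *\<^sub>R axis j 1)) has_derivative (\<lambda>t. t * partial j (vp_kernel n) z)) (at 0)"
  by simp
 then have "((\<lambda>h. vp_kernel n (z + h *\<^sub>R axis j 1)) has_real_derivative vp_deriv j n z) (at 0)"
  unfolding has_field_derivative_def vp_deriv_def by (simp only: mult.commute[of _ "dir_deriv _ _ _"])
 from DERIV_unique[OF this D1]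
 have e: "vp_deriv j n z = (real (2 * n) * ?c ^ (2 * n - 1) * (- ?s * pi)) * ?R / ?W" .
 have K: "vp_kernel n z = ?c ^ (2 * n) * ?R / ?W" using line[of 0] by simp
 have P: "cos_kernel ((\<lambda>_. n)(j := n - 1)) z = ?c ^ (2 * (n - 1)) * ?R"
  unfolding cos_kernel_def by (subst prod.remove[of UNIV j]) (auto intro!: prod.cong)
 have pw: "(?c ^ (2 * n - 1))\<^sup>2 = ?c ^ (2 * (n - 1)) * ?c ^ (2 * n)"
  using assms by (simp add: power2_eq_square mult_ac)
 have "(vp_deriv j n z)\<^sup>2 = 4 * (real n)\<^sup>2 * pi\<^sup>2 * ?s\<^sup>2 * (?c ^ (2 * n - 1))\<^sup>2 * ?R\<^sup>2 / ?W\<^sup>2"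
  unfolding e by (simp add: power_mult_distrib power_divide)
 also have "\<dots> = vp_weight j n z * (real n * vp_kernel n z)"
  unfolding vp_weight_def K P pw by (simp add: power2_eq_square)
 finally show ?thesis .
qed

lemma vp_weight_mass:
 assumes n: "n = Suc p" shows "(TI z. vp_weight j n z) \<le> 4 * pi\<^sup>2"
proof -
 let ?m = "(\<lambda>_. n)(j := n - 1) :: 3 \<Rightarrow> nat"
 have m': "?m(j := Suc (?m j)) = (\<lambda>_. n)" using n by auto
 have w: "wallis n = wallis p * (2 * real p + 1) / (2 * real p + 2)" unfolding n by (rule wallis_Suc)
 have pr: "(\<Prod>i\<in>UNIV. wallis (?m i)) = wallis p * wallis n ^ 2"
  using n by (subst prod.remove[of UNIV j]) (auto simp: card_Diff_singleton)
 have "(TI z. vp_weight j n z) = 4 * real n * pi\<^sup>2 * (wallis p * wallis n ^ 2 - wallis n ^ 3) / wallis n ^ 3"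
  unfolding vp_weight_def cos_kernel_sin2 m'
  by (simp add: integral_cos_kernel pr[simplified] continuous_integrable_torus continuous_cos_kernel)
 also have "\<dots> = 4 * real n * pi\<^sup>2 * (wallis p / wallis n - 1)"
  using wallis_pos[of n] by (simp add: field_simps power2_eq_square power3_eq_cube)
 also have "wallis p / wallis n - 1 = 1 / (2 * real p + 1)"
  unfolding w using wallis_pos[of p] by (simp add: divide_simps)
 also have "4 * real n * pi\<^sup>2 * (1 / (2 * real p + 1)) = 4 * pi\<^sup>2 * (real n / (2 * real p + 1))" by simp
 also have "\<dots> \<le> 4 * pi\<^sup>2 * 1" using n by (intro mult_left_mono) auto
 finally show ?thesis by simp
qed

lemma vp_weight_sin2_moment:
 assumes n: "n = Suc p"
 shows "(TI z. vp_weight j n z * (sin (pi * z $ i))\<^sup>2) \<le> 6 * pi\<^sup>2 / (real n + 1)"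
proof -
 let ?m = "(\<lambda>_. n)(j := n - 1) :: 3 \<Rightarrow> nat" and ?u = "\<lambda>_::3. n"
 let ?W = "wallis n"
 let ?Q = "(\<Prod>l\<in>UNIV. wallis ((?m(i := Suc (?m i))) l))"
 let ?E = "4 * real n * pi\<^sup>2 / ?W ^ 3 * (wallis p * ?W ^ 2 - ?Q - (?W ^ 3 - wallis (Suc n) * ?W ^ 2))"
 have m': "?m(j := Suc (?m j)) = ?u" using n by auto
 have W: "?W > 0" by (rule wallis_pos)
 have w: "?W = wallis p * (2 * real p + 1) / (2 * real p + 2)" unfolding n by (rule wallis_Suc)
 have wp: "wallis p = ?W * (2 * real p + 2) / (2 * real p + 1)" unfolding w by (simp add: divide_simps)
 have w1: "wallis (Suc n) = ?W * (2 * real n + 1) / (2 * real n + 2)" by (rule wallis_Suc)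
 have cancel: "q / w ^ 3 * (w * a / b * w\<^sup>2 - w ^ 3 - (w ^ 3 - w * d / e * w\<^sup>2)) = q * (a / b - 2 + d / e)"
  if "w > 0" for q w a b d e :: real
 proof -
  have "w * a / b * w\<^sup>2 - w ^ 3 - (w ^ 3 - w * d / e * w\<^sup>2) = w ^ 3 * (a / b - 2 + d / e)"
   by (simp add: power2_eq_square power3_eq_cube algebra_simps)
  then show ?thesis using that by simp
 qed
 have cancel2: "q / w ^ 3 * (w * a / b * w\<^sup>2 - w * a / b * (w * d / e * w) - (w ^ 3 - w * d / e * w\<^sup>2)) = q * ((a / b - 1) * (1 - d / e))"
  if "w > 0" for q w a b d e :: real
 proof -
  have "w * a / b * w\<^sup>2 - w * a / b * (w * d / e * w) - (w ^ 3 - w * d / e * w\<^sup>2) = w ^ 3 * ((a / b - 1) * (1 - d / e))"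
   by (simp add: power2_eq_square power3_eq_cube algebra_simps)
  then show ?thesis using that by simp
 qed
 have "vp_weight j n z * (sin (pi * z $ i))\<^sup>2
   = 4 * real n * pi\<^sup>2 / ?W ^ 3 * (cos_kernel ?m z - cos_kernel (?m(i := Suc (?m i))) z
     - (cos_kernel ?u z - cos_kernel (?u(i := Suc n)) z))" for z
  unfolding vp_weight_def cos_kernel_sin2[of ?m z j] m' cos_kernel_sin2[symmetric]
  by (simp add: cos_kernel_sin2[of ?u z i, symmetric] cos_kernel_sin2[of ?m z i, symmetric] left_diff_distrib mult.assoc)
 then have "(TI z. vp_weight j n z * (sin (pi * z $ i))\<^sup>2)
   = 4 * real n * pi\<^sup>2 / ?W ^ 3 * ((\<Prod>l\<in>UNIV. wallis (?m l)) - ?Q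
     - ((\<Prod>l\<in>UNIV. wallis (?u l)) - (\<Prod>l\<in>UNIV. wallis ((?u(i := Suc n)) l))))"
  by (simp only: integral_mult_right_zero)
   (simp only: integral_cos_kernel LINT_diff continuous_integrable_torus continuous_cos_kernel continuous_on_diff L1_diff)
 also have "(\<Prod>l\<in>UNIV. wallis (?m l)) = wallis p * ?W ^ 2"
  using n by (subst prod.remove[of UNIV j]) (auto simp: card_Diff_singleton)
 also have "(\<Prod>l\<in>UNIV. wallis (?u l)) = ?W ^ 3" by simp
 also have "(\<Prod>l\<in>UNIV. wallis ((?u(i := Suc n)) l)) = wallis (Suc n) * ?W ^ 2"
  by (subst prod.remove[of UNIV i]) (auto simp: card_Diff_singleton)
 also have "?E
   \<le> 6 * pi\<^sup>2 / (real n + 1)"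
 proof (cases "i = j")
  case True
  then have "?Q = ?W ^ 3" using m' by simp
  then have "?E
    = 4 * real n * pi\<^sup>2 * ((2 * real p + 2) / (2 * real p + 1) - 2 + (2 * real n + 1) / (2 * real n + 2))"
   unfolding wp w1 by (simp only:) (rule cancel[OF W])
  also have "(2 * real p + 2) / (2 * real p + 1) - 2 + (2 * real n + 1) / (2 * real n + 2) = 3 / ((2 * real p + 1) * (2 * real n + 2))"
   unfolding n by (simp add: divide_simps) (simp add: algebra_simps)
  also have "4 * real n * pi\<^sup>2 * (3 / ((2 * real p + 1) * (2 * real n + 2))) = 6 * pi\<^sup>2 / (real n + 1) * (real n / (2 * real p + 1))"
   by (simp add: divide_simps)
  also have "\<dots> \<le> 6 * pi\<^sup>2 / (real n + 1) * 1" using n by (intro mult_left_mono) auto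
  finally show ?thesis unfolding mult_1_right .
 next
  case False
  have "?Q = wallis p * (wallis (Suc n) * ?W)"
  proof -
   have c: "card (UNIV - {j} - {i}) = 1" using False by (simp add: card_Diff_singleton)
   show ?thesis using n False c
    by (subst prod.remove[of UNIV j], simp, simp, subst prod.remove[of "UNIV - {j}" i], auto)
  qed
  then have "?E
    = 4 * real n * pi\<^sup>2 * (((2 * real p + 2) / (2 * real p + 1) - 1) * (1 - (2 * real n + 1) / (2 * real n + 2)))"
   unfolding wp w1 by (simp only:) (rule cancel2[OF W])
  also have "(2 * real p + 2) / (2 * real p + 1) - 1 = 1 / (2 * real p + 1)" by (simp add: divide_simps)
  also have "1 - (2 * real n + 1) / (2 * real n + 2) = 1 / (2 * (real n + 1))" by (simp add: divide_simps)
  also have "4 * real n * pi\<^sup>2 * (1 / (2 * real p + 1) * (1 / (2 * (real n + 1)))) = 2 * pi\<^sup>2 / (real n + 1) * (real n / (2 * real p + 1))"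
   by (simp add: divide_simps)
  also have "\<dots> \<le> 6 * pi\<^sup>2 / (real n + 1) * 1" using n by (intro mult_mono divide_right_mono) auto
  finally show ?thesis unfolding mult_1_right .
 qed
 finally show ?thesis .
qed

section \<open>Double integrals over the torus\<close>

interpretation TT: pair_sigma_finite torus torus ..

abbreviation torus2 :: "((real^3) \<times> (real^3)) measure" where
 "torus2 \<equiv> torus \<Otimes>\<^sub>M torus"

lemma continuous_measurable_pair:
 fixes g :: "(real^3) \<times> (real^3) \<Rightarrow> real"
 assumes "continuous_on UNIV g" shows "g \<in> borel_measurable torus2"
proof -
 have id: "(\<lambda>x. x) \<in> borel_measurable torus" by (rule continuous_borel_torus) simp
 have "(\<lambda>p. (fst p, snd p)) \<in> torus2 \<rightarrow>\<^sub>M borel \<Otimes>\<^sub>M borel"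
  by (intro measurable_Pair measurable_compose[OF measurable_fst id] measurable_compose[OF measurable_snd id])
 then have "(\<lambda>p. p) \<in> torus2 \<rightarrow>\<^sub>M (borel :: ((real^3) \<times> (real^3)) measure)" by (simp add: borel_prod)
 from measurable_compose[OF this borel_measurable_continuous_onI[OF assms]] show ?thesis .
qed

lemma pair_mult_integrable:
 fixes g :: "(real^3) \<times> (real^3) \<Rightarrow> real"
 assumes g: "continuous_on UNIV g" and u: "integrable torus u"
 shows "integrable torus2 (\<lambda>p. g p * u (snd p))"
proof -
 have um: "(\<lambda>p. u (snd p)) \<in> borel_measurable torus2"
  using u by (intro measurable_compose[OF measurable_snd]) auto
 have ui: "integrable torus2 (\<lambda>p. u (snd p))"
  by (rule TT.Fubini_integrable[OF um]) (use u in \<open>auto intro!: AE_I2\<close>)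
 have "bounded (g ` (cbox 0 One \<times> cbox 0 One))"
  by (intro compact_imp_bounded compact_continuous_image continuous_on_subset[OF g] compact_Times) auto
 then obtain C where C: "\<And>p. p \<in> cbox 0 One \<times> cbox 0 One \<Longrightarrow> \<bar>g p\<bar> \<le> C" by (auto simp: bounded_iff)
 show ?thesis
 proof (rule L1_bound)
  show "integrable torus2 (\<lambda>p. C * u (snd p))" using ui by auto
  show "(\<lambda>p. g p * u (snd p)) \<in> borel_measurable torus2"
   by (intro borel_measurable_times continuous_measurable_pair g um)
  show "AE p in torus2. norm (g p * u (snd p)) \<le> norm (C * u (snd p))"
  proof (rule AE_I2)
   fix p assume "p \<in> space torus2"
   then have "\<bar>g p\<bar> \<le> \<bar>C\<bar>" using C[of p] by (auto simp: space_pair_measure intro: order_trans[OF _ abs_ge_self])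
   then show "norm (g p * u (snd p)) \<le> norm (C * u (snd p))" by (simp add: abs_mult mult_right_mono)
  qed
 qed
qed

lemma pair_continuous_integrable:
 fixes g :: "(real^3) \<times> (real^3) \<Rightarrow> real"
 assumes "continuous_on UNIV g" shows "integrable torus2 g"
 using pair_mult_integrable[OF assms, of "\<lambda>_. 1"] by simp

lemma continuous_pair_diff:
 fixes Q :: "real^3 \<Rightarrow> real"
 assumes "continuous_on UNIV Q" shows "continuous_on UNIV (\<lambda>p :: (real^3) \<times> (real^3). Q (fst p - snd p))"
 by (rule continuous_on_compose2[OF assms]) (auto intro!: continuous_intros)

lemma integral_pair_shift_fst:
 fixes Q u :: "real^3 \<Rightarrow> real"
 assumes Q: "continuous_on UNIV Q" "periodic Q" and u: "integrable torus u"
 shows "(LINT p|torus2. Q (fst p - snd p) * u (snd p)) = (TI z. Q z) * (TI x. u x)"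
proof -
 have i: "integrable torus2 (\<lambda>p. Q (fst p - snd p) * u (snd p))"
  by (rule pair_mult_integrable[OF continuous_pair_diff[OF Q(1)] u])
 have "(LINT p|torus2. Q (fst p - snd p) * u (snd p)) = (TI x. (TI y. Q (y - x) * u x))"
  using TT.integral_snd[of "\<lambda>y x. Q (y - x) * u x"] i by (simp add: case_prod_unfold)
 also have "\<dots> = (TI x. (TI z. Q z) * u x)"
 proof (intro LINT_cong refl)
  fix x
  have "(TI y. Q (y + (- x))) = (TI z. Q z)" by (rule integral_torus_shift[OF Q])
  then show "(TI y. Q (y - x) * u x) = (TI z. Q z) * u x" by simp
 qed
 finally show ?thesis by simp
qed

definition rconv :: "nat \<Rightarrow> (real^3 \<Rightarrow> real) \<Rightarrow> real^3 \<Rightarrow> real" where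
 "rconv n f y = (TI x. vp_kernel n (y - x) * f x)"

lemma of_real_rconv:
 assumes "integrable torus f" shows "complex_of_real (rconv n f y) = vp_conv n (\<lambda>x. of_real (f x)) y"
 unfolding rconv_def using assms
 by (subst vp_conv_eq_integral) (auto simp flip: integral_complex_of_real)

lemma continuous_rconv: "integrable torus f \<Longrightarrow> continuous_on A (rconv n f)"
proof -
 assume f: "integrable torus f"
 have "rconv n f = (\<lambda>y. Re (vp_conv n (\<lambda>x. of_real (f x)) y))"
  using of_real_rconv[OF f] by (metis Re_complex_of_real)
 then show ?thesis by (auto intro!: continuous_intros)
qed

lemma fcoeff_trig_notin:
 assumes "finite F" "l \<notin> F" shows "fcoeff (\<lambda>x. \<Sum>k\<in>F. a k * char k x) l = 0"
proof -
 have "fcoeff (\<lambda>x. \<Sum>k\<in>F. a k * char k x) l = (TI x. (\<Sum>k\<in>F. a k * (char k x * cnj (char l x))))"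
  by (simp add: fcoeff_def sum_distrib_left mult_ac)
 also have "\<dots> = (\<Sum>k\<in>F. a k * (if k = l then 1 else 0))"
  by (subst LINT_sum)
   (auto simp: integral_char_orthonormal intro!: continuous_integrable_torus continuous_intros)
 also have "\<dots> = 0" using assms by (intro sum.neutral) auto
 finally show ?thesis .
qed

text \<open>The multiplier \<open>1 - vp_coeff\<close> is at most \<open>min 1 (3 \<bar>k\<bar>\<^sup>2 / (n + 1))\<close>, and \<open>\<bar>k\<bar>\<^sup>2\<close> is paid by derivatives.\<close>

lemma norm2_rconv_diff:
 assumes f: "Hbound 1 f M" and n: "n \<ge> 1"
 shows "norm2 (\<lambda>x. f x - rconv n f x) \<le> 9 * M / (real n + 1)"
proof -
 let ?f = "\<lambda>x. complex_of_real (f x)" and ?g = "vp_conv n (\<lambda>x. complex_of_real (f x))"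
 have fL: "f \<in> L2" and fi: "integrable torus f" using Hbound_L2[OF f] by auto
 have gL: "?g \<in> L2" by (intro continuous_in_L2 continuous_vp_conv)
 have L: "(\<lambda>x. ?f x - ?g x) \<in> L2" by (intro L2_diff L2_of_real fL gL)
 have coef: "(cmod (fcoeff (\<lambda>x. ?f x - ?g x) k))\<^sup>2
   \<le> 3 * (\<Sum>j\<in>UNIV. (of_int (k j))\<^sup>2) / (real n + 1) * (cmod (rcoeff f k))\<^sup>2" for k
 proof -
  let ?S = "\<Sum>j\<in>UNIV. (of_int (k j))\<^sup>2 :: real"
  have d: "fcoeff (\<lambda>x. ?f x - ?g x) k = rcoeff f k - fcoeff ?g k"
   by (intro fcoeff_diff) (use fi L2_integrable[OF gL] in auto)
  show ?thesis
  proof (cases "k \<in> vp_freqs n")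
   case True
   have "fcoeff ?g k = of_real (vp_coeff n k) * rcoeff f k"
    unfolding vp_conv_def[abs_def] by (rule fcoeff_trig[OF finite_freqs True])
   then have "fcoeff (\<lambda>x. ?f x - ?g x) k = of_real (1 - vp_coeff n k) * rcoeff f k"
    unfolding d by (simp add: left_diff_distrib)
   then have "(cmod (fcoeff (\<lambda>x. ?f x - ?g x) k))\<^sup>2 = (1 - vp_coeff n k)\<^sup>2 * (cmod (rcoeff f k))\<^sup>2"
    by (simp only: norm_mult norm_of_real power_mult_distrib power2_abs)
   also have "\<dots> \<le> (1 - vp_coeff n k) * (cmod (rcoeff f k))\<^sup>2"
    using vp_coeff_le_1[OF True] by (intro mult_right_mono) (auto simp: power2_eq_square mult_left_le_one_le)
   also have "\<dots> \<le> 3 * ?S / (real n + 1) * (cmod (rcoeff f k))\<^sup>2"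
    by (intro mult_right_mono one_minus_vp_coeff_le True) auto
   finally show ?thesis .
  next
   case False
   then obtain j where "int n < \<bar>k j\<bar>" by (auto simp: vp_freqs_iff not_le)
   then have "real n + 1 \<le> \<bar>of_int (k j)\<bar>" by linarith
   then have "(real n + 1)\<^sup>2 \<le> (of_int (k j))\<^sup>2" using power_mono[of "real n + 1" "\<bar>of_int (k j)\<bar>" 2] by simp
   also have "\<dots> \<le> ?S" by (intro member_le_sum) auto
   finally have "(real n + 1)\<^sup>2 \<le> ?S" .
   moreover have "real n + 1 \<le> (real n + 1)\<^sup>2" unfolding power2_eq_square by (simp add: mult_le_cancel_left1)
   moreover have "?S \<le> 3 * ?S" using sum_nonneg[of UNIV "\<lambda>j. (of_int (k j))\<^sup>2 :: real"] by simp
   ultimately have "real n + 1 \<le> 3 * ?S" by (meson order_trans)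
   then have "1 \<le> 3 * ?S / (real n + 1)" by (simp add: pos_le_divide_eq)
   moreover have "fcoeff ?g k = 0"
    unfolding vp_conv_def[abs_def] by (rule fcoeff_trig_notin[OF finite_freqs False])
   ultimately show ?thesis unfolding d using mult_right_mono[of 1 "3 * ?S / (real n + 1)" "(cmod (rcoeff f k))\<^sup>2"] by simp
  qed
 qed
 have "norm2 (\<lambda>x. ?f x - ?g x) \<le> 9 * M / (real n + 1)"
 proof (rule Parseval_le[OF L])
  fix m
  have "(\<Sum>k\<in>vp_freqs m. (cmod (fcoeff (\<lambda>x. ?f x - ?g x) k))\<^sup>2)
    \<le> (\<Sum>k\<in>vp_freqs m. 3 * (\<Sum>j\<in>UNIV. (of_int (k j))\<^sup>2) / (real n + 1) * (cmod (rcoeff f k))\<^sup>2)"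
   by (intro sum_mono coef)
  also have "\<dots> = 3 / (real n + 1) * (\<Sum>k\<in>vp_freqs m. \<Sum>j\<in>UNIV. (of_int (k j))\<^sup>2 * (cmod (rcoeff f k))\<^sup>2)"
   by (simp add: sum_distrib_left sum_distrib_right sum_divide_distrib mult_ac)
  also have "(\<Sum>k\<in>vp_freqs m. \<Sum>j\<in>UNIV. (of_int (k j))\<^sup>2 * (cmod (rcoeff f k))\<^sup>2)
    = (\<Sum>j\<in>UNIV. \<Sum>k\<in>vp_freqs m. (of_int (k j))\<^sup>2 * (cmod (rcoeff f k))\<^sup>2)" by (rule sum.swap)
  also have "3 / (real n + 1) * \<dots> \<le> 3 / (real n + 1) * (\<Sum>j\<in>(UNIV :: 3 set). M)"
   by (intro mult_left_mono sum_mono Hbound_1_deriv_sum[OF f]) auto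
  finally show "(\<Sum>k\<in>vp_freqs m. (cmod (fcoeff (\<lambda>x. ?f x - ?g x) k))\<^sup>2) \<le> 9 * M / (real n + 1)" by simp
 qed
 moreover have "?f x - ?g x = of_real (f x - rconv n f x)" for x using of_real_rconv[OF fi, of n x] by simp
 ultimately show ?thesis by (simp add: norm2_of_real del: of_real_diff)
qed

text \<open>Translation is a Fourier multiplier whose distance to one is controlled by \<open>\<bar>k\<bar>\<close>, hence by first derivatives.\<close>

lemma norm2_trig_translate:
 fixes f :: "real^3 \<Rightarrow> real"
 assumes f: "Hbound 1 f M"
 shows "norm2 (\<lambda>y. rconv n f y - rconv n f (y + z)) \<le> 12 * M * (\<Sum>i\<in>UNIV. (sin (pi * z $ i))\<^sup>2)"
proof -
 have fi: "integrable torus f" using Hbound_L2[OF f] by auto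
 define a where "a k = of_real (vp_coeff n k) * rcoeff f k" for k
 have "complex_of_real (rconv n f y - rconv n f (y + z)) = (\<Sum>k\<in>vp_freqs n. (a k * (1 - char k z)) * char k y)" for y
  unfolding of_real_diff of_real_rconv[OF fi] vp_conv_def a_def sum_subtractf[symmetric]
  by (intro sum.cong refl) (simp add: char_add algebra_simps)
 then have "norm2 (\<lambda>y. rconv n f y - rconv n f (y + z)) = (\<Sum>k\<in>vp_freqs n. (cmod (a k * (1 - char k z)))\<^sup>2)"
  using norm2_of_real[of "\<lambda>y. rconv n f y - rconv n f (y + z)"] norm2_trig[OF finite_freqs, of "\<lambda>k. a k * (1 - char k z)"] by simp
 also have "\<dots> \<le> (\<Sum>k\<in>vp_freqs n. (cmod (rcoeff f k))\<^sup>2 * (12 * (\<Sum>i\<in>UNIV. (of_int (k i))\<^sup>2 * (sin (pi * z $ i))\<^sup>2)))"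
 proof (intro sum_mono)
  fix k assume k: "k \<in> vp_freqs n"
  have "cmod (a k) \<le> 1 * cmod (rcoeff f k)"
   unfolding a_def norm_mult using vp_coeff_le_1[OF k] by (intro mult_right_mono) auto
  then have 1: "(cmod (a k))\<^sup>2 \<le> (cmod (rcoeff f k))\<^sup>2" by (intro power_mono) auto
  have 2: "(cmod (1 - char k z))\<^sup>2 \<le> 12 * (\<Sum>i\<in>UNIV. (of_int (k i))\<^sup>2 * (sin (pi * z $ i))\<^sup>2)"
   using char_minus_1_le[of k z] by (simp add: norm_minus_commute)
  show "(cmod (a k * (1 - char k z)))\<^sup>2 \<le> (cmod (rcoeff f k))\<^sup>2 * (12 * (\<Sum>i\<in>UNIV. (of_int (k i))\<^sup>2 * (sin (pi * z $ i))\<^sup>2))"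
   unfolding norm_mult power_mult_distrib by (intro mult_mono 1 2) auto
 qed
 also have "\<dots> = 12 * (\<Sum>i\<in>UNIV. (sin (pi * z $ i))\<^sup>2 * (\<Sum>k\<in>vp_freqs n. (of_int (k i))\<^sup>2 * (cmod (rcoeff f k))\<^sup>2))"
  unfolding sum_distrib_left by (subst sum.swap) (simp add: mult_ac)
 also have "\<dots> \<le> 12 * (\<Sum>i\<in>UNIV. (sin (pi * z $ i))\<^sup>2 * M)"
  by (intro mult_left_mono sum_mono Hbound_1_deriv_sum[OF f]) auto
 finally show ?thesis by (simp add: sum_distrib_left mult_ac flip: sum_distrib_right)
qed

lemma periodic_rconv: "periodic (rconv n f)"
 unfolding periodic_def
proof (intro allI)
 fix y k
 have "vp_kernel n (y + axis k 1 - x) = vp_kernel n (y - x)" for x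
  using periodic_vp_kernel[of n] unfolding periodic_def by (simp only: diff_add_eq[symmetric])
 then show "rconv n f (y + axis k 1) = rconv n f y" unfolding rconv_def by simp
qed

text \<open>Mollification moves \<open>f\<close> by \<open>O(1/\<surd>n)\<close>, and the mollified function by \<open>\<bar>y - x\<bar>\<close> between \<open>x\<close> and \<open>y\<close>; a
 weight concentrated on the scale \<open>1/\<surd>n\<close> therefore only sees differences of this order.\<close>

lemma double_diff_bound:
 assumes f: "Hbound 1 f M" and n: "n \<ge> 1"
  and Q: "continuous_on UNIV Q" "periodic Q" "\<And>z. 0 \<le> Q z" "\<And>z. Q (- z) = Q z"
 shows "integrable torus2 (\<lambda>p. (rconv n f (fst p) - f (snd p))\<^sup>2 * Q (fst p - snd p))"
  "(LINT p|torus2. (rconv n f (fst p) - f (snd p))\<^sup>2 * Q (fst p - snd p))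
   \<le> 24 * M * (\<Sum>i\<in>UNIV. (TI z. Q z * (sin (pi * z $ i))\<^sup>2)) + 18 * M / (real n + 1) * (TI z. Q z)"
proof -
 let ?b = "rconv n f"
 have fL: "f \<in> L2" and fi: "integrable torus f" using Hbound_L2[OF f] by auto
 have bc: "continuous_on UNIV ?b" by (rule continuous_rconv[OF fi])
 have bf: "continuous_on UNIV (\<lambda>p :: (real^3) \<times> (real^3). ?b (fst p))" "continuous_on UNIV (\<lambda>p :: (real^3) \<times> (real^3). ?b (snd p))"
  by (auto intro!: continuous_on_compose2[OF bc] continuous_intros)
 have Qc: "continuous_on UNIV (\<lambda>p :: (real^3) \<times> (real^3). Q (fst p - snd p))" by (rule continuous_pair_diff[OF Q(1)])
 have f2: "integrable torus (\<lambda>x. (f x)\<^sup>2)" using L2_integrable_sq[OF fL] by simp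
 have "integrable torus2 (\<lambda>p. (?b (fst p))\<^sup>2 * Q (fst p - snd p) + ((-2 * ?b (fst p) * Q (fst p - snd p)) * f (snd p) + Q (fst p - snd p) * (f (snd p))\<^sup>2))"
  by (intro L1_add pair_continuous_integrable pair_mult_integrable[where u=f] pair_mult_integrable[where u="\<lambda>x. (f x)\<^sup>2"]
    continuous_intros bf Qc fi f2)
 then show main: "integrable torus2 (\<lambda>p. (?b (fst p) - f (snd p))\<^sup>2 * Q (fst p - snd p))"
  by (simp add: power2_diff algebra_simps)
 let ?d1 = "\<lambda>p. (?b (fst p) - ?b (snd p))\<^sup>2 * Q (fst p - snd p)"
 let ?d2 = "\<lambda>p. Q (fst p - snd p) * (f (snd p) - ?b (snd p))\<^sup>2"
 have i1: "integrable torus2 ?d1" by (intro pair_continuous_integrable continuous_intros bf Qc)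
 have dL: "(\<lambda>x. f x - ?b x) \<in> L2" by (intro L2_diff fL continuous_in_L2 bc)
 have d2: "integrable torus (\<lambda>x. (f x - ?b x)\<^sup>2)" using L2_integrable_sq[OF dL] by simp
 have i2: "integrable torus2 ?d2" using pair_mult_integrable[OF Qc d2] .
 have "(LINT p|torus2. (?b (fst p) - f (snd p))\<^sup>2 * Q (fst p - snd p))
   \<le> (LINT p|torus2. 2 * ?d1 p + 2 * ?d2 p)"
 proof (rule integral_mono[OF main])
  show "integrable torus2 (\<lambda>p. 2 * ?d1 p + 2 * ?d2 p)" using i1 i2 by simp
  fix p
  have "(x - y)\<^sup>2 \<le> 2 * (x - w)\<^sup>2 + 2 * (y - w)\<^sup>2" for x y w :: real
   using sum_squares_bound[of "x - w" "w - y"] by (simp add: power2_eq_square algebra_simps)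
  from mult_right_mono[OF this Q(3)] show "(?b (fst p) - f (snd p))\<^sup>2 * Q (fst p - snd p) \<le> 2 * ?d1 p + 2 * ?d2 p"
   by (simp add: distrib_right mult.assoc mult.commute[of "Q _"])
 qed
 also have "\<dots> = 2 * (LINT p|torus2. ?d1 p) + 2 * (LINT p|torus2. ?d2 p)" using i1 i2 by simp
 also have "(LINT p|torus2. ?d2 p) = (TI z. Q z) * norm2 (\<lambda>x. f x - ?b x)"
  unfolding norm2_def using integral_pair_shift_fst[OF Q(1,2) d2] by simp
 also have "(LINT p|torus2. ?d1 p) \<le> 12 * M * (\<Sum>i\<in>UNIV. (TI z. Q z * (sin (pi * z $ i))\<^sup>2))"
 proof -
  let ?G = "\<lambda>p :: (real^3) \<times> (real^3). (?b (fst p) - ?b (fst p + snd p))\<^sup>2 * Q (snd p)"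
  have bs: "continuous_on UNIV (\<lambda>p :: (real^3) \<times> (real^3). ?b (fst p + snd p))" "continuous_on UNIV (\<lambda>p :: (real^3) \<times> (real^3). Q (snd p))"
   by (auto intro!: continuous_on_compose2[OF bc] continuous_on_compose2[OF Q(1)] continuous_intros)
  have iG: "integrable torus2 ?G" by (intro pair_continuous_integrable continuous_intros bf bs)
  have "(LINT p|torus2. ?d1 p) = (TI y. (TI x. ?d1 (y, x)))"
   by (rule TT.integral_fst'[OF i1, symmetric])
  also have "\<dots> = (TI y. (TI x. ?G (y, x)))"
  proof (rule LINT_cong[OF refl])
   fix y
   let ?h = "\<lambda>x. (?b y - ?b x)\<^sup>2 * Q (y - x)"
   have hc: "continuous_on UNIV ?h"
    by (intro continuous_intros bc continuous_on_compose2[OF Q(1)]) auto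
   have hp: "periodic ?h" unfolding periodic_def
   proof (intro allI)
    fix x k
    have "Q (y - (x + axis k 1)) = Q (x + axis k 1 - y)" using Q(4)[of "x + axis k 1 - y"] by simp
    also have "\<dots> = Q (x - y + axis k 1)" by (simp only: diff_add_eq)
    also have "\<dots> = Q (x - y)" using Q(2) by (simp add: periodic_def)
    also have "\<dots> = Q (y - x)" using Q(4)[of "x - y"] by simp
    finally show "?h (x + axis k 1) = ?h x" using periodic_rconv[of n f] by (simp add: periodic_def)
   qed
   have "(TI x. ?h (x + y)) = (TI x. ?h x)" by (rule integral_torus_shift[OF hc hp])
   then show "(TI x. ?d1 (y, x)) = (TI x. ?G (y, x))"
    using Q(4) by (simp add: add.commute)
  qed
  also have "\<dots> = (TI x. (TI y. ?G (y, x)))"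
   using TT.Fubini_integral[of "\<lambda>y x. ?G (y, x)"] iG by (simp add: case_prod_unfold)
  also have "\<dots> = (TI x. norm2 (\<lambda>y. ?b y - ?b (y + x)) * Q x)"
   unfolding norm2_def by simp
  also have "\<dots> \<le> (TI x. 12 * M * (\<Sum>i\<in>UNIV. Q x * (sin (pi * x $ i))\<^sup>2))"
  proof (rule integral_mono)
   have "integrable torus (\<lambda>x. (TI y. ?G (y, x)))"
    using TT.integrable_snd[of "\<lambda>y x. ?G (y, x)"] iG by (simp add: case_prod_unfold)
   then show "integrable torus (\<lambda>x. norm2 (\<lambda>y. ?b y - ?b (y + x)) * Q x)" unfolding norm2_def by simp
   show "integrable torus (\<lambda>x. 12 * M * (\<Sum>i\<in>UNIV. Q x * (sin (pi * x $ i))\<^sup>2))"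
    by (intro continuous_integrable_torus continuous_intros Q(1))
   fix x
   show "norm2 (\<lambda>y. ?b y - ?b (y + x)) * Q x \<le> 12 * M * (\<Sum>i\<in>UNIV. Q x * (sin (pi * x $ i))\<^sup>2)"
    using mult_right_mono[OF norm2_trig_translate[OF f, of n x] Q(3)[of x]]
    by (simp add: sum_distrib_left mult_ac sum_distrib_right)
  qed
  also have "\<dots> = 12 * M * (\<Sum>i\<in>UNIV. (TI z. Q z * (sin (pi * z $ i))\<^sup>2))"
   by (subst integral_mult_right_zero, subst LINT_sum)
    (auto intro!: continuous_integrable_torus continuous_intros Q(1))
  finally show ?thesis .
 qed
 also have "(TI z. Q z) * norm2 (\<lambda>x. f x - ?b x) \<le> (TI z. Q z) * (9 * M / (real n + 1))"
  by (intro mult_left_mono norm2_rconv_diff[OF f n] LINT_nonneg Q(3))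
 finally show "(LINT p|torus2. (?b (fst p) - f (snd p))\<^sup>2 * Q (fst p - snd p))
   \<le> 24 * M * (\<Sum>i\<in>UNIV. (TI z. Q z * (sin (pi * z $ i))\<^sup>2)) + 18 * M / (real n + 1) * (TI z. Q z)"
  by (simp add: algebra_simps)
qed

section \<open>A convex substitute for the negative part\<close>

definition neg_slope :: "real \<Rightarrow> real \<Rightarrow> real" where
 "neg_slope \<delta> s = max (- 1) (min 0 (s / \<delta>))"

text \<open>A smoothing of the negative part with derivative \<^term>\<open>neg_slope \<delta>\<close>, written as the Legendre
 transform of \<open>\<delta> p\<^sup>2 / 2\<close> on \<open>-1 \<le> p \<le> 0\<close>.\<close>

definition neg_part :: "real \<Rightarrow> real \<Rightarrow> real" where
 "neg_part \<delta> s = neg_slope \<delta> s * s - \<delta> * (neg_slope \<delta> s)\<^sup>2 / 2"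

lemma neg_slope_bounds: "- 1 \<le> neg_slope \<delta> s" "neg_slope \<delta> s \<le> 0" "\<bar>neg_slope \<delta> s\<bar> \<le> 1"
 by (auto simp: neg_slope_def)

lemma neg_slope_cases:
 assumes "\<delta> > 0"
 obtains "0 \<le> s" "neg_slope \<delta> s = 0" | "s \<le> - \<delta>" "neg_slope \<delta> s = - 1" | "- \<delta> < s" "s < 0" "neg_slope \<delta> s = s / \<delta>"
proof -
 consider "0 \<le> s" | "s \<le> - \<delta>" | "- \<delta> < s" "s < 0" by linarith
 then show ?thesis
 proof cases
  case 1 then show ?thesis using assms by (intro that(1)) (auto simp: neg_slope_def)
 next
  case 2 then show ?thesis using assms by (intro that(2)) (auto simp: neg_slope_def field_simps min_def max_def)
 next
  case 3 then show ?thesis using assms by (intro that(3)) (auto simp: neg_slope_def field_simps min_def max_def)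
 qed
qed

lemma continuous_neg_slope [continuous_intros]: "continuous_on A f \<Longrightarrow> continuous_on A (\<lambda>x. neg_slope \<delta> (f x))"
 unfolding neg_slope_def divide_inverse by (intro continuous_intros)

lemma continuous_neg_part [continuous_intros]: "continuous_on A f \<Longrightarrow> continuous_on A (\<lambda>x. neg_part \<delta> (f x))"
 unfolding neg_part_def by (intro continuous_intros) auto

lemma neg_slope_Lipschitz:
 assumes "\<delta> > 0" shows "\<bar>neg_slope \<delta> b - neg_slope \<delta> a\<bar> \<le> \<bar>b - a\<bar> / \<delta>"
proof -
 have "\<bar>neg_slope \<delta> b - neg_slope \<delta> a\<bar> \<le> \<bar>b / \<delta> - a / \<delta>\<bar>" unfolding neg_slope_def by linarith
 also have "\<dots> = \<bar>b - a\<bar> / \<delta>" using assms by (simp flip: diff_divide_distrib)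
 finally show ?thesis .
qed

lemma neg_part_le_tangent:
 assumes \<delta>: "\<delta> > 0" shows "neg_part \<delta> b - neg_part \<delta> a \<le> neg_slope \<delta> b * (b - a)"
proof -
 let ?p = "neg_slope \<delta> b" and ?q = "neg_slope \<delta> a"
 \<comment> \<open>The value \<^term>\<open>neg_part \<delta> a\<close> is the maximum of \<open>p a - \<delta> p\<^sup>2 / 2\<close> over \<open>-1 \<le> p \<le> 0\<close>.\<close>
 have "0 \<le> (?q - ?p) * (a - \<delta> * (?q + ?p) / 2)"
 proof (rule neg_slope_cases[OF \<delta>, of a])
  assume "0 \<le> a" "neg_slope \<delta> a = 0"
  moreover have "\<delta> * ?p \<le> 0" using \<delta> neg_slope_bounds by (simp add: mult_nonneg_nonpos)
  ultimately show ?thesis using neg_slope_bounds(2)[of \<delta> b] by (intro mult_nonneg_nonneg) auto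
 next
  assume a: "a \<le> - \<delta>" "neg_slope \<delta> a = - 1"
  have "- \<delta> \<le> \<delta> * ?p" using mult_left_mono[OF neg_slope_bounds(1)[of \<delta> b], of \<delta>] \<delta> by simp
  then have "a - \<delta> * (?q + ?p) / 2 \<le> 0" using a by (simp add: algebra_simps)
  then show ?thesis using a neg_slope_bounds(1)[of \<delta> b] by (intro mult_nonpos_nonpos) auto
 next
  assume "neg_slope \<delta> a = a / \<delta>"
  then have "a = \<delta> * ?q" using \<delta> by simp
  then have "a - \<delta> * (?q + ?p) / 2 = \<delta> / 2 * (?q - ?p)" by (simp add: field_simps)
  then have "(?q - ?p) * (a - \<delta> * (?q + ?p) / 2) = (?q - ?p) * (\<delta> / 2 * (?q - ?p))" by (simp only:)
  also have "\<dots> = \<delta> / 2 * (?q - ?p)\<^sup>2" by (simp add: power2_eq_square)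
  also have "\<dots> \<ge> 0" using \<delta> by simp
  finally show ?thesis .
 qed
 also have "\<dots> = neg_slope \<delta> b * (b - a) - (neg_part \<delta> b - neg_part \<delta> a)"
  unfolding neg_part_def by (simp add: power2_eq_square algebra_simps add_divide_distrib diff_divide_distrib)
 finally show ?thesis by simp
qed

lemma neg_part_nonneg_arg: "\<delta> > 0 \<Longrightarrow> 0 \<le> s \<Longrightarrow> neg_part \<delta> s = 0"
 by (rule neg_slope_cases[of \<delta> s]) (auto simp: neg_part_def)

lemma neg_part_ge: "\<delta> > 0 \<Longrightarrow> max 0 (- s) - \<delta> / 2 \<le> neg_part \<delta> s"
proof (rule neg_slope_cases[of \<delta> s])
 assume d: "\<delta> > 0" and s: "- \<delta> < s" "s < 0" "neg_slope \<delta> s = s / \<delta>"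
 have "neg_part \<delta> s - (- s - \<delta> / 2) = (s + \<delta>)\<^sup>2 / (2 * \<delta>)"
  unfolding neg_part_def s(3) using d by (simp add: field_simps power2_eq_square)
 also have "\<dots> \<ge> 0" using d by simp
 finally show ?thesis using s by (simp add: max_def)
qed (auto simp: neg_part_def)

text \<open>The slope is Lipschitz with constant \<open>1/\<delta>\<close> but only changes for arguments in \<open>[-\<delta>, 0]\<close>; the factor
 \<open>\<bar>a\<bar>\<close> makes the bound uniform in \<open>\<delta>\<close>.\<close>

lemma abs_mult_neg_slope_diff:
 assumes \<delta>: "\<delta> > 0" shows "\<bar>a\<bar> * \<bar>neg_slope \<delta> b - neg_slope \<delta> a\<bar> \<le> \<bar>b - a\<bar>"
proof -
 have L: "\<bar>neg_slope \<delta> b - neg_slope \<delta> a\<bar> \<le> \<bar>b - a\<bar> / \<delta>" by (rule neg_slope_Lipschitz[OF \<delta>])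
 show ?thesis
 proof (rule neg_slope_cases[OF \<delta>, of a])
  assume a: "0 \<le> a" "neg_slope \<delta> a = 0"
  show ?thesis
  proof (cases "0 \<le> b")
   case True
   then have "neg_slope \<delta> b = 0" using \<delta> by (cases rule: neg_slope_cases[OF \<delta>, of b]) auto
   then show ?thesis using a by simp
  next
   case False
   then show ?thesis using a mult_left_mono[OF neg_slope_bounds(3)[of \<delta> b], of a] by simp
  qed
 next
  assume a: "a \<le> - \<delta>" "neg_slope \<delta> a = - 1"
  show ?thesis
  proof (rule neg_slope_cases[OF \<delta>, of b])
   assume b: "- \<delta> < b" "b < 0" "neg_slope \<delta> b = b / \<delta>"
   have "0 \<le> b / \<delta> + 1" using b \<delta> by (simp add: field_simps)
   then have "\<bar>a\<bar> * \<bar>neg_slope \<delta> b - neg_slope \<delta> a\<bar> = - a * (b / \<delta> + 1)"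
    unfolding a(2) b(3) using a(1) \<delta> by simp
   also have "\<dots> = - a + (- a / \<delta>) * b" by (simp add: algebra_simps)
   also have "\<dots> \<le> - a + 1 * b" using a b \<delta> by (intro add_left_mono mult_right_mono_neg) (auto simp: field_simps)
   finally show ?thesis using a b by simp
  qed (use a \<delta> in auto)
 next
  assume a: "- \<delta> < a" "a < 0" "neg_slope \<delta> a = a / \<delta>"
  have "\<bar>a\<bar> * \<bar>neg_slope \<delta> b - neg_slope \<delta> a\<bar> \<le> \<delta> * (\<bar>b - a\<bar> / \<delta>)" using a L by (intro mult_mono) auto
  then show ?thesis using \<delta> by simp
 qed
qed

lemma neg_slope_change_localised:
 assumes \<delta>: "\<delta> > 0" "\<delta> \<le> \<eta> / 2" and a: "a \<noteq> 0" "neg_slope \<delta> b \<noteq> neg_slope \<delta> a" "\<eta> \<le> \<bar>a\<bar>"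
 shows "\<eta> / 2 \<le> \<bar>b - a\<bar>"
proof -
 consider "\<eta> \<le> a" | "a \<le> - \<eta>" using a(3) by linarith
 then show ?thesis
 proof cases
  case 1
  then have "b < 0" using a \<delta> by (cases rule: neg_slope_cases[OF \<delta>(1), of a]; cases rule: neg_slope_cases[OF \<delta>(1), of b]) auto
  then show ?thesis using 1 \<delta> by linarith
 next
  case 2
  then have "- \<delta> < b" using a \<delta> by (cases rule: neg_slope_cases[OF \<delta>(1), of a]; cases rule: neg_slope_cases[OF \<delta>(1), of b]) auto
  then show ?thesis using 2 \<delta> by linarith
 qed
qed

section \<open>The commutator estimate\<close>

text \<open>The weight that survives the limit \<open>n \<rightarrow> \<infinity>\<close>.\<close>

definition bad :: "real \<Rightarrow> real \<Rightarrow> real \<Rightarrow> real \<Rightarrow> real" where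
 "bad \<eta> R a v = v\<^sup>2 * (if 0 < \<bar>a\<bar> \<and> \<bar>a\<bar> < \<eta> then 1 else 0) + v\<^sup>2 * (if R < v\<^sup>2 then 1 else 0)"

lemma bad_bounds: "0 \<le> bad \<eta> R a v" "bad \<eta> R a v \<le> 2 * v\<^sup>2"
 by (auto simp: bad_def)

lemma bad_measurable:
 assumes "f \<in> borel_measurable M" "u \<in> borel_measurable M" shows "(\<lambda>x. bad \<eta> R (f x) (u x)) \<in> borel_measurable M"
 unfolding bad_def using assms by measurable

text \<open>Pointwise form of the commutator estimate.  The velocity is estimated by \<open>R\<close> except where it
 is large, and a point where \<open>\<bar>a\<bar> \<ge> \<eta>\<close> only contributes if \<open>b\<close> has moved away from \<open>a\<close> by \<open>\<eta>/2\<close>.\<close>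

lemma neg_slope_commutator_pointwise:
 fixes a b v k P Q \<mu> \<eta> R :: real
 assumes \<mu>: "\<mu> > 0" and \<delta>: "\<delta> > 0" "\<delta> \<le> \<eta> / 2" and R: "0 \<le> R" and k: "k\<^sup>2 = P * Q" "0 \<le> P" "0 \<le> Q"
 shows "\<bar>(neg_slope \<delta> b - neg_slope \<delta> a) * (a * v) * k\<bar>
  \<le> \<mu> / 2 * (P * bad \<eta> R a v + 4 * R / \<eta>\<^sup>2 * ((b - a)\<^sup>2 * P)) + 1 / (2 * \<mu>) * ((b - a)\<^sup>2 * Q)"
proof (cases "neg_slope \<delta> b = neg_slope \<delta> a \<or> a = 0")
 case True
 have "0 \<le> \<mu> / 2 * (P * bad \<eta> R a v + 4 * R / \<eta>\<^sup>2 * ((b - a)\<^sup>2 * P)) + 1 / (2 * \<mu>) * ((b - a)\<^sup>2 * Q)"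
  using \<mu> R k(2,3) by (intro add_nonneg_nonneg mult_nonneg_nonneg bad_bounds divide_nonneg_nonneg) auto
 then show ?thesis using True by auto
next
 case False
 have \<eta>: "\<eta> > 0" using \<delta> by simp
 have v: "v\<^sup>2 \<le> bad \<eta> R a v + 4 * R / \<eta>\<^sup>2 * (b - a)\<^sup>2"
 proof (cases "\<bar>a\<bar> < \<eta>")
  case True
  then have "v\<^sup>2 \<le> bad \<eta> R a v" using False by (auto simp: bad_def)
  moreover have "0 \<le> 4 * R / \<eta>\<^sup>2 * (b - a)\<^sup>2" using R by simp
  ultimately show ?thesis by linarith
 next
  case a: False
  show ?thesis
  proof (cases "R < v\<^sup>2")
   case True
   then have "v\<^sup>2 \<le> bad \<eta> R a v" by (auto simp: bad_def)
   moreover have "0 \<le> 4 * R / \<eta>\<^sup>2 * (b - a)\<^sup>2" using R by simp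
   ultimately show ?thesis by linarith
  next
   case small: False
   have "\<eta> / 2 \<le> \<bar>b - a\<bar>" by (rule neg_slope_change_localised[OF \<delta>]) (use False a in auto)
   then have "(\<eta> / 2)\<^sup>2 \<le> (b - a)\<^sup>2" using power_mono[of "\<eta> / 2" "\<bar>b - a\<bar>" 2] \<eta> by simp
   then have "1 \<le> 4 / \<eta>\<^sup>2 * (b - a)\<^sup>2" using \<eta> by (simp add: field_simps)
   then have "R * 1 \<le> R * (4 / \<eta>\<^sup>2 * (b - a)\<^sup>2)" using R by (intro mult_left_mono) auto
   moreover have "R * (4 / \<eta>\<^sup>2 * (b - a)\<^sup>2) = 4 * R / \<eta>\<^sup>2 * (b - a)\<^sup>2" by simp
   ultimately show ?thesis using small bad_bounds(1)[of \<eta> R a v] by linarith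
  qed
 qed
 have "\<bar>(neg_slope \<delta> b - neg_slope \<delta> a) * (a * v) * k\<bar> = (\<bar>a\<bar> * \<bar>neg_slope \<delta> b - neg_slope \<delta> a\<bar>) * (\<bar>v\<bar> * \<bar>k\<bar>)"
  by (simp add: abs_mult)
 also have "\<dots> \<le> \<bar>b - a\<bar> * (\<bar>v\<bar> * \<bar>k\<bar>)" by (intro mult_right_mono abs_mult_neg_slope_diff[OF \<delta>(1)]) auto
 also have "\<dots> \<le> \<mu> / 2 * (v\<^sup>2 * P) + 1 / (2 * \<mu>) * ((b - a)\<^sup>2 * Q)"
 proof -
  let ?s = "sqrt P" and ?t = "sqrt Q"
  have kk: "\<bar>k\<bar> = ?s * ?t" using k real_sqrt_abs[of k] by (simp add: real_sqrt_mult)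
  have "0 \<le> (\<mu> * (\<bar>v\<bar> * ?s) - \<bar>b - a\<bar> * ?t)\<^sup>2 / (2 * \<mu>)" using \<mu> by simp
  also have "\<dots> = (\<mu>\<^sup>2 * (v\<^sup>2 * P) + (b - a)\<^sup>2 * Q - 2 * \<mu> * (\<bar>b - a\<bar> * (\<bar>v\<bar> * \<bar>k\<bar>))) / (2 * \<mu>)"
   unfolding power2_diff[of "\<mu> * (\<bar>v\<bar> * ?s)"] kk power_mult_distrib using k(2,3) by (simp add: mult_ac)
  also have "\<dots> = \<mu> / 2 * (v\<^sup>2 * P) + 1 / (2 * \<mu>) * ((b - a)\<^sup>2 * Q) - \<bar>b - a\<bar> * (\<bar>v\<bar> * \<bar>k\<bar>)"
   using \<mu> by (simp add: field_simps power2_eq_square)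
  finally show ?thesis by simp
 qed
 also have "v\<^sup>2 * P \<le> (bad \<eta> R a v + 4 * R / \<eta>\<^sup>2 * (b - a)\<^sup>2) * P" by (intro mult_right_mono v k)
 also have "\<dots> = P * bad \<eta> R a v + 4 * R / \<eta>\<^sup>2 * ((b - a)\<^sup>2 * P)" by (simp add: algebra_simps)
 finally show ?thesis using \<mu> by simp
qed

lemma integral_vp_deriv: "(TI z. vp_deriv j n z) = 0"
 unfolding vp_deriv_def
proof (rule integral_torus_deriv_eq_0)
 show "vp_kernel n differentiable (at x)" for x
  using torus_test_vp_kernel by (simp add: torus_test_def smooth_differentiable)
qed (use continuous_vp_deriv[of UNIV j n] in \<open>auto simp: periodic_vp_kernel vp_deriv_def\<close>)

lemma bad_integrable:
 assumes "f \<in> L2" "u \<in> L2" shows "integrable torus (\<lambda>x. bad \<eta> R (f x) (u x))"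
proof (rule L1_bound)
 show "integrable torus (\<lambda>x. 2 * (u x)\<^sup>2)" using L2_integrable_sq[OF assms(2)] by auto
 show "(\<lambda>x. bad \<eta> R (f x) (u x)) \<in> borel_measurable torus" by (intro bad_measurable L2_measurable assms)
qed (use bad_bounds in auto)

text \<open>Testing the mollified flux with \<open>neg_slope\<close> of the mollified density.  Since the derivative of the
 kernel has mean zero, \<open>neg_slope\<close> of the density itself may be subtracted, and only the commutator
 remains; the derivative of the kernel, of size \<open>\<surd>n\<close>, is compensated by the oscillation of \<open>f\<close>,
 of size \<open>1/\<surd>n\<close>.\<close>

lemma flux_commutator:
 fixes f u :: "real^3 \<Rightarrow> real"
 assumes f: "Hbound 1 f M" and u: "u \<in> L2" and n: "n = Suc p" and \<eta>: "\<eta> > 0" and \<mu>: "\<mu> > 0" and R: "0 \<le> R"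
 shows "\<bar>TI y. neg_slope (\<eta> / 2) (rconv n f y) * (TI x. f x * u x * vp_deriv j n (y - x))\<bar>
  \<le> \<mu> / 2 * (4 * pi\<^sup>2 * (TI x. bad \<eta> R (f x) (u x)) + 4 * R / \<eta>\<^sup>2 * (504 * pi\<^sup>2 * M / (real n + 1)))
   + 27 * M / \<mu>"
proof -
 let ?T = "neg_slope (\<eta> / 2)" and ?b = "rconv n f" and ?k = "vp_deriv j n" and ?P = "vp_weight j n"
 let ?Q = "\<lambda>z. real n * vp_kernel n z"
 have \<delta>: "\<eta> / 2 > 0" "\<eta> / 2 \<le> \<eta> / 2" using \<eta> by auto
 have fL: "f \<in> L2" and fi: "integrable torus f" and M: "0 \<le> M" using Hbound_L2[OF f] by auto
 have fu: "integrable torus (\<lambda>x. f x * u x)" by (rule L2_mult_integrable[OF fL u])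
 have Tm: "?T \<in> borel_measurable borel" by (intro borel_measurable_continuous_onI continuous_neg_slope continuous_on_id)
 have Tfu: "integrable torus (\<lambda>x. ?T (f x) * (f x * u x))"
 proof (rule L1_bound[OF fu])
  show "(\<lambda>x. ?T (f x) * (f x * u x)) \<in> borel_measurable torus"
   by (intro borel_measurable_times measurable_compose[OF L2_measurable[OF fL] Tm] L2_measurable fL u)
  show "AE x in torus. norm (?T (f x) * (f x * u x)) \<le> norm (f x * u x)"
   using neg_slope_bounds(3)[of "\<eta> / 2"] by (intro AE_I2) (simp add: abs_mult mult_left_le_one_le)
 qed
 have kc: "continuous_on UNIV (\<lambda>p :: (real^3) \<times> (real^3). ?k (fst p - snd p))"
  by (rule continuous_pair_diff[OF continuous_vp_deriv])
 have Tb: "continuous_on UNIV (\<lambda>p :: (real^3) \<times> (real^3). ?T (?b (fst p)))"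
  by (intro continuous_neg_slope continuous_on_compose2[OF continuous_rconv[OF fi, of UNIV]] continuous_intros) auto
 let ?G = "\<lambda>p. (?T (?b (fst p)) * ?k (fst p - snd p)) * (f (snd p) * u (snd p))"
 let ?H = "\<lambda>p. ?k (fst p - snd p) * (?T (f (snd p)) * (f (snd p) * u (snd p)))"
 have iG: "integrable torus2 ?G" by (rule pair_mult_integrable[OF continuous_on_mult[OF Tb kc] fu])
 have iH: "integrable torus2 ?H" by (rule pair_mult_integrable[OF kc Tfu])
 have H0: "(LINT p|torus2. ?H p) = 0"
  using integral_pair_shift_fst[OF continuous_vp_deriv periodic_vp_deriv Tfu, of j n] by (simp add: integral_vp_deriv)
 have n1: "n \<ge> 1" using n by simp
 let ?A = "\<lambda>p. ?P (fst p - snd p) * bad \<eta> R (f (snd p)) (u (snd p))"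
 let ?B = "\<lambda>p. (?b (fst p) - f (snd p))\<^sup>2 * ?P (fst p - snd p)"
 let ?C = "\<lambda>p. (?b (fst p) - f (snd p))\<^sup>2 * ?Q (fst p - snd p)"
 have Q: "continuous_on UNIV ?Q" "periodic ?Q" "\<And>z. 0 \<le> ?Q z" "\<And>z. ?Q (- z) = ?Q z"
  using periodic_vp_kernel[of n] by (auto intro!: continuous_intros continuous_vp_kernel simp: vp_kernel_even periodic_def)
 note dP = double_diff_bound[OF f n1 continuous_vp_weight periodic_vp_weight vp_weight_nonneg vp_weight_even, of j]
 note dQ = double_diff_bound[OF f n1 Q]
 have A: "integrable torus2 ?A"
  by (rule pair_mult_integrable[OF continuous_pair_diff[OF continuous_vp_weight] bad_integrable[OF fL u]])
 note B = dP(1) and C = dQ(1)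
 have S: "integrable torus2 (\<lambda>p. \<mu> / 2 * (?A p + 4 * R / \<eta>\<^sup>2 * ?B p) + 1 / (2 * \<mu>) * ?C p)"
  by (intro L1_add L1_mult_right A B C)
 have "(TI y. ?T (?b y) * (TI x. f x * u x * ?k (y - x))) = (TI y. (TI x. ?G (y, x)))"
 proof (rule LINT_cong[OF refl])
  show "?T (?b y) * (TI x. f x * u x * ?k (y - x)) = (TI x. ?G (y, x))" for y
   by (subst integral_mult_right_zero[symmetric]) (simp add: mult_ac)
 qed
 also have "\<dots> = (LINT p|torus2. ?G p)" by (rule TT.integral_fst'[OF iG])
 also have "\<dots> = (LINT p|torus2. ?G p - ?H p)" by (simp only: LINT_diff[OF iG iH] H0 diff_0_right)
 finally have "\<bar>TI y. ?T (?b y) * (TI x. f x * u x * ?k (y - x))\<bar> = \<bar>LINT p|torus2. ?G p - ?H p\<bar>"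
  by (rule arg_cong)
 also have "\<dots> \<le> (LINT p|torus2. \<bar>?G p - ?H p\<bar>)" by (rule integral_abs_bound)
 also have "\<dots> \<le> (LINT p|torus2. \<mu> / 2 * (?A p + 4 * R / \<eta>\<^sup>2 * ?B p) + 1 / (2 * \<mu>) * ?C p)"
 proof -
  show ?thesis
  proof (rule integral_mono[OF _ S])
   show "integrable torus2 (\<lambda>p. \<bar>?G p - ?H p\<bar>)" using iG iH by auto
   fix p
   have "\<bar>(?T (?b (fst p)) - ?T (f (snd p))) * (f (snd p) * u (snd p)) * ?k (fst p - snd p)\<bar>
     \<le> \<mu> / 2 * (?A p + 4 * R / \<eta>\<^sup>2 * ?B p) + 1 / (2 * \<mu>) * ?C p"
    by (rule neg_slope_commutator_pointwise[OF \<mu> \<delta> R vp_deriv_sq[OF n]]) (auto simp: vp_kernel_nonneg)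
   moreover have "(?T (?b (fst p)) - ?T (f (snd p))) * (f (snd p) * u (snd p)) * ?k (fst p - snd p) = ?G p - ?H p"
    by (simp add: left_diff_distrib right_diff_distrib mult_ac)
   ultimately show "\<bar>?G p - ?H p\<bar> \<le> \<mu> / 2 * (?A p + 4 * R / \<eta>\<^sup>2 * ?B p) + 1 / (2 * \<mu>) * ?C p"
    by (simp only:)
  qed
 qed
 also have "\<dots> = \<mu> / 2 * ((LINT p|torus2. ?A p) + 4 * R / \<eta>\<^sup>2 * (LINT p|torus2. ?B p))
   + 1 / (2 * \<mu>) * (LINT p|torus2. ?C p)"
 proof -
  note ci = L1_mult_right
  have 1: "integrable torus2 (\<lambda>p. ?A p + 4 * R / \<eta>\<^sup>2 * ?B p)" by (intro L1_add ci A B)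
  have 2: "integrable torus2 (\<lambda>p. 4 * R / \<eta>\<^sup>2 * ?B p)" by (intro ci B)
  have 3: "integrable torus2 (\<lambda>p. \<mu> / 2 * (?A p + 4 * R / \<eta>\<^sup>2 * ?B p))" by (intro ci 1)
  have 4: "integrable torus2 (\<lambda>p. 1 / (2 * \<mu>) * ?C p)" by (intro ci C)
  show ?thesis
   by (simp only: LINT_add[OF 3 4] LINT_add[OF A 2] integral_mult_right_zero)
 qed
 also have "\<dots> \<le> \<mu> / 2 * (4 * pi\<^sup>2 * (TI x. bad \<eta> R (f x) (u x)) + 4 * R / \<eta>\<^sup>2 * (504 * pi\<^sup>2 * M / (real n + 1)))
   + 1 / (2 * \<mu>) * (54 * M)"
 proof -
  have "(LINT p|torus2. ?A p) = (TI z. ?P z) * (TI x. bad \<eta> R (f x) (u x))"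
   by (rule integral_pair_shift_fst[OF continuous_vp_weight periodic_vp_weight bad_integrable[OF fL u]])
  also have "\<dots> \<le> 4 * pi\<^sup>2 * (TI x. bad \<eta> R (f x) (u x))"
   by (intro mult_right_mono vp_weight_mass[OF n] LINT_nonneg bad_bounds)
  finally have IA: "(LINT p|torus2. ?A p) \<le> 4 * pi\<^sup>2 * (TI x. bad \<eta> R (f x) (u x))" .
  have "(LINT p|torus2. ?B p)
    \<le> 24 * M * (\<Sum>i\<in>UNIV. (TI z. ?P z * (sin (pi * z $ i))\<^sup>2)) + 18 * M / (real n + 1) * (TI z. ?P z)"
   by (rule dP(2))
  also have "\<dots> \<le> 24 * M * (\<Sum>i\<in>(UNIV :: 3 set). 6 * pi\<^sup>2 / (real n + 1)) + 18 * M / (real n + 1) * (4 * pi\<^sup>2)"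
   using M by (intro add_mono mult_left_mono sum_mono vp_weight_sin2_moment[OF n] vp_weight_mass[OF n]) auto
  also have "\<dots> = 504 * pi\<^sup>2 * M / (real n + 1)"
  proof -
   have "24 * M * (3 * (6 * a / b)) + 18 * M / b * (4 * a) = 504 * a * M / b" for a b :: real
    by (cases "b = 0") (simp_all add: field_simps)
   from this[of "pi\<^sup>2" "real n + 1"] show ?thesis by simp
  qed
  finally have IB: "(LINT p|torus2. ?B p) \<le> 504 * pi\<^sup>2 * M / (real n + 1)" .
  have "(LINT p|torus2. ?C p)
    \<le> 24 * M * (\<Sum>i\<in>UNIV. (TI z. ?Q z * (sin (pi * z $ i))\<^sup>2)) + 18 * M / (real n + 1) * (TI z. ?Q z)"
   by (rule dQ(2))
  also have "\<dots> = 54 * M * (real n / (real n + 1))"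
  proof -
   have "24 * M * (3 * (a * (1 / (2 * b)))) + 18 * M / b * a = 54 * M * (a / b)" for a b :: real
    by (cases "b = 0") (simp_all add: field_simps)
   from this[of "real n" "real n + 1"] show ?thesis by (simp add: mult.assoc vp_kernel_sin2_moment integral_vp_kernel)
  qed
  also have "\<dots> \<le> 54 * M * 1" using M by (intro mult_left_mono) auto
  finally have IC: "(LINT p|torus2. ?C p) \<le> 54 * M" by simp
  show ?thesis using \<mu> R by (intro add_mono mult_left_mono IA IB IC) auto
 qed
 finally show ?thesis by simp
qed

section \<open>Evolution of a convex functional\<close>

text \<open>Summed over \<open>m\<close> equal steps, quadratic increments contribute \<open>C t\<^sup>2 / m\<close>.\<close>

lemma quadratic_increment_le:
 fixes g :: "real \<Rightarrow> real"
 assumes t: "0 \<le> t" and g: "\<And>a b. 0 \<le> a \<Longrightarrow> a \<le> b \<Longrightarrow> b \<le> t \<Longrightarrow> g b - g a \<le> C * (b - a)\<^sup>2"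
 shows "g t \<le> g 0"
proof -
 have "g t - g 0 \<le> C * t\<^sup>2 / real (Suc m)" for m
 proof -
  let ?s = "\<lambda>i. t * real i / real (Suc m)"
  have "(\<Sum>i<Suc m. g (?s (Suc i)) - g (?s i)) = g (?s (Suc m)) - g (?s 0)"
   by (rule sum_lessThan_telescope)
  then have "g t - g 0 = (\<Sum>i<Suc m. g (?s (Suc i)) - g (?s i))"
   by (simp del: sum.lessThan_Suc of_nat_Suc)
  also have "\<dots> \<le> (\<Sum>i<Suc m. C * (t / real (Suc m))\<^sup>2)"
  proof (rule sum_mono)
   fix i assume "i \<in> {..<Suc m}"
   then have i: "real (Suc i) \<le> real (Suc m)" by simp
   have "g (?s (Suc i)) - g (?s i) \<le> C * (?s (Suc i) - ?s i)\<^sup>2"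
   proof (rule g)
    show "?s (Suc i) \<le> t" using mult_left_mono[OF i t] by (simp add: pos_divide_le_eq)
    show "?s i \<le> ?s (Suc i)" using t by (intro divide_right_mono mult_left_mono) auto
   qed (use t in auto)
   also have "?s (Suc i) - ?s i = t / real (Suc m)" by (simp add: diff_divide_distrib[symmetric] algebra_simps)
   finally show "g (?s (Suc i)) - g (?s i) \<le> C * (t / real (Suc m))\<^sup>2" .
  qed
  also have "\<dots> = C * t\<^sup>2 / real (Suc m)" by (simp add: power2_eq_square)
  finally show ?thesis .
 qed
 moreover have "(\<lambda>m. C * t\<^sup>2 / real (Suc m)) \<longlonglongrightarrow> 0"
  using LIMSEQ_Suc[OF lim_const_over_n[of "C * t\<^sup>2"]] by simp
 ultimately have "g t - g 0 \<le> 0" by (intro LIMSEQ_le_const[of _ 0]) auto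
 then show ?thesis by simp
qed

text \<open>The chain rule, as an inequality, for a function of \<open>(t, y)\<close> depending on \<open>t\<close> through finitely
 many Lipschitz coefficients.  By convexity a time step contributes at most the slope at its right
 end times the increment, and slopes vary by a multiple of the step.\<close>

lemma neg_part_evolution:
 fixes a :: "'w \<Rightarrow> real^3 \<Rightarrow> real" and d :: "'w \<Rightarrow> real \<Rightarrow> real"
 assumes W: "finite W" and a: "\<And>w. continuous_on UNIV (a w)" "\<And>w y. \<bar>a w y\<bar> \<le> A"
  and d: "\<And>w. w \<in> W \<Longrightarrow> time_primitive (d w) B" and b0: "continuous_on UNIV b0" and \<delta>: "\<delta> > 0" and t: "0 \<le> t"
  and b: "\<And>\<tau> y. b \<tau> y = b0 y + (\<Sum>w\<in>W. a w y * time_primitive.D (d w) \<tau>)"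
 shows "integrable (lebesgue_on {0..t}) (\<lambda>\<tau>. \<Sum>w\<in>W. d w \<tau> * (TI y. a w y * neg_slope \<delta> (b \<tau> y)))"
  "(TI y. neg_part \<delta> (b t y)) - (TI y. neg_part \<delta> (b0 y))
   \<le> (LINT \<tau>|lebesgue_on {0..t}. (\<Sum>w\<in>W. d w \<tau> * (TI y. a w y * neg_slope \<delta> (b \<tau> y))))"
proof -
 let ?D = "\<lambda>w. time_primitive.D (d w)"
 let ?F = "\<lambda>w \<tau>. TI y. a w y * neg_slope \<delta> (b \<tau> y)"
 let ?e = "\<lambda>\<tau>. \<Sum>w\<in>W. d w \<tau> * ?F w \<tau>"
 let ?N = "\<lambda>\<tau>. TI y. neg_part \<delta> (b \<tau> y)"
 have A0: "0 \<le> A" using a(2)[of undefined 0] by linarith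
 have bc: "continuous_on UNIV (b \<tau>)" for \<tau> unfolding b[abs_def] by (intro continuous_intros b0 a)
 note ci = continuous_integrable_torus
 define L where "L = real (card W) * (A * \<bar>B\<bar>)"
 have L0: "0 \<le> L" unfolding L_def using A0 by simp
 have bL: "\<bar>b \<tau> y - b \<sigma> y\<bar> \<le> L * \<bar>\<tau> - \<sigma>\<bar>" for \<tau> \<sigma> y
 proof -
  have "b \<tau> y - b \<sigma> y = (\<Sum>w\<in>W. a w y * (?D w \<tau> - ?D w \<sigma>))"
   unfolding b by (simp add: right_diff_distrib sum_subtractf)
  also have "\<bar>\<dots>\<bar> \<le> (\<Sum>w\<in>W. \<bar>a w y * (?D w \<tau> - ?D w \<sigma>)\<bar>)" by (rule sum_abs)
  also have "\<dots> \<le> (\<Sum>w\<in>W. A * (\<bar>B\<bar> * \<bar>\<tau> - \<sigma>\<bar>))"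
   unfolding abs_mult by (intro sum_mono mult_mono a time_primitive.D_Lipschitz[OF d] A0) auto
  finally show ?thesis by (simp add: L_def mult_ac)
 qed
 have FL: "\<bar>?F w \<tau> - ?F w \<sigma>\<bar> \<le> A * (L * \<bar>\<tau> - \<sigma>\<bar> / \<delta>)" for w \<tau> \<sigma>
 proof -
  have "?F w \<tau> - ?F w \<sigma> = (TI y. a w y * (neg_slope \<delta> (b \<tau> y) - neg_slope \<delta> (b \<sigma> y)))"
   unfolding right_diff_distrib by (intro LINT_diff[symmetric] ci continuous_intros a bc)
  also have "\<bar>\<dots>\<bar> \<le> (TI y. \<bar>a w y * (neg_slope \<delta> (b \<tau> y) - neg_slope \<delta> (b \<sigma> y))\<bar>)"
   by (rule integral_abs_bound)
  also have "\<dots> \<le> (LINT y|(torus :: (real^3) measure). A * (L * \<bar>\<tau> - \<sigma>\<bar> / \<delta>))"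
  proof (rule integral_mono)
   show "integrable torus (\<lambda>y. \<bar>a w y * (neg_slope \<delta> (b \<tau> y) - neg_slope \<delta> (b \<sigma> y))\<bar>)"
    by (intro ci continuous_intros a bc)
   fix y
   have "\<bar>neg_slope \<delta> (b \<tau> y) - neg_slope \<delta> (b \<sigma> y)\<bar> \<le> \<bar>b \<tau> y - b \<sigma> y\<bar> / \<delta>" by (rule neg_slope_Lipschitz[OF \<delta>])
   also have "\<dots> \<le> L * \<bar>\<tau> - \<sigma>\<bar> / \<delta>" using \<delta> by (intro divide_right_mono bL) auto
   finally show "\<bar>a w y * (neg_slope \<delta> (b \<tau> y) - neg_slope \<delta> (b \<sigma> y))\<bar> \<le> A * (L * \<bar>\<tau> - \<sigma>\<bar> / \<delta>)"
    unfolding abs_mult by (intro mult_mono a A0) auto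
  qed simp
  also have "\<dots> = A * (L * \<bar>\<tau> - \<sigma>\<bar> / \<delta>)" by simp
  finally show ?thesis .
 qed
 have Fc: "continuous_on UNIV (?F w)" for w
 proof (rule lipschitz_on_continuous_on[of "A * (L / \<delta>)"], rule lipschitz_onI)
  show "0 \<le> A * (L / \<delta>)" using A0 L0 \<delta> by simp
  show "dist (?F w x) (?F w y) \<le> A * (L / \<delta>) * dist x y" for x y
   using FL[of w x y] by (simp add: dist_real_def)
 qed
 have dF: "integrable (lebesgue_on {r..s}) (\<lambda>\<tau>. d w \<tau> * ?F w \<tau>)" if "w \<in> W" "0 \<le> r" for w r s
  by (rule integrable_mult_continuous_interval[OF time_primitive.d_on[OF d] Fc]) (use that in auto)
 have ei: "integrable (lebesgue_on {r..s}) ?e" if "0 \<le> r" for r s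
  by (intro L1_sum dF that)
 show "integrable (lebesgue_on {0..t}) ?e" by (rule ei) simp
 define C where "C = real (card W) * (\<bar>B\<bar> * (A * (L / \<delta>)))"
 let ?g = "\<lambda>\<tau>. ?N \<tau> - (LINT \<sigma>|lebesgue_on {0..\<tau>}. ?e \<sigma>)"
 have step: "?g s - ?g r \<le> C * (s - r)\<^sup>2" if rs: "0 \<le> r" "r \<le> s" "s \<le> t" for r s
 proof -
  have "?N s - ?N r = (TI y. neg_part \<delta> (b s y) - neg_part \<delta> (b r y))"
   by (intro LINT_diff[symmetric] ci continuous_intros bc)
  also have "\<dots> \<le> (TI y. (\<Sum>w\<in>W. (?D w s - ?D w r) * (a w y * neg_slope \<delta> (b s y))))"
  proof (rule integral_mono)
   show "integrable torus (\<lambda>y. neg_part \<delta> (b s y) - neg_part \<delta> (b r y))" by (intro ci continuous_intros bc)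
   show "integrable torus (\<lambda>y. \<Sum>w\<in>W. (?D w s - ?D w r) * (a w y * neg_slope \<delta> (b s y)))"
    by (intro ci continuous_intros bc a)
   fix y
   have "neg_part \<delta> (b s y) - neg_part \<delta> (b r y) \<le> neg_slope \<delta> (b s y) * (b s y - b r y)"
    by (rule neg_part_le_tangent[OF \<delta>])
   also have "b s y - b r y = (\<Sum>w\<in>W. a w y * (?D w s - ?D w r))"
    unfolding b by (simp add: right_diff_distrib sum_subtractf)
   finally show "neg_part \<delta> (b s y) - neg_part \<delta> (b r y) \<le> (\<Sum>w\<in>W. (?D w s - ?D w r) * (a w y * neg_slope \<delta> (b s y)))"
    by (simp add: sum_distrib_left mult_ac)
  qed
  also have "\<dots> = (\<Sum>w\<in>W. (?D w s - ?D w r) * ?F w s)"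
   by (subst LINT_sum) (auto intro!: ci continuous_intros bc a)
  also have "\<dots> = (\<Sum>w\<in>W. (LINT \<tau>|lebesgue_on {r..s}. d w \<tau> * ?F w s))"
   using rs by (intro sum.cong refl) (simp add: time_primitive.D_diff[OF d])
  finally have N: "?N s - ?N r \<le> (\<Sum>w\<in>W. (LINT \<tau>|lebesgue_on {r..s}. d w \<tau> * ?F w s))" .
  have e: "(LINT \<sigma>|lebesgue_on {0..s}. ?e \<sigma>) - (LINT \<sigma>|lebesgue_on {0..r}. ?e \<sigma>) = (\<Sum>w\<in>W. (LINT \<tau>|lebesgue_on {r..s}. d w \<tau> * ?F w \<tau>))"
  proof -
   have I: "(LINT \<tau>|lebesgue_on {p..q}. ?e \<tau>) = integral {p..q} ?e" "?e integrable_on {p..q}" if "0 \<le> p" for p q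
    using ei[OF that, of q] by (auto intro: lebesgue_integral_eq_integral integrable_on_lebesgue_on)
   have "(LINT \<sigma>|lebesgue_on {0..s}. ?e \<sigma>) - (LINT \<sigma>|lebesgue_on {0..r}. ?e \<sigma>) = (LINT \<sigma>|lebesgue_on {r..s}. ?e \<sigma>)"
    using I rs by (simp add: algebra_simps Henstock_Kurzweil_Integration.integral_combine[symmetric, of 0 r s ?e])
   also have "\<dots> = (\<Sum>w\<in>W. (LINT \<tau>|lebesgue_on {r..s}. d w \<tau> * ?F w \<tau>))"
    by (intro LINT_sum dF rs)
   finally show ?thesis .
  qed
  have "?g s - ?g r \<le> (\<Sum>w\<in>W. (LINT \<tau>|lebesgue_on {r..s}. d w \<tau> * ?F w s) - (LINT \<tau>|lebesgue_on {r..s}. d w \<tau> * ?F w \<tau>))"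
   using N e by (simp add: sum_subtractf)
  also have "\<dots> \<le> (\<Sum>w\<in>W. \<bar>B\<bar> * (A * (L * (s - r) / \<delta>)) * (s - r))"
  proof (rule sum_mono)
   fix w assume w: "w \<in> W"
   interpret tp: time_primitive "d w" B by (rule d[OF w])
   let ?M = "lebesgue_on {r..s}"
   have i1: "integrable ?M (\<lambda>\<tau>. d w \<tau> * ?F w s)" using tp.d_on[of r s] rs by auto
   have i2: "integrable ?M (\<lambda>\<tau>. d w \<tau> * ?F w \<tau>)" by (rule dF[OF w]) (use rs in auto)
   have "(LINT \<tau>|?M. d w \<tau> * ?F w s) - (LINT \<tau>|?M. d w \<tau> * ?F w \<tau>) = (LINT \<tau>|?M. d w \<tau> * ?F w s - d w \<tau> * ?F w \<tau>)"
    by (rule LINT_diff[OF i1 i2, symmetric])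
   also have "\<dots> \<le> (LINT \<tau>|?M. \<bar>B\<bar> * (A * (L * (s - r) / \<delta>)))"
   proof (rule integral_mono_AE)
    show "integrable ?M (\<lambda>\<tau>. d w \<tau> * ?F w s - d w \<tau> * ?F w \<tau>)" by (intro L1_diff i1 i2)
    show "integrable ?M (\<lambda>\<tau>. \<bar>B\<bar> * (A * (L * (s - r) / \<delta>)))"
     by (auto intro!: finite_measure.integrable_const finite_measure_lebesgue_on)
    have "AE \<tau> in ?M. \<tau> \<in> space ?M" by (rule AE_space)
    moreover have "AE \<tau> in ?M. \<bar>d w \<tau>\<bar> \<le> \<bar>B\<bar>" using tp.B_on rs by blast
    ultimately show "AE \<tau> in ?M. d w \<tau> * ?F w s - d w \<tau> * ?F w \<tau> \<le> \<bar>B\<bar> * (A * (L * (s - r) / \<delta>))"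
    proof eventually_elim
     case (elim \<tau>)
     then have \<tau>: "r \<le> \<tau>" "\<tau> \<le> s" by auto
     have "\<bar>?F w s - ?F w \<tau>\<bar> \<le> A * (L * \<bar>s - \<tau>\<bar> / \<delta>)" by (rule FL)
     also have "\<dots> \<le> A * (L * (s - r) / \<delta>)"
      using \<tau> \<delta> by (intro mult_left_mono divide_right_mono A0 L0) auto
     finally have "\<bar>d w \<tau> * (?F w s - ?F w \<tau>)\<bar> \<le> \<bar>B\<bar> * (A * (L * (s - r) / \<delta>))"
      unfolding abs_mult using elim by (intro mult_mono) auto
     then show ?case by (simp add: right_diff_distrib)
    qed
   qed
   also have "\<dots> = \<bar>B\<bar> * (A * (L * (s - r) / \<delta>)) * (s - r)" using rs by (simp add: measure_restrict_space)
   finally show "(LINT \<tau>|?M. d w \<tau> * ?F w s) - (LINT \<tau>|?M. d w \<tau> * ?F w \<tau>) \<le> \<bar>B\<bar> * (A * (L * (s - r) / \<delta>)) * (s - r)" .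
  qed
  also have "\<dots> = C * (s - r)\<^sup>2" by (simp add: C_def power2_eq_square)
  finally show ?thesis .
 qed
 have "?g t \<le> ?g 0" by (rule quadratic_increment_le[OF t step])
 moreover have "b 0 = b0" unfolding b[abs_def] by (simp add: time_primitive.D_nonpos[OF d])
 moreover have "(LINT \<sigma>|lebesgue_on {0..0}. ?e \<sigma>) = 0" by (rule integral_singleton_0)
 ultimately show "?N t - (TI y. neg_part \<delta> (b0 y)) \<le> (LINT \<tau>|lebesgue_on {0..t}. ?e \<tau>)" by simp
qed

section \<open>Moments of weak solutions of balance laws\<close>

definition attains :: "(event \<Rightarrow> real) \<Rightarrow> (real^3 \<Rightarrow> real) \<Rightarrow> bool" where
 "attains f f0 \<longleftrightarrow> (\<forall>\<psi>. torus_test \<psi> \<longrightarrow> (\<forall>\<epsilon>>0. \<exists>\<delta>>0. AE t in lebesgue_on {0<..<\<delta>}.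
  \<bar>(TI x. \<psi> x * f (t, x)) - (TI x. \<psi> x * f0 x)\<bar> < \<epsilon>))"

lemma weak_balance_primitive:
 fixes F :: "event \<Rightarrow> real^3"
 assumes bal: "weak_balance f F (\<lambda>_. 0)" and F: "F \<in> borel_measurable spacetime"
  and Fb: "AE t in half_line. \<forall>j. integrable torus (\<lambda>x. F (t, x) $ j) \<and> (TI x. \<bar>F (t, x) $ j\<bar>) \<le> C"
  and init: "attains f f0" and \<psi>: "torus_test \<psi>"
 obtains B where "time_primitive (\<lambda>t. \<Sum>j\<in>UNIV. (TI x. F (t, x) $ j * partial j \<psi> x)) B"
  "AE t in half_line. (TI x. \<psi> x * f (t, x)) = (TI x. \<psi> x * f0 x)
   + time_primitive.D (\<lambda>t. \<Sum>j\<in>UNIV. (TI x. F (t, x) $ j * partial j \<psi> x)) t"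
proof -
 let ?d = "\<lambda>t. \<Sum>j\<in>UNIV. (TI x. F (t, x) $ j * partial j \<psi> x)"
 let ?p = "\<lambda>j. partial j \<psi>"
 have pc: "continuous_on UNIV (?p j)" and \<psi>c: "continuous_on UNIV \<psi>" for j using continuous_torus_test[OF \<psi>] by auto
 obtain K where K: "\<And>j x. x \<in> cbox 0 One \<Longrightarrow> \<bar>?p j x\<bar> \<le> K j"
 proof -
  have "\<forall>j. \<exists>B. \<forall>x\<in>cbox 0 One. norm (?p j x) \<le> B" using bounded_on_cell[OF pc] by blast
  then obtain K where "\<And>j x. x \<in> cbox 0 One \<Longrightarrow> norm (?p j x) \<le> K j" by metis
  then show thesis by (intro that[of K]) auto
 qed
 have slice: "AE t in half_line. \<forall>j. integrable torus (\<lambda>x. F (t, x) $ j * ?p j x) \<and> (TI x. \<bar>F (t, x) $ j * ?p j x\<bar>) \<le> \<bar>C\<bar> * \<bar>K j\<bar>"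
  using Fb
 proof eventually_elim
  case (elim t)
  show ?case
  proof (intro allI conjI)
   fix j
   have Fi: "integrable torus (\<lambda>x. F (t, x) $ j)" using elim by auto
   have i: "integrable torus (\<lambda>x. ?p j x * F (t, x) $ j)" by (rule integrable_continuous_mult_torus[OF pc Fi])
   then show i': "integrable torus (\<lambda>x. F (t, x) $ j * ?p j x)" by (simp add: mult.commute)
   have "(TI x. \<bar>F (t, x) $ j * ?p j x\<bar>) \<le> (TI x. \<bar>F (t, x) $ j\<bar> * \<bar>K j\<bar>)"
   proof (rule integral_mono)
    fix x assume "x \<in> space (torus :: (real^3) measure)"
    then have "\<bar>?p j x\<bar> \<le> \<bar>K j\<bar>" using K[of x j] by simp
    then show "\<bar>F (t, x) $ j * ?p j x\<bar> \<le> \<bar>F (t, x) $ j\<bar> * \<bar>K j\<bar>" unfolding abs_mult by (rule mult_left_mono) auto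
   qed (use i' Fi in auto)
   also have "\<dots> = (TI x. \<bar>F (t, x) $ j\<bar>) * \<bar>K j\<bar>" by simp
   also have "\<dots> \<le> \<bar>C\<bar> * \<bar>K j\<bar>" using elim by (intro mult_right_mono) (auto intro: order_trans[OF _ abs_ge_self])
   finally show "(TI x. \<bar>F (t, x) $ j * ?p j x\<bar>) \<le> \<bar>C\<bar> * \<bar>K j\<bar>" .
  qed
 qed
 have tp: "time_primitive ?d (\<Sum>j\<in>UNIV. \<bar>C\<bar> * \<bar>K j\<bar>)"
 proof
  fix b :: real
  show "integrable (lebesgue_on {0..b}) ?d"
  proof (rule L1_sum)
   fix j :: 3
   have "integrable (cyl {0..b}) (\<lambda>p. F p $ j * ?p j (snd p))"
   proof (rule cyl_integrableI)
    show "(\<lambda>p. F p $ j * ?p j (snd p)) \<in> borel_measurable (cyl {0..b})"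
     by (intro borel_measurable_times borel_measurable_nth cyl_measurable_mono[OF F] continuous_measurable_cyl continuous_fst_snd pc) auto
    show "AE t in lebesgue_on {0..b}. integrable torus (\<lambda>x. F (t, x) $ j * ?p j (snd (t, x))) \<and> (TI x. \<bar>F (t, x) $ j * ?p j (snd (t, x))\<bar>) \<le> \<bar>C\<bar> * \<bar>K j\<bar>"
     using AE_time_subset[OF slice, of 0 b] by (auto elim!: eventually_mono)
   qed
   from cyl_Fubini(2)[OF closed_atLeastAtMost this]
   show "integrable (lebesgue_on {0..b}) (\<lambda>t. TI x. F (t, x) $ j * ?p j x)" by simp
  qed
  show "AE t in half_line. \<bar>?d t\<bar> \<le> (\<Sum>j\<in>UNIV. \<bar>C\<bar> * \<bar>K j\<bar>)"
   using slice
  proof eventually_elim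
   case (elim t)
   have "\<bar>?d t\<bar> \<le> (\<Sum>j\<in>UNIV. \<bar>TI x. F (t, x) $ j * ?p j x\<bar>)" by (rule sum_abs)
   also have "\<dots> \<le> (\<Sum>j\<in>UNIV. \<bar>C\<bar> * \<bar>K j\<bar>)"
   proof (rule sum_mono)
    fix j
    have "\<bar>TI x. F (t, x) $ j * ?p j x\<bar> \<le> (TI x. \<bar>F (t, x) $ j * ?p j x\<bar>)" by (rule integral_abs_bound)
    then show "\<bar>TI x. F (t, x) $ j * ?p j x\<bar> \<le> \<bar>C\<bar> * \<bar>K j\<bar>" using elim by (meson order_trans)
   qed
   finally show ?case .
  qed
 qed
 interpret time_primitive ?d "\<Sum>j\<in>UNIV. \<bar>C\<bar> * \<bar>K j\<bar>" by (rule tp)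
 have fl: "loc_integrable f" and Fl: "loc_integrable F" using bal by (auto simp: weak_balance_def)
 have fp: "integrable (cyl {a..b}) (\<lambda>p. \<psi> (snd p) * f p)" if "0 < a" for a b
  using that fl by (intro cyl_mult_continuous continuous_fst_snd(2) \<psi>c) (simp add: loc_integrable_def)
 have "AE t in half_line. (TI x. \<psi> x * f (t, x)) = (TI x. \<psi> x * f0 x) + D t"
 proof (rule weak_solution_is_primitive)
  fix a b :: real assume "0 < a"
  from cyl_time_weighted_integral(2)[OF fp[OF this] continuous_on_const[of _ 1]]
  show "integrable (lebesgue_on {a..b}) (\<lambda>t. TI x. \<psi> x * f (t, x))" by simp
 next
  fix \<theta> :: "real \<Rightarrow> real" and a b :: real
  assume \<theta>: "time_test \<theta>" and a: "0 < a" "a \<le> b" and supp: "\<And>t. t \<notin> {a..b} \<Longrightarrow> \<theta> t = 0"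
  let ?\<phi> = "\<lambda>p. \<theta> (fst p) * \<psi> (snd p)"
  note tst = spacetime_test_product[OF \<theta> \<psi>]
  let ?X = "\<lambda>p. f p * time_deriv ?\<phi> p + F p \<bullet> space_grad ?\<phi> p"
  let ?e = "\<lambda>t. dir_deriv 1 \<theta> t * (TI x. \<psi> x * f (t, x)) + \<theta> t * ?d t"
  have X: "integrable spacetime ?X"
   by (intro L1_add integrable_scalar_test integrable_flux_test fl Fl tst)
  note Fub = cyl_Fubini[OF closed_atLeast X[unfolded spacetime_cyl]]
  have pt: "?X (t, x) = dir_deriv 1 \<theta> t * (\<psi> x * f (t, x)) + \<theta> t * (\<Sum>j\<in>UNIV. F (t, x) $ j * ?p j x)" for t x
   unfolding tst(2,3) by (simp add: torus_grad_def inner_vec_def sum_distrib_left mult_ac)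
  have fs: "AE t in half_line. integrable torus (\<lambda>x. f (t, x))"
   using fl by (intro AE_loc_integrable_slices) (simp add: loc_integrable_def)
  have eq: "AE t in half_line. (TI x. ?X (t, x)) = ?e t"
   using slice fs
  proof eventually_elim
   case (elim t)
   have 1: "integrable torus (\<lambda>x. \<psi> x * f (t, x))" by (rule integrable_continuous_mult_torus[OF \<psi>c elim(2)])
   have 2: "integrable torus (\<lambda>x. F (t, x) $ j * ?p j x)" for j using elim(1) by blast
   show ?case unfolding pt using 1 2 by simp
  qed
  have "0 = (LINT p|spacetime. ?X p)" using bal tst(1) by (simp add: weak_balance_def)
  also have "\<dots> = (LINT t|half_line. (TI x. ?X (t, x)))" using Fub(3) unfolding spacetime_cyl by simp
  also have "\<dots> = (LINT t|lebesgue_on {a..b}. (TI x. ?X (t, x)))"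
   by (rule lebesgue_on_zero_outside) (use a supp time_test_deriv_support[OF \<theta> supp] in \<open>auto simp: pt closed_sets_lebesgue\<close>)
  also have "\<dots> = (LINT t|lebesgue_on {a..b}. ?e t)"
  proof (rule LINT_cong_AE)
   show "AE t in lebesgue_on {a..b}. (TI x. ?X (t, x)) = ?e t" by (rule AE_time_subset[OF eq]) (use a in simp)
   show "(\<lambda>t. TI x. ?X (t, x)) \<in> borel_measurable (lebesgue_on {a..b})"
    by (rule borel_measurable_integrable[OF integrable_lebesgue_on_subset[OF _ _ _ Fub(2)]]) (use a in \<open>auto simp: closed_sets_lebesgue\<close>)
   show "?e \<in> borel_measurable (lebesgue_on {a..b})"
    using cyl_time_weighted_integral(2)[OF fp[OF a(1)] time_test_continuous_deriv[OF \<theta>]]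
     integrable_mult_continuous_interval[OF d_on time_test_continuous[OF \<theta>], of a b] a
    by (intro borel_measurable_add) (auto simp: mult.commute)
  qed
  finally show "(LINT t|lebesgue_on {a..b}. ?e t) = 0" ..
 next
  fix \<epsilon> :: real assume "\<epsilon> > 0"
  then show "\<exists>\<delta>>0. AE t in lebesgue_on {0<..<\<delta>}. \<bar>(TI x. \<psi> x * f (t, x)) - (TI x. \<psi> x * f0 x)\<bar> < \<epsilon>"
   using init \<psi> by (auto simp: attains_def)
 qed
 then show thesis using that tp by blast
qed

section \<open>Nonnegativity of densities\<close>

text \<open>Convolution with the kernel is a finite combination of moments against plane waves; a mode is
 a frequency together with the phase shift that selects the cosine or the sine.\<close>

definition modes :: "nat \<Rightarrow> ((3 \<Rightarrow> int) \<times> real) set" where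
 "modes n = vp_freqs n \<times> {0, - (pi / 2)}"

abbreviation mode_wave :: "(3 \<Rightarrow> int) \<times> real \<Rightarrow> real^3 \<Rightarrow> real" where
 "mode_wave w \<equiv> wave (fst w) (snd w)"

definition mode_amp :: "nat \<Rightarrow> (3 \<Rightarrow> int) \<times> real \<Rightarrow> real^3 \<Rightarrow> real" where
 "mode_amp n w y = (if fst w \<in> vp_freqs n then vp_coeff n (fst w) else 0) * mode_wave w y"

lemma finite_modes [simp]: "finite (modes n)"
 by (simp add: modes_def)

lemma continuous_mode_amp: "continuous_on A (mode_amp n w)"
 unfolding mode_amp_def[abs_def] by (intro continuous_intros continuous_torus_test torus_test_wave)

lemma mode_amp_le_1: "\<bar>mode_amp n w y\<bar> \<le> 1"
proof -
 have "\<bar>mode_amp n w y\<bar> \<le> 1 * 1"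
  unfolding mode_amp_def abs_mult by (intro mult_mono) (auto simp: wave_def vp_coeff_le_1)
 then show ?thesis by simp
qed

lemma sum_modes: "(\<Sum>w\<in>modes n. g (fst w) (snd w)) = (\<Sum>k\<in>vp_freqs n. g k 0 + g k (- (pi / 2)))" for g :: "_ \<Rightarrow> _ \<Rightarrow> real"
proof -
 have "(\<Sum>w\<in>modes n. g (fst w) (snd w)) = (\<Sum>k\<in>vp_freqs n. \<Sum>\<theta>\<in>{0, - (pi / 2)}. g k \<theta>)"
  unfolding modes_def by (simp only: sum.cartesian_product case_prod_unfold)
 then show ?thesis by simp
qed

lemma vp_kernel_modes: "vp_kernel n (y - x) = (\<Sum>w\<in>modes n. mode_amp n w y * mode_wave w x)"
proof -
 have "(\<Sum>w\<in>modes n. mode_amp n w y * mode_wave w x)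
   = (\<Sum>k\<in>vp_freqs n. vp_coeff n k * (wave k 0 y * wave k 0 x + wave k (- (pi / 2)) y * wave k (- (pi / 2)) x))"
  unfolding mode_amp_def
  by (subst sum_modes[of "\<lambda>k \<theta>. (if k \<in> vp_freqs n then vp_coeff n k else 0) * wave k \<theta> y * wave k \<theta> x"])
   (simp add: distrib_left mult.assoc)
 also have "\<dots> = (\<Sum>k\<in>vp_freqs n. vp_coeff n k * wave k 0 (y - x))"
  by (simp add: wave_def phase_diff cos_diff cos_add)
 finally show ?thesis by (simp add: vp_kernel_wave)
qed

lemma vp_deriv_modes:
 "vp_deriv j n (y - x) = - (\<Sum>w\<in>modes n. mode_amp n w y * partial j (mode_wave w) x)"
proof -
 have "((\<lambda>z. \<Sum>k\<in>vp_freqs n. vp_coeff n k * wave k 0 z) has_derivative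
   (\<lambda>h. \<Sum>k\<in>vp_freqs n. vp_coeff n k * phase k h * wave k (0 + pi / 2) (y - x))) (at (y - x))"
  by (intro has_derivative_sum has_derivative_wave)
 then have 1: "vp_deriv j n (y - x) = (\<Sum>k\<in>vp_freqs n. vp_coeff n k * (2 * pi * of_int (k j)) * wave k (pi / 2) (y - x))"
  unfolding vp_deriv_def vp_kernel_wave[abs_def] using dir_deriv_eqI[of _ _ "y - x" "axis j 1"] by (simp add: phase_axis)
 have "(\<Sum>w\<in>modes n. mode_amp n w y * partial j (mode_wave w) x)
   = (\<Sum>k\<in>vp_freqs n. vp_coeff n k * (2 * pi * of_int (k j)) * (wave k 0 y * wave k (pi / 2) x + wave k (- (pi / 2)) y * wave k 0 x))"
  unfolding mode_amp_def dir_deriv_wave_axis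
  by (subst sum_modes[of "\<lambda>k \<theta>. (if k \<in> vp_freqs n then vp_coeff n k else 0) * wave k \<theta> y * (2 * pi * of_int (k j) * wave k (\<theta> + pi / 2) x)"])
   (simp add: distrib_left mult_ac)
 also have "\<dots> = - (\<Sum>k\<in>vp_freqs n. vp_coeff n k * (2 * pi * of_int (k j)) * wave k (pi / 2) (y - x))"
  unfolding sum_negf[symmetric]
 proof (intro sum.cong refl)
  fix k
  have "wave k 0 y * wave k (pi / 2) x + wave k (- (pi / 2)) y * wave k 0 x = - wave k (pi / 2) (y - x)"
   by (simp add: wave_def phase_diff cos_add cos_diff sin_diff)
  then show "vp_coeff n k * (2 * pi * of_int (k j)) * (wave k 0 y * wave k (pi / 2) x + wave k (- (pi / 2)) y * wave k 0 x)
    = - (vp_coeff n k * (2 * pi * of_int (k j)) * wave k (pi / 2) (y - x))"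
   by (simp only: mult_minus_right)
 qed
 finally show ?thesis using 1 by simp
qed

lemma rconv_modes:
 assumes f: "integrable torus f"
 shows "rconv n f y = (\<Sum>w\<in>modes n. mode_amp n w y * (TI x. mode_wave w x * f x))"
proof -
 have i: "integrable torus (\<lambda>x. mode_wave w x * f x)" for w
  by (intro integrable_continuous_mult_torus continuous_torus_test torus_test_wave f)
 have "rconv n f y = (TI x. (\<Sum>w\<in>modes n. mode_amp n w y * (mode_wave w x * f x)))"
  unfolding rconv_def vp_kernel_modes sum_distrib_right by (simp add: mult.assoc)
 also have "\<dots> = (\<Sum>w\<in>modes n. (TI x. mode_amp n w y * (mode_wave w x * f x)))"
  by (intro LINT_sum L1_mult_right i)
 finally show ?thesis by simp
qed

lemma flux_modes:
 assumes g: "integrable torus g"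
 shows "(TI x. g x * vp_deriv j n (y - x))
  = - (\<Sum>w\<in>modes n. mode_amp n w y * (TI x. g x * partial j (mode_wave w) x))"
proof -
 have i: "integrable torus (\<lambda>x. g x * partial j (mode_wave w) x)" for w
  using integrable_continuous_mult_torus[OF continuous_torus_test(2)[OF torus_test_wave] g] by (simp add: mult.commute)
 have "(TI x. g x * vp_deriv j n (y - x)) = (TI x. - (\<Sum>w\<in>modes n. mode_amp n w y * (g x * partial j (mode_wave w) x)))"
  unfolding vp_deriv_modes by (simp add: sum_distrib_left mult_ac)
 also have "\<dots> = - (\<Sum>w\<in>modes n. (TI x. mode_amp n w y * (g x * partial j (mode_wave w) x)))"
  by (subst LINT_minus, subst LINT_sum)
   (auto intro!: L1_mult_right i)
 finally show ?thesis by simp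
qed

lemma L2_product_bound:
 fixes f g :: "real^3 \<Rightarrow> real"
 assumes "f \<in> L2" "norm2 f \<le> M" "g \<in> L2" "norm2 g \<le> M'"
 shows "integrable torus (\<lambda>x. f x * g x)" "(TI x. \<bar>f x * g x\<bar>) \<le> sqrt M * sqrt M'"
proof -
 show "integrable torus (\<lambda>x. f x * g x)" by (rule L2_mult_integrable) fact+
 have "(TI x. \<bar>f x * g x\<bar>) \<le> sqrt (norm2 f) * sqrt (norm2 g)"
  using integral_Cauchy_Schwarz[OF assms(1,3)] by (simp add: abs_mult)
 also have "\<dots> \<le> sqrt M * sqrt M'"
  using assms order_trans[OF norm2_nonneg assms(2)] by (intro mult_mono real_sqrt_le_mono) auto
 finally show "(TI x. \<bar>f x * g x\<bar>) \<le> sqrt M * sqrt M'" .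
qed

locale transported_density =
 fixes c :: "event \<Rightarrow> real" and v :: "event \<Rightarrow> real^3" and c0 :: "real^3 \<Rightarrow> real" and M M' :: real
 assumes c_Hbound: "AE t in half_line. Hbound 1 (\<lambda>x. c (t, x)) M"
  and c_measurable: "c \<in> borel_measurable spacetime"
  and v_L2: "AE t in half_line. \<forall>j. L2_le (\<lambda>x. v (t, x) $ j) M'"
  and v_measurable: "v \<in> borel_measurable spacetime"
  and balance: "weak_balance c (\<lambda>p. c p *\<^sub>R v p) (\<lambda>_. 0)"
  and c0_attained: "attains c c0" and c0_integrable: "integrable torus c0" and c0_nonneg: "AE x in torus. 0 \<le> c0 x"
begin

lemma bad_cyl:
 shows "integrable (cyl {0..t}) (\<lambda>p. bad \<eta> R (c p) (v p $ j))"
  and "integrable (lebesgue_on {0..t}) (\<lambda>\<tau>. TI x. bad \<eta> R (c (\<tau>, x)) (v (\<tau>, x) $ j))"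
proof -
 show 1: "integrable (cyl {0..t}) (\<lambda>p. bad \<eta> R (c p) (v p $ j))"
 proof (rule cyl_integrableI)
  show "(\<lambda>p. bad \<eta> R (c p) (v p $ j)) \<in> borel_measurable (cyl {0..t})"
   by (intro bad_measurable borel_measurable_nth cyl_measurable_mono c_measurable v_measurable) auto
  have "AE \<tau> in half_line. integrable torus (\<lambda>x. bad \<eta> R (c (\<tau>, x)) (v (\<tau>, x) $ j)) \<and> (TI x. \<bar>bad \<eta> R (c (\<tau>, x)) (v (\<tau>, x) $ j)\<bar>) \<le> 2 * M'"
   using c_Hbound v_L2
  proof eventually_elim
   case (elim \<tau>)
   let ?b = "\<lambda>x. bad \<eta> R (c (\<tau>, x)) (v (\<tau>, x) $ j)"
   have u: "(\<lambda>x. v (\<tau>, x) $ j) \<in> L2" using elim by auto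
   have b: "integrable torus ?b" by (rule bad_integrable[OF Hbound_L2(1)[OF elim(1)] u])
   have "(TI x. \<bar>?b x\<bar>) \<le> (TI x. 2 * (v (\<tau>, x) $ j)\<^sup>2)"
    using b L2_integrable_sq[OF u] bad_bounds by (intro integral_mono) auto
   also have "\<dots> = 2 * norm2 (\<lambda>x. v (\<tau>, x) $ j)" by (simp add: norm2_def)
   finally show ?case using b elim(2) by (auto intro: order_trans)
  qed
  then show "AE \<tau> in lebesgue_on {0..t}. integrable torus (\<lambda>x. bad \<eta> R (c (\<tau>, x)) (v (\<tau>, x) $ j)) \<and> (TI x. \<bar>bad \<eta> R (c (\<tau>, x)) (v (\<tau>, x) $ j)\<bar>) \<le> 2 * M'"
   by (rule AE_time_subset) simp
 qed
 show "integrable (lebesgue_on {0..t}) (\<lambda>\<tau>. TI x. bad \<eta> R (c (\<tau>, x)) (v (\<tau>, x) $ j))"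
  using cyl_Fubini(2)[OF closed_atLeastAtMost 1] .
qed

abbreviation moment_rate :: "(3 \<Rightarrow> int) \<times> real \<Rightarrow> real \<Rightarrow> real" where
 "moment_rate w \<equiv> \<lambda>t. \<Sum>j\<in>UNIV. (TI x. (c (t, x) *\<^sub>R v (t, x)) $ j * partial j (mode_wave w) x)"

lemma moment_evolution:
 obtains B where "\<And>w. w \<in> modes n \<Longrightarrow> time_primitive (moment_rate w) B"
  "AE t in half_line. \<forall>w\<in>modes n. (TI x. mode_wave w x * c (t, x)) = (TI x. mode_wave w x * c0 x)
   + time_primitive.D (moment_rate w) t"
proof -
 have Fb: "AE t in half_line. \<forall>j. integrable torus (\<lambda>x. (c (t, x) *\<^sub>R v (t, x)) $ j) \<and> (TI x. \<bar>(c (t, x) *\<^sub>R v (t, x)) $ j\<bar>) \<le> sqrt M * sqrt M'"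
  using c_Hbound v_L2
 proof eventually_elim
  case (elim t)
  then show ?case using L2_product_bound[OF Hbound_L2(1,2)[OF elim(1)]] by auto
 qed
 have Fm: "(\<lambda>p. c p *\<^sub>R v p) \<in> borel_measurable spacetime" by (intro borel_measurable_scaleR c_measurable v_measurable)
 let ?P = "\<lambda>w B. time_primitive (moment_rate w) B \<and> (AE t in half_line. (TI x. mode_wave w x * c (t, x))
   = (TI x. mode_wave w x * c0 x) + time_primitive.D (moment_rate w) t)"
 have "\<forall>w. \<exists>B. ?P w B"
 proof
  fix w
  obtain B where "?P w B"
   by (rule weak_balance_primitive[OF balance Fm Fb c0_attained torus_test_wave]) (rule that, rule conjI)
  then show "\<exists>B. ?P w B" ..
 qed
 then obtain B where P: "\<forall>w. ?P w (B w)" by (rule choice[THEN exE])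
 have B: "time_primitive (moment_rate w) (B w)" for w using P by (rule allE) (erule conjunct1)
 have eq: "AE t in half_line. (TI x. mode_wave w x * c (t, x)) = (TI x. mode_wave w x * c0 x)
   + time_primitive.D (moment_rate w) t" for w
  using P by (rule allE) (erule conjunct2)
 show thesis
 proof (rule that)
  fix w assume w: "w \<in> modes n"
  have le: "B w \<le> (\<Sum>w\<in>modes n. \<bar>B w\<bar>)"
   using member_le_sum[of w "modes n" "\<lambda>w. \<bar>B w\<bar>"] w by simp
  show "time_primitive (moment_rate w) (\<Sum>w\<in>modes n. \<bar>B w\<bar>)"
  proof
   show "AE t in half_line. \<bar>moment_rate w t\<bar> \<le> (\<Sum>w\<in>modes n. \<bar>B w\<bar>)"
    using time_primitive.B[OF B[of w]] by eventually_elim (use le in linarith)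
  qed (rule time_primitive.d[OF B])
 next
  show "AE t in half_line. \<forall>w\<in>modes n. (TI x. mode_wave w x * c (t, x)) = (TI x. mode_wave w x * c0 x)
   + time_primitive.D (moment_rate w) t"
   by (intro AE_finite_allI eq) simp
 qed
qed

text \<open>The integral of the convex function starts at zero since the mollified initial datum is nonnegative,
 and its growth is the mollified flux tested with the slope.\<close>

lemma mollified_negative_part:
 assumes n: "n = Suc p" and \<eta>: "\<eta> > 0" and \<mu>: "\<mu> > 0" and R: "0 \<le> R"
 shows "AE t in half_line. (TI y. neg_part (\<eta> / 2) (rconv n (\<lambda>x. c (t, x)) y))
  \<le> (LINT \<tau>|lebesgue_on {0..t}. (\<Sum>j\<in>UNIV. \<mu> / 2 * (4 * pi\<^sup>2 * (TI x. bad \<eta> R (c (\<tau>, x)) (v (\<tau>, x) $ j))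
    + 4 * R / \<eta>\<^sup>2 * (504 * pi\<^sup>2 * M / (real n + 1))) + 27 * M / \<mu>))"
proof -
 let ?T = "neg_slope (\<eta> / 2)"
 obtain B where B: "\<And>w. w \<in> modes n \<Longrightarrow> time_primitive (moment_rate w) B"
  and eq: "AE t in half_line. \<forall>w\<in>modes n. (TI x. mode_wave w x * c (t, x)) = (TI x. mode_wave w x * c0 x)
   + time_primitive.D (moment_rate w) t"
  by (rule moment_evolution[of n]) blast
 define b where "b \<tau> y = rconv n c0 y + (\<Sum>w\<in>modes n. mode_amp n w y * time_primitive.D (moment_rate w) \<tau>)" for \<tau> y
 have b_eq: "AE t in half_line. b t = rconv n (\<lambda>x. c (t, x))"
  using eq c_Hbound
 proof eventually_elim
  case (elim t)
  show ?case
  proof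
   fix y
   show "b t y = rconv n (\<lambda>x. c (t, x)) y"
    unfolding b_def rconv_modes[OF c0_integrable] rconv_modes[OF Hbound_L2(3)[OF elim(2)]] sum.distrib[symmetric]
    by (intro sum.cong refl) (use elim(1) in \<open>simp add: distrib_left\<close>)
  qed
 qed
 have \<delta>: "\<eta> / 2 > 0" using \<eta> by simp
 note evol = neg_part_evolution[OF finite_modes[of n] continuous_mode_amp mode_amp_le_1 B continuous_rconv[OF c0_integrable] \<delta> _ b_def]
 have b0: "(TI y. neg_part (\<eta> / 2) (rconv n c0 y)) = 0"
 proof -
  have "0 \<le> rconv n c0 y" for y
   unfolding rconv_def by (intro integral_nonneg_AE) (use c0_nonneg in \<open>auto elim!: eventually_mono\<close>)
  then show ?thesis by (simp add: neg_part_nonneg_arg[OF \<delta>])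
 qed
 let ?E = "\<lambda>\<tau>. \<Sum>w\<in>modes n. moment_rate w \<tau> * (TI y. mode_amp n w y * ?T (b \<tau> y))"
 let ?G = "\<lambda>\<tau>. \<Sum>j\<in>UNIV. \<mu> / 2 * (4 * pi\<^sup>2 * (TI x. bad \<eta> R (c (\<tau>, x)) (v (\<tau>, x) $ j))
    + 4 * R / \<eta>\<^sup>2 * (504 * pi\<^sup>2 * M / (real n + 1))) + 27 * M / \<mu>"
 have EG: "AE \<tau> in half_line. ?E \<tau> \<le> ?G \<tau>"
  using b_eq c_Hbound v_L2
 proof eventually_elim
  case (elim \<tau>)
  let ?f = "\<lambda>x. c (\<tau>, x)" and ?u = "\<lambda>j x. v (\<tau>, x) $ j"
  have f: "?f \<in> L2" "integrable torus ?f" using Hbound_L2[OF elim(2)] by auto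
  have fu: "integrable torus (\<lambda>x. ?f x * ?u j x)" for j using L2_mult_integrable[OF f(1), of "?u j"] elim(3) by auto
  have Tc: "continuous_on UNIV (\<lambda>y. ?T (b \<tau> y))" unfolding elim(1) by (intro continuous_intros continuous_rconv f)
  let ?I = "\<lambda>w j. TI x. ?f x * ?u j x * partial j (mode_wave w) x"
  have "(\<Sum>j\<in>UNIV. (TI y. ?T (b \<tau> y) * (TI x. ?f x * ?u j x * vp_deriv j n (y - x))))
    = (\<Sum>j\<in>UNIV. - (\<Sum>w\<in>modes n. ?I w j * (TI y. mode_amp n w y * ?T (b \<tau> y))))"
  proof (intro sum.cong refl)
   fix j
   have "(TI y. ?T (b \<tau> y) * (TI x. ?f x * ?u j x * vp_deriv j n (y - x)))
     = (TI y. - (\<Sum>w\<in>modes n. ?I w j * (mode_amp n w y * ?T (b \<tau> y))))"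
    unfolding flux_modes[OF fu] by (simp add: sum_distrib_left mult_ac)
   also have "\<dots> = - (\<Sum>w\<in>modes n. ?I w j * (TI y. mode_amp n w y * ?T (b \<tau> y)))"
    by (subst LINT_minus, subst LINT_sum)
     (auto intro!: L1_mult_right continuous_integrable_torus continuous_intros continuous_mode_amp Tc)
   finally show "(TI y. ?T (b \<tau> y) * (TI x. ?f x * ?u j x * vp_deriv j n (y - x)))
     = - (\<Sum>w\<in>modes n. ?I w j * (TI y. mode_amp n w y * ?T (b \<tau> y)))" .
  qed
  also have "\<dots> = - (\<Sum>w\<in>modes n. (\<Sum>j\<in>UNIV. ?I w j) * (TI y. mode_amp n w y * ?T (b \<tau> y)))"
   unfolding sum_negf sum_distrib_right by (subst sum.swap) (rule refl)
  also have "\<dots> = - ?E \<tau>" by simp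
  finally have "?E \<tau> = (\<Sum>j\<in>UNIV. - (TI y. ?T (b \<tau> y) * (TI x. ?f x * ?u j x * vp_deriv j n (y - x))))"
   unfolding sum_negf by linarith
  also have "\<dots> \<le> ?G \<tau>"
  proof (rule sum_mono)
   fix j
   have u: "?u j \<in> L2" using elim(3) by auto
   show "- (TI y. ?T (b \<tau> y) * (TI x. ?f x * ?u j x * vp_deriv j n (y - x)))
     \<le> \<mu> / 2 * (4 * pi\<^sup>2 * (TI x. bad \<eta> R (?f x) (?u j x)) + 4 * R / \<eta>\<^sup>2 * (504 * pi\<^sup>2 * M / (real n + 1))) + 27 * M / \<mu>"
    using flux_commutator[OF elim(2) u n \<eta> \<mu> R, of j] unfolding elim(1) by linarith
  qed
  finally show ?case .
 qed
 have "AE t in half_line. t \<in> space (lebesgue_on {0::real..})" by (rule AE_space)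
 with b_eq show ?thesis
 proof eventually_elim
  case (elim t)
  then have t: "0 \<le> t" by simp
  have "(TI y. neg_part (\<eta> / 2) (b t y)) \<le> (LINT \<tau>|lebesgue_on {0..t}. ?E \<tau>)"
   using evol(2)[OF _ t] unfolding b0 by simp
  also have "\<dots> \<le> (LINT \<tau>|lebesgue_on {0..t}. ?G \<tau>)"
  proof (rule integral_mono_AE)
   show "integrable (lebesgue_on {0..t}) ?E" using evol(1)[OF _ t] by simp
   show "integrable (lebesgue_on {0..t}) ?G"
    by (intro L1_sum L1_add L1_mult_right bad_cyl)
     (auto intro!: finite_measure.integrable_const finite_measure_lebesgue_on)
   show "AE \<tau> in lebesgue_on {0..t}. ?E \<tau> \<le> ?G \<tau>" by (rule AE_time_subset[OF EG]) simp
  qed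
  finally show ?case unfolding elim(1) .
 qed
qed

end

lemma bad_tendsto_0: "(\<lambda>m. bad (1 / (real m + 1)) (real m) a v) \<longlonglongrightarrow> 0"
proof (rule tendsto_eventually)
 obtain N1 :: nat where N1: "v\<^sup>2 \<le> real N1" using real_arch_simple by blast
 obtain N2 :: nat where N2: "a \<noteq> 0 \<Longrightarrow> 1 / (real N2 + 1) < \<bar>a\<bar>"
  using reals_Archimedean[of "\<bar>a\<bar>"] by (cases "a = 0") (auto simp: inverse_eq_divide add.commute)
 show "eventually (\<lambda>m. bad (1 / (real m + 1)) (real m) a v = 0) sequentially"
  using eventually_ge_at_top[of "max N1 N2"]
 proof eventually_elim
  case (elim m)
  have "\<not> real m < v\<^sup>2" using N1 elim by linarith
  moreover have "\<not> (0 < \<bar>a\<bar> \<and> \<bar>a\<bar> < 1 / (real m + 1))"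
  proof
   assume a: "0 < \<bar>a\<bar> \<and> \<bar>a\<bar> < 1 / (real m + 1)"
   have "1 / (real m + 1) \<le> 1 / (real N2 + 1)" using elim by (intro divide_left_mono) auto
   then show False using a N2 by auto
  qed
  ultimately show ?case by (simp only: bad_def if_False mult_zero_right add_0_right)
 qed
qed

context transported_density
begin

lemma bad_integral_tendsto_0:
 "(\<lambda>m. LINT \<tau>|lebesgue_on {0..t}. (TI x. bad (1 / (real m + 1)) (real m) (c (\<tau>, x)) (v (\<tau>, x) $ j))) \<longlonglongrightarrow> 0"
proof -
 have "(\<lambda>m. LINT p|cyl {0..t}. bad (1 / (real m + 1)) (real m) (c p) (v p $ j)) \<longlonglongrightarrow> (LINT p|cyl {0..t}. 0)"
 proof (rule integral_dominated_convergence)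
  \<comment> \<open>With these parameters \<^term>\<open>bad\<close> is the square of its last argument.\<close>
  have "integrable (cyl {0..t}) (\<lambda>p. 2 * bad 0 (- 1) (c p) (v p $ j))" using bad_cyl(1)[of t 0 "-1" j] by simp
  moreover have "- 1 < (y::real)\<^sup>2" for y using zero_le_power2[of y] by linarith
  then have "bad 0 (- 1) a y = y\<^sup>2" for a y by (simp add: bad_def)
  ultimately show "integrable (cyl {0..t}) (\<lambda>p. 2 * (v p $ j)\<^sup>2)" by simp
  show "(\<lambda>p. bad (1 / (real m + 1)) (real m) (c p) (v p $ j)) \<in> borel_measurable (cyl {0..t})" for m
   using bad_cyl(1) by (rule borel_measurable_integrable)
  show "AE p in cyl {0..t}. (\<lambda>m. bad (1 / (real m + 1)) (real m) (c p) (v p $ j)) \<longlonglongrightarrow> 0"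
   by (intro AE_I2 bad_tendsto_0)
  show "AE p in cyl {0..t}. norm (bad (1 / (real m + 1)) (real m) (c p) (v p $ j)) \<le> 2 * (v p $ j)\<^sup>2" for m
   using bad_bounds by (intro AE_I2) auto
 qed simp
 moreover have "(LINT p|cyl {0..t}. bad \<eta> R (c p) (v p $ j)) = (LINT \<tau>|lebesgue_on {0..t}. (TI x. bad \<eta> R (c (\<tau>, x)) (v (\<tau>, x) $ j)))" for \<eta> R
  by (rule cyl_Fubini(3)[OF closed_atLeastAtMost bad_cyl(1)])
 ultimately show ?thesis by simp
qed

text \<open>The negative part of \<open>c (t, \<cdot>)\<close> has integral at most \<open>81 M t / \<mu>\<close> for every \<open>\<mu>\<close>: first the
 mollification is removed, then the truncations \<open>\<eta> = 1/(m+1)\<close> and \<open>R = m\<close> are.\<close>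

lemma density_nonneg: "AE p in spacetime. 0 \<le> c p"
proof -
 let ?\<eta> = "\<lambda>m::nat. 1 / (real m + 1)"
 let ?\<beta> = "\<lambda>m j t. LINT \<tau>|lebesgue_on {0..t}. (TI x. bad (?\<eta> m) (real m) (c (\<tau>, x)) (v (\<tau>, x) $ j))"
 let ?rhs = "\<lambda>m l p t. LINT \<tau>|lebesgue_on {0..t}. (\<Sum>j\<in>UNIV. (real l + 1) / 2 * (4 * pi\<^sup>2 * (TI x. bad (?\<eta> m) (real m) (c (\<tau>, x)) (v (\<tau>, x) $ j))
    + 4 * real m / (?\<eta> m)\<^sup>2 * (504 * pi\<^sup>2 * M / (real (Suc p) + 1))) + 27 * M / (real l + 1))"
 have moll: "AE t in half_line. (TI y. neg_part (?\<eta> m / 2) (rconv (Suc p) (\<lambda>x. c (t, x)) y))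
  \<le> ?rhs m l p t" for m l p
  by (rule mollified_negative_part) auto
 have "AE t in half_line. \<forall>m l p. (TI y. neg_part (?\<eta> m / 2) (rconv (Suc p) (\<lambda>x. c (t, x)) y))
  \<le> ?rhs m l p t"
  unfolding AE_all_countable by (intro allI moll)
 moreover have "AE t in half_line. t \<in> space (lebesgue_on {0::real..})" by (rule AE_space)
 ultimately have "AE t in half_line. AE x in torus. max 0 (- c (t, x)) = 0"
  using c_Hbound
 proof eventually_elim
  case (elim t)
  then have t: "0 \<le> t" by simp
  let ?f = "\<lambda>x. c (t, x)"
  let ?N = "TI x. max 0 (- ?f x)"
  have f: "?f \<in> L2" "integrable torus ?f" and M: "0 \<le> M" using Hbound_L2[OF elim(3)] by auto
  have Ni: "integrable torus (\<lambda>x. max 0 (- ?f x))" using f by auto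
  have rhs: "(LINT \<tau>|lebesgue_on {0..t}. (\<Sum>j\<in>UNIV. \<mu> / 2 * (4 * pi\<^sup>2 * (TI x. bad \<eta> R (c (\<tau>, x)) (v (\<tau>, x) $ j)) + C) + K))
    = (\<Sum>j\<in>UNIV. \<mu> / 2 * (4 * pi\<^sup>2 * (LINT \<tau>|lebesgue_on {0..t}. (TI x. bad \<eta> R (c (\<tau>, x)) (v (\<tau>, x) $ j))) + C * t) + K * t)" for \<mu> \<eta> R C K
  proof -
   have c: "integrable (lebesgue_on {0..t}) (\<lambda>_. k)" for k :: real by (auto intro!: finite_measure.integrable_const finite_measure_lebesgue_on)
   have m: "(LINT \<tau>|lebesgue_on {0..t}. k) = k * t" for k :: real using t by (simp add: measure_restrict_space)
   note b = bad_cyl(2)[of t \<eta> R]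
   note mi = L1_mult_right and ad = L1_add
   have 1: "integrable (lebesgue_on {0..t}) (\<lambda>\<tau>. 4 * pi\<^sup>2 * (TI x. bad \<eta> R (c (\<tau>, x)) (v (\<tau>, x) $ j)))" for j by (intro mi b)
   have 2: "integrable (lebesgue_on {0..t}) (\<lambda>\<tau>. \<mu> / 2 * (4 * pi\<^sup>2 * (TI x. bad \<eta> R (c (\<tau>, x)) (v (\<tau>, x) $ j)) + C))" for j by (intro mi ad 1 c)
   show ?thesis
    by (subst LINT_sum)
     (intro ad 2 c, simp only: LINT_add[OF 2 c] LINT_add[OF 1 c] integral_mult_right_zero m)
  qed
  let ?X = "\<lambda>m l p. ?\<eta> m / 4 + sqrt (9 * M / (real (Suc p) + 1)) + (\<Sum>j\<in>UNIV. (real l + 1) / 2 * (4 * pi\<^sup>2 * ?\<beta> m j t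
    + 4 * real m / (?\<eta> m)\<^sup>2 * (504 * pi\<^sup>2 * M / (real (Suc p) + 1)) * t) + 27 * M / (real l + 1) * t)"
  have N_le: "?N \<le> ?X m l p" for m l p
  proof -
   let ?b = "rconv (Suc p) ?f"
   have bc: "continuous_on UNIV ?b" by (rule continuous_rconv[OF f(2)])
   have dL: "(\<lambda>x. ?f x - ?b x) \<in> L2" by (intro L2_diff f continuous_in_L2 bc)
   have d: "integrable torus (\<lambda>x. \<bar>?f x - ?b x\<bar>)" using L2_integrable[OF dL] by auto
   have np: "integrable torus (\<lambda>y. neg_part (?\<eta> m / 2) (?b y))" by (intro continuous_integrable_torus continuous_intros bc)
   have "?N \<le> (TI x. neg_part (?\<eta> m / 2) (?b x) + ?\<eta> m / 4 + \<bar>?f x - ?b x\<bar>)"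
   proof (rule integral_mono[OF Ni])
    show "integrable torus (\<lambda>x. neg_part (?\<eta> m / 2) (?b x) + ?\<eta> m / 4 + \<bar>?f x - ?b x\<bar>)" using np d by auto
    fix x
    have arith: "F \<le> P + e / 4 + D" if "B - e / 2 / 2 \<le> P" "F \<le> B + D" for F P B D e :: real using that by simp
    have "max 0 (- ?f x) \<le> max 0 (- ?b x) + \<bar>?f x - ?b x\<bar>" by linarith
    moreover have "max 0 (- ?b x) - ?\<eta> m / 2 / 2 \<le> neg_part (?\<eta> m / 2) (?b x)" by (rule neg_part_ge) simp
    ultimately show "max 0 (- ?f x) \<le> neg_part (?\<eta> m / 2) (?b x) + ?\<eta> m / 4 + \<bar>?f x - ?b x\<bar>"
     by (intro arith)
   qed
   also have "\<dots> = (TI x. neg_part (?\<eta> m / 2) (?b x)) + ?\<eta> m / 4 + (TI x. \<bar>?f x - ?b x\<bar>)"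
    using np d by simp
   also have "(TI x. \<bar>?f x - ?b x\<bar>) \<le> sqrt (9 * M / (real (Suc p) + 1))"
   proof -
    have "(TI x. norm (?f x - ?b x) * norm (1::real)) \<le> sqrt (norm2 (\<lambda>x. ?f x - ?b x)) * sqrt (norm2 (\<lambda>_. 1::real))"
     by (rule integral_Cauchy_Schwarz[OF dL]) (intro continuous_in_L2 continuous_on_const)
    also have "norm2 (\<lambda>_. 1::real) = 1" by (simp add: norm2_def)
    finally have "(TI x. \<bar>?f x - ?b x\<bar>) \<le> sqrt (norm2 (\<lambda>x. ?f x - ?b x))" by simp
    also have "\<dots> \<le> sqrt (9 * M / (real (Suc p) + 1))" by (intro real_sqrt_le_mono norm2_rconv_diff elim) simp
    finally show ?thesis .
   qed
   finally show ?thesis using elim(1)[rule_format, of m p l] unfolding rhs by linarith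
  qed
  have inv: "(\<lambda>p. K / (real (Suc p) + 1)) \<longlonglongrightarrow> 0" for K
   using LIMSEQ_ignore_initial_segment[OF lim_const_over_n[of K], of 2] by (simp add: add.commute)
  let ?Y = "\<lambda>m l. ?\<eta> m / 4 + (\<Sum>j\<in>UNIV. (real l + 1) / 2 * (4 * pi\<^sup>2 * ?\<beta> m j t) + 27 * M / (real l + 1) * t)"
  have lim_p: "?N \<le> ?Y m l" for m l
  proof (rule LIMSEQ_le_const)
   have "(\<lambda>p. ?X m l p)
    \<longlonglongrightarrow> ?\<eta> m / 4 + sqrt 0 + (\<Sum>j\<in>UNIV. (real l + 1) / 2 * (4 * pi\<^sup>2 * ?\<beta> m j t + 4 * real m / (?\<eta> m)\<^sup>2 * 0 * t) + 27 * M / (real l + 1) * t)"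
    by (intro tendsto_intros inv)
   then show "(\<lambda>p. ?X m l p)
    \<longlonglongrightarrow> ?Y m l" by simp
  qed (use N_le in blast)
  have lim_m: "?N \<le> 3 * (27 * M * t) / (real l + 1)" for l
  proof (rule LIMSEQ_le_const)
   have "(\<lambda>m. ?Y m l)
    \<longlonglongrightarrow> 0 / 4 + (\<Sum>j\<in>(UNIV :: 3 set). (real l + 1) / 2 * (4 * pi\<^sup>2 * 0) + 27 * M / (real l + 1) * t)"
    by (intro tendsto_intros bad_integral_tendsto_0) (use LIMSEQ_Suc[OF lim_const_over_n[of 1]] in \<open>simp_all add: add.commute\<close>)
   then show "(\<lambda>m. ?Y m l)
    \<longlonglongrightarrow> 3 * (27 * M * t) / (real l + 1)" by simp
  qed (use lim_p in blast)
  have "(\<lambda>l. 3 * (27 * M * t) / (real l + 1)) \<longlonglongrightarrow> 0"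
   using LIMSEQ_Suc[OF lim_const_over_n[of "3 * (27 * M * t)"]] by (simp add: add.commute)
  then have "?N \<le> 0" by (rule LIMSEQ_le_const) (use lim_m in blast)
  moreover have "0 \<le> ?N" by (intro LINT_nonneg) simp
  ultimately have "?N = 0" by simp
  then show "AE x in torus. max 0 (- c (t, x)) = 0"
   by (subst (asm) integral_nonneg_eq_0_iff_AE[OF Ni]) auto
 qed
 then have "AE p in spacetime. max 0 (- c p) = 0"
  by (intro AE_spacetimeI borel_measurable_max borel_measurable_uminus cyl_measurable_mono c_measurable) auto
 then show ?thesis by eventually_elim (simp add: max_def split: if_splits)
qed

end

section \<open>Manipulating weak formulations\<close>

lemma loc_integrable_cong_AE:
 assumes F: "F \<in> borel_measurable spacetime" "loc_integrable G" and eq: "AE p in spacetime. F p = G p"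
 shows "loc_integrable F"
 unfolding loc_integrable_def
proof (intro allI impI)
 fix a b :: real assume a: "0 < a"
 have G: "integrable (cyl {a..b}) G" using F(2) a by (simp add: loc_integrable_def)
 have "AE p in lborel. p \<in> {0..} \<times> cbox 0 One \<longrightarrow> F p = G p"
  using eq unfolding spacetime_cyl AE_lebesgue_on_iff[OF cyl_sets[OF closed_atLeast]] .
 then have "AE p in cyl {a..b}. F p = G p"
  unfolding AE_lebesgue_on_iff[OF cyl_sets[OF closed_atLeastAtMost]]
 proof eventually_elim
  case (elim p)
  then show ?case using a by (cases p) auto
 qed
 then show "integrable (cyl {a..b}) F"
  using integrable_cong_AE[of F "cyl {a..b}" G] cyl_measurable_mono[OF F(1), of a b] G a by auto
qed

lemma measurable_flux_test:
 assumes F: "F \<in> borel_measurable spacetime" and \<phi>: "spacetime_test \<phi>"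
 shows "(\<lambda>p. F p \<bullet> space_grad \<phi> p) \<in> borel_measurable spacetime"
proof -
 have "(\<lambda>p. space_grad \<phi> p $ j) \<in> borel_measurable spacetime" for j
  unfolding spacetime_cyl by (intro continuous_measurable_cyl continuous_spacetime_test(2)[OF \<phi>]) simp
 then show ?thesis unfolding inner_vec_def inner_real_def
  by (intro borel_measurable_sum borel_measurable_times borel_measurable_nth[OF F]) auto
qed

lemma weak_div_free_cong_AE:
 assumes F: "F \<in> borel_measurable spacetime" "weak_div_free G" and eq: "AE p in spacetime. F p = G p"
  and G: "G \<in> borel_measurable spacetime"
 shows "weak_div_free F"
 unfolding weak_div_free_def
proof (intro conjI allI impI)
 show "loc_integrable F" using F(2) by (intro loc_integrable_cong_AE[OF F(1) _ eq]) (simp add: weak_div_free_def)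
 fix \<phi> assume \<phi>: "spacetime_test \<phi>"
 have "(LINT p|spacetime. F p \<bullet> space_grad \<phi> p) = (LINT p|spacetime. G p \<bullet> space_grad \<phi> p)"
  by (rule LINT_cong_AE[OF measurable_flux_test[OF F(1) \<phi>] measurable_flux_test[OF G \<phi>]])
   (use eq in \<open>auto elim!: eventually_mono\<close>)
 then show "(LINT p|spacetime. F p \<bullet> space_grad \<phi> p) = 0" using F(2) \<phi> by (simp add: weak_div_free_def)
qed

lemma weak_div_free_scaleR: "weak_div_free F \<Longrightarrow> weak_div_free (\<lambda>p. r *\<^sub>R F p)"
 by (auto simp: weak_div_free_def loc_integrable_def)

lemma has_weak_grad_cong_AE:
 assumes G: "has_weak_grad f G" and H: "H \<in> borel_measurable spacetime" and eq: "AE p in spacetime. H p = G p"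
  and Gm: "G \<in> borel_measurable spacetime"
 shows "has_weak_grad f H"
 unfolding has_weak_grad_def
proof (intro conjI allI impI)
 show "loc_integrable H" using G by (intro loc_integrable_cong_AE[OF H _ eq]) (simp add: has_weak_grad_def)
 fix \<phi> assume \<phi>: "spacetime_test \<phi>"
 have m: "\<phi> \<in> borel_measurable spacetime"
  unfolding spacetime_cyl by (intro continuous_measurable_cyl continuous_spacetime_test(1)[OF \<phi>]) simp
 have "(LINT p|spacetime. \<phi> p *\<^sub>R H p) = (LINT p|spacetime. \<phi> p *\<^sub>R G p)"
  by (rule LINT_cong_AE[OF borel_measurable_scaleR[OF m H] borel_measurable_scaleR[OF m Gm]])
   (use eq in \<open>auto elim!: eventually_mono\<close>)
 then show "(LINT p|spacetime. f p *\<^sub>R space_grad \<phi> p) = - (LINT p|spacetime. \<phi> p *\<^sub>R H p)"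
  using G \<phi> by (simp add: has_weak_grad_def)
qed (use G in \<open>simp add: has_weak_grad_def\<close>)

text \<open>For a divergence free velocity \<open>v\<close>, the flux \<open>c v\<close> may be moved into the source term
 \<open>v \<cdot> \<nabla>c\<close> and back.\<close>

lemma weak_balance_advection_iff:
 assumes c: "Linf_Hbound 1 c" "c \<in> borel_measurable spacetime"
  and v: "\<And>j. Linf_Hbound 0 (\<lambda>p. v p $ j)" "v \<in> borel_measurable spacetime"
  and dv: "weak_div_free v" and G: "has_weak_grad c G"
  and F: "F \<in> borel_measurable spacetime" "F' \<in> borel_measurable spacetime"
  and eq: "AE p in spacetime. F p = F' p + c p *\<^sub>R v p"
 shows "weak_balance c F (\<lambda>_. 0) \<longleftrightarrow> weak_balance c F' (\<lambda>p. v p \<bullet> G p)"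
proof -
 note adv = advection[OF c v dv G]
 have eq': "AE p in spacetime. F' p = F p - c p *\<^sub>R v p" using eq by eventually_elim simp
 have li: "loc_integrable F \<longleftrightarrow> loc_integrable F'"
 proof
  assume "loc_integrable F"
  then have "loc_integrable (\<lambda>p. F p - c p *\<^sub>R v p)" using adv(2) by (simp add: loc_integrable_def)
  from loc_integrable_cong_AE[OF F(2) this eq'] show "loc_integrable F'" .
 next
  assume "loc_integrable F'"
  then have "loc_integrable (\<lambda>p. F' p + c p *\<^sub>R v p)" using adv(2) by (simp add: loc_integrable_def)
  from loc_integrable_cong_AE[OF F(1) this eq] show "loc_integrable F" .
 qed
 have int: "(LINT p|spacetime. c p * time_deriv \<phi> p + F p \<bullet> space_grad \<phi> p - 0 * \<phi> p)
   = (LINT p|spacetime. c p * time_deriv \<phi> p + F' p \<bullet> space_grad \<phi> p - (v p \<bullet> G p) * \<phi> p)"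
  if lc: "loc_integrable c" and lF: "loc_integrable F" and \<phi>: "spacetime_test \<phi>" for \<phi>
 proof -
  let ?X = "\<lambda>p. c p * time_deriv \<phi> p + F p \<bullet> space_grad \<phi> p - 0 * \<phi> p"
  let ?Y = "\<lambda>p. c p * time_deriv \<phi> p + F' p \<bullet> space_grad \<phi> p - (v p \<bullet> G p) * \<phi> p"
  let ?Z = "\<lambda>p. (c p *\<^sub>R v p) \<bullet> space_grad \<phi> p + (v p \<bullet> G p) * \<phi> p"
  have lF': "loc_integrable F'" using lF li by simp
  have X: "integrable spacetime ?X"
   using integrable_scalar_test(1)[OF lc \<phi>] integrable_flux_test[OF lF \<phi>] by simp
  have Y: "integrable spacetime ?Y"
   using integrable_scalar_test(1)[OF lc \<phi>] integrable_flux_test[OF lF' \<phi>] integrable_scalar_test(2)[OF adv(1) \<phi>] by simp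
  have "(LINT p|spacetime. ?X p) = (LINT p|spacetime. ?Y p + ?Z p)"
  proof (rule LINT_cong_AE)
   show "AE p in spacetime. ?X p = ?Y p + ?Z p" using eq by eventually_elim (simp add: inner_add_left)
  qed (rule borel_measurable_integrable[OF X]
    borel_measurable_integrable[OF L1_add[OF Y adv(3)[OF \<phi>]]])+
  also have "\<dots> = (LINT p|spacetime. ?Y p) + 0"
   unfolding adv(4)[OF \<phi>, symmetric] by (rule LINT_add[OF Y adv(3)[OF \<phi>]])
  finally show ?thesis by simp
 qed
 have "loc_integrable (\<lambda>_ :: event. 0 :: real)" by (simp add: loc_integrable_def)
 then show ?thesis unfolding weak_balance_def using li int adv(1) by auto
qed

section \<open>Algebra of the Maxwell-Stefan matrix\<close>

lemma species_mult_MS_matrix: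
 "species_mult (MS_matrix \<Delta> c) w $ i = (\<Sum>j\<in>UNIV. (c $ i * c $ j / \<Delta> i j) *\<^sub>R (w $ j - w $ i))"
proof -
 let ?S = "\<Sum>k\<in>UNIV. c $ i * c $ k / \<Delta> i k"
 have "species_mult (MS_matrix \<Delta> c) w $ i
   = (\<Sum>j\<in>UNIV. (c $ i * c $ j / \<Delta> i j) *\<^sub>R w $ j - (if i = j then ?S *\<^sub>R w $ j else 0))"
  unfolding species_mult_def MS_matrix_def by (simp add: scaleR_left_diff_distrib if_distrib[of "\<lambda>r. (_ * r) *\<^sub>R _"] cong: if_cong)
 also have "\<dots> = (\<Sum>j\<in>UNIV. (c $ i * c $ j / \<Delta> i j) *\<^sub>R w $ j) - ?S *\<^sub>R w $ i"
  by (simp add: sum_subtractf)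
 also have "\<dots> = (\<Sum>j\<in>UNIV. (c $ i * c $ j / \<Delta> i j) *\<^sub>R (w $ j - w $ i))"
  by (simp add: scaleR_right_diff_distrib sum_subtractf scaleR_left.sum)
 finally show ?thesis .
qed

lemma species_mult_MS_matrix_shift:
 assumes "\<And>i. w' $ i = w $ i + a"
 shows "species_mult (MS_matrix \<Delta> c) w' = species_mult (MS_matrix \<Delta> c) w"
 by (simp add: vec_eq_iff[of "species_mult _ _"] species_mult_MS_matrix assms)

lemma sum_species_mult_MS_matrix:
 assumes sym: "\<And>i j. \<Delta> i j = \<Delta> j i"
 shows "(\<Sum>i\<in>UNIV. species_mult (MS_matrix \<Delta> c) w $ i) = 0"
proof -
 let ?a = "\<lambda>i j. (c $ i * c $ j / \<Delta> i j) *\<^sub>R (w $ j - w $ i)"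
 have "?a j i = - ?a i j" for i j using sym[of i j] by (simp add: mult.commute flip: scaleR_minus_right)
 then have "(\<Sum>i\<in>UNIV. \<Sum>j\<in>UNIV. ?a j i) = (\<Sum>i\<in>UNIV. \<Sum>j\<in>UNIV. - ?a i j)" by (intro sum.cong refl)
 then have "(\<Sum>i\<in>UNIV. \<Sum>j\<in>UNIV. ?a j i) = - (\<Sum>i\<in>UNIV. \<Sum>j\<in>UNIV. ?a i j)" by (simp only: sum_negf)
 moreover have "(\<Sum>i\<in>UNIV. \<Sum>j\<in>UNIV. ?a j i) = (\<Sum>i\<in>UNIV. \<Sum>j\<in>UNIV. ?a i j)" by (rule sum.swap)
 ultimately have "S = - S" if "S = (\<Sum>i\<in>UNIV. \<Sum>j\<in>UNIV. ?a i j)" for S using that by (simp only:)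
 from this[OF refl] have "2 *\<^sub>R (\<Sum>i\<in>UNIV. \<Sum>j\<in>UNIV. ?a i j) = 0"
  unfolding scaleR_2 by (simp only: eq_neg_iff_add_eq_0)
 then show ?thesis unfolding species_mult_MS_matrix by simp
qed

lemma V_field_nth: "V_field C0 c U $ i = U $ i - (1 / C0) *\<^sub>R pairing c U"
 by (simp add: V_field_def)

lemma pairing_shift: "(\<And>i. w' $ i = w $ i + a) \<Longrightarrow> pairing c w' = pairing c w + (\<Sum>i\<in>UNIV. c $ i) *\<^sub>R a"
 by (simp add: pairing_def scaleR_right_distrib sum.distrib scaleR_left.sum)

section \<open>The total density\<close>

lemma Linf_sobolev_nth:
 fixes c :: "event \<Rightarrow> real^'n"
 assumes "c \<in> Linf_sobolev s" shows "Linf_Hbound s (\<lambda>p. c p $ i)"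
 using Linf_sobolevD(3)[OF assms, of "axis i 1"] by (simp add: inner_axis)

lemma Linf_sobolev_nth_nth:
 fixes u :: "event \<Rightarrow> real^3^'n"
 assumes "u \<in> Linf_sobolev s" shows "Linf_Hbound s (\<lambda>p. u p $ i $ j)"
 using Linf_sobolevD(3)[OF assms, of "axis i (axis j 1)"] by (simp add: inner_axis)

lemma sobolev_nth_L2:
 fixes f :: "real^3 \<Rightarrow> real^'n"
 assumes "f \<in> sobolev s" shows "(\<lambda>x. f x $ i) \<in> L2"
 using Hbound_L2(1)[OF sobolev_imp_Hbound[OF assms order_refl, of "axis i 1"]] by (simp add: inner_axis)

text \<open>Components commute with the integrals only for integrable slices, which almost every slice is.\<close>

lemma has_initial_datum_attains:
 fixes c :: "event \<Rightarrow> real^'n"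
 assumes c: "c \<in> Linf_sobolev s" and c0: "c0 \<in> sobolev s" and init: "has_initial_datum c c0"
 shows "attains (\<lambda>p. c p $ i) (\<lambda>x. c0 x $ i)"
 unfolding attains_def
proof (intro allI impI)
 fix \<psi> :: "real^3 \<Rightarrow> real" and \<epsilon> :: real assume \<psi>: "torus_test \<psi>" and \<epsilon>: "\<epsilon> > 0"
 obtain \<delta> where \<delta>: "\<delta> > 0" and lim: "AE t in lebesgue_on {0<..<\<delta>}.
   norm ((TI x. \<psi> x *\<^sub>R c (t, x)) - (TI x. \<psi> x *\<^sub>R c0 x)) < \<epsilon>"
  using init \<psi> \<epsilon> unfolding has_initial_datum_def by blast
 have nth: "(TI x. \<psi> x *\<^sub>R f x) $ i = (TI x. \<psi> x * f x $ i)"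
  if f: "\<And>b. b \<in> Basis \<Longrightarrow> integrable torus (\<lambda>x. f x \<bullet> b)" for f :: "real^3 \<Rightarrow> real^'n"
 proof -
  have "integrable torus f" using f by (subst integrable_componentwise) auto
  then have "integrable torus (\<lambda>x. \<psi> x *\<^sub>R f x)" by (rule integrable_scaleR_continuous_torus[OF continuous_torus_test(1)[OF \<psi>]])
  from integral_bounded_linear[OF bounded_linear_vec_nth[of i] this] show ?thesis by simp
 qed
 have c0i: "integrable torus (\<lambda>x. c0 x \<bullet> b)" if "b \<in> Basis" for b
  using Hbound_L2(3)[OF sobolev_imp_Hbound[OF c0 order_refl that]] .
 obtain M where "AE t in half_line. (\<lambda>x. c (t, x)) \<in> sobolev s \<and> sobolev_norm s (\<lambda>x. c (t, x)) \<le> M"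
  using c by (auto simp: Linf_sobolev_def)
 then have "AE t in lborel. t \<in> {0..} \<longrightarrow> (\<lambda>x. c (t, x)) \<in> sobolev s"
  by (subst (asm) AE_lebesgue_on_iff) (auto elim!: eventually_mono)
 moreover have "AE t in lborel. t \<in> {0<..<\<delta>} \<longrightarrow> norm ((TI x. \<psi> x *\<^sub>R c (t, x)) - (TI x. \<psi> x *\<^sub>R c0 x)) < \<epsilon>"
  using lim by (subst (asm) AE_lebesgue_on_iff) auto
 ultimately have "AE t in lborel. t \<in> {0<..<\<delta>} \<longrightarrow> \<bar>(TI x. \<psi> x * c (t, x) $ i) - (TI x. \<psi> x * c0 x $ i)\<bar> < \<epsilon>"
 proof eventually_elim
  case (elim t)
  show ?case
  proof
   assume t: "t \<in> {0<..<\<delta>}"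
   then have s: "(\<lambda>x. c (t, x)) \<in> sobolev s" using elim(1) by auto
   have ci: "integrable torus (\<lambda>x. c (t, x) \<bullet> b)" if "b \<in> Basis" for b
    using Hbound_L2(3)[OF sobolev_imp_Hbound[OF s order_refl that]] .
   have "\<bar>(TI x. \<psi> x * c (t, x) $ i) - (TI x. \<psi> x * c0 x $ i)\<bar>
     = \<bar>((TI x. \<psi> x *\<^sub>R c (t, x)) - (TI x. \<psi> x *\<^sub>R c0 x)) $ i\<bar>"
    by (simp add: nth[OF ci] nth[OF c0i])
   also have "\<dots> \<le> norm ((TI x. \<psi> x *\<^sub>R c (t, x)) - (TI x. \<psi> x *\<^sub>R c0 x))" by (rule component_le_norm_cart)
   also have "\<dots> < \<epsilon>" using elim(2) t by simp
   finally show "\<bar>(TI x. \<psi> x * c (t, x) $ i) - (TI x. \<psi> x * c0 x $ i)\<bar> < \<epsilon>" .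
  qed
 qed
 then show "\<exists>\<delta>>0. AE t in lebesgue_on {0<..<\<delta>}. \<bar>(TI x. \<psi> x * c (t, x) $ i) - (TI x. \<psi> x * c0 x $ i)\<bar> < \<epsilon>"
  using \<delta> by (intro exI[of _ \<delta>] conjI) (auto simp: AE_lebesgue_on_iff)
qed

lemma flux_slices:
 fixes c :: "event \<Rightarrow> real" and v :: "event \<Rightarrow> real^3"
 assumes c: "Linf_Hbound 1 c" and v: "\<And>j. Linf_Hbound 0 (\<lambda>p. v p $ j)"
 obtains C where "AE t in half_line. \<forall>j. integrable torus (\<lambda>x. (c (t, x) *\<^sub>R v (t, x)) $ j) \<and> (TI x. \<bar>(c (t, x) *\<^sub>R v (t, x)) $ j\<bar>) \<le> C"
proof -
 obtain M where M: "AE t in half_line. L2_le (\<lambda>x. c (t, x)) M" by (rule Linf_HboundE[OF c])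
 obtain M' where M': "AE t in half_line. \<forall>j. L2_le (\<lambda>x. v (t, x) $ j) M'"
  by (rule Linf_Hbound_0_uniform[of v, OF v])
 have "AE t in half_line. \<forall>j. integrable torus (\<lambda>x. (c (t, x) *\<^sub>R v (t, x)) $ j) \<and> (TI x. \<bar>(c (t, x) *\<^sub>R v (t, x)) $ j\<bar>) \<le> sqrt M * sqrt M'"
  using M M'
 proof eventually_elim
  case (elim t)
  then show ?case using L2_product_bound[of "\<lambda>x. c (t, x)" M _ M'] by auto
 qed
 then show thesis by (rule that)
qed

text \<open>The constant function is the wave of frequency zero.\<close>

lemma mass_conserved:
 assumes c: "Linf_Hbound 1 c" "c \<in> borel_measurable spacetime" and v: "\<And>j. Linf_Hbound 0 (\<lambda>p. v p $ j)" "v \<in> borel_measurable spacetime"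
  and bal: "weak_balance c (\<lambda>p. c p *\<^sub>R v p) (\<lambda>_. 0)" and init: "attains c c0"
 shows "AE t in half_line. (TI x. c (t, x)) = (TI x. c0 x)"
proof -
 have one: "wave (\<lambda>_. 0) 0 x = 1" for x by (simp add: wave_def phase_def)
 have d: "partial j (wave (\<lambda>_. 0) 0) x = 0" for j x by (simp add: dir_deriv_wave_axis)
 obtain C where C: "AE t in half_line. \<forall>j. integrable torus (\<lambda>x. (c (t, x) *\<^sub>R v (t, x)) $ j) \<and> (TI x. \<bar>(c (t, x) *\<^sub>R v (t, x)) $ j\<bar>) \<le> C"
  by (rule flux_slices[of c v, OF c(1) v(1)])
 have m: "(\<lambda>p. c p *\<^sub>R v p) \<in> borel_measurable spacetime" by (intro borel_measurable_scaleR c v)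
 obtain B where B: "time_primitive (\<lambda>t. \<Sum>j\<in>(UNIV :: 3 set). (TI x. (c (t, x) *\<^sub>R v (t, x)) $ j * partial j (wave (\<lambda>_. 0) 0) x)) B"
  and eq: "AE t in half_line. (TI x. wave (\<lambda>_. 0) 0 x * c (t, x)) = (TI x. wave (\<lambda>_. 0) 0 x * c0 x)
   + time_primitive.D (\<lambda>t. \<Sum>j\<in>UNIV. (TI x. (c (t, x) *\<^sub>R v (t, x)) $ j * partial j (wave (\<lambda>_. 0) 0) x)) t"
  by (rule weak_balance_primitive[OF bal m C init torus_test_wave]) blast
 have "time_primitive.D (\<lambda>t. \<Sum>j\<in>(UNIV :: 3 set). (TI x. (c (t, x) *\<^sub>R v (t, x)) $ j * partial j (wave (\<lambda>_. 0) 0) x)) t = 0" for t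
  unfolding time_primitive.D_def[OF B] by (simp add: d)
 then show ?thesis using eq by (simp add: one)
qed

text \<open>The columns of the Maxwell-Stefan matrix sum to zero, so \<open>\<Sum>c\<^sub>i\<close> has no spatial gradient;
 conservation of mass fixes its mean.\<close>

lemma total_density_eq:
 fixes c :: "event \<Rightarrow> real^'n" and u w :: "event \<Rightarrow> real^3^'n"
 assumes sym: "\<And>i j. \<Delta> i j = \<Delta> j i"
  and c: "c \<in> Linf_sobolev s" "1 \<le> s" and u: "u \<in> Linf_sobolev s'"
  and c0: "c0 \<in> sobolev s" "has_initial_datum c c0" "AE x in torus. (\<Sum>i\<in>UNIV. c0 x $ i) = C0"
  and bal: "\<And>i. weak_balance (\<lambda>p. c p $ i) (\<lambda>p. c p $ i *\<^sub>R u p $ i) (\<lambda>_. 0)"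
  and rel: "weak_gradient_relation \<Delta> c w"
 shows "AE p in spacetime. (\<Sum>i\<in>UNIV. c p $ i) = C0"
proof -
 have cH: "Linf_Hbound 1 (\<lambda>p. c p $ i)" for i by (rule Linf_Hbound_mono[OF Linf_sobolev_nth[OF c(1)] c(2)])
 have uH: "Linf_Hbound 0 (\<lambda>p. u p $ i $ j)" for i j by (rule Linf_Hbound_mono[OF Linf_sobolev_nth_nth[OF u]]) simp
 have cm: "(\<lambda>p. c p $ i) \<in> borel_measurable spacetime" for i by (rule borel_measurable_nth[OF Linf_sobolevD(1)[OF c(1)]])
 have um: "(\<lambda>p. u p $ i) \<in> borel_measurable spacetime" for i by (rule borel_measurable_nth[OF Linf_sobolevD(1)[OF u]])
 have mass: "AE t in half_line. (TI x. c (t, x) $ i) = (TI x. c0 x $ i)" for i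
  by (rule mass_conserved[OF cH cm uH um bal has_initial_datum_attains[OF c(1) c0(1,2)]])
 have c0i: "integrable torus (\<lambda>x. c0 x $ i)" for i by (rule L2_integrable[OF sobolev_nth_L2[OF c0(1)]])
 let ?G = "\<lambda>i p. species_mult (MS_matrix \<Delta> (c p)) (w p) $ i"
 have grad: "AE t in half_line. \<forall>j. weak_partial j (\<lambda>x. c (t, x) $ i) (\<lambda>x. ?G i (t, x) $ j)" for i
  using rel by (intro weak_grad_slices) (simp add: weak_gradient_relation_def)
 have "AE t in half_line. \<forall>i. (TI x. c (t, x) $ i) = (TI x. c0 x $ i)
   \<and> (\<forall>j. weak_partial j (\<lambda>x. c (t, x) $ i) (\<lambda>x. ?G i (t, x) $ j))"
  by (rule AE_all_finite) (use mass grad in \<open>auto intro: AE_conjI\<close>)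
 then have "AE t in half_line. AE x in torus. (\<Sum>i\<in>UNIV. c (t, x) $ i) - C0 = 0"
 proof eventually_elim
  case (elim t)
  let ?S = "\<lambda>x. \<Sum>i\<in>UNIV. c (t, x) $ i"
  have wd: "weak_partial j (\<lambda>x. c (t, x) $ i) (\<lambda>x. ?G i (t, x) $ j)" for i j using elim by blast
  have ci: "integrable torus (\<lambda>x. c (t, x) $ i)" and Gi: "integrable torus (\<lambda>x. ?G i (t, x) $ j)" for i j
   using wd[of j i] by (auto simp: has_weak_deriv_def)
  have Si: "integrable torus ?S" by (intro L1_sum ci)
  have ei: "integrable torus (\<lambda>x. cnj (char k x) * complex_of_real (f x))" if "integrable torus f" for k and f :: "real^3 \<Rightarrow> real"
   by (intro integrable_char_mult integrable_of_real that)
  have rsum: "rcoeff (\<lambda>x. \<Sum>i\<in>UNIV. f i x) k = (\<Sum>i\<in>UNIV. rcoeff (f i) k)" if "\<And>i::'n. integrable torus (f i)" for f k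
   unfolding fcoeff_def of_real_sum sum_distrib_left by (intro LINT_sum ei that)
  have mean: "(TI x. ?S x) = C0"
  proof -
   have "(TI x. ?S x) = (\<Sum>i\<in>UNIV. (TI x. c (t, x) $ i))" by (intro LINT_sum ci)
   also have "\<dots> = (\<Sum>i\<in>UNIV. (TI x. c0 x $ i))" using elim by simp
   also have "\<dots> = (TI x. (\<Sum>i\<in>UNIV. c0 x $ i))" by (intro LINT_sum[symmetric] c0i)
   also have "\<dots> = (LINT x|(torus :: (real^3) measure). C0)"
    by (rule LINT_cong_AE) (use c0(3) in \<open>auto intro!: borel_measurable_integrable c0i\<close>)
   finally show ?thesis by simp
  qed
  have "AE x in torus. ?S x = C0"
  proof (rule rcoeff_eq_imp_AE_eq[OF Si])
   show "integrable torus (\<lambda>x. C0)" by simp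
   fix k
   have const: "rcoeff (\<lambda>x. C0) k = C0 * (if k = (\<lambda>_. 0) then 1 else 0)"
    using integral_char_orthonormal[of "\<lambda>_. 0" k] by (auto simp: fcoeff_def mult.commute)
   show "rcoeff ?S k = rcoeff (\<lambda>x. C0) k"
   proof (cases "k = (\<lambda>_. 0)")
    case True
    have "rcoeff ?S k = complex_of_real (TI x. ?S x)"
     unfolding True fcoeff_def char_0 complex_cnj_one mult_1 by (rule integral_complex_of_real)
    then show ?thesis unfolding const mean using True by simp
   next
    case False
    then obtain j where j: "k j \<noteq> 0" by auto
    have "symbol (unit_index j) k * rcoeff ?S k = (\<Sum>i\<in>UNIV. symbol (unit_index j) k * rcoeff (\<lambda>x. c (t, x) $ i) k)"
     unfolding rsum[OF ci] sum_distrib_left ..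
    also have "\<dots> = (\<Sum>i\<in>UNIV. rcoeff (\<lambda>x. ?G i (t, x) $ j) k)" by (simp only: fcoeff_weak_deriv[OF wd])
    also have "\<dots> = rcoeff (\<lambda>x. \<Sum>i\<in>UNIV. ?G i (t, x) $ j) k" by (rule rsum[OF Gi, symmetric])
    also have "(\<lambda>x. \<Sum>i\<in>UNIV. ?G i (t, x) $ j) = (\<lambda>x. 0)"
    proof
     fix x
     show "(\<Sum>i\<in>UNIV. ?G i (t, x) $ j) = 0"
      using arg_cong[OF sum_species_mult_MS_matrix[where c="c (t, x)" and w="w (t, x)", OF sym], of "\<lambda>v. v $ j"] by simp
    qed
    finally have "symbol (unit_index j) k * rcoeff ?S k = 0" by (simp add: fcoeff_def)
    then show ?thesis unfolding const symbol_unit using j False by simp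
   qed
  qed
  then show ?case by eventually_elim simp
 qed
 then have "AE p in spacetime. (\<Sum>i\<in>UNIV. c p $ i) - C0 = 0"
  by (intro AE_spacetimeI borel_measurable_diff borel_measurable_sum borel_measurable_const cyl_measurable_mono[OF cm]) auto
 then show ?thesis by eventually_elim simp
qed

section \<open>Barycentric and relative velocities\<close>

locale MS_data =
 fixes \<Delta> :: "'n::finite \<Rightarrow> 'n \<Rightarrow> real" and s :: nat and C0 :: real
  and cin :: "real^3 \<Rightarrow> real^'n" and c :: "event \<Rightarrow> real^'n" and u :: "event \<Rightarrow> real^3^'n"
 assumes sym: "\<And>i j. \<Delta> i j = \<Delta> j i" and s: "s \<ge> 1" and C0: "C0 > 0"
  and cin: "cin \<in> sobolev s"
  and cin_AE: "AE x in torus. (\<forall>i. cin x $ i \<ge> 0) \<and> (\<Sum>i\<in>UNIV. cin x $ i) = C0"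
  and c: "c \<in> Linf_sobolev s" and u: "u \<in> Linf_sobolev (s - 1)" and init: "has_initial_datum c cin"
begin

lemma c_Hbound: "Linf_Hbound 1 (\<lambda>p. c p $ i)"
 by (rule Linf_Hbound_mono[OF Linf_sobolev_nth[OF c] s])

lemma c_measurable: "(\<lambda>p. c p $ i) \<in> borel_measurable spacetime"
 by (rule borel_measurable_nth[OF Linf_sobolevD(1)[OF c]])

lemma u_Hbound: "Linf_Hbound (s - 1) (\<lambda>p. u p $ i $ j)"
 by (rule Linf_sobolev_nth_nth[OF u])

lemma u_measurable: "(\<lambda>p. u p $ i) \<in> borel_measurable spacetime"
 by (rule borel_measurable_nth[OF Linf_sobolevD(1)[OF u]])

lemma total_density:
 assumes "\<And>i. weak_balance (\<lambda>p. c p $ i) (\<lambda>p. c p $ i *\<^sub>R u p $ i) (\<lambda>_. 0)" "weak_gradient_relation \<Delta> c w"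
 shows "AE p in spacetime. (\<Sum>i\<in>UNIV. c p $ i) = C0"
 by (rule total_density_eq[OF sym c s u cin init _ assms]) (use cin_AE in \<open>auto elim!: eventually_mono\<close>)

lemma pairing_measurable:
 fixes w :: "event \<Rightarrow> real^3^'n"
 assumes "\<And>i. (\<lambda>p. w p $ i) \<in> borel_measurable spacetime"
 shows "(\<lambda>p. pairing (c p) (w p)) \<in> borel_measurable spacetime"
 unfolding pairing_def by (intro borel_measurable_sum borel_measurable_scaleR c_measurable assms)

lemma species_mult_measurable:
 fixes w :: "event \<Rightarrow> real^3^'n"
 assumes "\<And>i. (\<lambda>p. w p $ i) \<in> borel_measurable spacetime"
 shows "(\<lambda>p. species_mult (MS_matrix \<Delta> (c p)) (w p) $ i) \<in> borel_measurable spacetime"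
 unfolding species_mult_MS_matrix
 by (intro borel_measurable_sum borel_measurable_scaleR borel_measurable_diff borel_measurable_divide borel_measurable_times
   c_measurable assms borel_measurable_const)

lemma V_field_measurable:
 fixes w :: "event \<Rightarrow> real^3^'n"
 assumes w: "\<And>i. (\<lambda>p. w p $ i) \<in> borel_measurable spacetime"
 shows "(\<lambda>p. V_field C0 (c p) (w p) $ i) \<in> borel_measurable spacetime"
 unfolding V_field_nth by (intro borel_measurable_diff borel_measurable_scaleR w pairing_measurable borel_measurable_const)

text \<open>For \<open>s \<ge> 2\<close> the densities are multipliers of \<open>H\<^bsup>s-1\<^esup>\<close>.  For \<open>s = 1\<close> this needs their boundedness,
 hence the propagation of nonnegativity.\<close>

lemma momentum_Hbound:
 assumes bal: "\<And>i. weak_balance (\<lambda>p. c p $ i) (\<lambda>p. c p $ i *\<^sub>R u p $ i) (\<lambda>_. 0)"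
  and total: "AE p in spacetime. (\<Sum>i\<in>UNIV. c p $ i) = C0"
 shows "Linf_Hbound (s - 1) (\<lambda>p. c p $ i * u p $ i $ j)"
proof (cases "s = 1")
 case False
 then obtain r where r: "s = r + 2" using s by (metis One_nat_def Suc_1 add.commute le_antisym less_eqE not_less_eq_eq)
 have "Linf_Hbound (r + 2) (\<lambda>p. c p $ i)" using Linf_sobolev_nth[OF c, of i] unfolding r .
 moreover have "Linf_Hbound (r + 1) (\<lambda>p. u p $ i $ j)" using u_Hbound[of i j] unfolding r by simp
 ultimately have "Linf_Hbound (r + 1) (\<lambda>p. c p $ i * u p $ i $ j)" by (rule Linf_Hbound_product)
 then show ?thesis unfolding r by simp
next
 case True
 have uH: "Linf_Hbound 0 (\<lambda>p. u p $ i $ j)" for i j using u_Hbound[of i j] unfolding True by simp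
 have "AE p in spacetime. 0 \<le> c p $ i" for i
 proof -
  obtain M where M: "AE t in half_line. Hbound 1 (\<lambda>x. c (t, x) $ i) M" by (rule Linf_HboundE[OF c_Hbound[of i]])
  obtain M' where M': "AE t in half_line. \<forall>j. L2_le (\<lambda>x. u (t, x) $ i $ j) M'"
   by (rule Linf_Hbound_0_uniform[of "\<lambda>p. u p $ i", OF uH])
  interpret transported_density "\<lambda>p. c p $ i" "\<lambda>p. u p $ i" "\<lambda>x. cin x $ i" M M'
   by unfold_locales (use M M' c_measurable u_measurable bal has_initial_datum_attains[OF c cin init] L2_integrable[OF sobolev_nth_L2[OF cin]] cin_AE
    in \<open>auto elim!: eventually_mono\<close>)
  show ?thesis by (rule density_nonneg)
 qed
 then have "AE p in spacetime. \<forall>i. 0 \<le> c p $ i" by (rule AE_all_finite)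
 with total have "AE p in spacetime. (c p $ i)\<^sup>2 \<le> C0\<^sup>2"
 proof eventually_elim
  case (elim p)
  have "c p $ i \<le> (\<Sum>i\<in>UNIV. c p $ i)" using elim(2) by (intro member_le_sum) auto
  then show ?case using elim by (intro power_mono) auto
 qed
 then have bound: "AE t in half_line. AE x in torus. (c (t, x) $ i)\<^sup>2 \<le> C0\<^sup>2"
  unfolding spacetime_cyl by (rule AE_cyl_slices[OF closed_atLeast])
 obtain K where "AE t in half_line. L2_le (\<lambda>x. u (t, x) $ i $ j) K"
  by (rule Linf_HboundE[OF uH[of i j]])
 moreover obtain M where "AE t in half_line. L2_le (\<lambda>x. c (t, x) $ i) M"
  by (rule Linf_HboundE[OF c_Hbound[of i]])
 ultimately have "AE t in half_line. Hbound 0 (\<lambda>x. c (t, x) $ i * u (t, x) $ i $ j) (C0\<^sup>2 * K)"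
  using bound
 proof eventually_elim
  case (elim t)
  then show ?case
   by (intro Hbound_0I AE_bounded_mult_L2) (auto intro: L2_measurable)
 qed
 then show ?thesis unfolding Linf_Hbound_def True by auto
qed

lemma velocity_Linf_sobolev:
 fixes v :: "event \<Rightarrow> real^3"
 assumes "v \<in> borel_measurable spacetime" "\<And>t. t \<ge> 0 \<Longrightarrow> periodic (\<lambda>x. v (t, x))" "\<And>j. Linf_Hbound r (\<lambda>p. v p $ j)"
 shows "v \<in> Linf_sobolev r"
 by (rule Linf_sobolevI) (use assms in \<open>auto simp: Basis_vec_def inner_axis\<close>)

text \<open>The barycentric velocity is \<open>\<langle>c, u\<rangle> / C\<^sub>0\<close>.  The Maxwell-Stefan matrix and \<open>V\<^sub>U\<close> only see \<open>u\<close> up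
 to a common velocity, so any normalisation of the relative velocities is allowed; \<open>U\<close> subtracts
 the mean over the species.\<close>

lemma solution_decomposes:
 assumes sol: "incompressible_MS_solution \<Delta> c u"
 shows "\<exists>(U :: event \<Rightarrow> real^3^'n) (ubar :: event \<Rightarrow> real^3).
   U \<in> Linf_sobolev (s - 1) \<and> ubar \<in> Linf_sobolev (s - 1) \<and>
   (AE p in spacetime. (\<Sum>i\<in>UNIV. U p $ i) = 0) \<and>
   weak_div_free ubar \<and>
   (AE p in spacetime. u p = (\<chi> i. ubar p) + V_field C0 (c p) (U p)) \<and>
   (\<forall>i. weak_balance (\<lambda>p. c p $ i) (\<lambda>p. c p $ i *\<^sub>R V_field C0 (c p) (U p) $ i)
       (\<lambda>p. ubar p \<bullet> weak_grad (\<lambda>q. c q $ i) p)) \<and>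
   weak_gradient_relation \<Delta> c U"
proof -
 have bal: "\<And>i. weak_balance (\<lambda>p. c p $ i) (\<lambda>p. c p $ i *\<^sub>R u p $ i) (\<lambda>_. 0)"
  and rel: "weak_gradient_relation \<Delta> c u" and div: "weak_div_free (\<lambda>p. pairing (c p) (u p))"
  using sol by (auto simp: incompressible_MS_solution_def)
 note total = total_density[OF bal rel]
 define m where "m p = (1 / real CARD('n)) *\<^sub>R (\<Sum>j\<in>UNIV. u p $ j)" for p
 define U :: "event \<Rightarrow> real^3^'n" where "U p = (\<chi> i. u p $ i - m p)" for p
 define ubar where "ubar p = (1 / C0) *\<^sub>R pairing (c p) (u p)" for p
 have U_nth: "U p $ i = u p $ i + - m p" for p i by (simp add: U_def)
 have mm: "m \<in> borel_measurable spacetime"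
  unfolding m_def[abs_def] by (intro borel_measurable_scaleR borel_measurable_const borel_measurable_sum u_measurable)
 have Um: "(\<lambda>p. U p $ i) \<in> borel_measurable spacetime" for i unfolding U_nth by (intro borel_measurable_add borel_measurable_uminus mm u_measurable)
 have ubm: "ubar \<in> borel_measurable spacetime"
  unfolding ubar_def[abs_def] by (intro borel_measurable_scaleR borel_measurable_const pairing_measurable u_measurable)
 have uper: "u (t, x + axis k 1) = u (t, x)" and cper: "c (t, x + axis k 1) = c (t, x)" if "t \<ge> 0" for t x k
  using Linf_sobolevD(2)[OF u that] Linf_sobolevD(2)[OF c that] by (auto simp: periodic_def)
 have U: "U \<in> Linf_sobolev (s - 1)"
 proof (rule Linf_sobolevI)
  show "U \<in> borel_measurable spacetime"
  proof (subst borel_measurable_euclidean_space, intro ballI)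
   fix b :: "real^3^'n" assume "b \<in> Basis"
   then obtain i b' where b: "b = axis i b'" by (auto simp: Basis_vec_def)
   show "(\<lambda>p. U p \<bullet> b) \<in> borel_measurable spacetime" unfolding b inner_axis by (intro borel_measurable_inner Um borel_measurable_const)
  qed
  show "periodic (\<lambda>x. U (t, x))" if "t \<ge> 0" for t using uper[OF that] by (simp add: periodic_def U_def m_def)
  fix b :: "real^3^'n" assume "b \<in> Basis"
  then obtain i j where b: "b = axis i (axis j 1)" by (auto simp: Basis_vec_def)
  have "Linf_Hbound (s - 1) (\<lambda>p. 1 * u p $ i $ j + (- (1 / real CARD('n))) * (\<Sum>l\<in>UNIV. u p $ l $ j))"
   by (intro Linf_Hbound_linear Linf_Hbound_sum u_Hbound) auto
  then show "Linf_Hbound (s - 1) (\<lambda>p. U p \<bullet> b)" unfolding b by (simp add: inner_axis U_def m_def)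
 qed
 have ub: "ubar \<in> Linf_sobolev (s - 1)"
 proof (rule velocity_Linf_sobolev[OF ubm])
  show "periodic (\<lambda>x. ubar (t, x))" if "t \<ge> 0" for t using uper[OF that] cper[OF that] by (simp add: periodic_def ubar_def)
  fix j
  have sm: "Linf_Hbound (s - 1) (\<lambda>p. \<Sum>i\<in>UNIV. c p $ i * u p $ i $ j)"
   by (intro Linf_Hbound_sum momentum_Hbound[OF bal total]) auto
  have "Linf_Hbound (s - 1) (\<lambda>p. (1 / C0) * (\<Sum>i\<in>UNIV. c p $ i * u p $ i $ j) + 0 * (\<Sum>i\<in>UNIV. c p $ i * u p $ i $ j))"
   by (rule Linf_Hbound_linear[OF sm sm])
  then show "Linf_Hbound (s - 1) (\<lambda>p. ubar p $ j)" by (simp add: ubar_def pairing_def)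
 qed
 have ub0: "Linf_Hbound 0 (\<lambda>p. ubar p $ j)" for j by (rule Linf_Hbound_mono[OF Linf_sobolev_nth[OF ub]]) simp
 have div_ub: "weak_div_free ubar" unfolding ubar_def[abs_def] by (rule weak_div_free_scaleR[OF div])
 have U_sum: "(\<Sum>i\<in>UNIV. U p $ i) = 0" for p
  by (simp add: U_def sum_subtractf sum_constant_scaleR m_def del: sum_constant)
 have V: "AE p in spacetime. \<forall>i. u p $ i = ubar p + V_field C0 (c p) (U p) $ i"
  using total
 proof eventually_elim
  case (elim p)
  have "pairing (c p) (U p) = pairing (c p) (u p) + C0 *\<^sub>R (- m p)"
   using pairing_shift[of "U p" "u p" "- m p" "c p", OF U_nth] elim by simp
  then show ?case using C0 by (simp add: V_field_nth U_nth ubar_def scaleR_diff_right)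
 qed
 then have dec: "AE p in spacetime. u p = (\<chi> i. ubar p) + V_field C0 (c p) (U p)"
  by eventually_elim (simp add: vec_eq_iff[where 'b='n])
 have AU: "species_mult (MS_matrix \<Delta> (c p)) (U p) = species_mult (MS_matrix \<Delta> (c p)) (u p)" for p
  by (rule species_mult_MS_matrix_shift[OF U_nth])
 have relU: "weak_gradient_relation \<Delta> c U" using rel by (simp add: weak_gradient_relation_def AU)
 have "weak_balance (\<lambda>p. c p $ i) (\<lambda>p. c p $ i *\<^sub>R V_field C0 (c p) (U p) $ i) (\<lambda>p. ubar p \<bullet> weak_grad (\<lambda>q. c q $ i) p)" for i
 proof (rule iffD1[OF weak_balance_advection_iff bal])
  show "Linf_Hbound 1 (\<lambda>p. c p $ i)" by (rule c_Hbound)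
  show "has_weak_grad (\<lambda>p. c p $ i) (weak_grad (\<lambda>q. c q $ i))"
   using rel by (intro has_weak_grad_weak_grad) (auto simp: weak_gradient_relation_def)
  show "(\<lambda>p. c p $ i *\<^sub>R u p $ i) \<in> borel_measurable spacetime" by (intro borel_measurable_scaleR c_measurable u_measurable)
  show "(\<lambda>p. c p $ i *\<^sub>R V_field C0 (c p) (U p) $ i) \<in> borel_measurable spacetime"
   by (intro borel_measurable_scaleR c_measurable V_field_measurable Um)
  show "AE p in spacetime. c p $ i *\<^sub>R u p $ i = c p $ i *\<^sub>R V_field C0 (c p) (U p) $ i + c p $ i *\<^sub>R ubar p"
   using V
  proof eventually_elim
   case (elim p)
   then show ?case by (metis add.commute scaleR_right_distrib)
  qed
 qed (rule c_measurable ub0 ubm div_ub)+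
 then show ?thesis using U ub U_sum div_ub dec relU by (intro exI[of _ U] exI[of _ ubar]) auto
qed

text \<open>Conversely, the decomposition gives back \<open>\<langle>c, u\<rangle> = C\<^sub>0 ubar\<close> as soon as \<open>\<Sum>c\<^sub>i = C\<^sub>0\<close>.\<close>

lemma decomposition_solves:
 fixes U :: "event \<Rightarrow> real^3^'n" and ubar :: "event \<Rightarrow> real^3"
 assumes U: "U \<in> Linf_sobolev (s - 1)" and ub: "ubar \<in> Linf_sobolev (s - 1)" and div: "weak_div_free ubar"
  and dec: "AE p in spacetime. u p = (\<chi> i. ubar p) + V_field C0 (c p) (U p)"
  and balV: "\<And>i. weak_balance (\<lambda>p. c p $ i) (\<lambda>p. c p $ i *\<^sub>R V_field C0 (c p) (U p) $ i) (\<lambda>p. ubar p \<bullet> weak_grad (\<lambda>q. c q $ i) p)"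
  and rel: "weak_gradient_relation \<Delta> c U"
 shows "incompressible_MS_solution \<Delta> c u"
proof -
 have ub0: "Linf_Hbound 0 (\<lambda>p. ubar p $ j)" for j by (rule Linf_Hbound_mono[OF Linf_sobolev_nth[OF ub]]) simp
 have ubm: "ubar \<in> borel_measurable spacetime" by (rule Linf_sobolevD(1)[OF ub])
 have Um: "(\<lambda>p. U p $ i) \<in> borel_measurable spacetime" for i by (rule borel_measurable_nth[OF Linf_sobolevD(1)[OF U]])
 have dec': "AE p in spacetime. \<forall>i. u p $ i = ubar p + V_field C0 (c p) (U p) $ i"
  using dec by eventually_elim simp
 have bal: "weak_balance (\<lambda>p. c p $ i) (\<lambda>p. c p $ i *\<^sub>R u p $ i) (\<lambda>_. 0)" for i
 proof (rule iffD2[OF weak_balance_advection_iff balV])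
  show "Linf_Hbound 1 (\<lambda>p. c p $ i)" by (rule c_Hbound)
  show "has_weak_grad (\<lambda>p. c p $ i) (weak_grad (\<lambda>q. c q $ i))"
   using rel by (intro has_weak_grad_weak_grad) (auto simp: weak_gradient_relation_def)
  show "(\<lambda>p. c p $ i *\<^sub>R u p $ i) \<in> borel_measurable spacetime" by (intro borel_measurable_scaleR c_measurable u_measurable)
  show "(\<lambda>p. c p $ i *\<^sub>R V_field C0 (c p) (U p) $ i) \<in> borel_measurable spacetime"
   by (intro borel_measurable_scaleR c_measurable V_field_measurable Um)
  show "AE p in spacetime. c p $ i *\<^sub>R u p $ i = c p $ i *\<^sub>R V_field C0 (c p) (U p) $ i + c p $ i *\<^sub>R ubar p"
   using dec'
  proof eventually_elim
   case (elim p)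
   then show ?case by (metis add.commute scaleR_right_distrib)
  qed
 qed (rule c_measurable ub0 ubm div)+
 have shift: "AE p in spacetime. \<forall>i. u p $ i = U p $ i + (ubar p - (1 / C0) *\<^sub>R pairing (c p) (U p))"
  using dec' by eventually_elim (simp add: V_field_nth)
 have relu: "weak_gradient_relation \<Delta> c u"
  unfolding weak_gradient_relation_def
 proof
  fix i
  show "has_weak_grad (\<lambda>p. c p $ i) (\<lambda>p. species_mult (MS_matrix \<Delta> (c p)) (u p) $ i)"
  proof (rule has_weak_grad_cong_AE)
   show "has_weak_grad (\<lambda>p. c p $ i) (\<lambda>p. species_mult (MS_matrix \<Delta> (c p)) (U p) $ i)"
    using rel by (simp add: weak_gradient_relation_def)
   show "AE p in spacetime. species_mult (MS_matrix \<Delta> (c p)) (u p) $ i = species_mult (MS_matrix \<Delta> (c p)) (U p) $ i"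
    using shift
   proof eventually_elim
    case (elim p)
    show ?case using species_mult_MS_matrix_shift[of "u p" "U p"] elim by simp
   qed
  qed (intro species_mult_measurable u_measurable Um)+
 qed
 have "AE p in spacetime. pairing (c p) (u p) = C0 *\<^sub>R ubar p"
  using shift total_density[OF bal rel]
 proof eventually_elim
  case (elim p)
  show ?case using pairing_shift[of "u p" "U p" _ "c p"] elim C0 by (simp add: scaleR_diff_right)
 qed
 then have "weak_div_free (\<lambda>p. pairing (c p) (u p))"
  by (intro weak_div_free_cong_AE[OF pairing_measurable weak_div_free_scaleR[OF div]] u_measurable
    borel_measurable_scaleR borel_measurable_const ubm)
 then show ?thesis using bal relu by (simp add: incompressible_MS_solution_def)
qed

end

theorem proposition4p1:
 fixes \<Delta> :: "'n::finite \<Rightarrow> 'n \<Rightarrow> real"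
  and s :: nat and C0 :: real
  and cin :: "real^3 \<Rightarrow> real^'n" and uin :: "real^3 \<Rightarrow> real^3^'n"
  and c :: "real \<times> (real^3) \<Rightarrow> real^'n" and u :: "real \<times> (real^3) \<Rightarrow> real^3^'n"
 assumes "CARD('n) \<ge> 2"
  and "\<And>i j. \<Delta> i j = \<Delta> j i" and "\<And>i j. \<Delta> i j > 0"
  and "s \<ge> 1" and "C0 > 0"
  and "cin \<in> sobolev s" and "uin \<in> sobolev (s - 1)"
  and "AE x in torus. (\<forall>i. cin x $ i \<ge> 0) \<and> (\<Sum>i\<in>UNIV. cin x $ i) = C0"
  and "c \<in> Linf_sobolev s" and "u \<in> Linf_sobolev (s - 1)"
  and "has_initial_datum c cin" and "has_initial_datum u uin"
 shows "incompressible_MS_solution \<Delta> c u \<longleftrightarrow>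
  (\<exists>(U :: real \<times> (real^3) \<Rightarrow> real^3^'n) (ubar :: real \<times> (real^3) \<Rightarrow> real^3).
   U \<in> Linf_sobolev (s - 1) \<and> ubar \<in> Linf_sobolev (s - 1) \<and>
   (AE p in spacetime. (\<Sum>i\<in>UNIV. U p $ i) = 0) \<and>
   weak_div_free ubar \<and>
   (AE p in spacetime. u p = (\<chi> i. ubar p) + V_field C0 (c p) (U p)) \<and>
   (\<forall>i. weak_balance (\<lambda>p. c p $ i) (\<lambda>p. c p $ i *\<^sub>R V_field C0 (c p) (U p) $ i)
       (\<lambda>p. ubar p \<bullet> weak_grad (\<lambda>q. c q $ i) p)) \<and>
   weak_gradient_relation \<Delta> c U)"
proof -
 interpret MS_data \<Delta> s C0 cin c u by unfold_locales (rule assms)+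
 show ?thesis using solution_decomposes decomposition_solves by blast
qed

end
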